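(* Assume that $(\mathbf A_1)$–$(\mathbf A_3)$ hold, $\vartheta\in\mathcal P_c(\mathbb{R}^n)$, and let $(\bar\alpha,\bar\beta)\in\hat{\mathcal U}$ be optimal for the problem $$(\hat P)\qquad \min\left\{\int\ell\,d\nu_S\colon\nu\text{ is a trajectory of }(\hat S)\right\}.$$ Then there exist $\lambda\in\mathbb{R}$ and a regular solution $\gamma\colon[0,S]\to\mathcal P_c(\mathbb{R}^{2n})$ of $$\partial_s\gamma_s+\nabla_{(y,p)}\cdot\left(\vec H[\gamma_s,\bar\alpha(s),\bar\beta(s)]\,\gamma_s\right)=0,\qquad \pi^1_\sharp\gamma_0=\vartheta,\qquad \pi^2_\sharp\gamma_S=(-\nabla\ell)_\sharp(\pi^1_\sharp\gamma_S),$$ such that the following maximum condition holds for Lebesgue-a.e. $s\in[0,S]$: $$\mathcal H\left(\gamma_s,\lambda,\bar\alpha(s),\bar\beta(s)\right)=\max_{(a,b)\in A}\mathcal H(\gamma_s,\lambda,a,b)=\max\left\{\mathcal H^1(\gamma_s,\lambda),\mathcal H^0(\gamma_s)\right\},$$ where $$\mathcal H^1(\gamma,\lambda)=\frac12\iint(p-q)\,g(y-z)\,d\gamma(z,q)\,d\gamma(y,p)+\int p f_0(y)\,d\gamma(y,p)+\lambda,\qquad \mathcal H^0(\gamma)=\max_{1\le i\le m}\left|\int p f_i(y)\,d\gamma(y,p)\right|.$$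
   Context: $|\cdot|$ is the Manhattan norm. $\mathcal P_c(\mathbb{R}^d)$ is the set of compactly supported Borel probability measures on $\mathbb{R}^d$, with the Wasserstein distance $W_1$. $F_\sharp\mu$ is the push-forward of $\mu$ through $F$. $\pi^1(y,p)=y$, $\pi^2(y,p)=p$ on $\mathbb{R}^{2n}=\mathbb{R}^n\times\mathbb{R}^n$. Products such as $pf(y)$ of vectors are scalar products, and $p\nabla f(y)$ is the row vector $p$ times the Jacobian. $(g*\mu)(x)=\int g(x-y)\,d\mu(y)$. Assumptions on $f_0,\dots,f_m,g\colon\mathbb{R}^n\to\mathbb{R}^n$ and $\ell\colon\mathbb{R}^n\to\mathbb{R}$. $(\mathbf A_1)$: there exist $C,L>0$ with $\sum_{i=0}^m|f_i(x)|+|g(x)|\le C$ and $\sum_{i=0}^m|f_i(x^1)-f_i(x^2)|+|g(x^1)-g(x^2)|\le L|x^1-x^2|$ for all $x,x^1,x^2$. $(\mathbf A_2)$: $g,f_i\in C^1$; $g(-x)=-g(x)$ for all $x$; for any compact $K\subset\mathbb{R}^n$ there is $L_K>0$ with $|\nabla g(x)-\nabla g(x')|\le L_K|x-x'|$ and $|\nabla f_i(x)-\nabla f_i(x')|\le L_K|x-x'|$, $i=0,\dots,m$, for all $x,x'\in K$. $(\mathbf A_3)$: $\ell\in C^1$ and $|\ell(x)|+|\nabla\ell(x)|\le C$ for all $x$. Reduced system $(\hat S)$, with given $T,M>0$ and $S=T+M$: $\partial_s\nu_s+\nabla\cdot(w_s\nu_s)=0$ on $[0,S]$, $\nu_0=\vartheta$,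 $w_s(x)=\alpha(s)\left(f_0(x)+(g*\nu_s)(x)\right)+\sum_{i=1}^m\beta_i(s)f_i(x)$, with controls $(\alpha,\beta)\in\hat{\mathcal U}=\{(\alpha,\beta)\in L^\infty([0,S];A)\colon\int_0^S\alpha\,ds=T\}$, $A=\{(a,b)\in\mathbb{R}^{1+m}\colon a\ge0,\ a+\sum_{j=1}^m|b_j|\le1\}$. For each control there is a unique solution $\nu[\alpha,\beta,\vartheta]$; continuity equations are understood in the weak (distributional) sense. The pair $(\bar\alpha,\bar\beta)$ is optimal for $(\hat P)$ if $\nu[\bar\alpha,\bar\beta,\vartheta]$ attains the minimum. $$\vec H[\gamma,a,b](y,p)=\begin{pmatrix} a\int g(y-z)\,d(\pi^1_\sharp\gamma)(z)+af_0(y)+\sum_{k=1}^mb_kf_k(y)\\ -a\int(p-q)\nabla g(y-z)\,d\gamma(z,q)-p\left(a\nabla f_0(y)+\sum_{k=1}^mb_k\nabla f_k(y)\right)\end{pmatrix},$$ $$\mathcal H(\gamma,\lambda,a,b)=\frac a2\iint(p-q)g(y-z)\,d\gamma(z,q)\,d\gamma(y,p)+a\lambda+a\int pf_0(y)\,d\gamma(y,p)+\sum_{k=1}^mb_k\int pf_k(y)\,d\gamma(y,p).$$ Regular solution: for $(\alpha,\beta)\in\hat{\mathcal U}$ and $\vartheta\in\mathcal P_c(\mathbb{R}^n)$, the regular solution of the Hamiltonian boundary value problem $$\partial_s\gamma_s+\nabla_{(y,p)}\cdot\left(\vec H[\gamma_s,\alpha(s),\beta(s)]\,\gamma_s\right)=0\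 \text{ on }[0,S],\qquad \pi^1_\sharp\gamma_0=\vartheta,\qquad \pi^2_\sharp\gamma_S=(-\nabla\ell)_\sharp(\pi^1_\sharp\gamma_S),$$ is the unique solution $\gamma$ of $\partial_s\gamma_s+\nabla_{(y,p)}\cdot(\vec H[\gamma_s,\alpha(s),\beta(s)]\gamma_s)=0$ with the terminal condition $\gamma_S=(\mathrm{id},-\nabla\ell)_\sharp\nu_S[\alpha,\beta,\vartheta]$. *)

theory Defs
  imports "HOL-Probability.Probability"
begin

section \<open>Norms, derivatives, smoothness\<close>

text \<open>The Manhattan norm. On \<^typ>\<open>real^'n^'n\<close> it is the sum of the absolute values of the
  entries, on \<^typ>\<open>(real^'n) \<times> (real^'n)\<close> the sum of the Manhattan norms of the components.\<close>

definition l1norm :: "'a::euclidean_space \<Rightarrow> real" where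
  "l1norm x = (\<Sum>b\<in>Basis. \<bar>x \<bullet> b\<bar>)"

definition grad :: "(real^'n \<Rightarrow> real) \<Rightarrow> real^'n \<Rightarrow> real^'n" where
  "grad l x = (\<chi> i. frechet_derivative l (at x) (axis i 1))"

text \<open>\<open>Ck k f\<close>: the function \<open>f\<close> is of class \<open>C\<^sup>k\<close> on the whole space.\<close>

primrec Ck :: "nat \<Rightarrow> ('a::euclidean_space \<Rightarrow> 'b::real_normed_vector) \<Rightarrow> bool" where
  "Ck 0 f \<longleftrightarrow> continuous_on UNIV f"
| "Ck (Suc k) f \<longleftrightarrow> (\<forall>x. f differentiable (at x)) \<and>
     (\<forall>b\<in>Basis. Ck k (\<lambda>x. frechet_derivative f (at x) b))"

section \<open>Compactly supported measures and the Wasserstein distance\<close>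

definition Pc :: "'a::euclidean_space measure set" where
  "Pc = {\<mu>. prob_space \<mu> \<and> sets \<mu> = sets borel \<and> (\<exists>K. compact K \<and> emeasure \<mu> (- K) = 0)}"

definition couplings ::
  "'a::euclidean_space measure \<Rightarrow> 'a measure \<Rightarrow> ('a \<times> 'a) measure set" where
  "couplings \<mu> \<nu> = {\<pi>. sets \<pi> = sets borel \<and> distr \<pi> borel fst = \<mu> \<and> distr \<pi> borel snd = \<nu>}"

definition W1 :: "'a::euclidean_space measure \<Rightarrow> 'a measure \<Rightarrow> ennreal" where
  "W1 \<mu> \<nu> = (INF \<pi>\<in>couplings \<mu> \<nu>. \<integral>\<^sup>+z. ennreal (l1norm (fst z - snd z)) \<partial>\<pi>)"

definition W1_continuous_on :: "real set \<Rightarrow> (real \<Rightarrow> 'a::euclidean_space measure) \<Rightarrow> bool" where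
  "W1_continuous_on I \<mu> \<longleftrightarrow> (\<forall>s\<in>I. ((\<lambda>t. W1 (\<mu> t) (\<mu> s)) \<longlongrightarrow> 0) (at s within I))"

section \<open>Continuity equations\<close>

text \<open>Test functions are of class \<open>C\<^sub>c\<^sup>\<infinity>\<close> on the open set \<open>(0,S) \<times> \<real>\<^sup>d\<close>.\<close>

definition test_function :: "real \<Rightarrow> (real \<times> 'a::euclidean_space \<Rightarrow> real) \<Rightarrow> bool" where
  "test_function S \<phi> \<longleftrightarrow> (\<forall>k. Ck k \<phi>) \<and> compact (closure {z. \<phi> z \<noteq> 0}) \<and>
     closure {z. \<phi> z \<noteq> 0} \<subseteq> {0<..<S} \<times> UNIV"

text \<open>Distributional solutions on \<open>[0,S]\<close> of
  \<open>\<partial>\<^sub>s \<mu>\<^sub>s + \<nabla>\<cdot>(w\<^sub>s \<mu>\<^sub>s) = 0\<close>, as \<open>W1\<close>-continuous curves in \<open>Pc\<close>; the continuity in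
  time gives a meaning to the values at \<open>0\<close> and \<open>S\<close>. The inner integrand
  \<open>frechet_derivative \<phi> (at (s, x)) (1, w s x)\<close> is
  \<open>\<partial>\<^sub>s \<phi>(s,x) + \<nabla>\<^sub>x \<phi>(s,x) \<cdot> w\<^sub>s(x)\<close>. Only the values of \<open>\<mu>\<close> on \<open>[0,S]\<close> matter.\<close>

definition continuity_eq ::
  "real \<Rightarrow> (real \<Rightarrow> 'a::euclidean_space \<Rightarrow> 'a) \<Rightarrow> (real \<Rightarrow> 'a measure) \<Rightarrow> bool" where
  "continuity_eq S w \<mu> \<longleftrightarrow>
     (\<forall>s\<in>{0..S}. \<mu> s \<in> Pc) \<and> W1_continuous_on {0..S} \<mu> \<and>
     (\<forall>\<phi>. test_function S \<phi> \<longrightarrow>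
        (let F = (\<lambda>s. \<integral>x. frechet_derivative \<phi> (at (s, x)) (1, w s x) \<partial>(\<mu> s))
         in integrable (lebesgue_on {0..S}) F \<and> integral\<^sup>L (lebesgue_on {0..S}) F = 0))"

section \<open>Assumptions on the data\<close>

text \<open>The fields \<open>f\<^sub>1, \<dots>, f\<^sub>m\<close> are indexed by a finite type \<open>'m\<close>; \<open>f\<^sub>0\<close> is kept apart.\<close>

definition assumption_A1 ::
  "real \<Rightarrow> real \<Rightarrow> (real^'n \<Rightarrow> real^'n) \<Rightarrow> ('m::finite \<Rightarrow> real^'n \<Rightarrow> real^'n) \<Rightarrow>
   (real^'n \<Rightarrow> real^'n) \<Rightarrow> bool" where
  "assumption_A1 C L f0 f g \<longleftrightarrow>
     (\<forall>x. l1norm (f0 x) + (\<Sum>i\<in>UNIV. l1norm (f i x)) + l1norm (g x) \<le> C) \<and>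
     (\<forall>x x'. l1norm (f0 x - f0 x') + (\<Sum>i\<in>UNIV. l1norm (f i x - f i x')) + l1norm (g x - g x')
        \<le> L * l1norm (x - x'))"

definition assumption_A2 ::
  "(real^'n \<Rightarrow> real^'n) \<Rightarrow> ('m::finite \<Rightarrow> real^'n \<Rightarrow> real^'n) \<Rightarrow> (real^'n \<Rightarrow> real^'n) \<Rightarrow> bool" where
  "assumption_A2 f0 f g \<longleftrightarrow>
     Ck 1 g \<and> Ck 1 f0 \<and> (\<forall>i. Ck 1 (f i)) \<and> (\<forall>x. g (- x) = - g x) \<and>
     (\<forall>K. compact K \<longrightarrow> (\<exists>LK>0. \<forall>x\<in>K. \<forall>x'\<in>K.
        l1norm (jacobian g (at x) - jacobian g (at x')) \<le> LK * l1norm (x - x') \<and>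
        l1norm (jacobian f0 (at x) - jacobian f0 (at x')) \<le> LK * l1norm (x - x') \<and>
        (\<forall>i. l1norm (jacobian (f i) (at x) - jacobian (f i) (at x')) \<le> LK * l1norm (x - x'))))"

definition assumption_A3 :: "real \<Rightarrow> (real^'n \<Rightarrow> real) \<Rightarrow> bool" where
  "assumption_A3 C l \<longleftrightarrow> Ck 1 l \<and> (\<forall>x. \<bar>l x\<bar> + l1norm (grad l x) \<le> C)"

section \<open>The reduced control problem\<close>

definition control_set :: "(real \<times> (real^'m)) set" where
  "control_set = {(a, b). 0 \<le> a \<and> a + (\<Sum>j\<in>UNIV. \<bar>b $ j\<bar>) \<le> 1}"

text \<open>Elements of \<open>L\<^sup>\<infinity>([0,S]; A)\<close> are given by representatives, so values in \<open>A\<close> are required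
  almost everywhere only.\<close>

definition controls :: "real \<Rightarrow> real \<Rightarrow> ((real \<Rightarrow> real) \<times> (real \<Rightarrow> real^'m)) set" where
  "controls S T = {(\<alpha>, \<beta>).
     \<alpha> \<in> borel_measurable (lebesgue_on {0..S}) \<and> \<beta> \<in> borel_measurable (lebesgue_on {0..S}) \<and>
     (AE s in lebesgue_on {0..S}. (\<alpha> s, \<beta> s) \<in> control_set) \<and>
     integral\<^sup>L (lebesgue_on {0..S}) \<alpha> = T}"

definition conv :: "(real^'n \<Rightarrow> real^'n) \<Rightarrow> (real^'n) measure \<Rightarrow> real^'n \<Rightarrow> real^'n" where
  "conv g \<mu> x = (\<integral>y. g (x - y) \<partial>\<mu>)"

text \<open>\<open>\<nu> = \<nu>[\<alpha>,\<beta>,\<theta>]\<close>\<close>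

definition trajectory ::
  "real \<Rightarrow> (real^'n \<Rightarrow> real^'n) \<Rightarrow> ('m::finite \<Rightarrow> real^'n \<Rightarrow> real^'n) \<Rightarrow> (real^'n \<Rightarrow> real^'n) \<Rightarrow>
   (real^'n) measure \<Rightarrow> (real \<Rightarrow> real) \<Rightarrow> (real \<Rightarrow> real^'m) \<Rightarrow> (real \<Rightarrow> (real^'n) measure) \<Rightarrow> bool" where
  "trajectory S f0 f g \<theta> \<alpha> \<beta> \<nu> \<longleftrightarrow>
     continuity_eq S
       (\<lambda>s x. \<alpha> s *\<^sub>R (f0 x + conv g (\<nu> s) x) + (\<Sum>i\<in>UNIV. \<beta> s $ i *\<^sub>R f i x)) \<nu> \<and>
     \<nu> 0 = \<theta>"

definition optimal ::
  "real \<Rightarrow> real \<Rightarrow> (real^'n \<Rightarrow> real^'n) \<Rightarrow> ('m::finite \<Rightarrow> real^'n \<Rightarrow> real^'n) \<Rightarrow>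
   (real^'n \<Rightarrow> real^'n) \<Rightarrow> (real^'n \<Rightarrow> real) \<Rightarrow> (real^'n) measure \<Rightarrow>
   (real \<Rightarrow> real) \<Rightarrow> (real \<Rightarrow> real^'m) \<Rightarrow> bool" where
  "optimal S T f0 f g l \<theta> \<alpha> \<beta> \<longleftrightarrow>
     (\<exists>\<nu>. trajectory S f0 f g \<theta> \<alpha> \<beta> \<nu> \<and>
        (\<forall>(\<alpha>', \<beta>')\<in>controls S T. \<forall>\<nu>'. trajectory S f0 f g \<theta> \<alpha>' \<beta>' \<nu>' \<longrightarrow>
           (\<integral>x. l x \<partial>(\<nu> S)) \<le> (\<integral>x. l x \<partial>(\<nu>' S))))"

section \<open>The Hamiltonian system\<close>

definition vecH ::
  "(real^'n \<Rightarrow> real^'n) \<Rightarrow> ('m::finite \<Rightarrow> real^'n \<Rightarrow> real^'n) \<Rightarrow> (real^'n \<Rightarrow> real^'n) \<Rightarrow>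
   ((real^'n) \<times> (real^'n)) measure \<Rightarrow> real \<Rightarrow> real^'m \<Rightarrow> (real^'n) \<times> (real^'n) \<Rightarrow> (real^'n) \<times> (real^'n)" where
  "vecH f0 f g \<gamma> a b = (\<lambda>(y, p).
     (a *\<^sub>R (\<integral>z. g (y - z) \<partial>(distr \<gamma> borel fst)) + a *\<^sub>R f0 y + (\<Sum>k\<in>UNIV. b $ k *\<^sub>R f k y),
      - (a *\<^sub>R (\<integral>(z, q). (p - q) v* jacobian g (at (y - z)) \<partial>\<gamma>))
        - p v* (a *\<^sub>R jacobian f0 (at y) + (\<Sum>k\<in>UNIV. b $ k *\<^sub>R jacobian (f k) (at y)))))"

definition calH ::
  "(real^'n \<Rightarrow> real^'n) \<Rightarrow> ('m::finite \<Rightarrow> real^'n \<Rightarrow> real^'n) \<Rightarrow> (real^'n \<Rightarrow> real^'n) \<Rightarrow>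
   ((real^'n) \<times> (real^'n)) measure \<Rightarrow> real \<Rightarrow> real \<Rightarrow> real^'m \<Rightarrow> real" where
  "calH f0 f g \<gamma> c a b =
     a / 2 * (\<integral>(y, p). (\<integral>(z, q). (p - q) \<bullet> g (y - z) \<partial>\<gamma>) \<partial>\<gamma>) + a * c
     + a * (\<integral>(y, p). p \<bullet> f0 y \<partial>\<gamma>) + (\<Sum>k\<in>UNIV. b $ k * (\<integral>(y, p). p \<bullet> f k y \<partial>\<gamma>))"

definition calH1 ::
  "(real^'n \<Rightarrow> real^'n) \<Rightarrow> (real^'n \<Rightarrow> real^'n) \<Rightarrow> ((real^'n) \<times> (real^'n)) measure \<Rightarrow> real \<Rightarrow> real" where
  "calH1 f0 g \<gamma> c =
     1 / 2 * (\<integral>(y, p). (\<integral>(z, q). (p - q) \<bullet> g (y - z) \<partial>\<gamma>) \<partial>\<gamma>)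
     + (\<integral>(y, p). p \<bullet> f0 y \<partial>\<gamma>) + c"

definition calH0 ::
  "('m::finite \<Rightarrow> real^'n \<Rightarrow> real^'n) \<Rightarrow> ((real^'n) \<times> (real^'n)) measure \<Rightarrow> real" where
  "calH0 f \<gamma> = (MAX i\<in>UNIV. \<bar>\<integral>(y, p). p \<bullet> f i y \<partial>\<gamma>\<bar>)"

text \<open>A solution of the boundary value problem is regular if it solves the terminal value problem
  with \<open>\<gamma>\<^sub>S = (id, -\<nabla>l)\<^sub>\<sharp> \<nu>\<^sub>S[\<alpha>,\<beta>,\<theta>]\<close>.\<close>

definition bvp_solution ::
  "real \<Rightarrow> (real^'n \<Rightarrow> real^'n) \<Rightarrow> ('m::finite \<Rightarrow> real^'n \<Rightarrow> real^'n) \<Rightarrow> (real^'n \<Rightarrow> real^'n) \<Rightarrow>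
   (real^'n \<Rightarrow> real) \<Rightarrow> (real^'n) measure \<Rightarrow> (real \<Rightarrow> real) \<Rightarrow> (real \<Rightarrow> real^'m) \<Rightarrow>
   (real \<Rightarrow> ((real^'n) \<times> (real^'n)) measure) \<Rightarrow> bool" where
  "bvp_solution S f0 f g l \<theta> \<alpha> \<beta> \<gamma> \<longleftrightarrow>
     continuity_eq S (\<lambda>s. vecH f0 f g (\<gamma> s) (\<alpha> s) (\<beta> s)) \<gamma> \<and>
     distr (\<gamma> 0) borel fst = \<theta> \<and>
     distr (\<gamma> S) borel snd = distr (distr (\<gamma> S) borel fst) borel (\<lambda>x. - grad l x)"

definition regular_solution ::
  "real \<Rightarrow> (real^'n \<Rightarrow> real^'n) \<Rightarrow> ('m::finite \<Rightarrow> real^'n \<Rightarrow> real^'n) \<Rightarrow> (real^'n \<Rightarrow> real^'n) \<Rightarrow>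
   (real^'n \<Rightarrow> real) \<Rightarrow> (real^'n) measure \<Rightarrow> (real \<Rightarrow> real) \<Rightarrow> (real \<Rightarrow> real^'m) \<Rightarrow>
   (real \<Rightarrow> ((real^'n) \<times> (real^'n)) measure) \<Rightarrow> bool" where
  "regular_solution S f0 f g l \<theta> \<alpha> \<beta> \<gamma> \<longleftrightarrow>
     bvp_solution S f0 f g l \<theta> \<alpha> \<beta> \<gamma> \<and>
     (\<exists>\<nu>. trajectory S f0 f g \<theta> \<alpha> \<beta> \<nu> \<and> \<gamma> S = distr (\<nu> S) borel (\<lambda>x. (x, - grad l x)))"

definition is_maximum :: "real \<Rightarrow> real set \<Rightarrow> bool" where
  "is_maximum v X \<longleftrightarrow> v \<in> X \<and> (\<forall>x\<in>X. x \<le> v)"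

end

theory Submission
  imports Defs
begin

text \<open>
  The representation \<open>\<nu>\<^sub>s = (X\<^sub>s)\<^sub>\<sharp>\<theta>\<close> of the solutions of the reduced system by the flow of their own
  velocity field turns the problem into one for ordinary differential equations indexed by the
  starting point \<open>x\<close> and coupled through \<open>\<theta>\<close>. Along the flow of the optimal control, let \<open>P\<close> be the
  solution of the linear backward equation with terminal value \<open>- \<nabla>l(X\<^sub>S)\<close>; then
  \<open>\<gamma>\<^sub>s = (X\<^sub>s, P\<^sub>s)\<^sub>\<sharp>\<theta>\<close> is the regular solution. As the control set is convex, the optimal control may be
  moved a fraction \<open>\<epsilon>\<close> of the way to any competitor. The cost then changes by \<open>- \<epsilon>\<close> times the integral of
  the increment of the (affine) Hamiltonian, up to \<open>o(\<epsilon>)\<close>, so this integral is not positive. What remains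
  is a linear maximisation problem under the constraint \<open>\<integral>\<alpha> = T\<close>, whose multiplier \<open>\<lambda>\<close> comes
  from the bathtub principle; here \<open>0 < T < S\<close> is used.
\<close>

section \<open>Integration along paths\<close>

text \<open>An optimal control comes with a trajectory that is known only as a distributional
  solution, so the flow representation amounts to a uniqueness theorem. Once the field generated by
  the trajectory is frozen the equation is linear, but the field is merely measurable in time and
  its space derivative is only locally Lipschitz. Hence no classical backward transport equation is
  available, and time is discretised instead.

  Moving towards a competitor by convex combination preserves
  \<open>\<integral>\<alpha> = T\<close>, which a change of the control near a single time would
  violate.

  Oddness of \<open>g\<close> enters twice: its Jacobian is even, which makes the adjoint of the
  linearised interaction the one that occurs in \<open>vecH\<close>, and the two halves of the
  interaction energy coincide, which explains the factor 1/2 in \<open>calH\<close>.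

  Controls are classes of Lebesgue measurable functions; the argument runs on Borel representatives
  that satisfy the constraints at every time, and returns to the given control by changing fields on
  null sets of times.\<close>

lemma borel_measurable_lebesgue_onI:
  fixes f :: "'a::euclidean_space \<Rightarrow> 'b::euclidean_space"
  shows "f \<in> borel_measurable borel \<Longrightarrow> f \<in> borel_measurable (lebesgue_on A)"
  by (simp add: measurable_completion measurable_restrict_space1)

lemma integrable_on_bounded_measurable:
  fixes f :: "real \<Rightarrow> 'b::euclidean_space"
  assumes "f \<in> borel_measurable borel" "\<And>t. t \<in> {a..b} \<Longrightarrow> norm (f t) \<le> B"
  shows "f integrable_on {a..b}"
  by (rule measurable_bounded_by_integrable_imp_integrable[where g="\<lambda>_. B"])
     (use assms borel_measurable_lebesgue_onI in \<open>auto simp: integrable_const_ivl\<close>)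

lemma integrable_lebesgue_on_bounded:
  fixes f :: "real \<Rightarrow> 'b::euclidean_space"
  assumes "f \<in> borel_measurable borel" "\<And>t. t \<in> {a..b} \<Longrightarrow> norm (f t) \<le> B"
  shows "integrable (lebesgue_on {a..b}) f"
  by (rule measurable_bounded_by_integrable_imp_lebesgue_integrable[where g="\<lambda>_. B"])
     (use assms borel_measurable_lebesgue_onI in auto)

lemma norm_integral_ivl_le:
  fixes f :: "real \<Rightarrow> 'b::euclidean_space"
  assumes "f integrable_on {a..b}" "\<And>t. t \<in> {a..b} \<Longrightarrow> norm (f t) \<le> B" "a \<le> b"
  shows "norm (integral {a..b} f) \<le> B * (b - a)"
proof -
  have "0 \<le> B" using assms(2)[of a] assms(3) norm_ge_zero[of "f a"] by (meson atLeastAtMost_iff order_refl order_trans)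
  from has_integral_bound[OF this, of f "integral {a..b} f" a b] show ?thesis
    using assms by (simp add: has_integral_integral)
qed

text \<open>Lebesgue measure on an interval, kept on the Borel sets of the whole line so that
  functions on the line need no restriction. It links the Henstock-Kurzweil \<open>integral\<close>
  over \<open>{a..b}\<close> with Fubini's theorem.\<close>

definition ivl_measure :: "real \<Rightarrow> real \<Rightarrow> real measure" where
  "ivl_measure a b = density lborel (indicator {a..b})"

lemma sets_ivl_measure[simp, measurable_cong]: "sets (ivl_measure a b) = sets borel"
  by (simp add: ivl_measure_def)

lemma space_ivl_measure[simp]: "space (ivl_measure a b) = UNIV"
  by (simp add: ivl_measure_def)

lemma finite_measure_ivl_measure: "finite_measure (ivl_measure a b)"
proof
  have "emeasure (ivl_measure a b) (space (ivl_measure a b)) = emeasure lborel {a..b}"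
    by (simp add: ivl_measure_def emeasure_density)
  also have "\<dots> < \<infinity>" by (cases "a \<le> b") auto
  finally show "emeasure (ivl_measure a b) (space (ivl_measure a b)) \<noteq> \<infinity>" by simp
qed

lemma AE_ivl_measure: "AE t in ivl_measure a b. t \<in> {a..b}"
  unfolding ivl_measure_def by (subst AE_density) (auto simp: indicator_def)

lemma integral_ivl_measure:
  fixes f :: "real \<Rightarrow> 'b::euclidean_space"
  assumes [measurable]: "f \<in> borel_measurable borel" and "\<And>t. t \<in> {a..b} \<Longrightarrow> norm (f t) \<le> B"
  shows "integral\<^sup>L (ivl_measure a b) f = integral {a..b} f"
proof -
  have "integral\<^sup>L (ivl_measure a b) f = (LINT t:{a..b}|lborel. f t)"
    unfolding ivl_measure_def set_lebesgue_integral_def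
    by (subst integral_density[symmetric]) (auto simp: ennreal_indicator)
  also have "\<dots> = integral {a..b} f"
  proof (rule set_borel_integral_eq_integral)
    have "integrable lborel (\<lambda>t. indicator {a..b} t *\<^sub>R B)"
      by (rule integrable_scaleR_left, rule integrable_real_indicator) (simp_all add: emeasure_lborel_Icc_eq)
    then show "set_integrable lborel {a..b} f"
      unfolding set_integrable_def
    proof (rule Bochner_Integration.integrable_bound)
      show "AE x in lborel. norm (indicator {a..b} x *\<^sub>R f x) \<le> norm (indicator {a..b} x *\<^sub>R B)"
        using assms(2) by (auto simp: indicator_def intro!: order_trans[OF _ abs_ge_self])
    qed simp
  qed
  finally show ?thesis .
qed

text \<open>Fubini's theorem for the finite measures \<open>ivl_measure a b\<close> and
  \<open>M\<close>: boundedness gives integrability, and \<open>integral_ivl_measure\<close>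
  translates back to the integral over the interval.\<close>

lemma
  fixes f :: "real \<Rightarrow> 'x \<Rightarrow> 'b::euclidean_space"
  assumes M: "finite_measure M"
    and f: "(\<lambda>(t, x). f t x) \<in> borel_measurable (borel \<Otimes>\<^sub>M M)"
    and B: "\<And>t x. t \<in> {a..b} \<Longrightarrow> x \<in> space M \<Longrightarrow> norm (f t x) \<le> B"
  shows borel_measurable_lebesgue_integral_time: "(\<lambda>t. \<integral>x. f t x \<partial>M) \<in> borel_measurable borel"
    and borel_measurable_integral_ivl: "(\<lambda>x. integral {a..b} (\<lambda>t. f t x)) \<in> borel_measurable M"
    and integral_ivl_swap: "integral {a..b} (\<lambda>t. \<integral>x. f t x \<partial>M) = (\<integral>x. integral {a..b} (\<lambda>t. f t x) \<partial>M)"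
    and norm_lebesgue_integral_time_le:
      "\<And>t. t \<in> {a..b} \<Longrightarrow> norm (\<integral>x. f t x \<partial>M) \<le> B * measure M (space M)"
proof -
  interpret M: finite_measure M by fact
  interpret I: finite_measure "ivl_measure a b" by (rule finite_measure_ivl_measure)
  interpret P: pair_sigma_finite "ivl_measure a b" M ..
  interpret PF: finite_measure "ivl_measure a b \<Otimes>\<^sub>M M"
    using finite_measure_pair_measure[OF M finite_measure_ivl_measure] .
  note f[measurable]
  show 1: "(\<lambda>t. \<integral>x. f t x \<partial>M) \<in> borel_measurable borel"
    by (rule M.borel_measurable_lebesgue_integral) (use f in \<open>simp add: case_prod_beta'\<close>)
  have fx: "(\<lambda>t. f t x) \<in> borel_measurable borel" if "x \<in> space M" for x
    using measurable_compose[OF measurable_Pair2'[OF that, where ?M1.0=borel] f] by simp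
  have ft: "(\<lambda>x. f t x) \<in> borel_measurable M" for t
    using measurable_compose[OF measurable_Pair1'[of t borel] f] by simp
  have eq: "integral {a..b} (\<lambda>t. f t x) = (LINT t|ivl_measure a b. f t x)" if "x \<in> space M" for x
    by (rule integral_ivl_measure[symmetric, of _ _ _ B]) (use B that fx in auto)
  have meas: "(\<lambda>x. LINT t|ivl_measure a b. f t x) \<in> borel_measurable M"
  proof (rule I.borel_measurable_lebesgue_integral)
    show "case_prod (\<lambda>x t. f t x) \<in> borel_measurable (M \<Otimes>\<^sub>M ivl_measure a b)"
      using measurable_compose[OF measurable_pair_swap' f]
      by (simp add: case_prod_beta' cong: measurable_cong_sets[OF sets_pair_measure_cong])
  qed
  then show "(\<lambda>x. integral {a..b} (\<lambda>t. f t x)) \<in> borel_measurable M"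
    by (subst measurable_cong[OF eq])
  show bd: "norm (\<integral>x. f t x \<partial>M) \<le> B * measure M (space M)" if "t \<in> {a..b}" for t
  proof -
    have "norm (\<integral>x. f t x \<partial>M) \<le> (\<integral>x. norm (f t x) \<partial>M)" by (rule integral_norm_bound)
    also have "\<dots> \<le> (\<integral>x. B \<partial>M)"
    proof (rule integral_mono)
      show "integrable M (\<lambda>x. norm (f t x))"
        by (rule M.integrable_const_bound[where B=B]) (use B[OF that] ft[of t] in auto)
    qed (use B[OF that] in auto)
    finally show ?thesis by (simp add: mult.commute)
  qed
  have "integral {a..b} (\<lambda>t. \<integral>x. f t x \<partial>M) = (LINT t|ivl_measure a b. (\<integral>x. f t x \<partial>M))"
    by (rule integral_ivl_measure[symmetric, OF 1]) (rule bd)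
  also have "\<dots> = (\<integral>x. (\<integral>t. f t x \<partial>ivl_measure a b) \<partial>M)"
  proof (rule P.Fubini_integral[symmetric], rule PF.integrable_const_bound[where B=B])
    show "AE z in ivl_measure a b \<Otimes>\<^sub>M M. norm (case_prod f z) \<le> B"
    proof (rule P.AE_pair_measure)
      show "{z \<in> space (ivl_measure a b \<Otimes>\<^sub>M M). norm (case_prod f z) \<le> B} \<in> sets (ivl_measure a b \<Otimes>\<^sub>M M)"
        by measurable
      show "AE x in ivl_measure a b. AE y in M. norm (case_prod f (x, y)) \<le> B"
        using AE_ivl_measure by eventually_elim (use B in auto)
    qed
  qed (use f in \<open>simp cong: measurable_cong_sets[OF sets_pair_measure_cong]\<close>)
  also have "\<dots> = (\<integral>x. integral {a..b} (\<lambda>t. f t x) \<partial>M)"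
    by (rule Bochner_Integration.integral_cong) (simp_all add: eq)
  finally show "integral {a..b} (\<lambda>t. \<integral>x. f t x \<partial>M) = (\<integral>x. integral {a..b} (\<lambda>t. f t x) \<partial>M)" .
qed

lemma has_integral_split_ivl:
  fixes f :: "real \<Rightarrow> 'b::euclidean_space"
  assumes "f integrable_on {0..S}" "0 \<le> s" "s \<le> t" "t \<le> S"
  shows "integral {0..t} f - integral {0..s} f = integral {s..t} f"
proof -
  have "f integrable_on {0..t}" by (rule integrable_subinterval_real[OF assms(1)]) (use assms in auto)
  from Henstock_Kurzweil_Integration.integral_combine[OF assms(2,3) this] show ?thesis by (simp add: algebra_simps)
qed

text \<open>\<open>Ck\<close> speaks of derivatives in basis directions only. This expansion turns
  that into continuity or measurability of a derivative applied to a varying vector.\<close>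

lemma linear_euclidean_sum:
  fixes h :: "'a::euclidean_space" and A :: "'a \<Rightarrow> 'b::real_vector"
  assumes "linear A"
  shows "A h = (\<Sum>b\<in>Basis. (h \<bullet> b) *\<^sub>R A b)"
proof -
  have "A h = A (\<Sum>b\<in>Basis. (h \<bullet> b) *\<^sub>R b)" by (simp add: euclidean_representation)
  then show ?thesis by (simp add: linear_sum[OF assms] linear_scale[OF assms])
qed

text \<open>The difference of both sides has derivative zero at every point, although the absolutely
  continuous path \<open>Y\<close> need not be differentiable.\<close>

lemma chain_rule_integral_path:
  fixes Y V :: "real \<Rightarrow> 'a::euclidean_space" and \<Phi> :: "'a \<Rightarrow> 'b::euclidean_space"
  assumes V: "V \<in> borel_measurable borel" "\<And>s. s \<in> {0..S} \<Longrightarrow> norm (V s) \<le> B"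
    and Y: "continuous_on UNIV Y" "\<And>s. s \<in> {0..S} \<Longrightarrow> Y s = Y 0 + integral {0..s} V"
    and \<Phi>: "\<And>x. (\<Phi> has_derivative \<Phi>' x) (at x)" "\<And>b. b \<in> Basis \<Longrightarrow> continuous_on UNIV (\<lambda>x. \<Phi>' x b)"
  shows chain_rule_integral_path_measurable: "(\<lambda>s. \<Phi>' (Y s) (V s)) \<in> borel_measurable borel"
    and chain_rule_integral_path_bounded: "\<exists>B'. \<forall>s\<in>{0..S}. norm (\<Phi>' (Y s) (V s)) \<le> B'"
    and chain_rule_integral_path_eq:
      "\<And>t. t \<in> {0..S} \<Longrightarrow> \<Phi> (Y t) = \<Phi> (Y 0) + integral {0..t} (\<lambda>s. \<Phi>' (Y s) (V s))"
proof -
  have lin: "linear (\<Phi>' x)" for x using \<Phi>(1) by (rule has_derivative_linear)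
  have exp: "\<Phi>' x h = (\<Sum>b\<in>Basis. (h \<bullet> b) *\<^sub>R \<Phi>' x b)" for x h
    by (rule linear_euclidean_sum[OF lin])
  have cont: "continuous_on UNIV (\<lambda>s. \<Phi>' (Y s) b)" if "b \<in> Basis" for b
    using continuous_on_compose2[OF \<Phi>(2)[OF that] Y(1)] by simp
  note borel_measurable_continuous_onI[OF cont, measurable] V(1)[measurable]
  let ?F = "\<lambda>s. \<Phi>' (Y s) (V s)"
  show meas: "?F \<in> borel_measurable borel"
    by (subst exp) measurable
  have nb: "norm (\<Phi>' x h) \<le> norm h * (\<Sum>b\<in>Basis. norm (\<Phi>' x b))" for x h
    unfolding exp[of x h] sum_distrib_left
    by (rule order_trans[OF norm_sum], rule sum_mono) (simp add: mult_right_mono Basis_le_norm)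
  have "compact ((\<lambda>s. \<Sum>b\<in>Basis. norm (\<Phi>' (Y s) b)) ` {0..S})"
    by (intro compact_continuous_image continuous_intros continuous_on_subset[OF cont]) auto
  from compact_imp_bounded[OF this] obtain B1 where B1: "\<And>s. s \<in> {0..S} \<Longrightarrow> (\<Sum>b\<in>Basis. norm (\<Phi>' (Y s) b)) \<le> B1"
    unfolding bounded_iff by (fastforce dest: abs_le_D1)
  have bdF: "norm (?F s) \<le> B * B1" if "s \<in> {0..S}" for s
    by (rule order_trans[OF nb]) (intro mult_mono B1 V that order_trans[OF norm_ge_zero V(2)[OF that]] sum_nonneg norm_ge_zero)
  then show "\<exists>B'. \<forall>s\<in>{0..S}. norm (?F s) \<le> B'" by blast
  have intF: "?F integrable_on {0..S}" by (rule integrable_on_bounded_measurable[OF meas bdF])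
  have intV: "V integrable_on {0..S}" by (rule integrable_on_bounded_measurable[OF V])
  let ?G = "\<lambda>t. \<Phi> (Y t) - integral {0..t} ?F"
  have "(?G has_derivative (\<lambda>_. 0)) (at r within {0..S})" if r: "r \<in> {0..S}" for r
    unfolding has_derivative_within_alt
  proof (intro conjI allI impI)
    fix e :: real assume e: "e > 0"
    \<comment> \<open>Two errors of size \<open>B * e'\<close> per unit of time will be added, one
      from the Taylor remainder of \<Phi> and one from the variation of \<open>\<Phi>'\<close>; the
      summand 1 guards against \<open>B = 0\<close>.\<close>
    define e' where "e' = e / (2 * (\<bar>B\<bar> + 1))"
    have e': "e' > 0" using e by (simp add: e'_def add_nonneg_pos)
    obtain d1 where d1: "d1 > 0" "\<And>y. norm (y - Y r) < d1 \<Longrightarrow> norm (\<Phi> y - \<Phi> (Y r) - \<Phi>' (Y r) (y - Y r)) \<le> e' * norm (y - Y r)"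
      using \<Phi>(1)[of "Y r"] e' unfolding has_derivative_at_alt by blast
    \<comment> \<open>Continuity of \<open>\<Phi>'\<close> is given on basis vectors, so its
      oscillation near \<open>Y r\<close> is measured by this sum.\<close>
    let ?\<kappa> = "\<lambda>s. \<Sum>b\<in>Basis. norm (\<Phi>' (Y s) b - \<Phi>' (Y r) b)"
    have "continuous (at r) ?\<kappa>"
      using continuous_on_eq_continuous_at[OF open_UNIV] cont
      by (intro continuous_intros) auto
    then obtain d2 where d2: "d2 > 0" and d2': "\<And>s. dist s r < d2 \<Longrightarrow> dist (?\<kappa> s) (?\<kappa> r) < e'"
      unfolding continuous_at_eps_delta using e' by blast
    have d2'': "?\<kappa> s < e'" if "dist s r < d2" for s
      using d2'[OF that] by (simp add: dist_real_def sum_nonneg)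
    have "continuous (at r) Y" using Y(1) continuous_on_eq_continuous_at[OF open_UNIV] by blast
    then obtain d3 where d3: "d3 > 0" "\<And>s. dist s r < d3 \<Longrightarrow> norm (Y s - Y r) < d1"
      unfolding continuous_at_eps_delta dist_norm using d1(1) by blast
    \<comment> \<open>The point \<open>r\<close> is one of the two ends, so increments to either
      side are covered while the integral runs over an ordered interval.\<close>
    have key: "norm (?G t - ?G s) \<le> e * (t - s)"
      if st: "s \<le> t" "s \<in> {0..S}" "t \<in> {0..S}" "r \<in> {s,t}" "t - s < min d2 d3" for s t
    proof -
      have sub: "{s..t} \<subseteq> {0..S}" using st by auto
      have iV: "V integrable_on {s..t}" and iF: "?F integrable_on {s..t}"
        using integrable_subinterval_real[OF intV] integrable_subinterval_real[OF intF] sub by auto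
      have dY: "Y t - Y s = integral {s..t} V"
        using Y(2)[of s] Y(2)[of t] st has_integral_split_ivl[OF intV, of s t] by (auto simp: algebra_simps)
      have dYn: "norm (Y t - Y s) \<le> B * (t - s)" unfolding dY
        by (rule norm_integral_ivl_le[OF iV V(2)]) (use sub st in auto)
      let ?R = "\<lambda>y. \<Phi> y - \<Phi> (Y r) - \<Phi>' (Y r) (y - Y r)"
      have bl: "bounded_linear (\<Phi>' (Y r))" using \<Phi>(1) by (rule has_derivative_bounded_linear)
      have R: "norm (?R y) \<le> e' * (B * (t - s))" if "y \<in> {Y s, Y t}" for y
      proof -
        have "norm (y - Y r) < d1" using that st d3 d1 by (auto simp: dist_real_def)
        from d1(2)[OF this] have "norm (?R y) \<le> e' * norm (y - Y r)" .
        also have "norm (y - Y r) \<le> B * (t - s)" using that st(4) dYn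
          by (auto simp: norm_minus_commute intro: order_trans[OF norm_ge_zero dYn])
        finally show ?thesis using e' by simp
      qed
      have R0: "?R (Y r) = 0" using linear_0[OF lin] by simp
      have "norm (\<Phi> (Y t) - \<Phi> (Y s) - \<Phi>' (Y r) (Y t - Y s)) = norm (?R (Y t) - ?R (Y s))"
        by (simp add: linear_diff[OF lin] algebra_simps)
      also have "\<dots> \<le> e' * (B * (t - s))"
      proof -
        have "?R (Y s) = 0 \<or> ?R (Y t) = 0" using st(4) R0 by blast
        then show ?thesis using R[of "Y t"] R[of "Y s"] by (metis diff_0 diff_zero insertCI norm_minus_cancel)
      qed
      finally have 1: "norm (\<Phi> (Y t) - \<Phi> (Y s) - \<Phi>' (Y r) (Y t - Y s)) \<le> e' * (B * (t - s))" .
      \<comment> \<open>The derivative frozen at \<open>Y r\<close> is linear and commutes with the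
        integral; this replaces the missing derivative of \<open>Y\<close>.\<close>
      have "\<Phi>' (Y r) (Y t - Y s) = integral {s..t} (\<lambda>\<sigma>. \<Phi>' (Y r) (V \<sigma>))"
        unfolding dY using integral_linear[OF iV bl] by (simp add: o_def)
      then have "\<Phi>' (Y r) (Y t - Y s) - integral {s..t} ?F = integral {s..t} (\<lambda>\<sigma>. \<Phi>' (Y r) (V \<sigma>) - ?F \<sigma>)"
        using integrable_linear[OF iV bl] iF by (simp add: integral_diff o_def)
      also have "norm \<dots> \<le> (B * e') * (t - s)"
      proof (rule norm_integral_ivl_le)
        show "(\<lambda>\<sigma>. \<Phi>' (Y r) (V \<sigma>) - ?F \<sigma>) integrable_on {s..t}"
          using integrable_linear[OF iV bl] iF by (intro integrable_diff) (auto simp: o_def)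
        fix \<sigma> assume \<sigma>: "\<sigma> \<in> {s..t}"
        have "\<Phi>' (Y r) (V \<sigma>) - ?F \<sigma> = (\<Sum>b\<in>Basis. (V \<sigma> \<bullet> b) *\<^sub>R (\<Phi>' (Y r) b - \<Phi>' (Y \<sigma>) b))"
          unfolding exp[of _ "V \<sigma>"] by (simp add: sum_subtractf scaleR_diff_right)
        also have "norm \<dots> \<le> (\<Sum>b\<in>Basis. norm (V \<sigma>) * norm (\<Phi>' (Y \<sigma>) b - \<Phi>' (Y r) b))"
          by (rule order_trans[OF norm_sum], rule sum_mono) (simp add: mult_right_mono Basis_le_norm norm_minus_commute)
        also have "\<dots> = norm (V \<sigma>) * ?\<kappa> \<sigma>" by (simp add: sum_distrib_left)
        also have "\<dots> \<le> B * e'"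
        proof (rule mult_mono)
          show "norm (V \<sigma>) \<le> B" using V(2) sub \<sigma> by auto
          then show "0 \<le> B" using norm_ge_zero order_trans by blast
          show "?\<kappa> \<sigma> \<le> e'" by (rule less_imp_le[OF d2'']) (use \<sigma> st in \<open>auto simp: dist_real_def\<close>)
        qed (simp add: sum_nonneg)
        finally show "norm (\<Phi>' (Y r) (V \<sigma>) - ?F \<sigma>) \<le> B * e'" .
      qed (use st in simp)
      finally have 2: "norm (\<Phi>' (Y r) (Y t - Y s) - integral {s..t} ?F) \<le> (B * e') * (t - s)" .
      have "?G t - ?G s = (\<Phi> (Y t) - \<Phi> (Y s) - \<Phi>' (Y r) (Y t - Y s)) + (\<Phi>' (Y r) (Y t - Y s) - integral {s..t} ?F)"
        using has_integral_split_ivl[OF intF, of s t] st by (simp add: algebra_simps)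
      then have "norm (?G t - ?G s) \<le> e' * (B * (t - s)) + (B * e') * (t - s)"
        using norm_triangle_mono[OF 1 2] by metis
      also have "\<dots> = (2 * B * e') * (t - s)" by simp
      also have "\<dots> \<le> e * (t - s)"
      proof (rule mult_right_mono)
        have "2 * B * e' \<le> 2 * (\<bar>B\<bar> + 1) * e'" using e' by (intro mult_right_mono) auto
        also have "\<dots> = e" unfolding e'_def by (simp add: field_simps add_nonneg_eq_0_iff)
        finally show "2 * B * e' \<le> e" .
      qed (use st in simp)
      finally show ?thesis .
    qed
    have "norm (?G y - ?G r) \<le> e * norm (y - r)" if "y \<in> {0..S}" "norm (y - r) < min d2 d3" for y
      using key[of r y] key[of y r] that r by (cases "y \<le> r") (auto simp: norm_minus_commute)
    then show "\<exists>d>0. \<forall>y\<in>{0..S}. norm (y - r) < d \<longrightarrow> norm (?G y - ?G r - 0) \<le> e * norm (y - r)"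
      by (intro exI[of _ "min d2 d3"]) (use d2 d3 in auto)
  qed simp
  then obtain c where c: "\<And>x. x \<in> {0..S} \<Longrightarrow> ?G x = c"
    using has_derivative_zero_constant[of "{0..S}" ?G] by auto
  show "\<Phi> (Y t) = \<Phi> (Y 0) + integral {0..t} ?F" if "t \<in> {0..S}" for t
    using c[OF that] c[of 0] that by (auto simp: algebra_simps)
qed

section \<open>Volterra integral equations\<close>

text \<open>Clamping time to \<open>{0..S}\<close> extends curves that are meaningful only there to
  the whole line, with continuity preserved.\<close>

definition clip :: "real \<Rightarrow> real \<Rightarrow> real" where
  "clip S s = max 0 (min S s)"

lemma clip_id[simp]: "s \<in> {0..S} \<Longrightarrow> clip S s = s"
  by (simp add: clip_def)

lemma clip_mem: "0 \<le> S \<Longrightarrow> clip S s \<in> {0..S}"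
  by (simp add: clip_def)

lemma continuous_on_clip[continuous_intros]: "continuous_on A f \<Longrightarrow> continuous_on A (\<lambda>x. clip S (f x))"
  unfolding clip_def by (intro continuous_intros)

lemma dist_clip_le: "\<bar>clip S s - clip S t\<bar> \<le> \<bar>s - t\<bar>"
  unfolding clip_def by (auto simp: max_def min_def)

text \<open>In time the integral is Lipschitz with constant \<open>B\<close>, uniformly in the
  parameter; at a fixed time dominated convergence gives continuity in the parameter.\<close>

lemma continuous_on_integral_param:
  fixes f :: "real \<Rightarrow> 'x::metric_space \<Rightarrow> 'b::euclidean_space"
  assumes meas: "\<And>x. (\<lambda>\<sigma>. f \<sigma> x) \<in> borel_measurable borel"
    and cont: "\<And>\<sigma>. continuous_on UNIV (f \<sigma>)"
    and bound: "\<And>\<sigma> x. norm (f \<sigma> x) \<le> B" and S: "0 \<le> S"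
  shows "continuous_on UNIV (\<lambda>z. integral {0..clip S (fst z)} (\<lambda>\<sigma>. f \<sigma> (snd z)))"
  unfolding continuous_on_sequentially o_def
proof (intro allI ballI impI, elim conjE)
  fix z and zs :: "nat \<Rightarrow> real \<times> 'x" assume lim: "zs \<longlonglongrightarrow> z"
  let ?G = "\<lambda>s x. integral {0..clip S s} (\<lambda>\<sigma>. f \<sigma> x)"
  have int: "(\<lambda>\<sigma>. f \<sigma> x) integrable_on {a..b}" for a b x
    by (rule integrable_on_bounded_measurable[OF meas bound])
  have mono: "norm (?G s x - ?G t x) \<le> B * \<bar>s - t\<bar>" if "clip S t \<le> clip S s" for s t x
  proof -
    have "?G s x - ?G t x = integral {clip S t..clip S s} (\<lambda>\<sigma>. f \<sigma> x)"
      by (rule has_integral_split_ivl[OF int, where S=S]) (use clip_mem[OF S] that in auto)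
    also have "norm \<dots> \<le> B * (clip S s - clip S t)" by (rule norm_integral_ivl_le[OF int bound that])
    also have "\<dots> \<le> B * \<bar>s - t\<bar>"
      using dist_clip_le[of S s t] that order_trans[OF norm_ge_zero bound] by (intro mult_left_mono) auto
    finally show ?thesis .
  qed
  have lip: "norm (?G s x - ?G t x) \<le> B * \<bar>s - t\<bar>" for s t x
    using mono[of s t x] mono[of t s x] by (cases "clip S t \<le> clip S s") (auto simp: norm_minus_commute abs_minus_commute)
  have 1: "(\<lambda>n. ?G (fst (zs n)) (snd (zs n)) - ?G (fst z) (snd (zs n))) \<longlonglongrightarrow> 0"
  proof (rule Lim_null_comparison[OF always_eventually], rule allI, rule lip)
    have "(\<lambda>n. B * \<bar>fst (zs n) - fst z\<bar>) \<longlonglongrightarrow> B * \<bar>fst z - fst z\<bar>"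
      by (intro tendsto_intros lim)
    then show "(\<lambda>n. B * \<bar>fst (zs n) - fst z\<bar>) \<longlonglongrightarrow> 0" by simp
  qed
  have 2: "(\<lambda>n. ?G (fst z) (snd (zs n))) \<longlonglongrightarrow> ?G (fst z) (snd z)"
  proof (rule dominated_convergence(2)[where h="\<lambda>_. B"])
    show "(\<lambda>n. f \<sigma> (snd (zs n))) \<longlonglongrightarrow> f \<sigma> (snd z)" for \<sigma>
      using cont[of \<sigma>] tendsto_snd[OF lim] unfolding continuous_on_sequentially o_def by blast
  qed (auto simp: int bound)
  show "(\<lambda>n. ?G (fst (zs n)) (snd (zs n))) \<longlonglongrightarrow> ?G (fst z) (snd z)"
    using tendsto_add[OF 1 2] by simp
qed

text \<open>Banach's fixed point theorem in the norm weighted by \<open>exp (- 2 \<Lambda> s)\<close>.\<close>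

lemma volterra_solution:
  fixes F :: "real \<Rightarrow> ('x::euclidean_space \<Rightarrow> 'b::euclidean_space) \<Rightarrow> 'x \<Rightarrow> 'b"
  assumes S: "0 \<le> S" and \<Lambda>: "0 < \<Lambda>"
    and u0: "continuous_on UNIV u0" "\<And>x. norm (u0 x) \<le> B0"
    and meas: "\<And>U x. continuous_on UNIV (\<lambda>z. U (fst z) (snd z)) \<Longrightarrow> (\<exists>B. \<forall>s x. norm (U s x) \<le> B) \<Longrightarrow>
       (\<lambda>\<sigma>. F \<sigma> (U \<sigma>) x) \<in> borel_measurable borel"
    and cont: "\<And>\<sigma> v. continuous_on UNIV v \<Longrightarrow> (\<exists>B. \<forall>y. norm (v y) \<le> B) \<Longrightarrow> continuous_on UNIV (F \<sigma> v)"
    and bnd: "\<And>\<rho>. \<exists>B. \<forall>\<sigma> v x. continuous_on UNIV v \<longrightarrow> (\<forall>y. norm (v y) \<le> \<rho>) \<longrightarrow> norm (F \<sigma> v x) \<le> B"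
    and lip: "\<And>\<sigma> v v' x d. continuous_on UNIV v \<Longrightarrow> continuous_on UNIV v' \<Longrightarrow>
       (\<exists>B. \<forall>y. norm (v y) \<le> B) \<Longrightarrow> (\<exists>B. \<forall>y. norm (v' y) \<le> B) \<Longrightarrow>
       (\<And>y. norm (v y - v' y) \<le> d) \<Longrightarrow> norm (F \<sigma> v x - F \<sigma> v' x) \<le> \<Lambda> * d"
  obtains U B where "continuous_on UNIV (\<lambda>z. U (fst z) (snd z))" "\<And>s x. norm (U s x) \<le> B"
    "\<And>s x. s \<in> {0..S} \<Longrightarrow> U s x = u0 x + integral {0..s} (\<lambda>\<sigma>. F \<sigma> (U \<sigma>) x)"
proof -
  define c where "c = clip S"
  have c: "c s \<in> {0..S}" for s using clip_mem[OF S] by (simp add: c_def)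
  \<comment> \<open>The unknown \<open>v\<close> of the fixed point problem carries the weight, and
    \<open>W v\<close> removes it. Clamped time keeps the weight bounded on the whole line, so that
    \<open>v\<close> can range over the complete space of bounded continuous functions.\<close>
  define W :: "((real \<times> 'x) \<Rightarrow>\<^sub>C 'b) \<Rightarrow> real \<Rightarrow> 'x \<Rightarrow> 'b"
    where "W v \<sigma> y = exp (2 * \<Lambda> * c \<sigma>) *\<^sub>R apply_bcontfun v (\<sigma>, y)" for v \<sigma> y
  have expS: "exp (2 * \<Lambda> * c \<sigma>) \<le> exp (2 * \<Lambda> * S)" for \<sigma>
    using c[of \<sigma>] \<Lambda> by simp
  have Wc: "continuous_on UNIV (\<lambda>z. W v (fst z) (snd z))" for v
    unfolding W_def c_def by (auto intro!: continuous_intros)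
  have Wc2: "continuous_on UNIV (W v \<sigma>)" for v \<sigma>
  proof -
    have "continuous_on UNIV (\<lambda>y. (\<sigma>, y))" by (rule continuous_on_Pair[OF continuous_on_const continuous_on_id])
    from continuous_on_compose2[OF Wc this] show ?thesis by simp
  qed
  have Wb: "norm (W v \<sigma> y) \<le> exp (2 * \<Lambda> * S) * norm v" for v \<sigma> y
    unfolding W_def using norm_bounded[of v "(\<sigma>, y)"] expS[of \<sigma>] by (simp only: norm_scaleR abs_exp_cancel) (intro mult_mono, auto)
  define I where "I v = (\<lambda>z. integral {0..clip S (fst z)} (\<lambda>\<sigma>. F \<sigma> (W v \<sigma>) (snd z)))" for v
  define T where "T v = (\<lambda>z. exp (- (2 * \<Lambda> * c (fst z))) *\<^sub>R (u0 (snd z) + I v z))" for v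
  have meas': "(\<lambda>\<sigma>. F \<sigma> (W v \<sigma>) x) \<in> borel_measurable borel" for v x
    using meas[of "W v" x] Wc Wb by blast
  have bnd': "\<exists>B. \<forall>\<sigma> x. norm (F \<sigma> (W v \<sigma>) x) \<le> B" for v
    using bnd[of "exp (2 * \<Lambda> * S) * norm v"] Wb Wc2 by meson
  have int: "(\<lambda>\<sigma>. F \<sigma> (W v \<sigma>) x) integrable_on {a..b}" for v x a b
    using bnd'[of v] integrable_on_bounded_measurable[OF meas'] by blast
  have Ic: "continuous_on UNIV (I v)" for v
  proof -
    obtain B where "\<forall>\<sigma> x. norm (F \<sigma> (W v \<sigma>) x) \<le> B" using bnd' by blast
    with meas' show ?thesis unfolding I_def
      by (intro continuous_on_integral_param[OF _ cont _ S, where B=B]) (use Wc2 Wb in blast)+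
  qed
  have Tb: "T v \<in> bcontfun" for v
  proof -
    obtain B where B: "\<forall>\<sigma> x. norm (F \<sigma> (W v \<sigma>) x) \<le> B" using bnd' by blast
    have "norm (I v z) \<le> \<bar>B\<bar> * S" for z
    proof -
      have "norm (I v z) \<le> B * (clip S (fst z) - 0)" unfolding I_def
        by (rule norm_integral_ivl_le[OF int]) (use B clip_mem[OF S] in auto)
      also have "\<dots> \<le> \<bar>B\<bar> * S" using clip_mem[OF S, of "fst z"] by (intro mult_mono) auto
      finally show ?thesis .
    qed
    then have "norm (T v z) \<le> 1 * (B0 + \<bar>B\<bar> * S)" for z
      unfolding T_def norm_scaleR using c[of "fst z"] \<Lambda>
      by (intro mult_mono norm_triangle_mono u0) auto
    moreover have "continuous_on UNIV (T v)"
      unfolding T_def c_def by (intro continuous_intros Ic continuous_on_compose2[OF u0(1)]) auto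
    ultimately show ?thesis by (intro bcontfun_normI) auto
  qed
  have apT: "apply_bcontfun (Bcontfun (T v)) = T v" for v
    by (rule Bcontfun_inverse) (rule Tb)
  have "dist (Bcontfun (T v)) (Bcontfun (T v')) \<le> 1/2 * dist v v'" for v v'
  proof (rule dist_bound)
    fix z :: "real \<times> 'x"
    let ?t = "c (fst z)" and ?x = "snd z" and ?d = "dist v v'"
    let ?h = "\<lambda>\<sigma>. F \<sigma> (W v \<sigma>) ?x - F \<sigma> (W v' \<sigma>) ?x"
    have "T v z - T v' z = exp (- (2 * \<Lambda> * ?t)) *\<^sub>R integral {0..?t} ?h"
      unfolding T_def I_def c_def[symmetric] by (simp add: integral_diff int scaleR_diff_right scaleR_add_right)
    also have "norm \<dots> = exp (- (2 * \<Lambda> * ?t)) * norm (integral {0..?t} ?h)" by simp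
    \<comment> \<open>The integral of \<open>\<Lambda> * exp (2 * \<Lambda> * \<sigma>)\<close> up
      to \<open>t\<close> is at most \<open>exp (2 * \<Lambda> * t) / 2\<close>; the weight cancels
      the exponential and leaves the contraction factor 1/2.\<close>
    also have "norm (integral {0..?t} ?h) \<le> integral {0..?t} (\<lambda>\<sigma>. \<Lambda> * (?d * exp (2 * \<Lambda> * \<sigma>)))"
    proof (rule integral_norm_bound_integral)
      show "?h integrable_on {0..?t}" by (intro integrable_diff int)
      show "(\<lambda>\<sigma>. \<Lambda> * (?d * exp (2 * \<Lambda> * \<sigma>))) integrable_on {0..?t}"
        by (intro integrable_continuous_interval continuous_intros)
      fix \<sigma> assume "\<sigma> \<in> {0..?t}"
      then have \<sigma>: "\<sigma> \<in> {0..S}" using c[of "fst z"] by auto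
      show "norm (?h \<sigma>) \<le> \<Lambda> * (?d * exp (2 * \<Lambda> * \<sigma>))"
      proof (rule lip[OF Wc2 Wc2])
        fix y
        have "norm (W v \<sigma> y - W v' \<sigma> y) = exp (2 * \<Lambda> * \<sigma>) * dist (apply_bcontfun v (\<sigma>, y)) (apply_bcontfun v' (\<sigma>, y))"
          using \<sigma> unfolding W_def dist_norm by (simp add: c_def flip: scaleR_diff_right)
        also have "\<dots> \<le> ?d * exp (2 * \<Lambda> * \<sigma>)"
          using dist_bounded[of v "(\<sigma>, y)" v'] by (simp add: mult.commute)
        finally show "norm (W v \<sigma> y - W v' \<sigma> y) \<le> ?d * exp (2 * \<Lambda> * \<sigma>)" .
      qed (use Wb in blast)+
    qed
    also have "integral {0..?t} (\<lambda>\<sigma>. \<Lambda> * (?d * exp (2 * \<Lambda> * \<sigma>))) = ?d / 2 * exp (2 * \<Lambda> * ?t) - ?d / 2 * exp (2 * \<Lambda> * 0)"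
      by (intro integral_unique fundamental_theorem_of_calculus)
         (use c[of "fst z"] \<Lambda> in \<open>auto intro!: derivative_eq_intros simp: has_real_derivative_iff_has_vector_derivative[symmetric]\<close>)
    also have "exp (- (2 * \<Lambda> * ?t)) * \<dots> \<le> exp (- (2 * \<Lambda> * ?t)) * (?d / 2 * exp (2 * \<Lambda> * ?t))"
      by (intro mult_left_mono) auto
    also have "\<dots> = 1/2 * ?d" by (simp add: exp_minus)
    finally show "dist (apply_bcontfun (Bcontfun (T v)) z) (apply_bcontfun (Bcontfun (T v')) z) \<le> 1/2 * ?d"
      unfolding apT dist_norm by simp
  qed
  then have "\<exists>!v. Bcontfun (T v) = v"
    by (intro banach_fix_type[where c="1/2"]) auto
  then obtain v where "Bcontfun (T v) = v" by blast
  then have fp: "apply_bcontfun v z = T v z" for z using apT by metis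
  show thesis
  proof (rule that[of "W v"])
    show "norm (W v s x) \<le> exp (2 * \<Lambda> * S) * norm v" for s x by (rule Wb)
    show "W v s x = u0 x + integral {0..s} (\<lambda>\<sigma>. F \<sigma> (W v \<sigma>) x)" if "s \<in> {0..S}" for s x
    proof -
      have "W v s x = exp (2 * \<Lambda> * s) *\<^sub>R T v (s, x)"
        unfolding W_def using fp[of "(s, x)"] that by (simp add: c_def)
      also have "\<dots> = (exp (2 * \<Lambda> * s) * exp (- (2 * \<Lambda> * s))) *\<^sub>R (u0 x + integral {0..s} (\<lambda>\<sigma>. F \<sigma> (W v \<sigma>) x))"
        unfolding T_def I_def using that by (simp add: c_def)
      also have "exp (2 * \<Lambda> * s) * exp (- (2 * \<Lambda> * s)) = 1" by (simp add: exp_minus)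
      finally show ?thesis by simp
    qed
  qed (rule Wc)
qed

section \<open>Compactly supported measures and Lagrangian solutions\<close>

lemma norm_le_l1norm: "norm x \<le> l1norm x"
  unfolding l1norm_def by (rule norm_le_l1)

lemma l1norm_le_norm: "l1norm (x::'a::euclidean_space) \<le> DIM('a) * norm x"
proof -
  have "l1norm x \<le> (\<Sum>b\<in>(Basis::'a set). norm x)" unfolding l1norm_def
    by (rule sum_mono) (rule Basis_le_norm)
  then show ?thesis by simp
qed

lemma l1norm_nonneg: "0 \<le> l1norm x"
  unfolding l1norm_def by (simp add: sum_nonneg)

lemma borel_measurable_l1norm[measurable (raw)]:
  "f \<in> borel_measurable M \<Longrightarrow> (\<lambda>x. l1norm (f x)) \<in> borel_measurable M"
  unfolding l1norm_def by (intro borel_measurable_sum borel_measurable_abs borel_measurable_inner borel_measurable_const)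

lemma PcD: "\<mu> \<in> Pc \<Longrightarrow> prob_space \<mu>" "\<mu> \<in> Pc \<Longrightarrow> sets \<mu> = sets borel" "\<mu> \<in> Pc \<Longrightarrow> space \<mu> = UNIV"
  unfolding Pc_def using sets_eq_imp_space_eq[of \<mu> borel] by auto

lemma borel_measurable_Pc: "\<mu> \<in> Pc \<Longrightarrow> borel_measurable \<mu> = borel_measurable borel"
  by (rule measurable_cong_sets) (auto dest: PcD)

lemma Pc_compact_AE:
  assumes "\<mu> \<in> Pc" obtains K where "compact K" "AE x in \<mu>. x \<in> K"
proof -
  from assms obtain K where K: "compact K" "emeasure \<mu> (- K) = 0" and s: "sets \<mu> = sets borel" unfolding Pc_def by blast
  have "- K \<in> null_sets \<mu>" using K s by (auto simp: null_sets_def compact_imp_closed)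
  from AE_not_in[OF this] have "AE x in \<mu>. x \<in> K" by simp
  with K that show thesis by blast
qed

lemma distr_Pc:
  assumes \<theta>: "\<theta> \<in> Pc" and Y: "continuous_on UNIV Y"
  shows "distr \<theta> borel Y \<in> Pc"
proof -
  interpret prob_space \<theta> using \<theta> by (rule PcD)
  have [measurable]: "Y \<in> measurable \<theta> borel"
    by (simp add: borel_measurable_Pc[OF \<theta>] borel_measurable_continuous_onI[OF Y])
  obtain K where K: "compact K" "AE x in \<theta>. x \<in> K" using Pc_compact_AE[OF \<theta>] .
  have cY: "compact (Y ` K)" by (rule compact_continuous_image[OF continuous_on_subset[OF Y] K(1)]) simp
  then have [measurable]: "Y ` K \<in> sets borel" by (simp add: borel_compact)
  have "emeasure (distr \<theta> borel Y) (- (Y ` K)) = emeasure \<theta> {x \<in> space \<theta>. Y x \<notin> Y ` K}"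
    by (subst emeasure_distr) (auto intro!: arg_cong[where f="emeasure \<theta>"])
  also have "\<dots> = 0"
  proof -
    have "AE x in \<theta>. \<not> (Y x \<notin> Y ` K)" using K(2) by eventually_elim auto
    then show ?thesis by (subst (asm) AE_iff_measurable[OF _ refl]) auto
  qed
  finally have "emeasure (distr \<theta> borel Y) (- (Y ` K)) = 0" .
  then show ?thesis unfolding Pc_def using cY by (auto intro!: prob_space_distr)
qed

section \<open>Couplings and the dual bound for the Wasserstein distance\<close>

text \<open>The image of \<theta> under the pair \<open>(Y, Z)\<close> is a coupling. The dimension
  compares the Manhattan norm in the cost with the Euclidean norm.\<close>

lemma W1_distr_le:
  fixes d :: real
  assumes \<theta>: "\<theta> \<in> Pc" and Y: "continuous_on UNIV Y" "continuous_on UNIV (Z :: 'x::euclidean_space \<Rightarrow> 'a::euclidean_space)"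
    and d: "\<And>x. norm (Y x - Z x) \<le> d"
  shows "W1 (distr \<theta> borel Y) (distr \<theta> borel Z) \<le> ennreal (DIM('a) * d)"
proof -
  interpret prob_space \<theta> using \<theta> by (rule PcD)
  have m[measurable]: "Y \<in> measurable \<theta> borel" "Z \<in> measurable \<theta> borel"
    by (auto simp: borel_measurable_Pc[OF \<theta>] intro!: borel_measurable_continuous_onI Y)
  have p[measurable]: "(\<lambda>x. (Y x, Z x)) \<in> measurable \<theta> borel"
    by (simp add: borel_measurable_Pc[OF \<theta>] borel_measurable_continuous_onI[OF continuous_on_Pair[OF Y]])
  have fs: "fst \<in> borel_measurable (borel :: ('a \<times> 'a) measure)" "snd \<in> borel_measurable (borel :: ('a \<times> 'a) measure)"
    by (auto intro!: borel_measurable_continuous_onI continuous_intros)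
  let ?\<pi> = "distr \<theta> borel (\<lambda>x. (Y x, Z x))"
  have "?\<pi> \<in> couplings (distr \<theta> borel Y) (distr \<theta> borel Z)"
    unfolding couplings_def by (simp add: distr_distr[OF fs(1) p] distr_distr[OF fs(2) p] o_def)
  then have "W1 (distr \<theta> borel Y) (distr \<theta> borel Z) \<le> (\<integral>\<^sup>+z. ennreal (l1norm (fst z - snd z)) \<partial>?\<pi>)"
    unfolding W1_def by (rule INF_lower)
  also have "\<dots> = (\<integral>\<^sup>+x. ennreal (l1norm (Y x - Z x)) \<partial>\<theta>)"
    using fs by (subst nn_integral_distr) (auto intro!: p)
  also have "\<dots> \<le> (\<integral>\<^sup>+x. ennreal (DIM('a) * d) \<partial>\<theta>)"
    by (intro nn_integral_mono ennreal_leI order_trans[OF l1norm_le_norm] mult_left_mono d) auto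
  also have "\<dots> = ennreal (DIM('a) * d)" by (simp add: emeasure_space_1)
  finally show ?thesis .
qed

text \<open>The easy half of Kantorovich-Rubinstein duality: integrate
  \<open>\<psi> x - \<psi> y\<close> against a coupling of cost below \<open>e\<close>, which exists
  because the inequality for \<open>W1\<close> is strict.\<close>

lemma W1_dual_bound:
  fixes \<psi> :: "'a::euclidean_space \<Rightarrow> real"
  assumes \<mu>: "\<mu> \<in> Pc" and \<nu>: "\<nu> \<in> Pc" and lip: "\<And>x y. \<bar>\<psi> x - \<psi> y\<bar> \<le> K * norm (x - y)" and K: "0 \<le> K"
    and B: "\<And>x. \<bar>\<psi> x\<bar> \<le> B" and W: "W1 \<mu> \<nu> < ennreal e"
  shows "\<bar>(\<integral>x. \<psi> x \<partial>\<mu>) - (\<integral>x. \<psi> x \<partial>\<nu>)\<bar> \<le> K * e"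
proof -
  interpret \<mu>: prob_space \<mu> using \<mu> by (rule PcD)
  have fs[measurable]: "fst \<in> borel_measurable (borel :: ('a \<times> 'a) measure)" "snd \<in> borel_measurable (borel :: ('a \<times> 'a) measure)"
    by (auto intro!: borel_measurable_continuous_onI continuous_intros)
  have e: "0 < e" using W by (metis ennreal_eq_0_iff linorder_not_less not_less_zero)
  have "K-lipschitz_on UNIV \<psi>" using lip K by (intro lipschitz_onI) (auto simp: dist_norm)
  then have "continuous_on UNIV \<psi>" by (rule lipschitz_on_continuous_on)
  then have \<psi>[measurable]: "\<psi> \<in> borel_measurable borel" by (rule borel_measurable_continuous_onI)
  from W obtain \<pi> where \<pi>: "sets \<pi> = sets borel" "distr \<pi> borel fst = \<mu>" "distr \<pi> borel snd = \<nu>"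
    and c: "(\<integral>\<^sup>+z. ennreal (l1norm (fst z - snd z)) \<partial>\<pi>) < ennreal e"
    unfolding W1_def INF_less_iff couplings_def by auto
  have m\<pi>: "measurable \<pi> N = measurable borel N" for N by (rule measurable_cong_sets) (auto simp: \<pi>)
  have sp: "space \<pi> = UNIV" using sets_eq_imp_space_eq[OF \<pi>(1)] by simp
  have "emeasure \<pi> (space \<pi>) = emeasure (distr \<pi> borel fst) UNIV"
    by (subst emeasure_distr) (auto simp: m\<pi> sp)
  also have "\<dots> = 1" using \<pi>(2) \<mu>.emeasure_space_1 PcD(3)[OF \<mu>] by simp
  finally interpret \<pi>: prob_space \<pi> by (rule prob_spaceI)
  have i: "integrable \<pi> (\<lambda>z. \<psi> (fst z))" "integrable \<pi> (\<lambda>z. \<psi> (snd z))"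
    using B by (auto intro!: \<pi>.integrable_const_bound[where B=B] simp: m\<pi>)
  have "(\<integral>x. \<psi> x \<partial>\<mu>) - (\<integral>x. \<psi> x \<partial>\<nu>) = (\<integral>z. \<psi> (fst z) \<partial>\<pi>) - (\<integral>z. \<psi> (snd z) \<partial>\<pi>)"
    unfolding \<pi>(2,3)[symmetric] by (subst (1 2) integral_distr) (auto simp: m\<pi>)
  also have "\<dots> = (\<integral>z. \<psi> (fst z) - \<psi> (snd z) \<partial>\<pi>)" using i by simp
  finally have eq: "(\<integral>x. \<psi> x \<partial>\<mu>) - (\<integral>x. \<psi> x \<partial>\<nu>) = (\<integral>z. \<psi> (fst z) - \<psi> (snd z) \<partial>\<pi>)" .
  have "ennreal \<bar>(\<integral>x. \<psi> x \<partial>\<mu>) - (\<integral>x. \<psi> x \<partial>\<nu>)\<bar> \<le> (\<integral>\<^sup>+z. ennreal \<bar>\<psi> (fst z) - \<psi> (snd z)\<bar> \<partial>\<pi>)"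
    unfolding eq using integral_norm_bound_ennreal[OF Bochner_Integration.integrable_diff[OF i]] by simp
  also have "\<dots> \<le> (\<integral>\<^sup>+z. ennreal K * ennreal (l1norm (fst z - snd z)) \<partial>\<pi>)"
    by (intro nn_integral_mono) (auto simp: K l1norm_nonneg ennreal_mult[symmetric] intro!: ennreal_leI order_trans[OF lip] mult_left_mono norm_le_l1norm)
  also have "\<dots> = ennreal K * (\<integral>\<^sup>+z. ennreal (l1norm (fst z - snd z)) \<partial>\<pi>)"
    by (rule nn_integral_cmult) (simp add: m\<pi>)
  also have "\<dots> \<le> ennreal K * ennreal e" by (intro mult_left_mono less_imp_le[OF c]) auto
  also have "\<dots> = ennreal (K * e)" using K e by (simp add: ennreal_mult)
  finally show ?thesis using K e by (simp add: ennreal_le_iff)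
qed

section \<open>Lagrangian solutions of continuity equations\<close>

lemma frechet_derivative_zero_outside:
  fixes \<phi> :: "'a::real_normed_vector \<Rightarrow> 'b::real_normed_vector"
  assumes "z \<notin> closure {z. \<phi> z \<noteq> 0}"
  shows "frechet_derivative \<phi> (at z) h = 0"
proof -
  have "(\<phi> has_derivative (\<lambda>_. 0)) (at z)"
  proof (rule has_derivative_transform_within_open[of "\<lambda>_. 0"])
    show "open (- closure {z. \<phi> z \<noteq> 0})" by auto
    show "0 = \<phi> x" if "x \<in> - closure {z. \<phi> z \<noteq> 0}" for x
      using that closure_subset[of "{z. \<phi> z \<noteq> 0}"] by auto
  qed (use assms in auto)
  from frechet_derivative_at[OF this] show ?thesis by metis
qed

lemma Ck1D:
  assumes "Ck (Suc 0) \<phi>"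
  shows "(\<phi> has_derivative frechet_derivative \<phi> (at z)) (at z)"
    "b \<in> Basis \<Longrightarrow> continuous_on UNIV (\<lambda>z. frechet_derivative \<phi> (at z) b)"
  using assms frechet_derivative_works by auto

lemma Pair_integral_path:
  fixes V :: "real \<Rightarrow> 'a::euclidean_space"
  assumes "V integrable_on {0..s}" "0 \<le> s"
  shows "integral {0..s} (\<lambda>\<sigma>. (1::real, V \<sigma>)) = (s, integral {0..s} V)"
proof -
  have bl: "bounded_linear (\<lambda>v::'a. (0::real, v))" by (intro bounded_linear_Pair bounded_linear_zero bounded_linear_ident)
  have "((\<lambda>\<sigma>. (1::real, 0::'a)) has_integral (s, 0)) {0..s}"
    using has_integral_const_real[of "(1::real, 0::'a)" 0 s] assms(2) by simp
  moreover have "((\<lambda>\<sigma>. (0::real, V \<sigma>)) has_integral (0, integral {0..s} V)) {0..s}"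
    using has_integral_linear[OF integrable_integral[OF assms(1)] bl] by (simp add: o_def)
  ultimately have "((\<lambda>\<sigma>. (1::real, 0::'a) + (0, V \<sigma>)) has_integral (s, 0) + (0, integral {0..s} V)) {0..s}"
    by (rule has_integral_add)
  then show ?thesis by (intro integral_unique) simp
qed

text \<open>Along every path the integrand is the derivative of the test function, which vanishes at
  both ends of the time interval; Fubini then integrates over the starting points. The field has to
  match \<open>V\<close> on the paths alone, which permits fields that depend on the measure
  itself.\<close>

lemma continuity_eq_Lagrangian:
  fixes Y V :: "real \<Rightarrow> 'x::euclidean_space \<Rightarrow> 'a::euclidean_space"
  assumes \<theta>: "\<theta> \<in> Pc" and S: "0 < S" and Yc: "continuous_on UNIV (\<lambda>z. Y (fst z) (snd z))"
    and Vm: "(\<lambda>z. V (fst z) (snd z)) \<in> borel_measurable borel"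
    and VB: "\<And>s x. s \<in> {0..S} \<Longrightarrow> norm (V s x) \<le> B"
    and Y: "\<And>s x. s \<in> {0..S} \<Longrightarrow> Y s x = Y 0 x + integral {0..s} (\<lambda>\<sigma>. V \<sigma> x)"
    and w: "\<And>s. s \<in> {0..S} \<Longrightarrow> w s \<in> borel_measurable borel" "\<And>s x. s \<in> {0..S} \<Longrightarrow> w s (Y s x) = V s x"
  shows "continuity_eq S w (\<lambda>s. distr \<theta> borel (Y s))"
  unfolding continuity_eq_def Let_def
proof (intro conjI ballI allI impI)
  interpret \<theta>: prob_space \<theta> using \<theta> by (rule PcD)
  have Ys: "continuous_on UNIV (Y s)" for s
  proof -
    have "continuous_on UNIV (\<lambda>y. (s, y))" by (rule continuous_on_Pair[OF continuous_on_const continuous_on_id])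
    from continuous_on_compose2[OF Yc this] show ?thesis by simp
  qed
  have Yx: "continuous_on UNIV (\<lambda>s. Y s x)" for x
  proof -
    have "continuous_on UNIV (\<lambda>s. (s, x))" by (rule continuous_on_Pair[OF continuous_on_id continuous_on_const])
    from continuous_on_compose2[OF Yc this] show ?thesis by simp
  qed
  have Vx: "(\<lambda>s. V s x) \<in> borel_measurable borel" for x
  proof -
    have "(\<lambda>s. (s, x)) \<in> borel_measurable borel"
      by (intro borel_measurable_continuous_onI continuous_on_Pair continuous_on_id continuous_on_const)
    from measurable_compose[OF this Vm] show ?thesis by simp
  qed
  have Vi: "(\<lambda>\<sigma>. V \<sigma> x) integrable_on {0..S}" for x
    by (rule integrable_on_bounded_measurable[OF Vx VB])
  show "distr \<theta> borel (Y s) \<in> Pc" for s by (rule distr_Pc[OF \<theta> Ys])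
  show "W1_continuous_on {0..S} (\<lambda>s. distr \<theta> borel (Y s))"
    unfolding W1_continuous_on_def
  proof
    fix s assume s: "s \<in> {0..S}"
    have mono: "norm (Y u x - Y t x) \<le> B * \<bar>u - t\<bar>" if "t \<le> u" "t \<in> {0..S}" "u \<in> {0..S}" for t u x
    proof -
      have "Y u x - Y t x = integral {t..u} (\<lambda>\<sigma>. V \<sigma> x)"
        using Y[of t x] Y[of u x] that has_integral_split_ivl[OF Vi, of t u x] by (auto simp: algebra_simps)
      also have "norm \<dots> \<le> B * (u - t)"
        by (rule norm_integral_ivl_le[OF integrable_subinterval_real[OF Vi] VB]) (use that in auto)
      finally show ?thesis using that by simp
    qed
    have lip: "norm (Y t x - Y s x) \<le> B * \<bar>t - s\<bar>" if "t \<in> {0..S}" for t x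
      using mono[of s t x] mono[of t s x] s that by (cases "s \<le> t") (auto simp: norm_minus_commute abs_minus_commute)
    have le: "\<forall>\<^sub>F t in at s within {0..S}. W1 (distr \<theta> borel (Y t)) (distr \<theta> borel (Y s)) \<le> ennreal (DIM('a) * (B * \<bar>t - s\<bar>))"
      unfolding eventually_at by (intro exI[of _ 1]) (use lip in \<open>auto intro!: W1_distr_le[OF \<theta> Ys Ys]\<close>)
    have "((\<lambda>t. DIM('a) * (B * \<bar>t - s\<bar>)) \<longlongrightarrow> DIM('a) * (B * \<bar>s - s\<bar>)) (at s within {0..S})"
      by (intro tendsto_intros)
    then have "((\<lambda>t. ennreal (DIM('a) * (B * \<bar>t - s\<bar>))) \<longlongrightarrow> 0) (at s within {0..S})"
      using tendsto_ennrealI by fastforce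
    then show "((\<lambda>t. W1 (distr \<theta> borel (Y t)) (distr \<theta> borel (Y s))) \<longlongrightarrow> 0) (at s within {0..S})"
      by (rule tendsto_sandwich[OF _ le tendsto_const, rotated]) auto
  qed
  fix \<phi> :: "real \<times> 'a \<Rightarrow> real" assume \<phi>: "test_function S \<phi>"
  then have "Ck (Suc 0) \<phi>" and supp: "compact (closure {z. \<phi> z \<noteq> 0})" "closure {z. \<phi> z \<noteq> 0} \<subseteq> {0<..<S} \<times> UNIV"
    unfolding test_function_def by auto
  note \<phi>' = Ck1D[OF \<open>Ck (Suc 0) \<phi>\<close>]
  define D where "D z h = frechet_derivative \<phi> (at z) h" for z h
  have D: "(\<phi> has_derivative D z) (at z)" for z using \<phi>'(1) unfolding D_def by simp
  have Dc: "continuous_on UNIV (\<lambda>z. D z b)" if "b \<in> Basis" for b using \<phi>'(2)[OF that] unfolding D_def .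
  have Dlin: "linear (D z)" for z using D by (rule has_derivative_linear)
  have Dexp: "D z h = (\<Sum>b\<in>Basis. (h \<bullet> b) *\<^sub>R D z b)" for z h by (rule linear_euclidean_sum[OF Dlin])
  have "bounded ((\<lambda>z. \<Sum>b\<in>Basis. \<bar>D z b\<bar>) ` closure {z. \<phi> z \<noteq> 0})"
    by (intro compact_imp_bounded compact_continuous_image continuous_intros continuous_on_subset[OF Dc] supp) auto
  then obtain B1 where B1: "\<And>z. z \<in> closure {z. \<phi> z \<noteq> 0} \<Longrightarrow> (\<Sum>b\<in>Basis. \<bar>D z b\<bar>) \<le> B1"
    unfolding bounded_iff by (fastforce dest: abs_le_D1)
  have B1': "(\<Sum>b\<in>Basis. \<bar>D z b\<bar>) \<le> \<bar>B1\<bar>" for z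
  proof (cases "z \<in> closure {z. \<phi> z \<noteq> 0}")
    case False
    then have "D z b = 0" for b unfolding D_def by (rule frechet_derivative_zero_outside)
    then show ?thesis by simp
  qed (use B1[of z] in simp)
  let ?f = "\<lambda>s x. D (s, Y s x) (1, V s x)"
  have fB: "norm (?f s x) \<le> (1 + B) * \<bar>B1\<bar>" if "s \<in> {0..S}" for s x
  proof -
    have "norm (?f s x) \<le> (\<Sum>b\<in>Basis. norm (1::real, V s x) * \<bar>D (s, Y s x) b\<bar>)"
      by (subst Dexp, rule order_trans[OF norm_sum], rule sum_mono) (simp add: abs_mult mult_right_mono Basis_le_norm)
    also have "\<dots> = norm (1::real, V s x) * (\<Sum>b\<in>Basis. \<bar>D (s, Y s x) b\<bar>)" by (simp add: sum_distrib_left)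
    also have "\<dots> \<le> (1 + B) * \<bar>B1\<bar>"
      using VB[OF that, of x] norm_Pair_le[of "1::real" "V s x"] order_trans[OF norm_ge_zero VB[OF that, of x]]
      by (intro mult_mono B1') (auto simp: sum_nonneg)
    finally show ?thesis .
  qed
  have fm: "(\<lambda>(s, x). ?f s x) \<in> borel_measurable (borel \<Otimes>\<^sub>M \<theta>)"
  proof -
    have Ym: "(\<lambda>z. (fst z, Y (fst z) (snd z))) \<in> borel_measurable borel"
      by (intro borel_measurable_continuous_onI continuous_intros Yc)
    have [measurable]: "(\<lambda>z. D (fst z, Y (fst z) (snd z)) b) \<in> borel_measurable borel" if "b \<in> Basis" for b
      using measurable_compose[OF Ym borel_measurable_continuous_onI[OF Dc[OF that]]] by simp
    have eqm: "borel_measurable (borel \<Otimes>\<^sub>M \<theta>) = borel_measurable (borel :: (real \<times> 'x) measure)"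
      by (rule measurable_cong_sets) (auto simp: borel_prod[symmetric] PcD(2)[OF \<theta>] cong: sets_pair_measure_cong)
    have [measurable]: "(\<lambda>z. (1::real, V (fst z) (snd z)) \<bullet> b) \<in> borel_measurable borel" for b
      using Vm by (cases b) (simp add: inner_prod_def)
    show ?thesis unfolding eqm case_prod_beta' by (subst Dexp) measurable
  qed
  have eqF: "(\<integral>x. frechet_derivative \<phi> (at (s, x)) (1, w s x) \<partial>distr \<theta> borel (Y s)) = (\<integral>x. ?f s x \<partial>\<theta>)" if s: "s \<in> {0..S}" for s
  proof -
    have "(\<lambda>x. frechet_derivative \<phi> (at (s, x)) (1, w s x)) \<in> borel_measurable borel"
    proof -
      note w(1)[OF s, measurable]
      have [measurable]: "(\<lambda>x. D (s, x) b) \<in> borel_measurable borel" if "b \<in> Basis" for b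
        by (intro borel_measurable_continuous_onI continuous_on_compose2[OF Dc[OF that]] continuous_on_Pair continuous_on_const continuous_on_id) auto
      have [measurable]: "(\<lambda>x. (1::real, w s x) \<bullet> b) \<in> borel_measurable borel" for b
        by (cases b) (simp add: inner_prod_def)
      show ?thesis unfolding D_def[symmetric] by (subst Dexp) measurable
    qed
    then show ?thesis
      using s
      by (subst integral_distr) (auto simp: D_def w borel_measurable_Pc[OF \<theta>] borel_measurable_continuous_onI[OF Ys])
  qed
  note F1 = borel_measurable_lebesgue_integral_time[OF \<theta>.finite_measure_axioms fm fB]
  note F2 = norm_lebesgue_integral_time_le[OF \<theta>.finite_measure_axioms fm fB]
  note F3 = integral_ivl_swap[OF \<theta>.finite_measure_axioms fm fB]
  have int: "integrable (lebesgue_on {0..S}) (\<lambda>s. \<integral>x. ?f s x \<partial>\<theta>)"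
    by (rule integrable_lebesgue_on_bounded[OF F1 F2])
  then show "integrable (lebesgue_on {0..S}) (\<lambda>s. \<integral>x. frechet_derivative \<phi> (at (s, x)) (1, w s x) \<partial>distr \<theta> borel (Y s))"
    by (subst Bochner_Integration.integrable_cong[OF refl eqF]) auto
  have "(LINT s|lebesgue_on {0..S}. \<integral>x. frechet_derivative \<phi> (at (s, x)) (1, w s x) \<partial>distr \<theta> borel (Y s))
     = (LINT s|lebesgue_on {0..S}. \<integral>x. ?f s x \<partial>\<theta>)"
    by (rule Bochner_Integration.integral_cong[OF refl]) (use eqF in auto)
  also have "\<dots> = integral {0..S} (\<lambda>s. \<integral>x. ?f s x \<partial>\<theta>)"
    by (rule lebesgue_integral_eq_integral[OF int]) auto
  also have "\<dots> = (\<integral>x. integral {0..S} (\<lambda>s. ?f s x) \<partial>\<theta>)" by (rule F3)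
  also have "\<dots> = (\<integral>x. 0 \<partial>\<theta>)"
  proof (rule Bochner_Integration.integral_cong[OF refl])
    fix x
    \<comment> \<open>Time is carried along as a first coordinate of velocity 1, so that the chain
      rule for a function without explicit time dependence applies.\<close>
    have "\<phi> (S, Y S x) = \<phi> (0, Y 0 x) + integral {0..S} (\<lambda>s. ?f s x)"
    proof (rule chain_rule_integral_path_eq[where Y="\<lambda>s. (s, Y s x)" and V="\<lambda>s. (1, V s x)" and \<Phi>=\<phi> and \<Phi>'=D and S=S and B="1 + B"])
      show "(\<lambda>s. (1::real, V s x)) \<in> borel_measurable borel"
        unfolding borel_prod[symmetric] using Vx[of x] by measurable
      show "norm (1::real, V s x) \<le> 1 + B" if "s \<in> {0..S}" for s
        using VB[OF that, of x] norm_Pair_le[of "1::real" "V s x"] by simp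
      show "continuous_on UNIV (\<lambda>s. (s, Y s x))" by (intro continuous_on_Pair continuous_on_id Yx)
      show "(s, Y s x) = (0, Y 0 x) + integral {0..s} (\<lambda>s. (1, V s x))" if "s \<in> {0..S}" for s
        using Y[OF that, of x] that integrable_subinterval_real[OF Vi, of 0 s] by (subst Pair_integral_path) auto
    qed (use D Dc S in auto)
    moreover have "\<phi> (r, y) = 0" if "r \<in> {0, S}" for r y
      using supp(2) closure_subset[of "{z. \<phi> z \<noteq> 0}"] that by auto
    ultimately show "integral {0..S} (\<lambda>s. ?f s x) = 0" by simp
  qed
  finally show "(LINT s|lebesgue_on {0..S}. \<integral>x. frechet_derivative \<phi> (at (s, x)) (1, w s x) \<partial>distr \<theta> borel (Y s)) = 0"
    by simp
qed

section \<open>Smooth functions and mollification\<close>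

text \<open>The classical flat function \<open>exp (- 1 / t)\<close> times a power of
  \<open>1 / t\<close>. The power is a parameter because differentiation raises it
  (\<open>flat_deriv\<close>).\<close>

definition flatexp :: "nat \<Rightarrow> real \<Rightarrow> real" where
  "flatexp j t = (if t > 0 then inverse t ^ j * exp (- inverse t) else 0)"

lemma flat_pos: "t > 0 \<Longrightarrow> flatexp j t > 0"
  and flat_zero: "t \<le> 0 \<Longrightarrow> flatexp j t = 0"
  and flat_nonneg: "flatexp j t \<ge> 0"
  by (auto simp: flatexp_def)

text \<open>With \<open>u = 1 / t\<close>, the exponential series dominates its single term
  \<open>u ^ (j + 2) / fact (j + 2)\<close>. A quadratic bound is what makes the difference quotient
  at 0 tend to 0.\<close>

lemma flat_le_square: "\<bar>flatexp j t\<bar> \<le> fact (j + 2) * t\<^sup>2"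
proof (cases "t > 0")
  case True
  define u where "u = inverse t"
  have u: "u > 0" "t = inverse u" using True by (auto simp: u_def)
  have "u ^ (j + 2) / fact (j + 2) \<le> exp u"
  proof -
    have "(\<Sum>n\<in>{j+2}. u ^ n /\<^sub>R fact n) \<le> (\<Sum>n. u ^ n /\<^sub>R fact n)"
      by (rule sum_le_suminf[OF summable_exp_generic]) (use u in auto)
    then show ?thesis by (simp add: exp_def divide_inverse mult.commute)
  qed
  then have "u ^ (j + 2) * exp (- u) \<le> fact (j + 2)"
    by (simp add: exp_minus field_simps del: fact_Suc)
  then have "u ^ j * exp (- u) * u\<^sup>2 \<le> fact (j + 2)"
    by (simp only: power_add mult_ac)
  then have *: "u ^ j * exp (- u) * u\<^sup>2 * (inverse u)\<^sup>2 \<le> fact (j + 2) * (inverse u)\<^sup>2"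
    by (rule mult_right_mono) simp
  have "u\<^sup>2 * (inverse u)\<^sup>2 = 1" using u by (simp flip: power_mult_distrib)
  with * have "u ^ j * exp (- u) \<le> fact (j + 2) * (inverse u)\<^sup>2"
    by (simp only: mult.assoc mult_1_right)
  moreover have "flatexp j t = u ^ j * exp (- u)" using True by (simp add: flatexp_def u_def)
  moreover have "t\<^sup>2 = (inverse u)\<^sup>2" using u(2) by (rule arg_cong)
  ultimately show ?thesis using flat_nonneg[of j t] by (simp only: abs_of_nonneg)
qed (simp add: flatexp_def)

lemma flat_deriv: "(flatexp j has_real_derivative flatexp (j + 2) t - j * flatexp (j + 1) t) (at t)"
proof (cases "t = 0")
  case True
  have "((\<lambda>h. (flatexp j (0 + h) - flatexp j 0) / h) \<longlongrightarrow> 0) (at 0)"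
  proof (rule Lim_null_comparison)
    show "\<forall>\<^sub>F h in at 0. norm ((flatexp j (0 + h) - flatexp j 0) / h) \<le> fact (j + 2) * \<bar>h\<bar>"
    proof (rule always_eventually, rule allI)
      fix h
      show "norm ((flatexp j (0 + h) - flatexp j 0) / h) \<le> fact (j + 2) * \<bar>h\<bar>"
        using flat_le_square[of j h]
        by (cases "h = 0") (auto simp: flat_zero[of 0] field_simps power2_eq_square simp del: fact_Suc)
    qed
    have "((\<lambda>h. fact (j + 2) * \<bar>h\<bar>) \<longlongrightarrow> fact (j + 2) * \<bar>0::real\<bar>) (at 0)" by (intro tendsto_intros)
    then show "((\<lambda>h. fact (j + 2) * \<bar>h\<bar>) \<longlongrightarrow> (0::real)) (at 0)" by simp
  qed
  then show ?thesis using True by (simp add: DERIV_def flatexp_def)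
next
  case False
  show ?thesis
  proof (cases "t > 0")
    case True
    have "((\<lambda>t. inverse t ^ j * exp (- inverse t)) has_real_derivative flatexp (j + 2) t - j * flatexp (j + 1) t) (at t)"
    proof -
      have "((\<lambda>t. inverse t ^ j * exp (- inverse t)) has_real_derivative
        (j * inverse t ^ (j - 1) * (- (inverse t * inverse t))) * exp (- inverse t) + inverse t ^ j * (exp (- inverse t) * (inverse t * inverse t))) (at t)"
        using True by (auto intro!: derivative_eq_intros simp: algebra_simps)
      also have "(j * inverse t ^ (j - 1) * (- (inverse t * inverse t))) * exp (- inverse t) + inverse t ^ j * (exp (- inverse t) * (inverse t * inverse t)) =
         flatexp (j + 2) t - j * flatexp (j + 1) t"
        using True by (cases j) (auto simp: flatexp_def algebra_simps)
      finally show ?thesis .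
    qed
    then show ?thesis
      by (rule has_field_derivative_transform_within_open[of _ _ _ "{0<..}"]) (use True in \<open>auto simp: flatexp_def\<close>)
  next
    case f: False
    have "((\<lambda>t. 0) has_real_derivative 0) (at t)" by simp
    then have "(flatexp j has_real_derivative 0) (at t)"
      by (rule has_field_derivative_transform_within_open[of _ _ _ "{..<0}"]) (use f False in \<open>auto simp: flatexp_def\<close>)
    then show ?thesis using f by (simp add: flat_zero)
  qed
qed

definition smooth :: "('a::euclidean_space \<Rightarrow> real) \<Rightarrow> bool" where
  "smooth f \<longleftrightarrow> (\<forall>k. Ck k f)"

lemma smooth_has_derivative: "smooth f \<Longrightarrow> (f has_derivative frechet_derivative f (at x)) (at x)"
  unfolding smooth_def using Ck1D(1) by blast

lemma smooth_frechet: "smooth f \<Longrightarrow> b \<in> Basis \<Longrightarrow> smooth (\<lambda>x. frechet_derivative f (at x) b)"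
  unfolding smooth_def by (metis Ck.simps(2))

text \<open>Derivatives of such expressions are again such expressions, so membership in every
  \<open>Ck\<close> follows by a single induction on the order, in place of separate product and
  chain rules at each order.\<close>

inductive smooth_expr :: "('a::euclidean_space \<Rightarrow> real) \<Rightarrow> bool" where
  base: "smooth f \<Longrightarrow> smooth_expr f"
| const: "smooth_expr (\<lambda>x. c)"
| inner: "smooth_expr (\<lambda>x. x \<bullet> v)"
| add: "smooth_expr f \<Longrightarrow> smooth_expr g \<Longrightarrow> smooth_expr (\<lambda>x. f x + g x)"
| mult: "smooth_expr f \<Longrightarrow> smooth_expr g \<Longrightarrow> smooth_expr (\<lambda>x. f x * g x)"
| inverse: "smooth_expr f \<Longrightarrow> (\<And>x. f x \<noteq> 0) \<Longrightarrow> smooth_expr (\<lambda>x. inverse (f x))"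
| flat: "smooth_expr f \<Longrightarrow> smooth_expr (\<lambda>x. flatexp j (f x))"

lemma smooth_expr_derivative:
  "smooth_expr f \<Longrightarrow> \<exists>f'. (\<forall>x. (f has_derivative f' x) (at x)) \<and> (\<forall>b\<in>Basis. smooth_expr (\<lambda>x. f' x b))"
proof (induction rule: smooth_expr.induct)
  case (base f)
  then show ?case
    by (intro exI[of _ "\<lambda>x. frechet_derivative f (at x)"]) (auto intro: smooth_has_derivative smooth_frechet smooth_expr.base)
next
  case (const c)
  show ?case by (rule exI[of _ "\<lambda>x h. 0"]) (auto intro: smooth_expr.const)
next
  case (inner v)
  show ?case by (rule exI[of _ "\<lambda>x h. h \<bullet> v"]) (auto intro!: smooth_expr.const derivative_eq_intros)
next
  case (add f g)
  then obtain f' g' where "\<forall>x. (f has_derivative f' x) (at x)" "\<forall>b\<in>Basis. smooth_expr (\<lambda>x. f' x b)"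
    "\<forall>x. (g has_derivative g' x) (at x)" "\<forall>b\<in>Basis. smooth_expr (\<lambda>x. g' x b)" by blast
  then show ?case
    by (intro exI[of _ "\<lambda>x h. f' x h + g' x h"]) (auto intro!: smooth_expr.add has_derivative_add)
next
  case (mult f g)
  then obtain f' g' where "\<forall>x. (f has_derivative f' x) (at x)" "\<forall>b\<in>Basis. smooth_expr (\<lambda>x. f' x b)"
    "\<forall>x. (g has_derivative g' x) (at x)" "\<forall>b\<in>Basis. smooth_expr (\<lambda>x. g' x b)" by blast
  with mult.hyps show ?case
    by (intro exI[of _ "\<lambda>x h. f x * g' x h + f' x h * g x"])
       (auto intro!: smooth_expr.add smooth_expr.mult has_derivative_mult)
next
  case (inverse f)
  then obtain f' where "\<forall>x. (f has_derivative f' x) (at x)" "\<forall>b\<in>Basis. smooth_expr (\<lambda>x. f' x b)" by blast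
  with inverse.hyps show ?case
    by (intro exI[of _ "\<lambda>x h. (- 1) * (inverse (f x) * f' x h * inverse (f x))"])
       (intro conjI allI ballI smooth_expr.mult smooth_expr.const smooth_expr.inverse; auto intro!: derivative_eq_intros)
next
  case (flat f j)
  then obtain f' where f': "\<forall>x. (f has_derivative f' x) (at x)" "\<forall>b\<in>Basis. smooth_expr (\<lambda>x. f' x b)" by blast
  have "((\<lambda>x. flatexp j (f x)) has_derivative (\<lambda>h. (flatexp (j + 2) (f x) + (- real j) * flatexp (j + 1) (f x)) * f' x h)) (at x)" for x
    using has_derivative_compose[OF f'(1)[rule_format, of x] flat_deriv[of j "f x", unfolded has_field_derivative_def]]
    by (simp add: algebra_simps)
  with f' flat.hyps show ?case
    by (intro exI[of _ "\<lambda>x h. (flatexp (j + 2) (f x) + (- real j) * flatexp (j + 1) (f x)) * f' x h"])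
       (intro conjI allI ballI smooth_expr.add smooth_expr.mult smooth_expr.const smooth_expr.flat; blast)
qed

lemma smooth_smooth_expr: "smooth_expr f \<Longrightarrow> smooth f"
proof -
  have "smooth_expr f \<Longrightarrow> Ck k f" for k
  proof (induction k arbitrary: f)
    case 0
    from smooth_expr_derivative[OF 0] show ?case
      by (auto intro!: continuous_at_imp_continuous_on intro: has_derivative_continuous)
  next
    case (Suc k)
    from smooth_expr_derivative[OF Suc.prems] obtain f' where
      f': "\<And>x. (f has_derivative f' x) (at x)" "\<And>b. b \<in> Basis \<Longrightarrow> smooth_expr (\<lambda>x. f' x b)" by blast
    have "frechet_derivative f (at x) = f' x" for x using frechet_derivative_at[OF f'(1)] by simp
    with f' Suc.IH show ?case by (auto simp: differentiable_def)
  qed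
  then show "smooth_expr f \<Longrightarrow> smooth f" by (simp add: smooth_def)
qed

lemma smooth_const: "smooth (\<lambda>x. c)"
  and smooth_inner: "smooth (\<lambda>x. x \<bullet> v)"
  and smooth_add: "smooth f \<Longrightarrow> smooth g \<Longrightarrow> smooth (\<lambda>x. f x + g x)"
  and smooth_mult: "smooth f \<Longrightarrow> smooth g \<Longrightarrow> smooth (\<lambda>x. f x * g x)"
  and smooth_inverse: "smooth f \<Longrightarrow> (\<And>x. f x \<noteq> 0) \<Longrightarrow> smooth (\<lambda>x. inverse (f x))"
  and smooth_flat: "smooth f \<Longrightarrow> smooth (\<lambda>x. flatexp j (f x))"
  by (auto intro!: smooth_smooth_expr intro: smooth_expr.intros)

lemma smooth_diff: "smooth f \<Longrightarrow> smooth g \<Longrightarrow> smooth (\<lambda>x. f x - g x)"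
  using smooth_add[OF _ smooth_mult[OF smooth_const[of "-1"]], of f g] by simp

lemma smooth_ident: "smooth (\<lambda>x::real. x)"
  using smooth_inner[of "1::real"] by simp

lemma smooth_inner_self: "smooth (\<lambda>x::'a::euclidean_space. x \<bullet> x)"
proof -
  have "smooth (\<lambda>x::'a. \<Sum>b\<in>B. (x \<bullet> b) * (x \<bullet> b))" if "finite B" for B
    using that by (induction B) (simp_all add: smooth_const smooth_add smooth_mult smooth_inner)
  from this[OF finite_Basis] show ?thesis by (simp flip: euclidean_inner)
qed

text \<open>Since \<open>Ck\<close> differentiates along basis vectors, the induction closes when
  \<open>A\<close> maps basis vectors to basis vectors or to 0. The projections \<open>fst\<close>
  and \<open>snd\<close> do.\<close>

lemma smooth_compose_linear:
  fixes A :: "'a::euclidean_space \<Rightarrow> 'b::euclidean_space"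
  assumes A: "bounded_linear A" "\<And>b. b \<in> Basis \<Longrightarrow> A b \<in> insert 0 Basis" and f: "smooth f"
  shows "smooth (\<lambda>x. f (A x))"
proof -
  have "smooth f \<Longrightarrow> Ck k (\<lambda>x. f (A x))" for k
  proof (induction k arbitrary: f)
    case 0
    then have "continuous_on UNIV f" unfolding smooth_def by (metis Ck.simps(1))
    then show ?case using continuous_on_compose2[OF _ linear_continuous_on[OF A(1)]] by auto
  next
    case (Suc k)
    have d: "((\<lambda>x. f (A x)) has_derivative (\<lambda>h. frechet_derivative f (at (A x)) (A h))) (at x)" for x
      by (rule has_derivative_compose[OF bounded_linear_imp_has_derivative[OF A(1)] smooth_has_derivative[OF Suc.prems]])
    have eq: "frechet_derivative (\<lambda>x. f (A x)) (at x) = (\<lambda>h. frechet_derivative f (at (A x)) (A h))" for x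
      using frechet_derivative_at[OF d] by simp
    have "Ck k (\<lambda>x. frechet_derivative f (at (A x)) (A b))" if "b \<in> Basis" for b
    proof (cases "A b = 0")
      case True
      have "frechet_derivative f (at z) 0 = 0" for z
        using linear_0[OF has_derivative_linear[OF smooth_has_derivative[OF Suc.prems]]] .
      then show ?thesis using True smooth_const[where c=0 and 'a='a] by (simp add: smooth_def)
    next
      case False
      then have "A b \<in> Basis" using A(2)[OF that] by simp
      from Suc.IH[OF smooth_frechet[OF Suc.prems this]] show ?thesis .
    qed
    then show ?case using d by (auto simp: eq differentiable_def)
  qed
  with f show ?thesis by (simp add: smooth_def)
qed

lemma smooth_tensor:
  fixes \<psi> :: "'a::euclidean_space \<Rightarrow> real"
  assumes "smooth \<eta>" "smooth \<psi>"
  shows "smooth (\<lambda>z::real \<times> 'a. \<eta> (fst z) * \<psi> (snd z))"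
proof (rule smooth_mult)
  show "smooth (\<lambda>z::real \<times> 'a. \<eta> (fst z))"
    by (rule smooth_compose_linear[where A=fst, OF bounded_linear_fst _ assms(1)]) (auto simp: Basis_prod_def)
  show "smooth (\<lambda>z::real \<times> 'a. \<psi> (snd z))"
    by (rule smooth_compose_linear[where A=snd, OF bounded_linear_snd _ assms(2)]) (auto simp: Basis_prod_def)
qed

section \<open>Smooth steps and approximate identities in time\<close>

text \<open>The standard smooth transition from 0 on the left of \<open>s\<close> to 1 on the right
  of \<open>s + h\<close>; of the two flat functions in the denominator one is always
  positive.\<close>

definition step :: "real \<Rightarrow> real \<Rightarrow> real \<Rightarrow> real" where
  "step s h \<sigma> = flatexp 0 (\<sigma> - s) * inverse (flatexp 0 (\<sigma> - s) + flatexp 0 (s + h - \<sigma>))"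

lemma step_denominator_pos: "h > 0 \<Longrightarrow> flatexp 0 (\<sigma> - s) + flatexp 0 (s + h - \<sigma>) > 0"
  using flat_pos[of "\<sigma> - s" 0] flat_pos[of "s + h - \<sigma>" 0] flat_nonneg[of 0 "\<sigma> - s"] flat_nonneg[of 0 "s + h - \<sigma>"]
  by (cases "\<sigma> > s") (auto intro: add_pos_nonneg add_nonneg_pos)

lemma smooth_step: "h > 0 \<Longrightarrow> smooth (step s h)"
  unfolding step_def[abs_def]
  by (intro smooth_mult smooth_inverse smooth_add smooth_flat smooth_diff smooth_ident smooth_const)
     (metis less_irrefl step_denominator_pos)

lemma step_left: "\<sigma> \<le> s \<Longrightarrow> step s h \<sigma> = 0"
  by (simp add: step_def flat_zero)

lemma step_right: "h > 0 \<Longrightarrow> s + h \<le> \<sigma> \<Longrightarrow> step s h \<sigma> = 1"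
  using flat_pos[of "\<sigma> - s" 0] by (simp add: step_def flat_zero)

lemma step_bounds: "h > 0 \<Longrightarrow> 0 \<le> step s h \<sigma> \<and> step s h \<sigma> \<le> 1"
  using step_denominator_pos[of h \<sigma> s] flat_nonneg[of 0 "\<sigma> - s"] flat_nonneg[of 0 "s + h - \<sigma>"]
  unfolding step_def by (auto simp: field_simps)

definition dstep :: "real \<Rightarrow> real \<Rightarrow> real \<Rightarrow> real" where
  "dstep s h \<sigma> = frechet_derivative (step s h) (at \<sigma>) 1"

lemma step_deriv: "h > 0 \<Longrightarrow> (step s h has_real_derivative dstep s h \<sigma>) (at \<sigma>)"
proof -
  assume "h > 0"
  note d = smooth_has_derivative[OF smooth_step, OF this, of s \<sigma>]
  have "frechet_derivative (step s h) (at \<sigma>) = (*) (dstep s h \<sigma>)"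
  proof
    fix r
    show "frechet_derivative (step s h) (at \<sigma>) r = dstep s h \<sigma> * r"
      using linear_scale[OF has_derivative_linear[OF d], of r 1] by (simp add: dstep_def)
  qed
  then show ?thesis using d unfolding has_field_derivative_def by simp
qed

lemma continuous_on_dstep: "h > 0 \<Longrightarrow> continuous_on UNIV (dstep s h)"
  using smooth_frechet[OF smooth_step, of h 1 s] unfolding smooth_def dstep_def[abs_def]
  by (metis Basis_real_def Ck.simps(1) singletonI)

text \<open>In the quotient rule the products of a function with its own derivative cancel, and what
  remains in the numerator is a sum of products of nonnegative functions.\<close>

lemma dstep_nonneg:
  assumes h: "h > 0" shows "dstep s h \<sigma> \<ge> 0"
proof -
  let ?a = "flatexp 0 (\<sigma> - s)" and ?b = "flatexp 0 (s + h - \<sigma>)" and ?a' = "flatexp 2 (\<sigma> - s)" and ?b' = "flatexp 2 (s + h - \<sigma>)"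
  have g: "((\<lambda>\<sigma>. \<sigma> - s) has_real_derivative 1) (at \<sigma>)" "((\<lambda>\<sigma>. s + h - \<sigma>) has_real_derivative - 1) (at \<sigma>)"
    by (auto intro!: derivative_eq_intros)
  have a: "((\<lambda>\<sigma>. flatexp 0 (\<sigma> - s)) has_real_derivative ?a') (at \<sigma>)"
    using DERIV_chain2[where f="flatexp 0", OF flat_deriv g(1)] by (simp add: numeral_2_eq_2)
  have b: "((\<lambda>\<sigma>. flatexp 0 (s + h - \<sigma>)) has_real_derivative - ?b') (at \<sigma>)"
    using DERIV_chain2[where f="flatexp 0", OF flat_deriv g(2)] by (simp add: numeral_2_eq_2)
  note pos = step_denominator_pos[OF h, of \<sigma> s]
  have "(step s h has_real_derivative (?a' * (?a + ?b) - ?a * (?a' + - ?b')) / ((?a + ?b) * (?a + ?b))) (at \<sigma>)"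
    unfolding step_def[abs_def] divide_inverse[symmetric]
    by (rule DERIV_divide[OF a DERIV_add[OF a b]]) (use pos in simp)
  then have "dstep s h \<sigma> = (?a' * (?a + ?b) - ?a * (?a' + - ?b')) / ((?a + ?b) * (?a + ?b))"
    using step_deriv[OF h] DERIV_unique by blast
  also have "\<dots> = (?a' * ?b + ?a * ?b') / ((?a + ?b) * (?a + ?b))" by (simp add: algebra_simps)
  also have "\<dots> \<ge> 0" by (simp add: flat_nonneg)
  finally show ?thesis .
qed

lemma dstep_zero: "h > 0 \<Longrightarrow> \<sigma> < s \<or> s + h < \<sigma> \<Longrightarrow> dstep s h \<sigma> = 0"
proof (elim disjE)
  assume h: "h > 0"
  show "dstep s h \<sigma> = 0" if "\<sigma> < s"
  proof -
    have "((\<lambda>_. 0) has_real_derivative 0) (at \<sigma>)" by simp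
    then have "(step s h has_real_derivative 0) (at \<sigma>)"
      by (rule has_field_derivative_transform_within_open[of _ _ _ "{..<s}"]) (use that in \<open>auto simp: step_left\<close>)
    then show ?thesis using step_deriv[OF h] DERIV_unique by blast
  qed
  show "dstep s h \<sigma> = 0" if "s + h < \<sigma>"
  proof -
    have "((\<lambda>_. 1) has_real_derivative 0) (at \<sigma>)" by simp
    then have "(step s h has_real_derivative 0) (at \<sigma>)"
      by (rule has_field_derivative_transform_within_open[of _ _ _ "{s+h<..}"]) (use that h in \<open>auto simp: step_right\<close>)
    then show ?thesis using step_deriv[OF h] DERIV_unique by blast
  qed
qed

lemma dstep_has_integral:
  assumes "h > 0" "a \<le> s" "s + h \<le> b"
  shows "(dstep s h has_integral 1) {a..b}"
proof -
  have "(dstep s h has_integral (step s h b - step s h a)) {a..b}"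
    by (rule fundamental_theorem_of_calculus)
       (use assms step_deriv in \<open>auto simp: has_real_derivative_iff_has_vector_derivative[symmetric] intro: has_field_derivative_at_within\<close>)
  then show ?thesis using assms by (simp add: step_left step_right)
qed

text \<open>\<open>dstep s h\<close> is a probability density on \<open>{s..s+h}\<close>, so the
  integral is a weighted mean of values of \<open>m\<close> near \<open>s\<close>.\<close>

lemma dstep_concentrates:
  assumes h: "h > 0" "a \<le> s" "s + h \<le> b" and m: "continuous_on {a..b} m"
    and e: "\<And>\<sigma>. \<sigma> \<in> {s..s+h} \<Longrightarrow> \<bar>m \<sigma> - m s\<bar> \<le> e"
  shows "\<bar>integral {a..b} (\<lambda>\<sigma>. dstep s h \<sigma> * m \<sigma>) - m s\<bar> \<le> e"
proof -
  have d: "continuous_on {a..b} (dstep s h)" using continuous_on_dstep[OF h(1)] continuous_on_subset by blast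
  have 1: "(\<lambda>\<sigma>. dstep s h \<sigma> * m \<sigma>) integrable_on {a..b}"
    by (intro integrable_continuous_interval continuous_intros d m)
  have 2: "((\<lambda>\<sigma>. dstep s h \<sigma> * c) has_integral c) {a..b}" for c
    using has_integral_mult_left[OF dstep_has_integral[OF h]] by simp
  have "integral {a..b} (\<lambda>\<sigma>. dstep s h \<sigma> * m \<sigma>) - m s = integral {a..b} (\<lambda>\<sigma>. dstep s h \<sigma> * (m \<sigma> - m s))"
    using has_integral_diff[OF integrable_integral[OF 1] 2[of "m s"]]
    by (simp only: integral_unique right_diff_distrib)
  also have "\<bar>\<dots>\<bar> \<le> integral {a..b} (\<lambda>\<sigma>. dstep s h \<sigma> * e)"
    unfolding real_norm_def[symmetric]
  proof (rule integral_norm_bound_integral)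
    show "(\<lambda>\<sigma>. dstep s h \<sigma> * (m \<sigma> - m s)) integrable_on {a..b}"
      by (intro integrable_continuous_interval continuous_intros d m)
    fix \<sigma>
    show "norm (dstep s h \<sigma> * (m \<sigma> - m s)) \<le> dstep s h \<sigma> * e"
    proof (cases "\<sigma> \<in> {s..s+h}")
      case True
      then show ?thesis using e dstep_nonneg[OF h(1)] by (simp add: abs_mult mult_left_mono)
    qed (use dstep_zero[OF h(1)] in force)
  qed (use 2 in blast)
  also have "\<dots> = e" using 2 by (rule integral_unique)
  finally show ?thesis .
qed

section \<open>Differentiation under the integral sign and convolution\<close>

text \<open>A derivative as the limit of one sequence of difference quotients: this transfers
  measurability and norm bounds from a function to its derivative.\<close>

lemma has_derivative_sequence:
  fixes f :: "'a::euclidean_space \<Rightarrow> 'b::real_normed_vector"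
  assumes "(f has_derivative f') (at x)"
  shows "(\<lambda>n. real (Suc n) *\<^sub>R (f (x + h /\<^sub>R real (Suc n)) - f x)) \<longlonglongrightarrow> f' h"
proof (cases "h = 0")
  case True
  then show ?thesis using linear_0[OF has_derivative_linear[OF assms]] by simp
next
  case False
  have lim: "(\<lambda>k. norm (f (x + k) - f x - f' k) / norm k) \<midarrow>0\<rightarrow> 0"
    using assms unfolding has_derivative_at by blast
  have hn: "(\<lambda>n. h /\<^sub>R real (Suc n)) \<longlonglongrightarrow> 0"
    using tendsto_scaleR[OF LIMSEQ_inverse_real_of_nat tendsto_const[of h]] by simp
  have "(\<lambda>n. norm (f (x + h /\<^sub>R real (Suc n)) - f x - f' (h /\<^sub>R real (Suc n))) / norm (h /\<^sub>R real (Suc n))) \<longlonglongrightarrow> 0"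
    using lim[unfolded tendsto_at_iff_sequentially, rule_format, of "\<lambda>n. h /\<^sub>R real (Suc n)"] hn False
    by (simp add: o_def)
  from tendsto_mult_left[OF this, of "norm h"]
  have "(\<lambda>n. norm h * (norm (f (x + h /\<^sub>R real (Suc n)) - f x - f' (h /\<^sub>R real (Suc n))) / norm (h /\<^sub>R real (Suc n)))) \<longlonglongrightarrow> 0" by simp
  moreover have "norm h * (norm (f (x + h /\<^sub>R real (Suc n)) - f x - f' (h /\<^sub>R real (Suc n))) / norm (h /\<^sub>R real (Suc n)))
     = norm (real (Suc n) *\<^sub>R (f (x + h /\<^sub>R real (Suc n)) - f x) - f' h)" for n
  proof -
    have "f' (h /\<^sub>R real (Suc n)) = f' h /\<^sub>R real (Suc n)" by (rule linear_scale[OF has_derivative_linear[OF assms]])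
    then have "real (Suc n) *\<^sub>R (f (x + h /\<^sub>R real (Suc n)) - f x) - f' h = real (Suc n) *\<^sub>R (f (x + h /\<^sub>R real (Suc n)) - f x - f' (h /\<^sub>R real (Suc n)))"
      by (simp add: scaleR_diff_right)
    then have "norm (real (Suc n) *\<^sub>R (f (x + h /\<^sub>R real (Suc n)) - f x) - f' h) = real (Suc n) * norm (f (x + h /\<^sub>R real (Suc n)) - f x - f' (h /\<^sub>R real (Suc n)))"
      by simp
    then show ?thesis using False by (simp add: field_simps)
  qed
  ultimately have "(\<lambda>n. norm (real (Suc n) *\<^sub>R (f (x + h /\<^sub>R real (Suc n)) - f x) - f' h)) \<longlonglongrightarrow> 0" by simp
  then show ?thesis by (rule LIM_zero_cancel[OF tendsto_norm_zero_cancel])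
qed

lemma has_derivative_lipschitz:
  fixes f :: "'a::euclidean_space \<Rightarrow> 'b::euclidean_space"
  assumes "\<And>x. (f has_derivative f' x) (at x)" "\<And>x h. norm (f' x h) \<le> B * norm h"
  shows "norm (f x - f y) \<le> B * norm (x - y)"
  by (rule differentiable_bound[OF convex_UNIV]) (use assms in \<open>auto intro!: onorm_le\<close>)

lemma lipschitz_has_derivative:
  fixes f :: "'a::euclidean_space \<Rightarrow> 'b::real_normed_vector"
  assumes d: "(f has_derivative f') (at x)" and lip: "\<And>y. norm (f y - f x) \<le> K * norm (y - x)"
  shows "norm (f' h) \<le> K * norm h"
proof (rule LIMSEQ_le_const2[OF tendsto_norm[OF has_derivative_sequence[OF d]]])
  have "norm (real (Suc n) *\<^sub>R (f (x + h /\<^sub>R real (Suc n)) - f x)) \<le> K * norm h" for n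
  proof -
    have "norm (real (Suc n) *\<^sub>R (f (x + h /\<^sub>R real (Suc n)) - f x)) = real (Suc n) * norm (f (x + h /\<^sub>R real (Suc n)) - f x)"
      by simp
    also have "\<dots> \<le> real (Suc n) * (K * norm (h /\<^sub>R real (Suc n)))"
      using lip[of "x + h /\<^sub>R real (Suc n)"] by (intro mult_left_mono) (auto simp del: of_nat_Suc)
    also have "\<dots> = K * norm h" by (simp del: of_nat_Suc)
    finally show ?thesis .
  qed
  then show "\<exists>N. \<forall>n\<ge>N. norm (real (Suc n) *\<^sub>R (f (x + h /\<^sub>R real (Suc n)) - f x)) \<le> K * norm h" by blast
qed

text \<open>Dominated convergence for the remainder divided by the norm of the increment, which is
  at most \<open>2 * B\<close> because \<open>f\<close> is Lipschitz with constant \<open>B\<close>.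
  Measurability of the derivative is a consequence of that of the function.\<close>

lemma
  fixes f :: "'a::euclidean_space \<Rightarrow> 'y \<Rightarrow> 'b::euclidean_space"
  assumes M: "finite_measure M" and meas: "\<And>x. f x \<in> borel_measurable M"
    and C: "\<And>x y. y \<in> space M \<Longrightarrow> norm (f x y) \<le> C"
    and d: "\<And>x y. y \<in> space M \<Longrightarrow> ((\<lambda>x. f x y) has_derivative f' x y) (at x)"
    and bd: "\<And>x y h. y \<in> space M \<Longrightarrow> norm (f' x y h) \<le> B * norm h"
  shows borel_measurable_derivative_param: "(\<lambda>y. f' x y h) \<in> borel_measurable M"
    and has_derivative_integral_param: "((\<lambda>x. \<integral>y. f x y \<partial>M) has_derivative (\<lambda>h. \<integral>y. f' x y h \<partial>M)) (at x)"
proof -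
  interpret finite_measure M by fact
  note meas[measurable]
  show meas'[measurable]: "(\<lambda>y. f' x y h) \<in> borel_measurable M" for x h
  proof (rule borel_measurable_LIMSEQ_metric)
    show "(\<lambda>n. real (Suc n) *\<^sub>R (f (x + h /\<^sub>R real (Suc n)) y - f x y)) \<longlonglongrightarrow> f' x y h" if "y \<in> space M" for y
      using has_derivative_sequence[OF d[OF that]] .
  qed measurable
  have i: "integrable M (f x)" for x by (rule integrable_const_bound[where B=C]) (use C in auto)
  have i': "integrable M (\<lambda>y. f' x y h)" for x h
    by (rule integrable_const_bound[where B="B * norm h"]) (use bd in auto)
  show "((\<lambda>x. \<integral>y. f x y \<partial>M) has_derivative (\<lambda>h. \<integral>y. f' x y h \<partial>M)) (at x)"
    unfolding has_derivative_at
  proof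
    have lin: "linear (f' x y)" if "y \<in> space M" for y using d[OF that] by (rule has_derivative_linear)
    show "bounded_linear (\<lambda>h. \<integral>y. f' x y h \<partial>M)"
    proof (rule bounded_linear_intro)
      fix h k :: 'a and r :: real
      show "(\<integral>y. f' x y (h + k) \<partial>M) = (\<integral>y. f' x y h \<partial>M) + (\<integral>y. f' x y k \<partial>M)"
        by (subst Bochner_Integration.integral_add[OF i' i', symmetric])
           (auto intro!: Bochner_Integration.integral_cong simp: linear_add[OF lin])
      show "(\<integral>y. f' x y (r *\<^sub>R h) \<partial>M) = r *\<^sub>R (\<integral>y. f' x y h \<partial>M)"
      proof -
        have "(\<integral>y. f' x y (r *\<^sub>R h) \<partial>M) = (\<integral>y. r *\<^sub>R f' x y h \<partial>M)"
          by (rule Bochner_Integration.integral_cong) (simp_all add: linear_scale[OF lin])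
        then show ?thesis by simp
      qed
      have "norm (\<integral>y. f' x y h \<partial>M) \<le> (\<integral>y. B * norm h \<partial>M)"
        by (rule order_trans[OF integral_norm_bound], rule integral_mono) (use i' bd in auto)
      then show "norm (\<integral>y. f' x y h \<partial>M) \<le> norm h * (measure M (space M) * B)" by (simp add: mult_ac)
    qed
    show "(\<lambda>h. norm ((\<integral>y. f (x + h) y \<partial>M) - (\<integral>y. f x y \<partial>M) - (\<integral>y. f' x y h \<partial>M)) / norm h) \<midarrow>0\<rightarrow> 0"
      unfolding tendsto_at_iff_sequentially
    proof (intro allI impI)
      fix X :: "nat \<Rightarrow> 'a" assume X: "\<forall>i. X i \<in> UNIV - {0}" "X \<longlonglongrightarrow> 0"
      let ?r = "\<lambda>n y. (f (x + X n) y - f x y - f' x y (X n)) /\<^sub>R norm (X n)"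
      have "(\<lambda>n. \<integral>y. ?r n y \<partial>M) \<longlonglongrightarrow> (\<integral>y. 0 \<partial>M)"
      proof (rule integral_dominated_convergence[where w="\<lambda>_. 2 * B"])
        show "AE y in M. (\<lambda>n. ?r n y) \<longlonglongrightarrow> 0"
        proof (rule AE_I2)
          fix y assume y: "y \<in> space M"
          have "(\<lambda>h. norm (f (x + h) y - f x y - f' x y h) / norm h) \<midarrow>0\<rightarrow> 0"
            using d[OF y, of x] unfolding has_derivative_at by blast
          then have "(\<lambda>n. norm (f (x + X n) y - f x y - f' x y (X n)) / norm (X n)) \<longlonglongrightarrow> 0"
            unfolding tendsto_at_iff_sequentially using X by (auto simp: o_def)
          then show "(\<lambda>n. ?r n y) \<longlonglongrightarrow> 0"
            by (intro tendsto_norm_zero_cancel[where f="\<lambda>n. ?r n y"]) (simp add: divide_inverse mult.commute)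
        qed
        show "AE y in M. norm (?r n y) \<le> 2 * B" for n
        proof (rule AE_I2)
          fix y assume y: "y \<in> space M"
          have nz: "norm (X n) > 0" using X by simp
          have "norm (f (x + X n) y - f x y) \<le> B * norm (X n)"
            using has_derivative_lipschitz[OF d[OF y] bd[OF y], of "x + X n" x] by simp
          then have "norm (f (x + X n) y - f x y - f' x y (X n)) \<le> 2 * B * norm (X n)"
            using norm_triangle_ineq4[of "f (x + X n) y - f x y" "f' x y (X n)"] bd[OF y, of x "X n"] by simp
          then have "norm (f (x + X n) y - f x y - f' x y (X n)) / norm (X n) \<le> 2 * B" using nz by (simp add: pos_divide_le_eq)
          then show "norm (?r n y) \<le> 2 * B" by (simp only: norm_scaleR abs_norm_cancel abs_inverse divide_inverse mult.commute)
        qed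
      qed auto
      moreover have "norm (\<integral>y. ?r n y \<partial>M) = norm ((\<integral>y. f (x + X n) y \<partial>M) - (\<integral>y. f x y \<partial>M) - (\<integral>y. f' x y (X n) \<partial>M)) / norm (X n)" for n
        using i i' by (simp add: divide_inverse mult.commute)
      ultimately show "((\<lambda>h. norm ((\<integral>y. f (x + h) y \<partial>M) - (\<integral>y. f x y \<partial>M) - (\<integral>y. f' x y h \<partial>M)) / norm h) \<circ> X) \<longlonglongrightarrow> 0"
        using tendsto_norm_zero[of "\<lambda>n. \<integral>y. ?r n y \<partial>M"] by (simp add: o_def)
    qed
  qed
qed

lemma smooth_continuous: "smooth f \<Longrightarrow> continuous_on UNIV f"
  unfolding smooth_def by (metis Ck.simps(1))

lemma smooth_compact_bounded:
  fixes \<kappa> :: "'a::euclidean_space \<Rightarrow> real"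
  assumes \<kappa>: "smooth \<kappa>" "\<And>x. norm x > r \<Longrightarrow> \<kappa> x = 0"
  shows "\<exists>C. 0 \<le> C \<and> (\<forall>x. \<bar>\<kappa> x\<bar> \<le> C)"
proof -
  have "bounded (\<kappa> ` cball 0 r)"
    by (intro compact_imp_bounded compact_continuous_image continuous_on_subset[OF smooth_continuous[OF \<kappa>(1)]]) auto
  then obtain C where C: "\<And>z. z \<in> cball 0 r \<Longrightarrow> \<bar>\<kappa> z\<bar> \<le> C" unfolding bounded_iff real_norm_def by blast
  have "\<bar>\<kappa> z\<bar> \<le> \<bar>C\<bar>" for z using C[of z] \<kappa>(2)[of z] by (cases "z \<in> cball 0 r") auto
  then show ?thesis by (intro exI[of _ "\<bar>C\<bar>"]) simp
qed

lemma smooth_frechet_zero: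
  assumes \<kappa>: "smooth \<kappa>" "\<And>x. norm x > r \<Longrightarrow> \<kappa> x = 0" and z: "norm z > r"
  shows "frechet_derivative \<kappa> (at z) h = 0"
proof (rule frechet_derivative_zero_outside)
  have "closure {z. \<kappa> z \<noteq> 0} \<subseteq> cball 0 r"
  proof (rule closure_minimal[OF subsetI])
    show "x \<in> cball 0 r" if "x \<in> {z. \<kappa> z \<noteq> 0}" for x
      using that \<kappa>(2)[of x] by (cases "norm x > r") auto
  qed simp
  then show "z \<notin> closure {z. \<kappa> z \<noteq> 0}" using z by auto
qed

lemma smooth_compact_derivative_bound:
  fixes \<kappa> :: "'a::euclidean_space \<Rightarrow> real"
  assumes \<kappa>: "smooth \<kappa>" "\<And>x. norm x > r \<Longrightarrow> \<kappa> x = 0"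
  shows "\<exists>C. 0 \<le> C \<and> (\<forall>x h. \<bar>frechet_derivative \<kappa> (at x) h\<bar> \<le> C * norm h)"
proof -
  let ?D = "\<lambda>z. frechet_derivative \<kappa> (at z)"
  have "\<exists>C. 0 \<le> C \<and> (\<forall>x. \<bar>?D x b\<bar> \<le> C)" if b: "b \<in> Basis" for b
  proof -
    have z: "?D x b = 0" if "norm x > r" for x by (rule smooth_frechet_zero[OF \<kappa> that])
    from smooth_compact_bounded[OF smooth_frechet[OF \<kappa>(1) b] z] show ?thesis .
  qed
  then have "\<forall>b\<in>Basis. \<exists>C. 0 \<le> C \<and> (\<forall>x. \<bar>?D x b\<bar> \<le> C)" by blast
  from bchoice[OF this] obtain C where C: "\<And>b. b \<in> Basis \<Longrightarrow> 0 \<le> C b" "\<And>b x. b \<in> Basis \<Longrightarrow> \<bar>?D x b\<bar> \<le> C b"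
    by blast
  have "\<bar>?D z h\<bar> \<le> (\<Sum>b\<in>Basis. C b) * norm h" for z h
  proof -
    have "?D z h = (\<Sum>b\<in>Basis. (h \<bullet> b) *\<^sub>R ?D z b)"
      by (rule linear_euclidean_sum[OF has_derivative_linear[OF smooth_has_derivative[OF \<kappa>(1)]]])
    also have "\<bar>\<dots>\<bar> \<le> (\<Sum>b\<in>Basis. norm h * C b)"
      by (rule order_trans[OF sum_abs], rule sum_mono) (auto simp: abs_mult intro!: mult_mono Basis_le_norm C)
    finally show ?thesis by (simp add: sum_distrib_left mult.commute)
  qed
  then show ?thesis using C(1) by (intro exI[of _ "\<Sum>b\<in>Basis. C b"]) (simp add: sum_nonneg)
qed

text \<open>Every derivative falls on the kernel, and the derivatives of the kernel are smooth with
  support in the same ball. Hence the induction on the order runs over all kernels at once, while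
  \<open>q\<close> stays merely bounded and measurable.\<close>

lemma smooth_convolution:
  fixes \<kappa> :: "'a::euclidean_space \<Rightarrow> real"
  assumes \<kappa>: "smooth \<kappa>" "\<And>x. x \<notin> cball 0 r \<Longrightarrow> \<kappa> x = 0"
    and M: "finite_measure M" "sets M = sets borel"
    and q: "q \<in> borel_measurable borel" "\<And>y. \<bar>q y\<bar> \<le> Q"
  shows "smooth (\<lambda>x. \<integral>y. \<kappa> (x - y) * q y \<partial>M)"
proof -
  interpret finite_measure M by fact
  have mM: "borel_measurable M = (borel_measurable borel :: ('a \<Rightarrow> real) set)" by (rule measurable_cong_sets) (auto simp: M)
  have deriv: "((\<lambda>x. \<integral>y. \<kappa> (x - y) * q y \<partial>M) has_derivative (\<lambda>h. \<integral>y. frechet_derivative \<kappa> (at (x - y)) h * q y \<partial>M)) (at x)"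
    if \<kappa>: "smooth \<kappa>" "\<And>x. x \<notin> cball 0 r \<Longrightarrow> \<kappa> x = 0" for \<kappa> :: "'a \<Rightarrow> real" and x
  proof -
    let ?D = "\<lambda>z. frechet_derivative \<kappa> (at z)"
    note d = smooth_has_derivative[OF \<kappa>(1)]
    have \<kappa>': "\<kappa> x = 0" if "norm x > r" for x using \<kappa>(2)[of x] that by simp
    obtain B0 where B0: "0 \<le> B0" and bK: "\<And>z. \<bar>\<kappa> z\<bar> \<le> B0" using smooth_compact_bounded[OF \<kappa>(1) \<kappa>'] by blast
    obtain B1 where B1: "0 \<le> B1" and bD: "\<And>z h. \<bar>?D z h\<bar> \<le> B1 * norm h"
      using smooth_compact_derivative_bound[OF \<kappa>(1) \<kappa>'] by blast
    show ?thesis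
    proof (rule has_derivative_integral_param[OF M(1), where f="\<lambda>x y. \<kappa> (x - y) * q y"
        and f'="\<lambda>x y h. ?D (x - y) h * q y" and C="B0 * Q" and B="B1 * Q"])
      show "(\<lambda>y. \<kappa> (x - y) * q y) \<in> borel_measurable M" for x
        unfolding mM using borel_measurable_continuous_onI[OF smooth_continuous[OF \<kappa>(1)]] q(1) by measurable
      show "norm (\<kappa> (x - y) * q y) \<le> B0 * Q" for x y
        unfolding real_norm_def abs_mult using B0 by (intro mult_mono bK q) auto
      show "((\<lambda>x. \<kappa> (x - y) * q y) has_derivative (\<lambda>h. ?D (x - y) h * q y)) (at x)" for x y
        by (rule has_derivative_mult_left, rule has_derivative_compose[where f="\<lambda>x. x - y" and g=\<kappa> and f'="\<lambda>h. h", OF _ d])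
           (auto intro!: derivative_eq_intros)
      show "norm (?D (x - y) h * q y) \<le> B1 * Q * norm h" for x y h
      proof -
        have "\<bar>?D (x - y) h\<bar> * \<bar>q y\<bar> \<le> (B1 * norm h) * Q" using B1 by (intro mult_mono bD q(2)) auto
        then show ?thesis by (simp add: abs_mult mult_ac)
      qed
    qed
  qed
  have "Ck k (\<lambda>x. \<integral>y. \<kappa> (x - y) * q y \<partial>M)" if "smooth \<kappa>" "\<And>x. x \<notin> cball 0 r \<Longrightarrow> \<kappa> x = 0" for k \<kappa>
    using that
  proof (induction k arbitrary: \<kappa>)
    case 0
    show ?case unfolding Ck.simps
      by (intro continuous_at_imp_continuous_on ballI has_derivative_continuous[OF deriv[OF 0]])
  next
    case (Suc k)
    note d = deriv[OF Suc.prems]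
    have eq: "frechet_derivative (\<lambda>x. \<integral>y. \<kappa> (x - y) * q y \<partial>M) (at x) = (\<lambda>h. \<integral>y. frechet_derivative \<kappa> (at (x - y)) h * q y \<partial>M)" for x
      using frechet_derivative_at[OF d] by simp
    have "Ck k (\<lambda>x. \<integral>y. frechet_derivative \<kappa> (at (x - y)) b * q y \<partial>M)" if "b \<in> Basis" for b
    proof (rule Suc.IH)
      show "smooth (\<lambda>z. frechet_derivative \<kappa> (at z) b)" using smooth_frechet[OF Suc.prems(1) that] .
      show "frechet_derivative \<kappa> (at z) b = 0" if z: "z \<notin> cball 0 r" for z
        by (rule smooth_frechet_zero[OF Suc.prems(1), of r]) (use Suc.prems(2) z in auto)
    qed
    then show ?case using d by (auto simp: eq differentiable_def)
  qed
  then show ?thesis using \<kappa> unfolding smooth_def[of "\<lambda>x. \<integral>y. \<kappa> (x - y) * q y \<partial>M"] by blast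
qed

section \<open>Functions with Lipschitz derivative and their mollification\<close>

definition C11 :: "real \<Rightarrow> real \<Rightarrow> real \<Rightarrow> ('a::euclidean_space \<Rightarrow> real) \<Rightarrow> ('a \<Rightarrow> 'a \<Rightarrow> real) \<Rightarrow> bool" where
  "C11 a b r \<phi> \<phi>' \<longleftrightarrow> (\<forall>x. (\<phi> has_derivative \<phi>' x) (at x)) \<and> (\<forall>x h. \<bar>\<phi>' x h\<bar> \<le> a * norm h) \<and>
     (\<forall>x y h. \<bar>\<phi>' x h - \<phi>' y h\<bar> \<le> b * norm (x - y) * norm h) \<and> (\<forall>x. norm x > r \<longrightarrow> \<phi> x = 0)"

lemma C11D:
  assumes "C11 a b r \<phi> \<phi>'"
  shows "(\<phi> has_derivative \<phi>' x) (at x)" "\<bar>\<phi>' x h\<bar> \<le> a * norm h"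
    "\<bar>\<phi>' x h - \<phi>' y h\<bar> \<le> b * norm (x - y) * norm h" "norm x > r \<Longrightarrow> \<phi> x = 0"
  using assms unfolding C11_def by auto

lemma C11_lipschitz: "C11 a b r \<phi> \<phi>' \<Longrightarrow> \<bar>\<phi> x - \<phi> y\<bar> \<le> a * norm (x - y)"
  using has_derivative_lipschitz[of \<phi> \<phi>' a x y] C11D by (metis real_norm_def)

lemma C11_continuous: "C11 a b r \<phi> \<phi>' \<Longrightarrow> continuous_on UNIV \<phi>"
  by (intro continuous_at_imp_continuous_on ballI has_derivative_continuous[OF C11D(1)])

lemma C11_bounded: "C11 a b r \<phi> \<phi>' \<Longrightarrow> \<exists>B. \<forall>x. \<bar>\<phi> x\<bar> \<le> B"
proof -
  assume C: "C11 a b r \<phi> \<phi>'"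
  have "bounded (\<phi> ` cball 0 r)"
    by (intro compact_imp_bounded compact_continuous_image continuous_on_subset[OF C11_continuous[OF C]]) auto
  then obtain B0 where B0: "\<And>z. z \<in> cball 0 r \<Longrightarrow> \<bar>\<phi> z\<bar> \<le> B0" unfolding bounded_iff real_norm_def by blast
  have "\<bar>\<phi> z\<bar> \<le> \<bar>B0\<bar>" for z using B0[of z] C11D(4)[OF C, of z] by (cases "z \<in> cball 0 r") auto
  then show ?thesis by blast
qed

lemma C11_deriv_continuous:
  assumes C: "C11 a b r \<phi> \<phi>'" shows "continuous_on UNIV (\<lambda>x. \<phi>' x h)"
proof -
  have "\<bar>b * norm h\<bar>-lipschitz_on UNIV (\<lambda>x. \<phi>' x h)"
  proof (rule lipschitz_onI)
    fix x y
    have "\<bar>\<phi>' x h - \<phi>' y h\<bar> \<le> (b * norm h) * norm (x - y)" using C11D(3)[OF C, of x h y] by (simp add: mult_ac)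
    also have "\<dots> \<le> \<bar>b * norm h\<bar> * norm (x - y)" by (intro mult_right_mono) auto
    finally show "dist (\<phi>' x h) (\<phi>' y h) \<le> \<bar>b * norm h\<bar> * dist x y" by (simp add: dist_norm)
  qed simp
  then show ?thesis by (rule lipschitz_on_continuous_on)
qed

lemma C11_deriv_zero:
  assumes C: "C11 a b r \<phi> \<phi>'" and x: "norm x > r" shows "\<phi>' x h = 0"
proof -
  have "(\<phi> has_derivative (\<lambda>_. 0)) (at x)"
    by (rule has_derivative_transform_within_open[of "\<lambda>_. 0" _ _ _ "- cball 0 r"]) (use x C11D(4)[OF C] in auto)
  from has_derivative_unique[OF this C11D(1)[OF C]] show ?thesis by metis
qed

lemma smooth_C11:
  fixes \<psi> :: "'a::euclidean_space \<Rightarrow> real"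
  assumes \<psi>: "smooth \<psi>" "\<And>x. norm x > r \<Longrightarrow> \<psi> x = 0"
  obtains a b where "C11 a b r \<psi> (\<lambda>x. frechet_derivative \<psi> (at x))"
proof -
  let ?D = "\<lambda>z. frechet_derivative \<psi> (at z)"
  obtain a where a: "\<And>x h. \<bar>?D x h\<bar> \<le> a * norm h" using smooth_compact_derivative_bound[OF \<psi>] by blast
  have "\<exists>C. 0 \<le> C \<and> (\<forall>x y. \<bar>?D x k - ?D y k\<bar> \<le> C * norm (x - y))" if k: "k \<in> Basis" for k
  proof -
    note s = smooth_frechet[OF \<psi>(1) k]
    have z: "?D x k = 0" if "norm x > r" for x by (rule smooth_frechet_zero[OF \<psi> that])
    obtain C where C: "0 \<le> C" "\<And>x h. \<bar>frechet_derivative (\<lambda>x. ?D x k) (at x) h\<bar> \<le> C * norm h"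
      using smooth_compact_derivative_bound[OF s z] by blast
    have "norm (?D x k - ?D y k) \<le> C * norm (x - y)" for x y
      by (rule has_derivative_lipschitz[OF smooth_has_derivative[OF s]]) (use C in simp)
    then show ?thesis using C(1) by auto
  qed
  then have "\<forall>k\<in>Basis. \<exists>C. 0 \<le> C \<and> (\<forall>x y. \<bar>?D x k - ?D y k\<bar> \<le> C * norm (x - y))" by blast
  from bchoice[OF this] obtain C where C: "\<And>k. k \<in> Basis \<Longrightarrow> 0 \<le> C k"
    "\<And>k x y. k \<in> Basis \<Longrightarrow> \<bar>?D x k - ?D y k\<bar> \<le> C k * norm (x - y)" by blast
  have "\<bar>?D x h - ?D y h\<bar> \<le> (\<Sum>k\<in>Basis. C k) * norm (x - y) * norm h" for x y h
  proof -
    have ex: "?D z h = (\<Sum>k\<in>Basis. (h \<bullet> k) *\<^sub>R ?D z k)" for z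
      by (rule linear_euclidean_sum[OF has_derivative_linear[OF smooth_has_derivative[OF \<psi>(1)]]])
    have "\<bar>?D x h - ?D y h\<bar> = \<bar>\<Sum>k\<in>Basis. (h \<bullet> k) * (?D x k - ?D y k)\<bar>"
      unfolding ex[of x] ex[of y] by (simp add: sum_subtractf right_diff_distrib)
    also have "\<dots> \<le> (\<Sum>k\<in>Basis. norm h * (C k * norm (x - y)))"
      by (rule order_trans[OF sum_abs], rule sum_mono) (auto simp: abs_mult intro!: mult_mono Basis_le_norm C)
    also have "\<dots> = (\<Sum>k\<in>Basis. C k) * norm (x - y) * norm h"
      by (simp add: sum_distrib_right sum_distrib_left mult_ac)
    finally show ?thesis .
  qed
  then have "C11 a (\<Sum>k\<in>Basis. C k) r \<psi> ?D"
    unfolding C11_def using smooth_has_derivative[OF \<psi>(1)] a \<psi>(2) by blast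
  then show thesis by (rule that)
qed

text \<open>The mollified function averages translates by at most \<open>e\<close>, so its errors
  are those of such a shift: \<open>a * e\<close> for the function and \<open>b * e\<close> for the
  derivative.\<close>

lemma mollification:
  fixes \<phi> :: "'a::euclidean_space \<Rightarrow> real"
  assumes C: "C11 a b r \<phi> \<phi>'" and e: "e > 0" "e \<le> 1"
  obtains \<psi> \<psi>' where "smooth \<psi>" "\<And>x. (\<psi> has_derivative \<psi>' x) (at x)" "\<And>x. norm x > r + 1 \<Longrightarrow> \<psi> x = 0"
    "\<And>x. \<bar>\<psi> x - \<phi> x\<bar> \<le> a * e" "\<And>x h. \<bar>\<psi>' x h - \<phi>' x h\<bar> \<le> b * e * norm h"
proof -
  \<comment> \<open>A bump supported in the ball of radius \<open>e\<close>, written with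
    \<open>x \<bullet> x\<close> in place of the norm to be smooth at the origin as well.\<close>
  define \<rho> where "\<rho> x = flatexp 0 (e\<^sup>2 - x \<bullet> x)" for x :: 'a
  have \<rho>s: "smooth \<rho>" unfolding \<rho>_def by (intro smooth_flat smooth_diff smooth_const smooth_inner_self)
  have \<rho>0: "\<rho> x = 0" if "x \<notin> cball 0 e" for x
  proof -
    have "e\<^sup>2 \<le> (norm x)\<^sup>2" using that e by (intro power_mono) auto
    then show ?thesis by (simp add: \<rho>_def flat_zero flip: power2_norm_eq_inner)
  qed
  have \<rho>n: "\<rho> x \<ge> 0" for x by (simp add: \<rho>_def flat_nonneg)
  have \<rho>c: "continuous_on UNIV \<rho>" by (rule smooth_continuous[OF \<rho>s])
  have \<rho>m[measurable]: "\<rho> \<in> borel_measurable borel" by (rule borel_measurable_continuous_onI[OF \<rho>c])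
  have \<rho>i: "integrable lborel \<rho>"
  proof -
    have "integrable lborel (\<lambda>x. indicator (cball 0 e) x *\<^sub>R \<rho> x)"
      by (rule borel_integrable_compact) (auto intro: continuous_on_subset[OF \<rho>c])
    also have "(\<lambda>x. indicator (cball 0 e) x *\<^sub>R \<rho> x) = \<rho>"
    proof
      show "indicator (cball 0 e) x *\<^sub>R \<rho> x = \<rho> x" for x using \<rho>0[of x] by (cases "x \<in> cball 0 e") auto
    qed
    finally show ?thesis .
  qed
  define c where "c = integral\<^sup>L lborel \<rho>"
  have c: "c > 0"
  proof -
    have "c \<noteq> 0"
    proof
      assume "c = 0"
      then have "AE x in lborel. \<rho> x = 0"
        using integral_nonneg_eq_0_iff_AE[OF \<rho>i] \<rho>n by (simp add: c_def)
      moreover have "ball 0 e \<subseteq> {x. \<rho> x \<noteq> 0}"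
      proof
        fix x :: 'a assume "x \<in> ball 0 e"
        then have "(norm x)\<^sup>2 < e\<^sup>2" by (intro power_strict_mono) auto
        then show "x \<in> {x. \<rho> x \<noteq> 0}" using flat_pos[of "e\<^sup>2 - x \<bullet> x" 0] by (simp add: \<rho>_def flip: power2_norm_eq_inner)
      qed
      ultimately have "AE x in lborel. x \<notin> ball (0::'a) e" by (elim eventually_mono) blast
      then have "emeasure lborel (ball (0::'a) e) = 0" by (subst (asm) AE_iff_measurable[OF _ refl]) (auto simp: ball_def)
      then show False using content_ball_pos[OF e(1), of "0::'a"] by (simp add: measure_def)
    qed
    moreover have "c \<ge> 0" unfolding c_def using \<rho>n by simp
    ultimately show ?thesis by simp
  qed
  \<comment> \<open>Normalisation to a probability measure makes \<psi> an average of translates of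
    \<phi>.\<close>
  define P where "P = density lborel (\<lambda>x. ennreal (\<rho> x / c))"
  have P: "prob_space P"
  proof (rule prob_spaceI)
    have "emeasure P (space P) = (\<integral>\<^sup>+x. ennreal (\<rho> x / c) \<partial>lborel)"
      unfolding P_def by (subst emeasure_density) auto
    also have "\<dots> = ennreal (\<integral>x. \<rho> x / c \<partial>lborel)" using \<rho>i \<rho>n c by (intro nn_integral_eq_integral) auto
    also have "\<dots> = 1" using c by (simp add: c_def[symmetric])
    finally show "emeasure P (space P) = 1" .
  qed
  interpret P: prob_space P by fact
  have sP: "sets P = sets borel" by (simp add: P_def)
  have mP: "borel_measurable P = (borel_measurable borel :: ('a \<Rightarrow> real) set)" by (rule measurable_cong_sets) (auto simp: sP)
  have AEP: "AE y in P. norm y \<le> e"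
    unfolding P_def by (subst AE_density) (use \<rho>0 in \<open>force intro!: AE_I2\<close>)+
  have \<phi>m[measurable]: "\<phi> \<in> borel_measurable borel" by (rule borel_measurable_continuous_onI[OF C11_continuous[OF C]])
  have \<phi>'m[measurable]: "(\<lambda>x. \<phi>' x h) \<in> borel_measurable borel" for h by (rule borel_measurable_continuous_onI[OF C11_deriv_continuous[OF C]])
  obtain Q where Q: "\<And>x. \<bar>\<phi> x\<bar> \<le> Q" using C11_bounded[OF C] by blast
  define \<psi> where "\<psi> x = (\<integral>y. \<phi> (x - y) \<partial>P)" for x
  define \<psi>' where "\<psi>' x h = (\<integral>y. \<phi>' (x - y) h \<partial>P)" for x h
  have d: "(\<psi> has_derivative \<psi>' x) (at x)" for x
    unfolding \<psi>_def \<psi>'_def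
  proof (rule has_derivative_integral_param[OF P.finite_measure_axioms, where f="\<lambda>x y. \<phi> (x - y)"
      and f'="\<lambda>x y. \<phi>' (x - y)" and C=Q and B=a])
    show "((\<lambda>x. \<phi> (x - y)) has_derivative \<phi>' (x - y)) (at x)" for x y
      by (rule has_derivative_compose[where f="\<lambda>x. x - y" and g=\<phi> and f'="\<lambda>h. h", OF _ C11D(1)[OF C]])
         (auto intro!: derivative_eq_intros)
  qed (use C11D[OF C] Q in \<open>auto simp: mP\<close>)
  have a0: "0 \<le> a"
  proof -
    obtain k :: 'a where "k \<in> Basis" using nonempty_Basis by blast
    then have "norm k = 1" by simp
    then show ?thesis using C11D(2)[OF C, of 0 k] by simp
  qed
  have i: "integrable P (\<lambda>y. \<phi> (x - y))" for x by (rule P.integrable_const_bound[where B=Q]) (use Q in \<open>auto simp: mP\<close>)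
  have i': "integrable P (\<lambda>y. \<phi>' (x - y) h)" for x h
    by (rule P.integrable_const_bound[where B="a * norm h"]) (use C11D[OF C] in \<open>auto simp: mP\<close>)
  have b0: "0 \<le> b * norm (x - y) * norm h" for x y h :: 'a using C11D(3)[OF C, of x h y] by linarith
  show thesis
  proof (rule that[of \<psi> \<psi>'])
    \<comment> \<open>The same function is written in a second way. As an average over shifts the
      derivative falls on \<phi>, which gave the derivative formula and gives the error bounds; as a
      convolution it falls on \<rho>, which gives smoothness. The measure is finite because \<phi>
      vanishes outside the ball.\<close>
    let ?M = "density lborel (indicator (cball (0::'a) r))"
    have eq: "\<psi> x = (\<integral>y. (\<rho> (x - y)) * (\<phi> y / c) \<partial>?M)" for x
    proof -
      have "\<psi> x = (\<integral>y. (\<rho> y / c) *\<^sub>R \<phi> (x - y) \<partial>lborel)"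
        unfolding \<psi>_def P_def by (rule integral_density) (use \<rho>n c in auto)
      also have "\<dots> = (\<integral>y. (\<rho> (x - y) / c) *\<^sub>R \<phi> y \<partial>lborel)"
      proof -
        have "lborel = distr lborel borel (\<lambda>y. x + (-1) *\<^sub>R y)"
          using lborel_affine[where c="-1" and t=x] by (simp add: density_1)
        then have "(\<integral>y. (\<rho> (x - y) / c) *\<^sub>R \<phi> y \<partial>lborel) = (\<integral>y. (\<rho> (x - y) / c) *\<^sub>R \<phi> y \<partial>distr lborel borel (\<lambda>y. x + (-1) *\<^sub>R y))"
          by simp
        also have "\<dots> = (\<integral>y. (\<rho> y / c) *\<^sub>R \<phi> (x - y) \<partial>lborel)"
          by (subst integral_distr) auto
        finally show ?thesis by (rule sym)
      qed
      also have "\<dots> = (\<integral>y. indicator (cball 0 r) y *\<^sub>R (\<rho> (x - y) * (\<phi> y / c)) \<partial>lborel)"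
        using C11D(4)[OF C] by (intro Bochner_Integration.integral_cong) (auto simp: indicator_def)
      also have "\<dots> = (\<integral>y. (\<rho> (x - y)) * (\<phi> y / c) \<partial>?M)"
        by (subst integral_density[symmetric]) (auto simp: ennreal_indicator intro!: borel_measurable_indicator)
      finally show ?thesis .
    qed
    have "smooth (\<lambda>x. \<integral>y. (\<rho> (x - y)) * (\<phi> y / c) \<partial>?M)"
    proof (rule smooth_convolution[OF \<rho>s \<rho>0, where Q="Q / c"])
      show "finite_measure ?M"
      proof
        have "emeasure ?M (space ?M) = emeasure lborel (cball (0::'a) r)"
          using borel_closed[OF closed_cball[of "0::'a" r]] by (simp add: emeasure_density borel_measurable_indicator)
        also have "\<dots> < \<infinity>" by (rule emeasure_bounded_finite) simp
        finally show "emeasure ?M (space ?M) \<noteq> \<infinity>" by simp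
      qed
      show "\<bar>\<phi> y / c\<bar> \<le> Q / c" for y using Q c by (simp add: divide_right_mono)
    qed auto
    then show "smooth \<psi>" by (simp only: eq[abs_def])
    show "\<psi> x = 0" if "norm x > r + 1" for x
    proof -
      have "AE y in P. \<phi> (x - y) = 0" using AEP
      proof eventually_elim
        case (elim y)
        then have "norm (x - y) > r" using that e norm_triangle_ineq2[of x y] by linarith
        then show ?case by (rule C11D(4)[OF C])
      qed
      then show ?thesis unfolding \<psi>_def by (subst integral_eq_zero_AE) auto
    qed
    show "\<bar>\<psi> x - \<phi> x\<bar> \<le> a * e" for x
    proof -
      have "\<psi> x - \<phi> x = (\<integral>y. \<phi> (x - y) - \<phi> x \<partial>P)" unfolding \<psi>_def using i by (simp add: P.prob_space)
      also have "\<bar>\<dots>\<bar> \<le> (\<integral>y. \<bar>\<phi> (x - y) - \<phi> x\<bar> \<partial>P)" by (rule integral_abs_bound)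
      also have "\<dots> \<le> (\<integral>y. a * e \<partial>P)"
      proof (rule integral_mono_AE)
        show "AE y in P. \<bar>\<phi> (x - y) - \<phi> x\<bar> \<le> a * e" using AEP
        proof eventually_elim
          case (elim y)
          then show ?case using C11_lipschitz[OF C, of "x - y" x] mult_left_mono[OF elim a0] by simp
        qed
      qed (use i in auto)
      finally show ?thesis by (simp add: P.prob_space)
    qed
    show "\<bar>\<psi>' x h - \<phi>' x h\<bar> \<le> b * e * norm h" for x h
    proof -
      have "\<psi>' x h - \<phi>' x h = (\<integral>y. \<phi>' (x - y) h - \<phi>' x h \<partial>P)" unfolding \<psi>'_def using i' by (simp add: P.prob_space)
      also have "\<bar>\<dots>\<bar> \<le> (\<integral>y. \<bar>\<phi>' (x - y) h - \<phi>' x h\<bar> \<partial>P)" by (rule integral_abs_bound)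
      also have "\<dots> \<le> (\<integral>y. b * e * norm h \<partial>P)"
      proof (rule integral_mono_AE)
        have bh: "0 \<le> b * norm h"
        proof -
          obtain k :: 'a where "k \<in> Basis" using nonempty_Basis by blast
          then show ?thesis using b0[of k 0 h] by simp
        qed
        show "AE y in P. \<bar>\<phi>' (x - y) h - \<phi>' x h\<bar> \<le> b * e * norm h" using AEP
        proof eventually_elim
          case (elim y)
          then show ?case using C11D(3)[OF C, of "x - y" h x] mult_left_mono[OF elim bh] by (simp add: mult_ac)
        qed
      qed (use i' in auto)
      finally show ?thesis by (simp add: P.prob_space)
    qed
  qed (rule d)
qed

section \<open>Uniqueness for the linear continuity equation\<close>

definition lipb :: "real \<Rightarrow> ('a::euclidean_space \<Rightarrow> real) \<Rightarrow> bool" where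
  "lipb K \<psi> \<longleftrightarrow> 0 \<le> K \<and> (\<forall>x y. \<bar>\<psi> x - \<psi> y\<bar> \<le> K * norm (x - y)) \<and> (\<exists>B. \<forall>x. \<bar>\<psi> x\<bar> \<le> B)"

text \<open>Closeness tested on bounded Lipschitz functions, scaled by their Lipschitz constant.
  This is the form in which continuity in \<open>W1\<close> enters the uniqueness argument.\<close>

definition dual_close :: "'a::euclidean_space measure \<Rightarrow> 'a measure \<Rightarrow> real \<Rightarrow> bool" where
  "dual_close \<mu> \<nu> e \<longleftrightarrow> (\<forall>\<psi> K. lipb K \<psi> \<longrightarrow> \<bar>(\<integral>x. \<psi> x \<partial>\<mu>) - (\<integral>x. \<psi> x \<partial>\<nu>)\<bar> \<le> K * e)"

lemma lipb_continuous: "lipb K \<psi> \<Longrightarrow> continuous_on UNIV \<psi>"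
  by (rule lipschitz_on_continuous_on[of K]) (auto simp: lipb_def dist_norm intro!: lipschitz_onI)

lemma lipb_integrable:
  assumes "lipb K \<psi>" "\<mu> \<in> Pc" shows "integrable \<mu> \<psi>"
proof -
  interpret prob_space \<mu> using assms(2) by (rule PcD)
  obtain B where "\<forall>x. \<bar>\<psi> x\<bar> \<le> B" using assms(1) unfolding lipb_def by blast
  then show ?thesis
    using borel_measurable_continuous_onI[OF lipb_continuous[OF assms(1)]]
    by (intro integrable_const_bound[where B=B]) (auto simp: borel_measurable_Pc[OF assms(2)])
qed

lemma C11_nonneg:
  assumes C: "C11 a b r \<phi> (\<phi>' :: 'a::euclidean_space \<Rightarrow> 'a \<Rightarrow> real)"
  shows "0 \<le> a" "0 \<le> b"
proof -
  obtain k :: 'a where "k \<in> Basis" using nonempty_Basis by blast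
  then have k: "norm k = 1" by simp
  show "0 \<le> a" using C11D(2)[OF C, of 0 k] k by simp
  show "0 \<le> b" using C11D(3)[OF C, of k k 0] k by simp
qed

lemma C11_lipb: "C11 a b r \<phi> \<phi>' \<Longrightarrow> lipb a \<phi>"
  unfolding lipb_def using C11_nonneg(1) C11_lipschitz C11_bounded by blast

lemma C11_deriv_lipb:
  assumes C: "C11 a b r \<phi> \<phi>'" shows "lipb (b * norm h) (\<lambda>x. \<phi>' x h)"
  unfolding lipb_def using C11D(2,3)[OF C, where h=h] C11_nonneg[OF C] by (auto simp: mult_ac)

text \<open>Mean value inequality for \<phi> minus its linear part at \<open>x\<close>, whose
  derivative on the ball around \<open>x\<close> through \<open>y\<close> is at most
  \<open>b * norm (y - x)\<close>.\<close>

lemma C11_taylor: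
  assumes C: "C11 a b r \<phi> \<phi>'"
  shows "\<bar>\<phi> y - \<phi> x - \<phi>' x (y - x)\<bar> \<le> b * (norm (y - x))\<^sup>2"
proof -
  let ?\<chi> = "\<lambda>z. \<phi> z - \<phi>' x z"
  have lin: "bounded_linear (\<phi>' x)" using C11D(1)[OF C] by (rule has_derivative_bounded_linear)
  have "norm (?\<chi> y - ?\<chi> x) \<le> (b * norm (y - x)) * norm (y - x)"
  proof (rule differentiable_bound[where S="cball x (norm (y - x))" and f'="\<lambda>z h. \<phi>' z h - \<phi>' x h"])
    fix z assume z: "z \<in> cball x (norm (y - x))"
    show "(?\<chi> has_derivative (\<lambda>h. \<phi>' z h - \<phi>' x h)) (at z within cball x (norm (y - x)))"
      by (intro has_derivative_diff has_derivative_at_withinI[OF C11D(1)[OF C]] bounded_linear_imp_has_derivative lin)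
    show "onorm (\<lambda>h. \<phi>' z h - \<phi>' x h) \<le> b * norm (y - x)"
    proof (rule onorm_le)
      fix h
      have "norm (\<phi>' z h - \<phi>' x h) \<le> b * norm (z - x) * norm h" using C11D(3)[OF C, of z h x] by simp
      also have "\<dots> \<le> b * norm (y - x) * norm h"
        using z C11_nonneg[OF C] by (intro mult_right_mono mult_left_mono) (auto simp: dist_norm norm_minus_commute)
      finally show "norm (\<phi>' z h - \<phi>' x h) \<le> b * norm (y - x) * norm h" .
    qed
  qed (auto simp: dist_norm norm_minus_commute)
  then show ?thesis using linear_diff[OF bounded_linear.linear[OF lin], of y x] by (simp add: power2_eq_square algebra_simps)
qed

text \<open>The field \<open>w\<close> is frozen: in the application it is the velocity generated by
  the solution itself, after which the equation is linear in \<nu>. The curve is taken on the whole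
  time axis. \<open>int_m\<close> supplies measurability of fluxes in time, where both the field and
  the measure vary.\<close>

locale linear_ce =
  fixes S :: real and \<theta> :: "'a::euclidean_space measure" and \<nu> :: "real \<Rightarrow> 'a measure"
    and w :: "real \<Rightarrow> 'a \<Rightarrow> 'a" and A :: "real \<Rightarrow> 'a \<Rightarrow> 'a \<Rightarrow> 'a" and B \<Lambda> :: real
  assumes S: "0 < S" and \<nu>P: "\<And>s. \<nu> s \<in> Pc" and \<nu>0: "\<nu> 0 = \<theta>"
    and \<nu>_cont: "\<And>s e. e > 0 \<Longrightarrow> \<exists>d>0. \<forall>t. \<bar>t - s\<bar> < d \<longrightarrow> dual_close (\<nu> t) (\<nu> s) e"
    and wm: "(\<lambda>z. w (fst z) (snd z)) \<in> borel_measurable borel"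
    and wB: "\<And>s x. norm (w s x) \<le> B" and wL: "\<And>s x y. norm (w s x - w s y) \<le> \<Lambda> * norm (x - y)"
    and wd: "\<And>s x. (w s has_derivative A s x) (at x)"
    and int_m: "\<And>q K b. lipb K q \<Longrightarrow> b \<in> Basis \<Longrightarrow> (\<lambda>s. \<integral>x. q x * (w s x \<bullet> b) \<partial>\<nu> s) \<in> borel_measurable borel"
    and ce: "\<And>\<phi>. test_function S \<phi> \<Longrightarrow>
       (LINT s|lebesgue_on {0..S}. \<integral>x. frechet_derivative \<phi> (at (s, x)) (1, w s x) \<partial>\<nu> s) = 0"
begin

lemma B_nonneg: "0 \<le> B" using wB norm_ge_zero order_trans by blast

lemma Lam_nonneg: "0 \<le> \<Lambda>"
proof -
  obtain k :: 'a where "k \<in> Basis" using nonempty_Basis by blast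
  then have "norm k = 1" by simp
  then show ?thesis using order_trans[OF norm_ge_zero wL[of 0 k 0]] by simp
qed

lemma A_bound: "norm (A s x h) \<le> \<Lambda> * norm h"
  by (rule lipschitz_has_derivative[OF wd wL])

lemma w_measurable: "w s \<in> borel_measurable borel"
proof -
  have "\<Lambda>-lipschitz_on UNIV (w s)" using wL Lam_nonneg by (intro lipschitz_onI) (auto simp: dist_norm)
  from borel_measurable_continuous_onI[OF lipschitz_on_continuous_on[OF this]] show ?thesis .
qed

lemma w_measurable_time: "(\<lambda>s. w s x) \<in> borel_measurable borel"
proof -
  have "(\<lambda>s. (s, x)) \<in> borel_measurable borel"
    by (intro borel_measurable_continuous_onI continuous_on_Pair continuous_on_id continuous_on_const)
  from measurable_compose[OF this wm] show ?thesis by simp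
qed

lemma w_integrable_on: "(\<lambda>\<sigma>. w \<sigma> x) integrable_on {s..t}"
  by (rule integrable_on_bounded_measurable[OF w_measurable_time wB])

lemma integral_continuous_time:
  assumes "lipb K \<psi>" shows "continuous_on UNIV (\<lambda>s. \<integral>x. \<psi> x \<partial>\<nu> s)"
  unfolding continuous_on_iff
proof (intro ballI allI impI)
  fix s e :: real assume e: "0 < e"
  have K: "0 \<le> K" using assms by (simp add: lipb_def)
  define e' where "e' = e / (2 * (K + 1))"
  have e': "e' > 0" "K * e' < e" using e K by (auto simp: e'_def field_simps add_nonneg_pos intro!: add_nonneg_pos)
  obtain d where d: "d > 0" "\<forall>t. \<bar>t - s\<bar> < d \<longrightarrow> dual_close (\<nu> t) (\<nu> s) e'" using \<nu>_cont[OF e'(1)] by blast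
  have "dist (\<integral>x. \<psi> x \<partial>\<nu> t) (\<integral>x. \<psi> x \<partial>\<nu> s) < e" if "dist t s < d" for t
    using d(2) that assms e'(2) unfolding dual_close_def dist_real_def by (meson order_le_less_trans)
  then show "\<exists>d>0. \<forall>t\<in>UNIV. dist t s < d \<longrightarrow> dist (\<integral>x. \<psi> x \<partial>\<nu> t) (\<integral>x. \<psi> x \<partial>\<nu> s) < e" using d(1) by blast
qed

lemma C11_flux_measurable:
  assumes C: "C11 a b r \<phi> \<phi>'"
  shows "(\<lambda>s. \<integral>x. \<phi>' x (w s x) \<partial>\<nu> s) \<in> borel_measurable borel"
proof -
  have "(\<integral>x. \<phi>' x (w s x) \<partial>\<nu> s) = (\<Sum>k\<in>Basis. \<integral>x. \<phi>' x k * (w s x \<bullet> k) \<partial>\<nu> s)" for s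
  proof -
    interpret prob_space "\<nu> s" using \<nu>P by (rule PcD)
    have "\<phi>' x (w s x) = (\<Sum>k\<in>Basis. \<phi>' x k * (w s x \<bullet> k))" for x
      using linear_euclidean_sum[OF has_derivative_linear[OF C11D(1)[OF C]], of x "w s x"] by (simp add: mult.commute)
    then have "(\<integral>x. \<phi>' x (w s x) \<partial>\<nu> s) = (\<integral>x. (\<Sum>k\<in>Basis. \<phi>' x k * (w s x \<bullet> k)) \<partial>\<nu> s)" by simp
    also have "\<dots> = (\<Sum>k\<in>Basis. \<integral>x. \<phi>' x k * (w s x \<bullet> k) \<partial>\<nu> s)"
    proof (rule Bochner_Integration.integral_sum)
      fix k :: 'a assume k: "k \<in> Basis"
      show "integrable (\<nu> s) (\<lambda>x. \<phi>' x k * (w s x \<bullet> k))"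
      proof (rule integrable_const_bound[where B="a * B"])
        show "AE x in \<nu> s. norm (\<phi>' x k * (w s x \<bullet> k)) \<le> a * B"
        proof (rule AE_I2)
          fix x
          have "\<bar>\<phi>' x k\<bar> * \<bar>w s x \<bullet> k\<bar> \<le> a * B"
            using C11D(2)[OF C, of x k] k order_trans[OF Basis_le_norm[OF k] wB] C11_nonneg[OF C] by (intro mult_mono) auto
          then show "norm (\<phi>' x k * (w s x \<bullet> k)) \<le> a * B" by (simp add: abs_mult)
        qed
        show "(\<lambda>x. \<phi>' x k * (w s x \<bullet> k)) \<in> borel_measurable (\<nu> s)"
          unfolding borel_measurable_Pc[OF \<nu>P]
          using w_measurable borel_measurable_continuous_onI[OF C11_deriv_continuous[OF C]] by measurable
      qed
    qed
    finally show ?thesis .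
  qed
  then show ?thesis using int_m[OF C11_deriv_lipb[OF C]] by simp
qed

lemma C11_flux_lipb:
  assumes C: "C11 a b r \<phi> \<phi>'" shows "lipb (a * \<Lambda> + b * B) (\<lambda>x. \<phi>' x (w s x))" "\<bar>\<phi>' x (w s x)\<bar> \<le> a * B"
proof -
  note nn = C11_nonneg[OF C] B_nonneg Lam_nonneg
  show bd: "\<bar>\<phi>' x (w s x)\<bar> \<le> a * B" for x
    using C11D(2)[OF C, of x "w s x"] mult_left_mono[OF wB nn(1), of s x] by linarith
  have "\<bar>\<phi>' x (w s x) - \<phi>' y (w s y)\<bar> \<le> (a * \<Lambda> + b * B) * norm (x - y)" for x y
  proof -
    have lin: "linear (\<phi>' x)" using C11D(1)[OF C] by (rule has_derivative_linear)
    have "\<phi>' x (w s x) - \<phi>' y (w s y) = \<phi>' x (w s x - w s y) + (\<phi>' x (w s y) - \<phi>' y (w s y))"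
      by (simp add: linear_diff[OF lin])
    moreover have "\<bar>\<phi>' x (w s x - w s y)\<bar> \<le> a * (\<Lambda> * norm (x - y))"
      using C11D(2)[OF C, of x "w s x - w s y"] mult_left_mono[OF wL nn(1), of s x y] by linarith
    moreover have "\<bar>\<phi>' x (w s y) - \<phi>' y (w s y)\<bar> \<le> b * norm (x - y) * B"
      using C11D(3)[OF C, of x "w s y" y] mult_left_mono[OF wB, of "b * norm (x - y)" s y] nn by simp
    ultimately show ?thesis by (simp add: algebra_simps)
  qed
  then show "lipb (a * \<Lambda> + b * B) (\<lambda>x. \<phi>' x (w s x))" unfolding lipb_def using bd nn by auto
qed

lemma C11_flux_bound:
  assumes C: "C11 a b r \<phi> \<phi>'" shows "\<bar>\<integral>x. \<phi>' x (w s x) \<partial>\<nu> t\<bar> \<le> a * B"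
proof -
  interpret prob_space "\<nu> t" using \<nu>P by (rule PcD)
  have "\<bar>\<integral>x. \<phi>' x (w s x) \<partial>\<nu> t\<bar> \<le> (\<integral>x. \<bar>\<phi>' x (w s x)\<bar> \<partial>\<nu> t)" by (rule integral_abs_bound)
  also have "\<dots> \<le> (\<integral>x. a * B \<partial>\<nu> t)"
    using lipb_integrable[OF C11_flux_lipb(1)[OF C] \<nu>P] C11_flux_lipb(2)[OF C]
    by (intro integral_mono integrable_abs) auto
  finally show ?thesis by (simp add: prob_space)
qed

text \<open>The equation is tested with \<open>\<eta> \<sigma> * \<psi> x\<close>, where \<eta> is a
  smoothed indicator of the time interval. Its derivative concentrates at \<open>s\<close> and
  \<open>t\<close> and produces the two boundary terms as \<open>h\<close> tends to 0. The strict
  inequalities keep the support inside the open time interval.\<close>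

lemma balance_smooth_interior:
  assumes \<psi>: "smooth \<psi>" "\<And>x. norm x > r \<Longrightarrow> \<psi> x = 0" and st: "0 < s" "s < t" "t < S"
  defines "I \<equiv> \<lambda>s. \<integral>x. frechet_derivative \<psi> (at x) (w s x) \<partial>\<nu> s"
  shows "(\<integral>x. \<psi> x \<partial>\<nu> t) - (\<integral>x. \<psi> x \<partial>\<nu> s) = integral {s..t} I"
proof -
  obtain a b where C: "C11 a b r \<psi> (\<lambda>x. frechet_derivative \<psi> (at x))" using smooth_C11[OF \<psi>] .
  define m where "m s = (\<integral>x. \<psi> x \<partial>\<nu> s)" for s
  have mc: "continuous_on UNIV m" unfolding m_def by (rule integral_continuous_time[OF C11_lipb[OF C]])
  have Im[measurable]: "I \<in> borel_measurable borel" unfolding I_def by (rule C11_flux_measurable[OF C])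
  have IB: "\<bar>I s\<bar> \<le> a * B" for s unfolding I_def by (rule C11_flux_bound[OF C])
  have Ii: "I integrable_on {u..v}" for u v by (rule integrable_on_bounded_measurable[OF Im]) (use IB in auto)
  have key: "\<bar>m t - m s - integral {s..t} I\<bar> \<le> 2 * e" if e: "e > 0" for e
  proof -
    obtain d1 where d1: "d1 > 0" "\<And>\<sigma>. \<bar>\<sigma> - s\<bar> < d1 \<Longrightarrow> \<bar>m \<sigma> - m s\<bar> < e / 2"
      using mc e unfolding continuous_on_iff dist_real_def by (metis UNIV_I half_gt_zero)
    obtain d2 where d2: "d2 > 0" "\<And>\<sigma>. \<bar>\<sigma> - t\<bar> < d2 \<Longrightarrow> \<bar>m \<sigma> - m t\<bar> < e / 2"
      using mc e unfolding continuous_on_iff dist_real_def by (metis UNIV_I half_gt_zero)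
    \<comment> \<open>The four bounds keep \<open>m\<close> within \<open>e / 2\<close> of its
      values at \<open>s\<close> and at \<open>t\<close> on the two ramps, keep the test function
      away from time \<open>S\<close>, and limit the flux over one ramp to
      \<open>e / 2\<close>.\<close>
    define h where "h = Min {d1 / 2, d2 / 2, (S - t) / 2, e / (2 * (a * B + 1))}"
    have aB: "0 \<le> a * B" using IB[of 0] by linarith
    then have h0: "h > 0" unfolding h_def using d1 d2 st e by (subst Min_gr_iff) auto
    have hle: "h \<le> d1 / 2" "h \<le> d2 / 2" "h \<le> (S - t) / 2" "h \<le> e / (2 * (a * B + 1))"
      unfolding h_def by (rule Min_le; simp)+
    have h: "h > 0" "h < d1" "h < d2" "t + h < S" "h \<le> e / (2 * (a * B + 1))"
      using h0 hle d1(1) d2(1) st by (auto simp: field_simps)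
    have hB: "h * (a * B) \<le> e / 2"
    proof -
      have "h * (a * B) \<le> h * (a * B + 1)" using h by (intro mult_left_mono) auto
      also have "\<dots> \<le> e / (2 * (a * B + 1)) * (a * B + 1)" using h aB by (intro mult_right_mono) auto
      also have "\<dots> = e / 2" using aB by (simp add: field_simps)
      finally show ?thesis .
    qed
    \<comment> \<open>It rises on \<open>{s..s+h}\<close> and falls on \<open>{t..t+h}\<close>; both
      ramps lie to the right of their base point.\<close>
    define \<eta> where "\<eta> \<sigma> = step s h \<sigma> - step t h \<sigma>" for \<sigma>
    have \<eta>s: "smooth \<eta>" unfolding \<eta>_def by (intro smooth_diff smooth_step h)
    have \<eta>d: "(\<eta> has_real_derivative (dstep s h \<sigma> - dstep t h \<sigma>)) (at \<sigma>)" for \<sigma>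
      unfolding \<eta>_def by (intro DERIV_diff step_deriv h)
    have \<eta>0: "\<eta> \<sigma> = 0" if "\<sigma> \<notin> {s..t+h}" for \<sigma>
      using that st h by (cases "\<sigma> < s") (auto simp: \<eta>_def step_left step_right)
    define \<phi> where "\<phi> z = \<eta> (fst z) * \<psi> (snd z)" for z
    have tf: "test_function S \<phi>"
      unfolding test_function_def
    proof (intro conjI)
      show "\<forall>k. Ck k \<phi>" using smooth_tensor[OF \<eta>s \<psi>(1)] unfolding smooth_def \<phi>_def .
      have "{z. \<phi> z \<noteq> 0} \<subseteq> {s..t+h} \<times> cball 0 r"
      proof
        fix z assume "z \<in> {z. \<phi> z \<noteq> 0}"
        then have "\<eta> (fst z) \<noteq> 0" "\<psi> (snd z) \<noteq> 0" by (auto simp: \<phi>_def)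
        then have "fst z \<in> {s..t+h}" "\<not> norm (snd z) > r" using \<eta>0 \<psi>(2) by blast+
        then show "z \<in> {s..t+h} \<times> cball 0 r" by (cases z) auto
      qed
      moreover have cp: "compact ({s..t+h} \<times> cball (0::'a) r)" by (intro compact_Times) auto
      ultimately have cl: "closure {z. \<phi> z \<noteq> 0} \<subseteq> {s..t+h} \<times> cball 0 r"
        by (intro closure_minimal compact_imp_closed)
      show "compact (closure {z. \<phi> z \<noteq> 0})" using compact_Int_closed[OF cp closed_closure, of "{z. \<phi> z \<noteq> 0}"] cl by (simp add: Int_absorb1)
      show "closure {z. \<phi> z \<noteq> 0} \<subseteq> {0<..<S} \<times> UNIV" using cl st h by auto
    qed
    have d\<phi>: "frechet_derivative \<phi> (at (\<sigma>, x)) (1, v) = (dstep s h \<sigma> - dstep t h \<sigma>) * \<psi> x + \<eta> \<sigma> * frechet_derivative \<psi> (at x) v" for \<sigma> x v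
    proof -
      have 1: "((\<lambda>z. \<eta> (fst z)) has_derivative (\<lambda>k. (dstep s h \<sigma> - dstep t h \<sigma>) * fst k)) (at (\<sigma>, x))"
        using has_derivative_compose[OF bounded_linear_imp_has_derivative[OF bounded_linear_fst], of \<eta> "(*) (dstep s h \<sigma> - dstep t h \<sigma>)" "(\<sigma>, x)" UNIV] \<eta>d[unfolded has_field_derivative_def, of \<sigma>]
        by simp
      have 2: "((\<lambda>z. \<psi> (snd z)) has_derivative (\<lambda>k. frechet_derivative \<psi> (at x) (snd k))) (at (\<sigma>, x))"
        using has_derivative_compose[OF bounded_linear_imp_has_derivative[OF bounded_linear_snd], of \<psi> "frechet_derivative \<psi> (at x)" "(\<sigma>, x)" UNIV] smooth_has_derivative[OF \<psi>(1), of x]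
        by simp
      have "(\<phi> has_derivative (\<lambda>k. \<eta> \<sigma> * frechet_derivative \<psi> (at x) (snd k) + (dstep s h \<sigma> - dstep t h \<sigma>) * fst k * \<psi> x)) (at (\<sigma>, x))"
        unfolding \<phi>_def using has_derivative_mult[OF 1 2] by simp
      from frechet_derivative_at[OF this] have "frechet_derivative \<phi> (at (\<sigma>, x)) = (\<lambda>k. \<eta> \<sigma> * frechet_derivative \<psi> (at x) (snd k) + (dstep s h \<sigma> - dstep t h \<sigma>) * fst k * \<psi> x)" by simp
      then show ?thesis by simp
    qed
    let ?F = "\<lambda>\<sigma>. dstep s h \<sigma> * m \<sigma> - dstep t h \<sigma> * m \<sigma> + (step s h \<sigma> * I \<sigma> - step t h \<sigma> * I \<sigma>)"
    have eqF: "(\<integral>x. frechet_derivative \<phi> (at (\<sigma>, x)) (1, w \<sigma> x) \<partial>\<nu> \<sigma>) = ?F \<sigma>" for \<sigma>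
      unfolding d\<phi> using lipb_integrable[OF C11_lipb[OF C] \<nu>P, of \<sigma>] lipb_integrable[OF C11_flux_lipb(1)[OF C] \<nu>P, of \<sigma> \<sigma>]
      by (simp add: m_def I_def \<eta>_def algebra_simps)
    have sm: "continuous_on UNIV (step u h)" for u by (rule smooth_continuous[OF smooth_step[OF h(1)]])
    have [measurable]: "step u h \<in> borel_measurable borel" for u by (rule borel_measurable_continuous_onI[OF sm])
    have si: "(\<lambda>\<sigma>. step u h \<sigma> * I \<sigma>) integrable_on {p..q}" for u p q
    proof (rule integrable_on_bounded_measurable)
      show "norm (step u h \<sigma> * I \<sigma>) \<le> 1 * (a * B)" for \<sigma>
        unfolding norm_mult using step_bounds[OF h(1), of u \<sigma>] IB[of \<sigma>] by (intro mult_mono) auto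
    qed measurable
    have dc: "continuous_on X (\<lambda>\<sigma>. dstep u h \<sigma> * m \<sigma>)" for u X
      by (intro continuous_intros continuous_on_subset[OF continuous_on_dstep[OF h(1)]] continuous_on_subset[OF mc]) auto
    have di: "(\<lambda>\<sigma>. dstep u h \<sigma> * m \<sigma>) integrable_on {p..q}" for u p q
      by (rule integrable_continuous_interval[OF dc])
    have "integral {0..S} ?F = 0"
    proof -
      have Fm: "?F \<in> borel_measurable borel"
        using borel_measurable_continuous_onI[OF dc] by measurable
      have "bounded ((\<lambda>\<sigma>. dstep s h \<sigma> * m \<sigma> - dstep t h \<sigma> * m \<sigma>) ` {0..S})"
        by (intro compact_imp_bounded compact_continuous_image continuous_on_diff dc) auto
      then obtain Q where Q: "\<And>\<sigma>. \<sigma> \<in> {0..S} \<Longrightarrow> \<bar>dstep s h \<sigma> * m \<sigma> - dstep t h \<sigma> * m \<sigma>\<bar> \<le> Q"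
        unfolding bounded_iff real_norm_def by blast
      have F: "integrable (lebesgue_on {0..S}) ?F"
      proof (rule integrable_lebesgue_on_bounded[OF Fm])
        fix \<sigma> assume \<sigma>: "\<sigma> \<in> {0..S}"
        have "\<bar>step u h \<sigma> * I \<sigma>\<bar> \<le> 1 * (a * B)" for u
          unfolding abs_mult using step_bounds[OF h(1), of u \<sigma>] IB[of \<sigma>] by (intro mult_mono) auto
        from this[of s] this[of t] show "norm (?F \<sigma>) \<le> Q + 2 * (a * B)" using Q[OF \<sigma>] by simp
      qed
      have "integral {0..S} ?F = integral\<^sup>L (lebesgue_on {0..S}) ?F"
        by (rule lebesgue_integral_eq_integral[OF F, symmetric]) auto
      also have "\<dots> = 0" using ce[OF tf] unfolding eqF .
      finally show ?thesis .
    qed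
    then have 0: "integral {0..S} (\<lambda>\<sigma>. dstep s h \<sigma> * m \<sigma>) - integral {0..S} (\<lambda>\<sigma>. dstep t h \<sigma> * m \<sigma>)
       + (integral {0..S} (\<lambda>\<sigma>. step s h \<sigma> * I \<sigma>) - integral {0..S} (\<lambda>\<sigma>. step t h \<sigma> * I \<sigma>)) = 0"
      by (simp add: integral_add integral_diff integrable_add integrable_diff di si)
    have c1: "\<bar>integral {0..S} (\<lambda>\<sigma>. dstep s h \<sigma> * m \<sigma>) - m s\<bar> \<le> e / 2"
    proof (rule dstep_concentrates[OF h(1)])
      show "\<bar>m \<sigma> - m s\<bar> \<le> e / 2" if "\<sigma> \<in> {s..s + h}" for \<sigma>
        by (rule less_imp_le[OF d1(2)]) (use that h in auto)
    qed (use st h in \<open>auto intro: continuous_on_subset[OF mc]\<close>)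
    have c2: "\<bar>integral {0..S} (\<lambda>\<sigma>. dstep t h \<sigma> * m \<sigma>) - m t\<bar> \<le> e / 2"
    proof (rule dstep_concentrates[OF h(1)])
      show "\<bar>m \<sigma> - m t\<bar> \<le> e / 2" if "\<sigma> \<in> {t..t + h}" for \<sigma>
        by (rule less_imp_le[OF d2(2)]) (use that h in auto)
    qed (use st h in \<open>auto intro: continuous_on_subset[OF mc]\<close>)
    \<comment> \<open>The smooth step differs from a jump at \<open>u\<close> only on the ramp,
      where the flux integral is at most \<open>h * (a * B)\<close>.\<close>
    have c3: "\<bar>integral {0..S} (\<lambda>\<sigma>. step u h \<sigma> * I \<sigma>) - integral {u..S} I\<bar> \<le> e / 2" if u: "u \<in> {s, t}" for u
    proof -
      have u': "0 \<le> u" "u \<le> S" "u + h \<le> S" "u \<le> u + h" using u st h by auto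
      have "integral {0..S} (\<lambda>\<sigma>. step u h \<sigma> * I \<sigma>) = integral {0..u} (\<lambda>\<sigma>. step u h \<sigma> * I \<sigma>) + integral {u..S} (\<lambda>\<sigma>. step u h \<sigma> * I \<sigma>)"
        using Henstock_Kurzweil_Integration.integral_combine[OF u'(1,2) si, of u] by simp
      also have "integral {0..u} (\<lambda>\<sigma>. step u h \<sigma> * I \<sigma>) = integral {0..u} (\<lambda>\<sigma>. 0)"
        by (rule Henstock_Kurzweil_Integration.integral_cong) (auto simp: step_left)
      finally have "integral {0..S} (\<lambda>\<sigma>. step u h \<sigma> * I \<sigma>) - integral {u..S} I = integral {u..S} (\<lambda>\<sigma>. step u h \<sigma> * I \<sigma> - I \<sigma>)"
        by (simp add: integral_diff si Ii)
      also have "\<dots> = integral {u..u+h} (\<lambda>\<sigma>. step u h \<sigma> * I \<sigma> - I \<sigma>) + integral {u+h..S} (\<lambda>\<sigma>. step u h \<sigma> * I \<sigma> - I \<sigma>)"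
        using Henstock_Kurzweil_Integration.integral_combine[OF u'(4,3) integrable_diff[OF si Ii], of u] by simp
      also have "integral {u+h..S} (\<lambda>\<sigma>. step u h \<sigma> * I \<sigma> - I \<sigma>) = integral {u+h..S} (\<lambda>\<sigma>. 0)"
        by (rule Henstock_Kurzweil_Integration.integral_cong) (use h in \<open>auto simp: step_right\<close>)
      finally have eq: "integral {0..S} (\<lambda>\<sigma>. step u h \<sigma> * I \<sigma>) - integral {u..S} I = integral {u..u+h} (\<lambda>\<sigma>. step u h \<sigma> * I \<sigma> - I \<sigma>)" by simp
      have "norm (integral {u..u+h} (\<lambda>\<sigma>. step u h \<sigma> * I \<sigma> - I \<sigma>)) \<le> (a * B) * (u + h - u)"
      proof (rule norm_integral_ivl_le[OF integrable_diff[OF si Ii]])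
        fix \<sigma>
        have "norm (step u h \<sigma> * I \<sigma> - I \<sigma>) = \<bar>step u h \<sigma> - 1\<bar> * \<bar>I \<sigma>\<bar>" by (simp add: left_diff_distrib flip: abs_mult)
        also have "\<dots> \<le> 1 * (a * B)" using step_bounds[OF h(1), of u \<sigma>] IB[of \<sigma>] by (intro mult_mono) auto
        finally show "norm (step u h \<sigma> * I \<sigma> - I \<sigma>) \<le> a * B" by simp
      qed (use u' in simp)
      then show ?thesis unfolding eq using hB by (simp add: mult.commute)
    qed
    have "integral {s..S} I - integral {t..S} I = integral {s..t} I"
      using Henstock_Kurzweil_Integration.integral_combine[of s t S I] st Ii by simp
    then show ?thesis using 0 c1 c2 c3[of s] c3[of t] by simp argo
  qed
  have "\<bar>m t - m s - integral {s..t} I\<bar> \<le> 0"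
    by (rule field_le_epsilon) (use key[of "_ / 2"] in fastforce)
  then show ?thesis by (simp add: m_def)
qed

text \<open>The difference of the two sides is constant on the open interval and continuous up to
  its ends. This is where continuity of the curve gives a meaning to the initial value.\<close>

lemma balance_smooth:
  assumes \<psi>: "smooth \<psi>" "\<And>x. norm x > r \<Longrightarrow> \<psi> x = 0" and st: "0 \<le> s" "s \<le> t" "t \<le> S"
  defines "I \<equiv> \<lambda>s. \<integral>x. frechet_derivative \<psi> (at x) (w s x) \<partial>\<nu> s"
  shows "(\<integral>x. \<psi> x \<partial>\<nu> t) - (\<integral>x. \<psi> x \<partial>\<nu> s) = integral {s..t} I"
proof -
  obtain a b where C: "C11 a b r \<psi> (\<lambda>x. frechet_derivative \<psi> (at x))" using smooth_C11[OF \<psi>] .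
  have Im: "I \<in> borel_measurable borel" unfolding I_def by (rule C11_flux_measurable[OF C])
  have Ii: "I integrable_on {u..v}" for u v
    by (rule integrable_on_bounded_measurable[OF Im, of _ _ "a * B"]) (use C11_flux_bound[OF C] in \<open>auto simp: I_def\<close>)
  let ?G = "\<lambda>u. (\<integral>x. \<psi> x \<partial>\<nu> u) - integral {0..u} I"
  have split: "integral {0..v} I - integral {0..u} I = integral {u..v} I" if "0 \<le> u" "u \<le> v" "v \<le> S" for u v
    by (rule has_integral_split_ivl[OF Ii that])
  have int: "?G u = ?G v" if "0 < u" "u < v" "v < S" for u v
    using balance_smooth_interior[of \<psi> r u v, OF \<psi> that] split[of u v] that unfolding I_def by simp
  have cst: "?G u = ?G (S / 2)" if "u \<in> {0<..<S}" for u
    using int[of u "S / 2"] int[of "S / 2" u] that S by (cases "u < S / 2"; cases "u > S / 2") auto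
  have cc: "continuous_on (closure {0<..<S}) ?G"
    using S by (intro continuous_on_diff continuous_on_subset[OF integral_continuous_time[OF C11_lipb[OF C]]])
               (auto intro: indefinite_integral_continuous_1 Ii)
  have "?G u = ?G (S / 2)" if u: "u \<in> {0..S}" for u
    by (rule continuous_constant_on_closure[OF cc cst]) (use u S in auto)
  from this[of s] this[of t] show ?thesis using split[of s t] st by simp
qed

text \<open>Mollification at scale \<open>e\<close> changes the two integrals of \<phi> by
  \<open>a * e\<close> each and the flux term by at most \<open>b * e * B * (t - s)\<close>.\<close>

lemma balance_C11:
  assumes C: "C11 a b r \<phi> \<phi>'" and st: "0 \<le> s" "s \<le> t" "t \<le> S"
  shows "(\<integral>x. \<phi> x \<partial>\<nu> t) - (\<integral>x. \<phi> x \<partial>\<nu> s) = integral {s..t} (\<lambda>\<sigma>. \<integral>x. \<phi>' x (w \<sigma> x) \<partial>\<nu> \<sigma>)"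
proof -
  note nn = C11_nonneg[OF C] B_nonneg
  let ?I = "\<lambda>\<sigma>. \<integral>x. \<phi>' x (w \<sigma> x) \<partial>\<nu> \<sigma>"
  have Ii: "?I integrable_on {s..t}"
    by (rule integrable_on_bounded_measurable[OF C11_flux_measurable[OF C], of _ _ "a * B"]) (use C11_flux_bound[OF C] in auto)
  have key: "\<bar>(\<integral>x. \<phi> x \<partial>\<nu> t) - (\<integral>x. \<phi> x \<partial>\<nu> s) - integral {s..t} ?I\<bar> \<le> (2 * a + b * B * (t - s)) * e" if e: "0 < e" "e \<le> 1" for e
  proof -
    obtain \<psi> \<psi>' where \<psi>: "smooth \<psi>" "\<And>x. (\<psi> has_derivative \<psi>' x) (at x)" "\<And>x. norm x > r + 1 \<Longrightarrow> \<psi> x = 0"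
      "\<And>x. \<bar>\<psi> x - \<phi> x\<bar> \<le> a * e" "\<And>x h. \<bar>\<psi>' x h - \<phi>' x h\<bar> \<le> b * e * norm h"
      using mollification[OF C e] by metis
    have fd: "frechet_derivative \<psi> (at x) = \<psi>' x" for x using frechet_derivative_at[OF \<psi>(2)] by simp
    obtain a2 b2 where C2: "C11 a2 b2 (r + 1) \<psi> (\<lambda>x. frechet_derivative \<psi> (at x))" using smooth_C11[OF \<psi>(1,3)] .
    let ?J = "\<lambda>\<sigma>. \<integral>x. \<psi>' x (w \<sigma> x) \<partial>\<nu> \<sigma>"
    have bal: "(\<integral>x. \<psi> x \<partial>\<nu> t) - (\<integral>x. \<psi> x \<partial>\<nu> s) = integral {s..t} ?J"
      using balance_smooth[OF \<psi>(1,3) st] by (simp add: fd)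
    have Ji: "?J integrable_on {s..t}"
      by (rule integrable_on_bounded_measurable[OF C11_flux_measurable[OF C2, unfolded fd], of _ _ "a2 * B"])
         (use C11_flux_bound[OF C2] in \<open>auto simp: fd\<close>)
    have 1: "\<bar>(\<integral>x. \<psi> x \<partial>\<nu> u) - (\<integral>x. \<phi> x \<partial>\<nu> u)\<bar> \<le> a * e" for u
    proof -
      interpret prob_space "\<nu> u" using \<nu>P by (rule PcD)
      note i = lipb_integrable[OF C11_lipb[OF C2] \<nu>P, of u] lipb_integrable[OF C11_lipb[OF C] \<nu>P, of u]
      have "\<bar>(\<integral>x. \<psi> x \<partial>\<nu> u) - (\<integral>x. \<phi> x \<partial>\<nu> u)\<bar> = \<bar>\<integral>x. \<psi> x - \<phi> x \<partial>\<nu> u\<bar>" using i by simp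
      also have "\<dots> \<le> (\<integral>x. \<bar>\<psi> x - \<phi> x\<bar> \<partial>\<nu> u)" by (rule integral_abs_bound)
      also have "\<dots> \<le> (\<integral>x. a * e \<partial>\<nu> u)" using i \<psi>(4) by (intro integral_mono integrable_abs) auto
      finally show ?thesis by (simp add: prob_space)
    qed
    have 2: "\<bar>?J u - ?I u\<bar> \<le> b * e * B" for u
    proof -
      interpret prob_space "\<nu> u" using \<nu>P by (rule PcD)
      note i = lipb_integrable[OF C11_flux_lipb(1)[OF C2, unfolded fd] \<nu>P, of u u] lipb_integrable[OF C11_flux_lipb(1)[OF C] \<nu>P, of u u]
      have "\<bar>?J u - ?I u\<bar> = \<bar>\<integral>x. \<psi>' x (w u x) - \<phi>' x (w u x) \<partial>\<nu> u\<bar>" using i by simp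
      also have "\<dots> \<le> (\<integral>x. \<bar>\<psi>' x (w u x) - \<phi>' x (w u x)\<bar> \<partial>\<nu> u)" by (rule integral_abs_bound)
      also have "\<dots> \<le> (\<integral>x. b * e * B \<partial>\<nu> u)"
      proof (rule integral_mono)
        show "\<bar>\<psi>' x (w u x) - \<phi>' x (w u x)\<bar> \<le> b * e * B" for x
          using \<psi>(5)[of x "w u x"] mult_left_mono[OF wB, of "b * e" u x] nn e by simp
      qed (use i in auto)
      finally show ?thesis by (simp add: prob_space)
    qed
    have "\<bar>integral {s..t} ?J - integral {s..t} ?I\<bar> \<le> (b * e * B) * (t - s)"
      using norm_integral_ivl_le[OF integrable_diff[OF Ji Ii], of "b * e * B"] 2 st by (simp add: integral_diff Ji Ii)
    then show ?thesis using 1[of s] 1[of t] bal by (simp add: algebra_simps)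
  qed
  let ?c = "2 * a + b * B * (t - s)"
  have c: "?c \<ge> 0" using nn st by simp
  have "\<bar>(\<integral>x. \<phi> x \<partial>\<nu> t) - (\<integral>x. \<phi> x \<partial>\<nu> s) - integral {s..t} ?I\<bar> \<le> 0"
  proof (rule field_le_epsilon)
    fix e :: real assume e: "0 < e"
    have "\<bar>(\<integral>x. \<phi> x \<partial>\<nu> t) - (\<integral>x. \<phi> x \<partial>\<nu> s) - integral {s..t} ?I\<bar> \<le> ?c * min 1 (e / (?c + 1))"
      by (rule key) (use e c in auto)
    also have "\<dots> \<le> ?c * (e / (?c + 1))" using c by (intro mult_left_mono) auto
    also have "\<dots> \<le> 0 + e" using c e by (simp add: field_simps)
    finally show "\<bar>(\<integral>x. \<phi> x \<partial>\<nu> t) - (\<integral>x. \<phi> x \<partial>\<nu> s) - integral {s..t} ?I\<bar> \<le> 0 + e" .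
  qed
  then show ?thesis by simp
qed

end

section \<open>Smooth functions determine a measure\<close>

lemma smooth_step_comp: "h > 0 \<Longrightarrow> smooth f \<Longrightarrow> smooth (\<lambda>x. step s h (f x))"
  unfolding step_def
  by (intro smooth_mult smooth_inverse smooth_add smooth_flat smooth_diff smooth_const)
     (auto simp: less_imp_neq[OF step_denominator_pos, symmetric])

lemma smooth_prod:
  fixes f :: "'i \<Rightarrow> 'a::euclidean_space \<Rightarrow> real"
  assumes "finite I" "\<And>i. i \<in> I \<Longrightarrow> smooth (f i)" shows "smooth (\<lambda>x. \<Prod>i\<in>I. f i x)"
  using assms by (induction I) (simp_all add: smooth_const smooth_mult)

lemma step_tendsto: "(\<lambda>n. step s (inverse (real (Suc n))) \<sigma>) \<longlonglongrightarrow> (if s < \<sigma> then 1 else 0)"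
proof (cases "s < \<sigma>")
  case True
  have "\<forall>\<^sub>F n in sequentially. inverse (real (Suc n)) < \<sigma> - s"
    using LIMSEQ_inverse_real_of_nat True by (intro order_tendstoD(2)) auto
  then have "\<forall>\<^sub>F n in sequentially. step s (inverse (real (Suc n))) \<sigma> = 1"
    by eventually_elim (auto intro!: step_right)
  then show ?thesis using True by (simp add: tendsto_eventually)
qed (simp add: step_left)

text \<open>Products of one-dimensional steps approximate the indicators of open boxes.\<close>

lemma measure_eq_smooth:
  fixes \<mu> \<nu> :: "'a::euclidean_space measure"
  assumes \<mu>: "\<mu> \<in> Pc" and \<nu>: "\<nu> \<in> Pc"
    and eq: "\<And>\<psi> r. smooth \<psi> \<Longrightarrow> (\<And>x. norm x > r \<Longrightarrow> \<psi> x = 0) \<Longrightarrow> (\<integral>x. \<psi> x \<partial>\<mu>) = (\<integral>x. \<psi> x \<partial>\<nu>)"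
  shows "\<mu> = \<nu>"
proof -
  have box: "emeasure \<mu> (box c d) = emeasure \<nu> (box c d)" for c d :: 'a
  proof -
    \<comment> \<open>One factor cuts off below \<open>c \<bullet> b\<close>; the other is a step in
      the negated coordinate and cuts off above \<open>d \<bullet> b\<close>. Both vanish at the
      faces themselves, so the limit is the indicator of the open box.\<close>
    define \<psi> where "\<psi> n x = (\<Prod>b\<in>Basis. step (c \<bullet> b) (inverse (real (Suc n))) (x \<bullet> b) * step (- (d \<bullet> b)) (inverse (real (Suc n))) (x \<bullet> - b))" for n and x :: 'a
    have sm: "smooth (\<psi> n)" for n unfolding \<psi>_def
      by (intro smooth_prod smooth_mult smooth_step_comp smooth_inner) auto
    have out: "\<psi> n x = 0" if "x \<notin> box c d" for n x
    proof -
      from that obtain b where b: "b \<in> Basis" "x \<bullet> b \<le> c \<bullet> b \<or> d \<bullet> b \<le> x \<bullet> b" by (auto simp: mem_box not_less)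
      then have "step (c \<bullet> b) (inverse (real (Suc n))) (x \<bullet> b) * step (- (d \<bullet> b)) (inverse (real (Suc n))) (x \<bullet> - b) = 0"
        by (auto simp: step_left simp del: of_nat_Suc)
      then show ?thesis using b(1) unfolding \<psi>_def by (auto simp del: of_nat_Suc)
    qed
    have lim: "(\<lambda>n. \<psi> n x) \<longlonglongrightarrow> indicator (box c d) x" for x
    proof (cases "x \<in> box c d")
      case True
      have "(\<lambda>n. \<psi> n x) \<longlonglongrightarrow> (\<Prod>b\<in>Basis. (if c \<bullet> b < x \<bullet> b then 1 else 0) * (if - (d \<bullet> b) < x \<bullet> - b then 1 else 0))"
        unfolding \<psi>_def by (intro tendsto_prod tendsto_mult step_tendsto)
      also have "(\<Prod>b\<in>Basis. (if c \<bullet> b < x \<bullet> b then 1 else 0) * (if - (d \<bullet> b) < x \<bullet> - b then 1 else 0)) = (1::real)"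
        using True by (intro prod.neutral) (auto simp: mem_box)
      finally show ?thesis using True by simp
    qed (simp add: out)
    have bd: "\<bar>\<psi> n x\<bar> \<le> 1" for n x
      unfolding \<psi>_def abs_prod
      by (intro prod_le_1) (use step_bounds in \<open>auto simp: abs_mult intro!: mult_le_one simp del: of_nat_Suc\<close>)
    have conv: "(\<lambda>n. \<integral>x. \<psi> n x \<partial>\<rho>) \<longlonglongrightarrow> measure \<rho> (box c d)" if \<rho>: "\<rho> \<in> Pc" for \<rho>
    proof -
      interpret prob_space \<rho> using \<rho> by (rule PcD)
      have "(\<lambda>n. \<integral>x. \<psi> n x \<partial>\<rho>) \<longlonglongrightarrow> (\<integral>x. indicator (box c d) x \<partial>\<rho>)"
      proof (rule integral_dominated_convergence[where w="\<lambda>_. 1"])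
        show "\<psi> n \<in> borel_measurable \<rho>" for n unfolding borel_measurable_Pc[OF \<rho>]
          by (rule borel_measurable_continuous_onI[OF smooth_continuous[OF sm]])
        show "indicator (box c d) \<in> borel_measurable \<rho>" using PcD(2)[OF \<rho>] by (intro borel_measurable_indicator) auto
      qed (use lim bd in auto)
      then show ?thesis using PcD(3)[OF \<rho>] by simp
    qed
    obtain r where r: "\<And>x. x \<in> box c d \<Longrightarrow> norm x \<le> r" using bounded_box[of c d] unfolding bounded_iff by blast
    have "(\<integral>x. \<psi> n x \<partial>\<mu>) = (\<integral>x. \<psi> n x \<partial>\<nu>)" for n
      by (rule eq[OF sm, of r]) (use out r in force)
    then have "measure \<mu> (box c d) = measure \<nu> (box c d)"
      using conv[OF \<mu>] conv[OF \<nu>] LIMSEQ_unique by auto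
    then show ?thesis
      using PcD(1)[OF \<mu>] PcD(1)[OF \<nu>] by (simp add: prob_space_def finite_measure.emeasure_eq_measure)
  qed
  let ?E = "range (\<lambda>(a, b). box a b :: 'a set)"
  show ?thesis
  proof (rule measure_eqI_generator_eq[where E="?E" and \<Omega>=UNIV and A="\<lambda>n::nat. box (- (real n *\<^sub>R One)) (real n *\<^sub>R One)"])
    show "Int_stable ?E" by (auto simp: Int_stable_def box_Int_box)
    show "sets \<mu> = sigma_sets UNIV ?E" "sets \<nu> = sigma_sets UNIV ?E"
      using PcD(2)[OF \<mu>] PcD(2)[OF \<nu>] by (simp_all add: borel_eq_box)
    show "(\<Union>i. box (- (real i *\<^sub>R One)) (real i *\<^sub>R One)) = (UNIV :: 'a set)" by (rule UN_box_eq_UNIV)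
    show "emeasure \<mu> (box (- (real i *\<^sub>R One)) (real i *\<^sub>R One)) \<noteq> \<infinity>" for i
      using PcD(1)[OF \<mu>] by (simp add: prob_space_def finite_measure.emeasure_finite)
  qed (use box in auto)
qed

lemma C11_mono:
  assumes C: "C11 a b r \<phi> \<phi>'" and "a \<le> a'" "b \<le> b'" "r \<le> r'" shows "C11 a' b' r' \<phi> \<phi>'"
  unfolding C11_def
proof (intro conjI allI impI)
  show "\<bar>\<phi>' x h\<bar> \<le> a' * norm h" for x h
    using C11D(2)[OF C, of x h] mult_right_mono[OF assms(2) norm_ge_zero, of h] by linarith
  show "\<bar>\<phi>' x h - \<phi>' y h\<bar> \<le> b' * norm (x - y) * norm h" for x y h
    using C11D(3)[OF C, of x h y] mult_right_mono[OF assms(3), of "norm (x - y) * norm h"] by (simp add: mult.assoc)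
qed (use C11D[OF C] assms in auto)

section \<open>The explicit Euler scheme, uniform support and duality\<close>

context linear_ce
begin

text \<open>One explicit Euler step: the field is integrated in time at the fixed point
  \<open>x\<close>, because it is only measurable in time and its value at a single time would be
  meaningless.\<close>

definition euler :: "real \<Rightarrow> real \<Rightarrow> 'a \<Rightarrow> 'a" where
  "euler s t x = x + integral {s..t} (\<lambda>\<sigma>. w \<sigma> x)"

definition deuler :: "real \<Rightarrow> real \<Rightarrow> 'a \<Rightarrow> 'a \<Rightarrow> 'a" where
  "deuler s t x h = h + integral {s..t} (\<lambda>\<sigma>. A \<sigma> x h)"

text \<open>Time plays the role of the integration variable in the lemma on parameter integrals, of
  which only the measurability part is used. The interval from 0 to 1 is arbitrary, since
  \<open>ivl_measure\<close> lives on all Borel sets.\<close>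

lemma A_measurable_time: "(\<lambda>\<sigma>. A \<sigma> x h) \<in> borel_measurable borel"
  using borel_measurable_derivative_param[OF finite_measure_ivl_measure[of 0 1], of "\<lambda>x \<sigma>. w \<sigma> x" B "\<lambda>x \<sigma>. A \<sigma> x" \<Lambda> x h]
    w_measurable_time wB wd A_bound by simp

lemma A_integrable_on: "(\<lambda>\<sigma>. A \<sigma> x h) integrable_on {s..t}"
  by (rule integrable_on_bounded_measurable[OF A_measurable_time A_bound])

lemma euler_has_derivative: "(euler s t has_derivative deuler s t x) (at x)"
proof -
  have 1: "(\<integral>\<sigma>. w \<sigma> x \<partial>ivl_measure s t) = integral {s..t} (\<lambda>\<sigma>. w \<sigma> x)" for x
    by (rule integral_ivl_measure[OF w_measurable_time wB])
  have 2: "(\<integral>\<sigma>. A \<sigma> x h \<partial>ivl_measure s t) = integral {s..t} (\<lambda>\<sigma>. A \<sigma> x h)" for x h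
    by (rule integral_ivl_measure[OF A_measurable_time A_bound])
  have "((\<lambda>x. \<integral>\<sigma>. w \<sigma> x \<partial>ivl_measure s t) has_derivative (\<lambda>h. \<integral>\<sigma>. A \<sigma> x h \<partial>ivl_measure s t)) (at x)"
    by (rule has_derivative_integral_param[OF finite_measure_ivl_measure, where f="\<lambda>x \<sigma>. w \<sigma> x" and f'="\<lambda>x \<sigma>. A \<sigma> x" and C=B and B=\<Lambda>])
       (use w_measurable_time wB wd A_bound in auto)
  then show ?thesis unfolding 1 2 euler_def[abs_def] deuler_def[abs_def]
    by (intro has_derivative_add has_derivative_ident)
qed

context
  fixes s t :: real assumes st: "s \<le> t"
begin

lemma euler_displacement: "norm (euler s t x - x) \<le> B * (t - s)"
  unfolding euler_def using norm_integral_ivl_le[OF w_integrable_on wB st] by simp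

lemma deuler_bound: "norm (deuler s t x h) \<le> (1 + \<Lambda> * (t - s)) * norm h"
proof -
  have "norm (integral {s..t} (\<lambda>\<sigma>. A \<sigma> x h)) \<le> (\<Lambda> * norm h) * (t - s)"
    by (rule norm_integral_ivl_le[OF A_integrable_on A_bound st])
  then show ?thesis unfolding deuler_def
    using norm_triangle_ineq[of h "integral {s..t} (\<lambda>\<sigma>. A \<sigma> x h)"] by (simp add: algebra_simps)
qed

lemma euler_lipschitz: "norm (euler s t x - euler s t y) \<le> (1 + \<Lambda> * (t - s)) * norm (x - y)"
  by (rule has_derivative_lipschitz[OF euler_has_derivative deuler_bound])

lemma deuler_lipschitz:
  assumes K: "\<And>\<sigma> h. norm (A \<sigma> x h - A \<sigma> y h) \<le> K * norm (x - y) * norm h"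
  shows "norm (deuler s t x h - deuler s t y h) \<le> K * (t - s) * norm (x - y) * norm h"
proof -
  have "deuler s t x h - deuler s t y h = integral {s..t} (\<lambda>\<sigma>. A \<sigma> x h - A \<sigma> y h)"
    unfolding deuler_def by (simp add: integral_diff A_integrable_on)
  also have "norm \<dots> \<le> (K * norm (x - y) * norm h) * (t - s)"
    by (rule norm_integral_ivl_le[OF integrable_diff[OF A_integrable_on A_integrable_on] K st])
  finally show ?thesis by (simp add: mult_ac)
qed

text \<open>By the chain rule the derivative at \<open>x\<close> is \<open>\<phi>'\<close> at the
  image composed with \<open>deuler\<close>. The variation of \<open>\<phi>'\<close> contributes
  \<open>b\<close> times the squared Lipschitz constant of the step, the variation of
  \<open>deuler\<close> contributes \<open>a * K * (t - s)\<close>. A Lipschitz bound for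
  \<open>A\<close> on one ball suffices because of the support of \<phi>.\<close>

lemma C11_euler:
  assumes C: "C11 a b r \<phi> \<phi>'" and R: "r + B * (t - s) \<le> R" and K: "0 \<le> K"
    "\<And>\<sigma> x y h. norm x \<le> R \<Longrightarrow> norm y \<le> R \<Longrightarrow> norm (A \<sigma> x h - A \<sigma> y h) \<le> K * norm (x - y) * norm h"
  shows "C11 (a * (1 + \<Lambda> * (t - s))) (b * (1 + \<Lambda> * (t - s))\<^sup>2 + a * K * (t - s)) (r + B * (t - s))
     (\<lambda>x. \<phi> (euler s t x)) (\<lambda>x h. \<phi>' (euler s t x) (deuler s t x h))"
  unfolding C11_def
proof (intro conjI allI impI)
  let ?E = "euler s t" and ?D = "deuler s t" and ?l = "1 + \<Lambda> * (t - s)"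
  note nn = C11_nonneg[OF C] Lam_nonneg
  have l: "0 \<le> ?l" using nn st by simp
  show "((\<lambda>x. \<phi> (?E x)) has_derivative (\<lambda>h. \<phi>' (?E x) (?D x h))) (at x)" for x
    by (rule has_derivative_compose[OF euler_has_derivative C11D(1)[OF C]])
  have far: "norm x \<le> r + B * (t - s)" if "norm (?E x) \<le> r" for x
    using euler_displacement[of x] that norm_triangle_ineq2[of x "?E x"] by (simp add: norm_minus_commute)
  show "\<bar>\<phi>' (?E x) (?D x h)\<bar> \<le> a * ?l * norm h" for x h
    using C11D(2)[OF C, of "?E x" "?D x h"] mult_left_mono[OF deuler_bound nn(1), of x h] by (simp add: mult.assoc)
  have first: "\<bar>\<phi>' (?E x) (?D z h) - \<phi>' (?E y) (?D z h)\<bar> \<le> b * ?l\<^sup>2 * norm (x - y) * norm h" for x y z h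
  proof -
    have "\<bar>\<phi>' (?E x) (?D z h) - \<phi>' (?E y) (?D z h)\<bar> \<le> b * norm (?E x - ?E y) * norm (?D z h)" by (rule C11D(3)[OF C])
    also have "\<dots> \<le> b * (?l * norm (x - y)) * (?l * norm h)"
      using nn l by (intro mult_mono mult_left_mono euler_lipschitz deuler_bound) auto
    finally show ?thesis by (simp add: power2_eq_square mult_ac)
  qed
  have nn2: "0 \<le> a * K * (t - s) * norm (x - y) * norm h" for x y h :: 'a using nn K st by simp
  show "\<bar>\<phi>' (?E x) (?D x h) - \<phi>' (?E y) (?D y h)\<bar> \<le> (b * ?l\<^sup>2 + a * K * (t - s)) * norm (x - y) * norm h" for x y h
  proof -
    \<comment> \<open>If one image lies outside the support, \<open>\<phi>'\<close> vanishes there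
      for every direction, so both terms may be taken with the same \<open>deuler\<close> and the
      estimate \<open>first\<close> is enough. Otherwise both points lie in the ball on which
      \<open>A\<close> is Lipschitz.\<close>
    consider "norm (?E x) > r" | "norm (?E y) > r" | "norm (?E x) \<le> r" "norm (?E y) \<le> r" by linarith
    then show ?thesis
    proof cases
      case 1
      then have "\<phi>' (?E x) u = 0" for u by (rule C11_deriv_zero[OF C])
      then show ?thesis using first[of x y h y] nn2[of x y h] by (simp add: algebra_simps)
    next
      case 2
      then have "\<phi>' (?E y) u = 0" for u by (rule C11_deriv_zero[OF C])
      then show ?thesis using first[of x x h y] nn2[of x y h] by (simp add: algebra_simps)
    next
      case 3
      then have xy: "norm x \<le> R" "norm y \<le> R" using far R by force+
      have lin: "linear (\<phi>' (?E y))" using C11D(1)[OF C] by (rule has_derivative_linear)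
      have "\<bar>\<phi>' (?E y) (?D x h - ?D y h)\<bar> \<le> a * (K * (t - s) * norm (x - y) * norm h)"
        by (rule order_trans[OF C11D(2)[OF C]]) (intro mult_left_mono deuler_lipschitz K xy nn)
      then show ?thesis using first[of x x h y]
        by (simp add: linear_diff[OF lin] algebra_simps)
    qed
  qed
  show "\<phi> (?E x) = 0" if "norm x > r + B * (t - s)" for x
    using far[of x] that C11D(4)[OF C, of "?E x"] by force
qed

text \<open>In the balance of \<phi> the measure under the flux is frozen at time \<open>s\<close>;
  the flux is Lipschitz with constant \<open>a * \<Lambda> + b * B\<close>, which gives the term
  with \<open>e\<close>. With the measure frozen, the flux integrates to the first-order Taylor term
  of \<phi> at the Euler step, with remainder \<open>b * (B * (t - s))\<^sup>2\<close>.\<close>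

lemma euler_step:
  assumes C: "C11 a b r \<phi> \<phi>'" and S: "0 \<le> s" "t \<le> S"
    and e: "\<And>\<sigma>. \<sigma> \<in> {s..t} \<Longrightarrow> dual_close (\<nu> \<sigma>) (\<nu> s) e"
  shows "\<bar>(\<integral>x. \<phi> x \<partial>\<nu> t) - (\<integral>x. \<phi> (euler s t x) \<partial>\<nu> s)\<bar> \<le> (t - s) * ((a * \<Lambda> + b * B) * e + b * B\<^sup>2 * (t - s))"
proof -
  interpret prob_space "\<nu> s" using \<nu>P by (rule PcD)
  note nn = C11_nonneg[OF C] B_nonneg
  let ?I = "\<lambda>\<sigma>. \<integral>x. \<phi>' x (w \<sigma> x) \<partial>\<nu> \<sigma>" and ?J = "\<lambda>\<sigma>. \<integral>x. \<phi>' x (w \<sigma> x) \<partial>\<nu> s"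
  have 1: "(\<integral>x. \<phi> x \<partial>\<nu> t) - (\<integral>x. \<phi> x \<partial>\<nu> s) = integral {s..t} ?I"
    by (rule balance_C11[OF C]) (use S st in auto)
  have jm: "(\<lambda>(\<sigma>, x). \<phi>' x (w \<sigma> x)) \<in> borel_measurable (borel \<Otimes>\<^sub>M \<nu> s)"
  proof -
    have eqm: "borel_measurable (borel \<Otimes>\<^sub>M \<nu> s) = borel_measurable (borel :: (real \<times> 'a) measure)"
      by (rule measurable_cong_sets) (auto simp: borel_prod[symmetric] PcD(2)[OF \<nu>P] cong: sets_pair_measure_cong)
    have [measurable]: "(\<lambda>z::real \<times> 'a. \<phi>' (snd z) k) \<in> borel_measurable borel" for k
      by (intro borel_measurable_continuous_onI continuous_on_compose2[OF C11_deriv_continuous[OF C]] continuous_intros) auto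
    note wm[measurable]
    have "\<phi>' x (w \<sigma> x) = (\<Sum>k\<in>Basis. (w \<sigma> x \<bullet> k) *\<^sub>R \<phi>' x k)" for \<sigma> x
      by (rule linear_euclidean_sum[OF has_derivative_linear[OF C11D(1)[OF C]]])
    then show ?thesis unfolding eqm case_prod_beta' by simp
  qed
  have jb: "norm (\<phi>' x (w \<sigma> x)) \<le> a * B" for \<sigma> x using C11_flux_lipb(2)[OF C] by simp
  have Jm: "?J \<in> borel_measurable borel"
    by (rule borel_measurable_lebesgue_integral_time[OF finite_measure_axioms jm jb])
  have J: "integral {s..t} ?J = (\<integral>x. integral {s..t} (\<lambda>\<sigma>. \<phi>' x (w \<sigma> x)) \<partial>\<nu> s)"
    by (rule integral_ivl_swap[OF finite_measure_axioms jm jb])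
  have Ji: "?J integrable_on {s..t}"
    by (rule integrable_on_bounded_measurable[OF Jm, of _ _ "a * B * 1"])
       (use norm_lebesgue_integral_time_le[OF finite_measure_axioms jm jb, of _ s t] in \<open>simp add: prob_space\<close>)
  have Ii: "?I integrable_on {s..t}"
    by (rule integrable_on_bounded_measurable[OF C11_flux_measurable[OF C], of _ _ "a * B"]) (use C11_flux_bound[OF C] in auto)
  have lin: "bounded_linear (\<phi>' x)" for x using C11D(1)[OF C] by (rule has_derivative_bounded_linear)
  have inner: "integral {s..t} (\<lambda>\<sigma>. \<phi>' x (w \<sigma> x)) = \<phi>' x (euler s t x - x)" for x
    using integral_linear[OF w_integrable_on lin] unfolding euler_def by (simp add: o_def)
  have tay: "\<bar>\<phi> (euler s t x) - \<phi> x - integral {s..t} (\<lambda>\<sigma>. \<phi>' x (w \<sigma> x))\<bar> \<le> b * (B * (t - s))\<^sup>2" for x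
    unfolding inner
    by (rule order_trans[OF C11_taylor[OF C]]) (intro mult_left_mono power_mono euler_displacement nn norm_ge_zero)
  obtain Q where Q: "\<And>x. \<bar>\<phi> x\<bar> \<le> Q" using C11_bounded[OF C] by blast
  have i1: "integrable (\<nu> s) \<phi>" by (rule lipb_integrable[OF C11_lipb[OF C] \<nu>P])
  have ec: "continuous_on UNIV (euler s t)"
    by (intro continuous_at_imp_continuous_on ballI has_derivative_continuous[OF euler_has_derivative])
  have i2: "integrable (\<nu> s) (\<lambda>x. \<phi> (euler s t x))"
    by (rule integrable_const_bound[where B=Q])
       (use Q in \<open>auto simp: borel_measurable_Pc[OF \<nu>P] intro!: borel_measurable_continuous_onI continuous_on_compose2[OF C11_continuous[OF C] ec]\<close>)
  have i3: "integrable (\<nu> s) (\<lambda>x. integral {s..t} (\<lambda>\<sigma>. \<phi>' x (w \<sigma> x)))"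
  proof (rule integrable_const_bound[where B="a * B * (t - s)"])
    show "(\<lambda>x. integral {s..t} (\<lambda>\<sigma>. \<phi>' x (w \<sigma> x))) \<in> borel_measurable (\<nu> s)"
      by (rule borel_measurable_integral_ivl[OF finite_measure_axioms jm jb])
    have "\<bar>\<phi>' x (euler s t x - x)\<bar> \<le> a * (B * (t - s))" for x
      by (rule order_trans[OF C11D(2)[OF C]]) (intro mult_left_mono euler_displacement nn)
    then show "AE x in \<nu> s. norm (integral {s..t} (\<lambda>\<sigma>. \<phi>' x (w \<sigma> x))) \<le> a * B * (t - s)"
      unfolding inner by (simp add: mult.assoc)
  qed
  have 2: "\<bar>(\<integral>x. \<phi> (euler s t x) \<partial>\<nu> s) - (\<integral>x. \<phi> x \<partial>\<nu> s) - integral {s..t} ?J\<bar> \<le> b * (B * (t - s))\<^sup>2"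
  proof -
    have "(\<integral>x. \<phi> (euler s t x) \<partial>\<nu> s) - (\<integral>x. \<phi> x \<partial>\<nu> s) - integral {s..t} ?J
      = (\<integral>x. \<phi> (euler s t x) - \<phi> x - integral {s..t} (\<lambda>\<sigma>. \<phi>' x (w \<sigma> x)) \<partial>\<nu> s)"
      unfolding J using i1 i2 i3 by simp
    also have "\<bar>\<dots>\<bar> \<le> (\<integral>x. \<bar>\<phi> (euler s t x) - \<phi> x - integral {s..t} (\<lambda>\<sigma>. \<phi>' x (w \<sigma> x))\<bar> \<partial>\<nu> s)" by (rule integral_abs_bound)
    also have "\<dots> \<le> (\<integral>x. b * (B * (t - s))\<^sup>2 \<partial>\<nu> s)"
      using i1 i2 i3 tay by (intro integral_mono integrable_abs Bochner_Integration.integrable_diff) auto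
    finally show ?thesis by (simp add: prob_space)
  qed
  have 3: "\<bar>integral {s..t} ?I - integral {s..t} ?J\<bar> \<le> ((a * \<Lambda> + b * B) * e) * (t - s)"
  proof -
    have "norm (integral {s..t} (\<lambda>\<sigma>. ?I \<sigma> - ?J \<sigma>)) \<le> ((a * \<Lambda> + b * B) * e) * (t - s)"
      by (rule norm_integral_ivl_le[OF integrable_diff[OF Ii Ji] _ st])
         (use e C11_flux_lipb(1)[OF C] in \<open>auto simp: dual_close_def\<close>)
    then show ?thesis by (simp add: integral_diff Ii Ji)
  qed
  have "b * (B * (t - s))\<^sup>2 = (t - s) * (b * B\<^sup>2 * (t - s))" by (simp add: power2_eq_square)
  then show ?thesis using 1 2 3 by (simp add: algebra_simps)
qed

end

text \<open>The displacement \<open>Y s x - x\<close> is bounded, unlike \<open>Y\<close>, and is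
  therefore the unknown given to \<open>volterra_solution\<close>. That lemma asks for a positive
  Lipschitz constant, whence \<open>\<Lambda> + 1\<close>.\<close>

lemma flow_exists:
  obtains Y where "continuous_on UNIV (\<lambda>z. Y (fst z) (snd z))"
    "\<forall>s\<in>{0..S}. \<forall>x. Y s x = x + integral {0..s} (\<lambda>\<sigma>. w \<sigma> (Y \<sigma> x))"
proof -
  have wc: "continuous_on UNIV (w s)" for s
    by (intro continuous_at_imp_continuous_on ballI has_derivative_continuous[OF wd])
  obtain U C where U: "continuous_on UNIV (\<lambda>z. U (fst z) (snd z))" "\<And>s x. norm (U s x) \<le> C"
    "\<And>s x. s \<in> {0..S} \<Longrightarrow> U s x = 0 + integral {0..s} (\<lambda>\<sigma>. w \<sigma> (x + U \<sigma> x))"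
  proof (rule volterra_solution[of S "\<Lambda> + 1" "\<lambda>_. 0" 0 "\<lambda>\<sigma> v x. w \<sigma> (x + v x)"])
    fix U :: "real \<Rightarrow> 'a \<Rightarrow> 'a" and x :: 'a assume U: "continuous_on UNIV (\<lambda>z. U (fst z) (snd z))"
    have "continuous_on UNIV (\<lambda>\<sigma>::real. (\<sigma>, x))" by (intro continuous_on_Pair continuous_on_id continuous_on_const)
    from continuous_on_compose2[OF U this] have "continuous_on UNIV (\<lambda>\<sigma>. U \<sigma> x)" by simp
    then have "(\<lambda>\<sigma>. (\<sigma>, x + U \<sigma> x)) \<in> borel_measurable borel"
      by (intro borel_measurable_continuous_onI continuous_on_Pair continuous_on_id continuous_on_add continuous_on_const)
    from measurable_compose[OF this wm] show "(\<lambda>\<sigma>. w \<sigma> (x + U \<sigma> x)) \<in> borel_measurable borel" by simp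
  next
    fix \<sigma> and v :: "'a \<Rightarrow> 'a" assume "continuous_on UNIV v"
    then show "continuous_on UNIV (\<lambda>x. w \<sigma> (x + v x))"
      by (intro continuous_on_compose2[OF wc] continuous_intros) auto
  next
    show "\<exists>B. \<forall>\<sigma> v x. continuous_on UNIV v \<longrightarrow> (\<forall>y. norm (v y) \<le> \<rho>) \<longrightarrow> norm (w \<sigma> (x + v x)) \<le> B" for \<rho>
      using wB by blast
  next
    fix \<sigma> and v v' :: "'a \<Rightarrow> 'a" and x d assume d: "\<And>y. norm (v y - v' y) \<le> d"
    have "norm (w \<sigma> (x + v x) - w \<sigma> (x + v' x)) \<le> \<Lambda> * norm (v x - v' x)" using wL[of \<sigma> "x + v x" "x + v' x"] by simp
    also have "\<dots> \<le> (\<Lambda> + 1) * d" using d[of x] Lam_nonneg by (intro mult_mono) auto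
    finally show "norm (w \<sigma> (x + v x) - w \<sigma> (x + v' x)) \<le> (\<Lambda> + 1) * d" .
  qed (use S Lam_nonneg in \<open>auto intro: continuous_on_const\<close>)
  show thesis
    by (rule that[of "\<lambda>s x. x + U s x"]) (use U in \<open>auto intro!: continuous_intros\<close>)
qed

text \<open>Uniform continuity on a compact interval through a Lebesgue number of the covering; two
  distances \<open>e / 2\<close> to a common centre are added.\<close>

lemma uniformly_dual_close:
  assumes e: "e > 0"
  obtains \<delta> where "\<delta> > 0" "\<And>s t. s \<in> {0..S} \<Longrightarrow> \<bar>t - s\<bar> < \<delta> \<Longrightarrow> dual_close (\<nu> t) (\<nu> s) e"
proof -
  have "\<forall>s. \<exists>d>0. \<forall>t. \<bar>t - s\<bar> < d \<longrightarrow> dual_close (\<nu> t) (\<nu> s) (e / 2)" using \<nu>_cont e by simp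
  then obtain d where d: "\<And>s. d s > 0" "\<And>s t. \<bar>t - s\<bar> < d s \<Longrightarrow> dual_close (\<nu> t) (\<nu> s) (e / 2)" by metis
  have "{0..S} \<subseteq> \<Union>((\<lambda>s. ball s (d s)) ` {0..S})" using d(1) by force
  from Heine_Borel_lemma[OF compact_Icc this] obtain \<delta> where \<delta>: "\<delta> > 0"
    "\<And>x. x \<in> {0..S} \<Longrightarrow> \<exists>G\<in>(\<lambda>s. ball s (d s)) ` {0..S}. ball x \<delta> \<subseteq> G" by auto
  show thesis
  proof (rule that[OF \<delta>(1)])
    fix s t assume s: "s \<in> {0..S}" and t: "\<bar>t - s\<bar> < \<delta>"
    from \<delta>(2)[OF s] obtain u where u: "ball s \<delta> \<subseteq> ball u (d u)" by blast
    have "s \<in> ball s \<delta>" "t \<in> ball s \<delta>" using t \<delta>(1) by (auto simp: dist_real_def abs_minus_commute)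
    then have "s \<in> ball u (d u)" "t \<in> ball u (d u)" using u by blast+
    then have "\<bar>s - u\<bar> < d u" "\<bar>t - u\<bar> < d u" by (auto simp: dist_real_def abs_minus_commute)
    then have "dual_close (\<nu> s) (\<nu> u) (e / 2)" "dual_close (\<nu> t) (\<nu> u) (e / 2)" using d(2) by blast+
    then show "dual_close (\<nu> t) (\<nu> s) e"
      unfolding dual_close_def
    proof (intro allI impI)
      fix \<psi> :: "'a \<Rightarrow> real" and K assume l: "lipb K \<psi>"
        and *: "\<forall>\<psi> K. lipb K \<psi> \<longrightarrow> \<bar>(\<integral>x. \<psi> x \<partial>\<nu> s) - (\<integral>x. \<psi> x \<partial>\<nu> u)\<bar> \<le> K * (e / 2)"
        "\<forall>\<psi> K. lipb K \<psi> \<longrightarrow> \<bar>(\<integral>x. \<psi> x \<partial>\<nu> t) - (\<integral>x. \<psi> x \<partial>\<nu> u)\<bar> \<le> K * (e / 2)"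
      from *(1)[rule_format, OF l] *(2)[rule_format, OF l]
      show "\<bar>(\<integral>x. \<psi> x \<partial>\<nu> t) - (\<integral>x. \<psi> x \<partial>\<nu> s)\<bar> \<le> K * e" by linarith
    qed
  qed
qed

lemma euler_flow_error:
  assumes Y: "continuous_on UNIV (\<lambda>z. Y (fst z) (snd z))"
      "\<And>s x. s \<in> {0..S} \<Longrightarrow> Y s x = x + integral {0..s} (\<lambda>\<sigma>. w \<sigma> (Y \<sigma> x))"
    and st: "0 \<le> s" "s \<le> t" "t \<le> S"
  shows "norm (euler s t (Y s x) - Y t x) \<le> \<Lambda> * B * (t - s)\<^sup>2"
proof -
  have Ym: "(\<lambda>\<sigma>. (\<sigma>, Y \<sigma> x)) \<in> borel_measurable borel"
  proof -
    have "continuous_on UNIV (\<lambda>\<sigma>::real. (\<sigma>, x))" by (intro continuous_on_Pair continuous_on_id continuous_on_const)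
    from continuous_on_compose2[OF Y(1) this] have "continuous_on UNIV (\<lambda>\<sigma>. Y \<sigma> x)" by simp
    then show ?thesis by (intro borel_measurable_continuous_onI continuous_on_Pair continuous_on_id)
  qed
  have wm': "(\<lambda>\<sigma>. w \<sigma> (Y \<sigma> x)) \<in> borel_measurable borel" using measurable_compose[OF Ym wm] by simp
  have i: "(\<lambda>\<sigma>. w \<sigma> (Y \<sigma> x)) integrable_on {u..v}" for u v by (rule integrable_on_bounded_measurable[OF wm' wB])
  have diff: "Y v x - Y u x = integral {u..v} (\<lambda>\<sigma>. w \<sigma> (Y \<sigma> x))" if "0 \<le> u" "u \<le> v" "v \<le> S" for u v
    using Y(2)[of u x] Y(2)[of v x] that has_integral_split_ivl[OF i that] by (simp add: algebra_simps)
  have "euler s t (Y s x) - Y t x = integral {s..t} (\<lambda>\<sigma>. w \<sigma> (Y s x) - w \<sigma> (Y \<sigma> x))"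
    using diff[OF st] unfolding euler_def by (simp add: integral_diff w_integrable_on i algebra_simps)
  also have "norm \<dots> \<le> (\<Lambda> * (B * (t - s))) * (t - s)"
  proof (rule norm_integral_ivl_le[OF integrable_diff[OF w_integrable_on i] _ st(2)])
    fix \<sigma> assume \<sigma>: "\<sigma> \<in> {s..t}"
    have "norm (w \<sigma> (Y s x) - w \<sigma> (Y \<sigma> x)) \<le> \<Lambda> * norm (Y s x - Y \<sigma> x)" by (rule wL)
    also have "norm (Y s x - Y \<sigma> x) = norm (integral {s..\<sigma>} (\<lambda>\<sigma>. w \<sigma> (Y \<sigma> x)))"
      using diff[of s \<sigma>] st \<sigma> by (simp add: norm_minus_commute)
    also have "\<dots> \<le> B * (\<sigma> - s)" by (rule norm_integral_ivl_le[OF i wB]) (use \<sigma> in simp)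
    also have "\<dots> \<le> B * (t - s)" using \<sigma> B_nonneg by (intro mult_left_mono) auto
    finally show "norm (w \<sigma> (Y s x) - w \<sigma> (Y \<sigma> x)) \<le> \<Lambda> * (B * (t - s))" using Lam_nonneg by (simp add: mult_left_mono)
  qed
  finally show ?thesis by (simp add: power2_eq_square mult_ac)
qed

text \<open>Each measure has compact support, but one ball for all times is needed later to make the
  derivative of the interaction field locally Lipschitz. As that bound is not yet available, the
  test function is not transported; at each step it is replaced by a wider cutoff that dominates it
  along the Euler step. The integral of the cutoff starts at 1 and loses arbitrarily little.\<close>

lemma uniform_support:
  obtains R where "\<And>t. t \<in> {0..S} \<Longrightarrow> AE x in \<nu> t. norm x \<le> R"
proof -
  obtain X where X: "compact X" "AE x in \<nu> 0. x \<in> X" using Pc_compact_AE[OF \<nu>P] by blast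
  obtain R where R: "0 < R" "\<And>x. x \<in> X \<Longrightarrow> norm x \<le> R" using compact_imp_bounded[OF X(1)] unfolding bounded_pos by blast
  \<comment> \<open>Where a cutoff is positive, \<open>x \<bullet> x\<close> is below
    \<open>U + 1\<close>, and on the ball of radius \<open>r\<close> one step of length
    \<open>h\<close> increases \<open>x \<bullet> x\<close> by at most \<open>v * h\<close>. As
    \<open>U\<close> depends on \<open>v\<close> and thus on \<open>r\<close>, the radius is chosen
    large enough for \<open>U + 1 \<le> r\<^sup>2\<close>; the term of \<open>U\<close> linear in
    \<open>r\<close> is beaten by \<open>r\<^sup>2\<close>.\<close>
  define r where "r = 3 * (B * S) + R\<^sup>2 + 2"
  define v where "v = 2 * B * r + B\<^sup>2 * S"
  define u where "u s = R\<^sup>2 + v * s" for s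
  define U where "U = u S"
  have BS: "0 \<le> B * S" using B_nonneg S by simp
  have r0: "0 \<le> r" using BS by (simp add: r_def)
  have v0: "0 \<le> v" using B_nonneg r0 S by (simp add: v_def)
  have uU: "0 \<le> u s" "u s \<le> U" if "s \<in> {0..S}" for s
    using that v0 unfolding u_def U_def by (auto intro!: add_nonneg_nonneg mult_left_mono)
  have Ur: "U + 1 \<le> r\<^sup>2"
  proof -
    define z where "z = B * S"
    define y where "y = 2 * z * r"
    have z: "0 \<le> z" using BS by (simp add: z_def)
    have 1: "U + 1 = R\<^sup>2 + 1 + y + z\<^sup>2"
      by (simp add: U_def u_def v_def y_def z_def power2_eq_square algebra_simps)
    have 2: "r\<^sup>2 = y + (3 * z + R\<^sup>2 + 2) * (z + R\<^sup>2 + 2)"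
      by (simp add: r_def y_def z_def power2_eq_square algebra_simps)
    have "0 \<le> R\<^sup>2 * z" "0 \<le> R\<^sup>2 * R\<^sup>2" "0 \<le> z\<^sup>2" using z by auto
    then have 3: "z\<^sup>2 + (R\<^sup>2 + 1) \<le> (3 * z + R\<^sup>2 + 2) * (z + R\<^sup>2 + 2)"
      using z by (simp add: algebra_simps power2_eq_square)
    show ?thesis unfolding 1 2 using 3 by simp
  qed
  \<comment> \<open>A cutoff in \<open>x \<bullet> x\<close> with threshold \<open>q\<close>: equal
    to 1 up to \<open>q\<close> and to 0 from \<open>q + 1\<close> on.\<close>
  define p where "p q x = 1 - step 0 1 (x \<bullet> x - q)" for q :: real and x :: 'a
  have pb: "0 \<le> p q x" "p q x \<le> 1" for q x using step_bounds[of 1 0 "x \<bullet> x - q"] by (auto simp: p_def)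
  have p1: "p q x = 1" if "x \<bullet> x \<le> q" for q x using that by (simp add: p_def step_left)
  have p0: "p q x = 0" if "q + 1 \<le> x \<bullet> x" for q x using that by (simp add: p_def step_right)
  have mono: "step 0 1 x \<le> step 0 1 y" if "x \<le> y" for x y
    by (rule DERIV_nonneg_imp_nondecreasing[OF that]) (intro exI conjI, rule step_deriv, simp, rule dstep_nonneg, simp)
  \<comment> \<open>All cutoffs with threshold in \<open>{0..U}\<close> are slices of this one
    smooth function of compact support in threshold and space, so their \<open>C11\<close> constants
    are uniform in the threshold.\<close>
  define \<Psi> where "\<Psi> z = (step (-1) 1 (fst z) - step U 1 (fst z)) * p (fst z) (snd z)" for z :: "real \<times> 'a"
  have U0: "0 \<le> U" using uU[of S] S by simp
  have \<Psi>s: "smooth \<Psi>"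
  proof -
    have f: "smooth (\<lambda>z::real \<times> 'a. fst z)"
      by (rule smooth_compose_linear[where A=fst and f="\<lambda>x. x", OF bounded_linear_fst _ smooth_ident]) (auto simp: Basis_prod_def)
    have g: "smooth (\<lambda>z::real \<times> 'a. snd z \<bullet> snd z)"
      by (rule smooth_compose_linear[where A=snd and f="\<lambda>x. x \<bullet> x", OF bounded_linear_snd _ smooth_inner_self]) (auto simp: Basis_prod_def)
    show ?thesis unfolding \<Psi>_def p_def
      by (rule smooth_mult; intro smooth_diff smooth_step_comp smooth_const f g; simp)
  qed
  have \<Psi>0: "\<Psi> z = 0" if "norm z > 2 * U + 3" for z
  proof (rule ccontr)
    assume nz: "\<Psi> z \<noteq> 0"
    have "\<not> fst z < -1" using nz U0 by (auto simp: \<Psi>_def step_left)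
    moreover have "\<not> U + 1 < fst z" using nz U0 by (auto simp: \<Psi>_def step_right)
    ultimately have 1: "- 1 \<le> fst z" "fst z \<le> U + 1" by auto
    have "\<not> fst z + 1 \<le> snd z \<bullet> snd z" using nz p0 by (auto simp: \<Psi>_def)
    then have "(norm (snd z))\<^sup>2 \<le> U + 2" using 1 by (simp add: power2_norm_eq_inner)
    also have "U + 2 \<le> (U + 2)\<^sup>2" using U0 by (simp add: power2_eq_square mult_le_cancel_left1)
    finally have "norm (snd z) \<le> U + 2" by (rule power2_le_imp_le) (use U0 in simp)
    then have "norm z \<le> (U + 1) + (U + 2)" using norm_Pair_le[of "fst z" "snd z"] 1 U0 by simp
    then show False using that by simp
  qed
  obtain a b where \<Psi>C: "C11 a b (2 * U + 3) \<Psi> (\<lambda>z. frechet_derivative \<Psi> (at z))" using smooth_C11[OF \<Psi>s \<Psi>0] .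
  have pC: "C11 a b (2 * U + 3) (p q) (\<lambda>x h. frechet_derivative \<Psi> (at (q, x)) (0, h))" if q: "0 \<le> q" "q \<le> U" for q
    unfolding C11_def
  proof (intro conjI allI impI)
    have pq: "p q = (\<lambda>x. \<Psi> (q, x))" using q by (auto simp: \<Psi>_def step_right step_left)
    have n: "norm (0::real, h) = norm h" for h :: 'a by (simp add: norm_Pair)
    show "(p q has_derivative (\<lambda>h. frechet_derivative \<Psi> (at (q, x)) (0, h))) (at x)" for x
      unfolding pq
      by (rule has_derivative_compose[where f="\<lambda>x. (q, x)" and f'="\<lambda>h. (0, h)", OF _ C11D(1)[OF \<Psi>C]])
         (intro has_derivative_Pair has_derivative_const has_derivative_ident)
    show "\<bar>frechet_derivative \<Psi> (at (q, x)) (0, h)\<bar> \<le> a * norm h" for x h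
      using C11D(2)[OF \<Psi>C, of "(q, x)" "(0, h)"] by (simp add: n)
    show "\<bar>frechet_derivative \<Psi> (at (q, x)) (0, h) - frechet_derivative \<Psi> (at (q, y)) (0, h)\<bar> \<le> b * norm (x - y) * norm h" for x y h
      using C11D(3)[OF \<Psi>C, of "(q, x)" "(0, h)" "(q, y)"] by (simp add: n)
    show "p q x = 0" if "norm x > 2 * U + 3" for x
      using C11D(4)[OF \<Psi>C, of "(q, x)"] that norm_snd_le[of x q] unfolding pq by force
  qed
  note nn = C11_nonneg[OF \<Psi>C] B_nonneg Lam_nonneg
  define c where "c = a * \<Lambda> + b * B + b * B\<^sup>2"
  have c0: "0 \<le> c" using nn by (simp add: c_def)
  have main: "(\<integral>x. p (u t) x \<partial>\<nu> t) \<ge> 1" if t: "t \<in> {0..S}" for t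
  proof (rule field_le_epsilon)
    fix e' :: real assume e': "0 < e'"
    define e where "e = e' / (t * c + 1)"
    have tc: "0 \<le> t * c" using t c0 by simp
    have e: "e > 0" using e' tc by (simp add: e_def)
    obtain \<delta> where \<delta>: "\<delta> > 0" "\<And>s t. s \<in> {0..S} \<Longrightarrow> \<bar>t - s\<bar> < \<delta> \<Longrightarrow> dual_close (\<nu> t) (\<nu> s) e"
      using uniformly_dual_close[OF e] by blast
    \<comment> \<open>The step length will be below \<delta>, for closeness of consecutive measures,
      and below \<open>e\<close>, so that errors quadratic in it are of order \<open>h * e\<close>
      as well.\<close>
    obtain N :: nat where N: "t / min \<delta> e < real N" using reals_Archimedean2 by blast
    have N0: "0 < real N" using N t \<delta>(1) e by (smt (verit) atLeastAtMost_iff divide_nonneg_pos)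
    define h where "h = t / real N"
    have "t < real N * min \<delta> e" using N \<delta>(1) e by (simp add: pos_divide_less_eq)
    then have "h < min \<delta> e" by (simp only: h_def pos_divide_less_eq[OF N0] mult.commute)
    then have h: "0 \<le> h" "h < \<delta>" "h < e" "real N * h = t"
      using N0 t by (auto simp: h_def)
    \<comment> \<open>Each step loses at most \<open>h * (c * e)\<close>, the error of
      \<open>euler_step\<close>; the total loss is proportional to \<open>e\<close> whatever the
      number of steps.\<close>
    have "(\<integral>x. p (u (real j * h)) x \<partial>\<nu> (real j * h)) \<ge> 1 - (real j * h) * (c * e)" if "j \<le> N" for j
      using that
    proof (induction j)
      case 0
      interpret prob_space "\<nu> 0" using \<nu>P by (rule PcD)
      have "AE x in \<nu> 0. p (u 0) x = 1" using X(2)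
      proof eventually_elim
        case (elim x)
        then have "(norm x)\<^sup>2 \<le> R\<^sup>2" using R by (intro power_mono) auto
        then show ?case by (intro p1) (simp add: u_def power2_norm_eq_inner)
      qed
      then have "(\<integral>x. p (u 0) x \<partial>\<nu> 0) = (\<integral>x. 1 \<partial>\<nu> 0)"
        using borel_measurable_continuous_onI[OF C11_continuous[OF pC[OF uU[of 0]]]] S
        by (intro integral_cong_AE) (auto simp: borel_measurable_Pc[OF \<nu>P])
      then show ?case by (simp add: prob_space)
    next
      case (Suc j)
      define s where "s = real j * h"
      define s' where "s' = s + h"
      have "real (Suc j) * h \<le> real N * h" using Suc.prems h by (intro mult_right_mono) auto
      then have s: "real (Suc j) * h = s'" "0 \<le> s" "s \<le> s'" "s' \<le> S" "s' - s = h" "s \<le> S"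
        using h t by (auto simp: s_def s'_def algebra_simps)
      have q: "0 \<le> u s" "u s \<le> U" "0 \<le> u s'" "u s' \<le> U" using uU[of s] uU[of s'] s by auto
      note Cs = pC[OF q(1,2)] and Cs' = pC[OF q(3,4)]
      have st: "\<bar>(\<integral>x. p (u s') x \<partial>\<nu> s') - (\<integral>x. p (u s') (euler s s' x) \<partial>\<nu> s)\<bar> \<le> (s' - s) * ((a * \<Lambda> + b * B) * e + b * B\<^sup>2 * (s' - s))"
        by (rule euler_step[OF s(3) Cs' s(2,4)]) (rule \<delta>(2), use s h in auto)
      have "(a * \<Lambda> + b * B) * e + b * B\<^sup>2 * h \<le> c * e"
        using mult_left_mono[of h e "b * B\<^sup>2"] nn h unfolding c_def by (simp add: algebra_simps)
      then have st': "(\<integral>x. p (u s') x \<partial>\<nu> s') \<ge> (\<integral>x. p (u s') (euler s s' x) \<partial>\<nu> s) - h * (c * e)"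
        using st mult_left_mono[OF _ h(1), of "(a * \<Lambda> + b * B) * e + b * B\<^sup>2 * h" "c * e"] unfolding s(5) by linarith
      \<comment> \<open>The threshold grows by \<open>h * v\<close>, which is as much as
        \<open>x \<bullet> x\<close> can grow in this step where the old cutoff may be positive;
        elsewhere the left side is 0.\<close>
      have pw: "p (u s) x \<le> p (u s') (euler s s' x)" for x
      proof (cases "u s + 1 \<le> x \<bullet> x")
        case True
        then show ?thesis using p0[of "u s" x] pb by simp
      next
        case False
        let ?y = "euler s s' x"
        have "(norm x)\<^sup>2 \<le> r\<^sup>2" using False q Ur by (simp add: power2_norm_eq_inner)
        then have xr: "norm x \<le> r" using r0 by (rule power2_le_imp_le)
        have "norm ?y \<le> norm x + B * h"
          using euler_displacement[OF s(3), of x] norm_triangle_sub[of ?y x] s(5) by simp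
        then have "(norm ?y)\<^sup>2 \<le> (norm x + B * h)\<^sup>2" by (intro power_mono) auto
        also have "\<dots> = (norm x)\<^sup>2 + h * (2 * B * norm x + B\<^sup>2 * h)" by (simp add: power2_eq_square algebra_simps)
        also have "\<dots> \<le> (norm x)\<^sup>2 + h * v"
          unfolding v_def using h s xr nn by (intro add_left_mono mult_left_mono add_mono) auto
        finally have "?y \<bullet> ?y - u s' \<le> x \<bullet> x - u s"
          using s(5) by (simp add: power2_norm_eq_inner u_def s'_def algebra_simps)
        from mono[OF this] show ?thesis by (simp add: p_def)
      qed
      interpret prob_space "\<nu> s" using \<nu>P by (rule PcD)
      have ec: "continuous_on UNIV (euler s s')"
        by (intro continuous_at_imp_continuous_on ballI has_derivative_continuous[OF euler_has_derivative])
      have "(\<integral>x. p (u s) x \<partial>\<nu> s) \<le> (\<integral>x. p (u s') (euler s s' x) \<partial>\<nu> s)"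
      proof (rule integral_mono[OF lipb_integrable[OF C11_lipb[OF Cs] \<nu>P] _ pw])
        show "integrable (\<nu> s) (\<lambda>x. p (u s') (euler s s' x))"
          by (rule integrable_const_bound[where B=1])
             (use pb in \<open>auto simp: borel_measurable_Pc[OF \<nu>P] intro!: borel_measurable_continuous_onI continuous_on_compose2[OF C11_continuous[OF Cs'] ec]\<close>)
      qed
      moreover have "(\<integral>x. p (u s) x \<partial>\<nu> s) \<ge> 1 - s * (c * e)" using Suc unfolding s_def by simp
      ultimately show ?case using st' unfolding s(1) by (simp add: s'_def algebra_simps)
    qed
    from this[of N] have "(\<integral>x. p (u t) x \<partial>\<nu> t) \<ge> 1 - t * (c * e)" using h(4) by simp
    moreover have "t * (c * e) \<le> e'" using tc e' by (simp add: e_def field_simps)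
    ultimately show "1 \<le> (\<integral>x. p (u t) x \<partial>\<nu> t) + e'" by linarith
  qed
  show thesis
  proof (rule that[of r])
    fix t assume t: "t \<in> {0..S}"
    interpret prob_space "\<nu> t" using \<nu>P by (rule PcD)
    have i: "integrable (\<nu> t) (p (u t))" by (rule lipb_integrable[OF C11_lipb[OF pC[OF uU[OF t]]] \<nu>P])
    have "(\<integral>x. 1 - p (u t) x \<partial>\<nu> t) = 0"
    proof -
      have "(\<integral>x. 1 - p (u t) x \<partial>\<nu> t) \<le> 0" using main[OF t] i by (simp add: prob_space)
      moreover have "0 \<le> (\<integral>x. 1 - p (u t) x \<partial>\<nu> t)" using pb by simp
      ultimately show ?thesis by simp
    qed
    then have "AE x in \<nu> t. 1 - p (u t) x = 0"
      using i pb by (subst (asm) integral_nonneg_eq_0_iff_AE) auto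
    then show "AE x in \<nu> t. norm x \<le> r"
    proof eventually_elim
      case (elim x)
      then have "\<not> u t + 1 \<le> x \<bullet> x" using p0 by force
      then have "(norm x)\<^sup>2 \<le> r\<^sup>2" using uU[OF t] Ur by (simp add: power2_norm_eq_inner)
      then show "norm x \<le> r" using r0 by (rule power2_le_imp_le)
    qed
  qed
qed

text \<open>Duality: the test function is transported backwards along the explicit Euler scheme, which
  keeps it of class \<open>C\<^sup>1\<^sup>,\<^sup>1\<close> with uniform bounds. This avoids differentiating the flow.\<close>

lemma flow_representation:
  assumes Y: "continuous_on UNIV (\<lambda>z. Y (fst z) (snd z))"
      "\<And>s x. s \<in> {0..S} \<Longrightarrow> Y s x = x + integral {0..s} (\<lambda>\<sigma>. w \<sigma> (Y \<sigma> x))"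
    and A_lip: "\<And>r. \<exists>K. \<forall>s x y h. norm x \<le> r \<longrightarrow> norm y \<le> r \<longrightarrow> norm (A s x h - A s y h) \<le> K * norm (x - y) * norm h"
    and t: "t \<in> {0..S}"
  shows "\<nu> t = distr \<theta> borel (Y t)"
proof -
  have \<theta>: "\<theta> \<in> Pc" using \<nu>P[of 0] \<nu>0 by simp
  interpret \<theta>: prob_space \<theta> using \<theta> by (rule PcD)
  have Yc: "continuous_on UNIV (Y s)" for s
  proof -
    have "continuous_on UNIV (\<lambda>x::'a. (s, x))" by (intro continuous_on_Pair continuous_on_id continuous_on_const)
    from continuous_on_compose2[OF Y(1) this] show ?thesis by simp
  qed
  show ?thesis
  proof (rule measure_eq_smooth[OF \<nu>P distr_Pc[OF \<theta> Yc]])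
    fix \<psi> :: "'a \<Rightarrow> real" and r assume "smooth \<psi>" "\<And>x. norm x > r \<Longrightarrow> \<psi> x = 0"
    then obtain a b where C: "C11 a b r \<psi> (\<lambda>x. frechet_derivative \<psi> (at x))" by (rule smooth_C11)
    \<comment> \<open>Backward transport over a time of at most \<open>S\<close> enlarges the
      support by at most \<open>B * S\<close>, so one local Lipschitz constant of \<open>A\<close>
      serves all steps.\<close>
    obtain K where K: "\<And>s x y h. norm x \<le> r + B * S \<Longrightarrow> norm y \<le> r + B * S \<Longrightarrow> norm (A s x h - A s y h) \<le> K * norm (x - y) * norm h"
      using A_lip[of "r + B * S"] by blast
    define k where "k = \<bar>K\<bar>"
    have k: "0 \<le> k" "norm (A s x h - A s y h) \<le> k * norm (x - y) * norm h" if "norm x \<le> r + B * S" "norm y \<le> r + B * S" for s x y h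
    proof -
      have "K * norm (x - y) * norm h \<le> k * norm (x - y) * norm h" unfolding k_def by (intro mult_right_mono) auto
      with K[OF that, of s h] show "norm (A s x h - A s y h) \<le> k * norm (x - y) * norm h" by linarith
    qed (simp add: k_def)
    have k0: "0 \<le> k" by (simp add: k_def)
    note nn = C11_nonneg[OF C] B_nonneg Lam_nonneg k0
    define \<Delta> where "\<Delta> \<phi> s = (\<integral>x. \<phi> x \<partial>\<nu> s) - (\<integral>x. \<phi> (Y s x) \<partial>\<theta>)" for \<phi> :: "'a \<Rightarrow> real" and s
    \<comment> \<open>Bounds that hold for the transported function at every stage. A step of length
      \<open>h\<close> multiplies the derivative bound by at most
      \<open>exp (\<Lambda> * h)\<close>; it multiplies the Lipschitz constant of the derivative by
      at most the square of that and adds a source proportional to \<open>k * h\<close>.\<close>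
    define a1 where "a1 = a * exp (\<Lambda> * S)"
    define b1 where "b1 = (b + a * k * S) * exp (2 * \<Lambda> * S)"
    have nn1: "0 \<le> a1" "0 \<le> b1" using nn S by (auto simp: a1_def b1_def)
    define c where "c = a1 * \<Lambda> + b1 * B + b1 * B\<^sup>2 + a1 * (\<Lambda> * B)"
    have c: "0 \<le> c" using nn nn1 by (simp add: c_def)
    have key: "\<bar>\<Delta> \<psi> t\<bar> \<le> t * c * e" if e: "e > 0" for e
    proof -
      obtain \<delta> where \<delta>: "\<delta> > 0" "\<And>s t. s \<in> {0..S} \<Longrightarrow> \<bar>t - s\<bar> < \<delta> \<Longrightarrow> dual_close (\<nu> t) (\<nu> s) e"
        using uniformly_dual_close[OF e] by blast
      obtain N :: nat where N: "t / min \<delta> e < real N" using reals_Archimedean2 by blast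
      have N0: "0 < real N" using N t \<delta>(1) e by (smt (verit) atLeastAtMost_iff divide_nonneg_pos)
      define h where "h = t / real N"
      have "t < real N * min \<delta> e" using N \<delta>(1) e by (simp add: pos_divide_less_eq)
      then have "h < min \<delta> e" by (simp only: h_def pos_divide_less_eq[OF N0] mult.commute)
      then have h: "0 \<le> h" "h < \<delta>" "h < e" "real N * h = t"
        using N0 t by (auto simp: h_def)
      \<comment> \<open>Error of one step per unit of time: the first two terms come from \<nu>
        (\<open>euler_step\<close>), the last one from the flow
        (\<open>euler_flow_error\<close>).\<close>
      define G where "G = (a1 * \<Lambda> + b1 * B) * e + b1 * B\<^sup>2 * h + a1 * (\<Lambda> * B) * h"
      \<comment> \<open>The comparison of the two measures at time \<open>t\<close> is traded for a
        comparison at an earlier time with a transported test function. After \<open>N\<close> steps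
        time 0 is reached, where both measures are \<theta>.\<close>
      have "\<exists>\<phi> \<phi>'. C11 (a * exp (\<Lambda> * (real j * h))) ((b + a * k * (real j * h)) * exp (2 * \<Lambda> * (real j * h))) (r + B * (real j * h)) \<phi> \<phi>' \<and>
          \<bar>\<Delta> \<psi> t - \<Delta> \<phi> (t - real j * h)\<bar> \<le> (real j * h) * G" if "j \<le> N" for j
        using that
      proof (induction j)
        case 0
        show ?case using C by auto
      next
        case (Suc j)
        define \<tau> where "\<tau> = real j * h"
        define aj where "aj = a * exp (\<Lambda> * \<tau>)"
        define bj where "bj = (b + a * k * \<tau>) * exp (2 * \<Lambda> * \<tau>)"
        from Suc obtain \<phi> \<phi>' where \<phi>: "C11 aj bj (r + B * \<tau>) \<phi> \<phi>'" "\<bar>\<Delta> \<psi> t - \<Delta> \<phi> (t - \<tau>)\<bar> \<le> \<tau> * G"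
          unfolding \<tau>_def aj_def bj_def by auto
        have "real (Suc j) * h \<le> real N * h" using Suc.prems h by (intro mult_right_mono) auto
        then have \<tau>h: "0 \<le> \<tau>" "\<tau> + h \<le> t" "real (Suc j) * h = \<tau> + h"
          using h by (auto simp: \<tau>_def algebra_simps)
        define s where "s = t - (\<tau> + h)"
        define u where "u = t - \<tau>"
        have su: "0 \<le> s" "s \<le> u" "u \<le> S" "u - s = h" using \<tau>h h t by (auto simp: s_def u_def)
        have \<tau>S: "\<tau> + h \<le> S" "\<tau> \<le> S" using \<tau>h t h by auto
        have aj: "0 \<le> aj" "aj \<le> a1" unfolding aj_def a1_def using nn \<tau>S by (auto intro!: mult_left_mono)
        have bj: "0 \<le> bj" "bj \<le> b1" unfolding bj_def b1_def using nn \<tau>S \<tau>h S by (auto intro!: mult_mono add_mono)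
        have ex: "1 + \<Lambda> * h \<le> exp (\<Lambda> * h)" by (rule exp_ge_add_one_self)
        have "C11 (aj * (1 + \<Lambda> * (u - s))) (bj * (1 + \<Lambda> * (u - s))\<^sup>2 + aj * k * (u - s)) (r + B * \<tau> + B * (u - s))
           (\<lambda>x. \<phi> (euler s u x)) (\<lambda>x h. \<phi>' (euler s u x) (deuler s u x h))"
        proof (rule C11_euler[OF su(2) \<phi>(1), where R="r + B * S"])
          show "r + B * \<tau> + B * (u - s) \<le> r + B * S" using mult_left_mono[OF \<tau>S(1) B_nonneg] su(4) by (simp add: algebra_simps)
        qed (use k k0 in auto)
        then have C': "C11 (a * exp (\<Lambda> * (\<tau> + h))) ((b + a * k * (\<tau> + h)) * exp (2 * \<Lambda> * (\<tau> + h))) (r + B * (\<tau> + h))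
           (\<lambda>x. \<phi> (euler s u x)) (\<lambda>x h. \<phi>' (euler s u x) (deuler s u x h))"
        proof (rule C11_mono)
          have "aj * (1 + \<Lambda> * h) \<le> aj * exp (\<Lambda> * h)" using ex aj by (intro mult_left_mono) auto
          then show "aj * (1 + \<Lambda> * (u - s)) \<le> a * exp (\<Lambda> * (\<tau> + h))"
            using su(4) by (simp add: aj_def distrib_left exp_add mult_ac)
          have "(1 + \<Lambda> * h)\<^sup>2 \<le> (exp (\<Lambda> * h))\<^sup>2" using ex nn h by (intro power_mono) auto
          also have "\<dots> = exp (2 * \<Lambda> * h)" by (simp add: exp_double mult.assoc)
          finally have "bj * (1 + \<Lambda> * h)\<^sup>2 \<le> bj * exp (2 * \<Lambda> * h)" using bj by (intro mult_left_mono) auto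
          also have "\<dots> = (b + a * k * \<tau>) * exp (2 * \<Lambda> * (\<tau> + h))" by (simp add: bj_def distrib_left exp_add mult_ac)
          finally have 1: "bj * (1 + \<Lambda> * h)\<^sup>2 \<le> (b + a * k * \<tau>) * exp (2 * \<Lambda> * (\<tau> + h))" .
          have "\<Lambda> * \<tau> \<le> 2 * \<Lambda> * (\<tau> + h)" using nn \<tau>h h mult_nonneg_nonneg[of \<Lambda> \<tau>] mult_nonneg_nonneg[of \<Lambda> h] by (simp add: algebra_simps)
          then have "aj \<le> a * exp (2 * \<Lambda> * (\<tau> + h))" unfolding aj_def using nn by (intro mult_left_mono) auto
          then have "aj * (k * h) \<le> a * exp (2 * \<Lambda> * (\<tau> + h)) * (k * h)" using nn h by (intro mult_right_mono) auto
          with 1 show "bj * (1 + \<Lambda> * (u - s))\<^sup>2 + aj * k * (u - s) \<le> (b + a * k * (\<tau> + h)) * exp (2 * \<Lambda> * (\<tau> + h))"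
            using su(4) by (simp add: algebra_simps)
        qed (simp add: su(4) algebra_simps)
        have st1: "\<bar>(\<integral>x. \<phi> x \<partial>\<nu> u) - (\<integral>x. \<phi> (euler s u x) \<partial>\<nu> s)\<bar> \<le> (u - s) * ((aj * \<Lambda> + bj * B) * e + bj * B\<^sup>2 * (u - s))"
          by (rule euler_step[OF su(2) \<phi>(1) su(1,3)]) (rule \<delta>(2), use su h in auto)
        have "(aj * \<Lambda> + bj * B) * e + bj * B\<^sup>2 * h \<le> (a1 * \<Lambda> + b1 * B) * e + b1 * B\<^sup>2 * h"
          using aj bj nn h e by (intro add_mono mult_right_mono) auto
        then have st1': "\<bar>(\<integral>x. \<phi> x \<partial>\<nu> u) - (\<integral>x. \<phi> (euler s u x) \<partial>\<nu> s)\<bar> \<le> h * ((a1 * \<Lambda> + b1 * B) * e + b1 * B\<^sup>2 * h)"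
          using order_trans[OF st1[unfolded su(4)] mult_left_mono[OF _ h(1)]] by blast
        have ec: "continuous_on UNIV (euler s u)"
          by (intro continuous_at_imp_continuous_on ballI has_derivative_continuous[OF euler_has_derivative])
        obtain Q where Q: "\<And>x. \<bar>\<phi> x\<bar> \<le> Q" using C11_bounded[OF \<phi>(1)] by blast
        have i1: "integrable \<theta> (\<lambda>x. \<phi> (Y u x))"
          by (rule \<theta>.integrable_const_bound[where B=Q])
             (use Q in \<open>auto simp: borel_measurable_Pc[OF \<theta>] intro!: borel_measurable_continuous_onI continuous_on_compose2[OF C11_continuous[OF \<phi>(1)] Yc]\<close>)
        have i2: "integrable \<theta> (\<lambda>x. \<phi> (euler s u (Y s x)))"
          by (rule \<theta>.integrable_const_bound[where B=Q])
             (use Q in \<open>auto simp: borel_measurable_Pc[OF \<theta>] intro!: borel_measurable_continuous_onI continuous_on_compose2[OF C11_continuous[OF \<phi>(1)]] continuous_on_compose2[OF ec Yc]\<close>)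
        have st2: "\<bar>(\<integral>x. \<phi> (Y u x) \<partial>\<theta>) - (\<integral>x. \<phi> (euler s u (Y s x)) \<partial>\<theta>)\<bar> \<le> a1 * (\<Lambda> * B * h\<^sup>2)"
        proof -
          have "\<bar>(\<integral>x. \<phi> (Y u x) \<partial>\<theta>) - (\<integral>x. \<phi> (euler s u (Y s x)) \<partial>\<theta>)\<bar> = \<bar>\<integral>x. \<phi> (Y u x) - \<phi> (euler s u (Y s x)) \<partial>\<theta>\<bar>"
            using i1 i2 by simp
          also have "\<dots> \<le> (\<integral>x. \<bar>\<phi> (Y u x) - \<phi> (euler s u (Y s x))\<bar> \<partial>\<theta>)" by (rule integral_abs_bound)
          also have "\<dots> \<le> (\<integral>x. a1 * (\<Lambda> * B * h\<^sup>2) \<partial>\<theta>)"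
          proof (rule integral_mono)
            fix x
            have "\<bar>\<phi> (Y u x) - \<phi> (euler s u (Y s x))\<bar> \<le> aj * norm (Y u x - euler s u (Y s x))" by (rule C11_lipschitz[OF \<phi>(1)])
            also have "\<dots> \<le> a1 * (\<Lambda> * B * h\<^sup>2)"
              using euler_flow_error[OF Y su(1-3), of x] su(4) aj nn1 by (intro mult_mono) (auto simp: norm_minus_commute)
            finally show "\<bar>\<phi> (Y u x) - \<phi> (euler s u (Y s x))\<bar> \<le> a1 * (\<Lambda> * B * h\<^sup>2)" .
          qed (use i1 i2 in auto)
          finally show ?thesis by (simp add: \<theta>.prob_space)
        qed
        have "\<bar>\<Delta> \<phi> u - \<Delta> (\<lambda>x. \<phi> (euler s u x)) s\<bar> \<le> h * ((a1 * \<Lambda> + b1 * B) * e + b1 * B\<^sup>2 * h) + a1 * (\<Lambda> * B * h\<^sup>2)"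
          unfolding \<Delta>_def using st1' st2 by linarith
        also have "\<dots> = h * G" by (simp add: G_def power2_eq_square algebra_simps)
        finally have "\<bar>\<Delta> \<psi> t - \<Delta> (\<lambda>x. \<phi> (euler s u x)) s\<bar> \<le> \<tau> * G + h * G" using \<phi>(2) unfolding u_def by linarith
        then show ?case using C' unfolding \<tau>h(3) s_def by (auto simp: distrib_right)
      qed
      from this[of N] h(4) obtain \<phi> \<phi>' where \<phi>: "C11 (a * exp (\<Lambda> * t)) ((b + a * k * t) * exp (2 * \<Lambda> * t)) (r + B * t) \<phi> \<phi>'"
        "\<bar>\<Delta> \<psi> t - \<Delta> \<phi> 0\<bar> \<le> t * G" by auto
      have "\<Delta> \<phi> 0 = 0" unfolding \<Delta>_def using Y(2)[of 0] S \<nu>0 by simp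
      then have "\<bar>\<Delta> \<psi> t\<bar> \<le> t * G" using \<phi>(2) by simp
      also have "\<dots> \<le> t * (c * e)"
      proof (rule mult_left_mono)
        have "b1 * B\<^sup>2 * h \<le> b1 * B\<^sup>2 * e" "a1 * (\<Lambda> * B) * h \<le> a1 * (\<Lambda> * B) * e"
          using nn nn1 h by (auto intro!: mult_left_mono)
        then show "G \<le> c * e" unfolding G_def c_def by (simp add: algebra_simps)
      qed (use t in simp)
      finally show ?thesis by (simp add: mult.assoc)
    qed
    have tc: "0 \<le> t * c" using t c by simp
    have "\<bar>\<Delta> \<psi> t\<bar> \<le> 0"
    proof (rule field_le_epsilon)
      fix e :: real assume e: "0 < e"
      have "\<bar>\<Delta> \<psi> t\<bar> \<le> t * c * (e / (t * c + 1))" by (rule key) (use e tc in simp)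
      also have "\<dots> \<le> 0 + e" using tc e by (simp add: field_simps)
      finally show "\<bar>\<Delta> \<psi> t\<bar> \<le> 0 + e" .
    qed
    then have "(\<integral>x. \<psi> x \<partial>\<nu> t) = (\<integral>x. \<psi> (Y t x) \<partial>\<theta>)" by (simp add: \<Delta>_def)
    also have "\<dots> = (\<integral>x. \<psi> x \<partial>distr \<theta> borel (Y t))"
      by (rule integral_distr[symmetric])
         (auto simp: borel_measurable_Pc[OF \<theta>] intro!: borel_measurable_continuous_onI Yc C11_continuous[OF C])
    finally show "(\<integral>x. \<psi> x \<partial>\<nu> t) = (\<integral>x. \<psi> x \<partial>distr \<theta> borel (Y t))" .
  qed
qed

end

section \<open>The mean-field flow\<close>

lemma continuous_on_slices:
  fixes X :: "real \<Rightarrow> 'x::euclidean_space \<Rightarrow> 'b::topological_space"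
  assumes "continuous_on UNIV (\<lambda>z. X (fst z) (snd z))"
  shows "continuous_on UNIV (X s)" "continuous_on UNIV (\<lambda>s. X s x)"
proof -
  have "continuous_on UNIV (\<lambda>x::'x. (s, x))" "continuous_on UNIV (\<lambda>s::real. (s, x))"
    by (intro continuous_on_Pair continuous_on_id continuous_on_const)+
  from this[THEN continuous_on_compose2[OF assms]]
  show "continuous_on UNIV (X s)" "continuous_on UNIV (\<lambda>s. X s x)" by simp_all
qed

lemma borel_measurable_slice:
  fixes V :: "real \<Rightarrow> 'x::euclidean_space \<Rightarrow> 'b::topological_space"
  assumes "(\<lambda>z. V (fst z) (snd z)) \<in> borel_measurable borel"
  shows "(\<lambda>s. V s x) \<in> borel_measurable borel"
proof -
  have "(\<lambda>s::real. (s, x)) \<in> borel_measurable borel"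
    by (intro borel_measurable_continuous_onI continuous_on_Pair continuous_on_id continuous_on_const)
  from measurable_compose[OF this assms] show ?thesis by simp
qed

lemma continuous_on_lebesgue_integral:
  fixes h :: "'u::metric_space \<Rightarrow> 'x \<Rightarrow> 'b::euclidean_space"
  assumes M: "finite_measure M" and h: "\<And>u. h u \<in> borel_measurable M"
    "\<And>z. z \<in> space M \<Longrightarrow> continuous_on UNIV (\<lambda>u. h u z)" "\<And>u z. z \<in> space M \<Longrightarrow> norm (h u z) \<le> B"
  shows "continuous_on UNIV (\<lambda>u. \<integral>z. h u z \<partial>M)"
  unfolding continuous_on_sequentially o_def
proof (intro allI ballI impI, elim conjE)
  interpret finite_measure M by fact
  fix us :: "nat \<Rightarrow> 'u" and u assume us: "us \<longlonglongrightarrow> u"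
  show "(\<lambda>n. \<integral>z. h (us n) z \<partial>M) \<longlonglongrightarrow> (\<integral>z. h u z \<partial>M)"
  proof (rule integral_dominated_convergence[where w="\<lambda>_. B"])
    show "AE z in M. (\<lambda>n. h (us n) z) \<longlonglongrightarrow> h u z"
      using h(2) us unfolding continuous_on_sequentially o_def by auto
  qed (use h in auto)
qed

text \<open>Integrability is left open, as the integral of a non-integrable function is 0 by
  convention.\<close>

lemma (in prob_space) norm_integral_le:
  fixes f :: "'a \<Rightarrow> 'b::{banach, second_countable_topology}"
  assumes "AE x in M. norm (f x) \<le> B" "0 \<le> B" shows "norm (\<integral>x. f x \<partial>M) \<le> B"
proof (cases "integrable M f")
  case True
  have "norm (\<integral>x. f x \<partial>M) \<le> (\<integral>x. norm (f x) \<partial>M)" by (rule integral_norm_bound)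
  also have "\<dots> \<le> (\<integral>x. B \<partial>M)" using True assms by (intro integral_mono_AE) auto
  finally show ?thesis by (simp add: prob_space)
qed (use assms in \<open>simp add: not_integrable_integral_eq\<close>)

lemma continuous_on_matrix_vector_mult:
  fixes A :: "'a::topological_space \<Rightarrow> real^'n^'m"
  assumes "continuous_on X A" "continuous_on X v" shows "continuous_on X (\<lambda>x. A x *v v x)"
  unfolding matrix_vector_mult_def
  by (intro continuous_on_vec_lambda continuous_on_sum continuous_on_mult continuous_on_component assms)

lemma continuous_on_vector_matrix_mult:
  fixes A :: "'a::topological_space \<Rightarrow> real^'n^'m"
  assumes "continuous_on X A" "continuous_on X v" shows "continuous_on X (\<lambda>x. v x v* A x)"
  unfolding vector_matrix_mult_def
  by (intro continuous_on_vec_lambda continuous_on_sum continuous_on_mult continuous_on_component assms)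

lemma dual_close_self: "0 \<le> e \<Longrightarrow> dual_close \<mu> \<mu> e"
  by (auto simp: dual_close_def lipb_def)

lemma lipb_mult:
  assumes "lipb K p" "lipb K' q" shows "\<exists>K''. lipb K'' (\<lambda>x. p x * q x)"
proof -
  obtain P Q where P: "\<And>x. \<bar>p x\<bar> \<le> P" and Q: "\<And>x. \<bar>q x\<bar> \<le> Q" using assms unfolding lipb_def by blast
  have nn: "0 \<le> P" "0 \<le> Q" using order_trans[OF abs_ge_zero P] order_trans[OF abs_ge_zero Q] by auto
  have K: "0 \<le> K" "0 \<le> K'" "\<And>x y. \<bar>p x - p y\<bar> \<le> K * norm (x - y)" "\<And>x y. \<bar>q x - q y\<bar> \<le> K' * norm (x - y)"
    using assms by (auto simp: lipb_def)
  have "\<bar>p x * q x - p y * q y\<bar> \<le> (K * Q + P * K') * norm (x - y)" for x y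
  proof -
    have "p x * q x - p y * q y = (p x - p y) * q x + p y * (q x - q y)" by (simp add: algebra_simps)
    also have "\<bar>\<dots>\<bar> \<le> \<bar>p x - p y\<bar> * \<bar>q x\<bar> + \<bar>p y\<bar> * \<bar>q x - q y\<bar>" by (metis abs_mult abs_triangle_ineq)
    also have "\<dots> \<le> (K * norm (x - y)) * Q + P * (K' * norm (x - y))"
      using nn K by (intro add_mono mult_mono P Q) auto
    finally show ?thesis by (simp add: algebra_simps)
  qed
  moreover have "\<bar>p x * q x\<bar> \<le> P * Q" for x unfolding abs_mult using nn by (intro mult_mono P Q) auto
  ultimately show ?thesis unfolding lipb_def using nn K by (intro exI[of _ "K * Q + P * K'"]) auto
qed

lemma lipb_inner:
  fixes G :: "'a::euclidean_space \<Rightarrow> 'b::euclidean_space"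
  assumes "\<And>x y. norm (G x - G y) \<le> K * norm (x - y)" "\<And>x. norm (G x) \<le> B" "0 \<le> K" "b \<in> Basis"
  shows "lipb K (\<lambda>x. G x \<bullet> b)"
  unfolding lipb_def
proof (intro conjI allI)
  show "\<bar>G x \<bullet> b - G y \<bullet> b\<bar> \<le> K * norm (x - y)" for x y
    using order_trans[OF Basis_le_norm[OF assms(4)] assms(1)] by (simp add: inner_diff_left)
  show "\<exists>B. \<forall>x. \<bar>G x \<bullet> b\<bar> \<le> B" using order_trans[OF Basis_le_norm[OF assms(4)] assms(2)] by blast
qed fact

text \<open>\<open>dual_close\<close> tests real functions, so the vector field is estimated
  component by component; the dimension is the number of components.\<close>

lemma conv_dual_close:
  fixes g :: "real^'n \<Rightarrow> real^'n" and L C e :: real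
  assumes g: "\<And>x y. norm (g x - g y) \<le> L * norm (x - y)" "\<And>x. norm (g x) \<le> C" "0 \<le> L"
    and \<mu>: "\<mu> \<in> Pc" "\<nu> \<in> Pc" and e: "dual_close \<mu> \<nu> e"
  shows "norm (conv g \<mu> x - conv g \<nu> x) \<le> CARD('n) * (L * e)"
proof -
  have gx: "norm (g (x - y) - g (x - z)) \<le> L * norm (y - z)" for y z
    using g(1)[of "x - y" "x - z"] by (simp add: norm_minus_commute)
  have i: "integrable \<rho> (\<lambda>y. g (x - y))" if \<rho>: "\<rho> \<in> Pc" for \<rho>
  proof -
    interpret prob_space \<rho> using \<rho> by (rule PcD)
    have "L-lipschitz_on UNIV (\<lambda>y. g (x - y))" using gx g(3) by (intro lipschitz_onI) (auto simp: dist_norm)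
    then show ?thesis
      using g(2) by (intro integrable_const_bound[where B=C])
        (auto simp: borel_measurable_Pc[OF \<rho>] intro!: borel_measurable_continuous_onI lipschitz_on_continuous_on)
  qed
  have "norm (conv g \<mu> x - conv g \<nu> x) \<le> (\<Sum>b\<in>Basis. \<bar>(conv g \<mu> x - conv g \<nu> x) \<bullet> b\<bar>)" by (rule norm_le_l1)
  also have "\<dots> \<le> (\<Sum>b\<in>(Basis::(real^'n) set). L * e)"
  proof (rule sum_mono)
    fix b :: "real^'n" assume b: "b \<in> Basis"
    have "lipb L (\<lambda>y. g (x - y) \<bullet> b)" by (rule lipb_inner[OF gx g(2,3) b])
    with e have "\<bar>(\<integral>y. g (x - y) \<bullet> b \<partial>\<mu>) - (\<integral>y. g (x - y) \<bullet> b \<partial>\<nu>)\<bar> \<le> L * e" unfolding dual_close_def by blast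
    then show "\<bar>(conv g \<mu> x - conv g \<nu> x) \<bullet> b\<bar> \<le> L * e"
      unfolding conv_def using i[OF \<mu>(1)] i[OF \<mu>(2)] by (simp add: inner_diff_left)
  qed
  finally show ?thesis by simp
qed

lemma W1_continuous_dual_close:
  assumes W: "W1_continuous_on {0..S} \<nu>" and P: "\<And>s. s \<in> {0..S} \<Longrightarrow> \<nu> s \<in> Pc" and S: "0 \<le> S" and e: "0 < e"
  shows "\<exists>d>0. \<forall>t. \<bar>t - s\<bar> < d \<longrightarrow> dual_close (\<nu> (clip S t)) (\<nu> (clip S s)) e"
proof -
  let ?u = "clip S s"
  have u: "?u \<in> {0..S}" by (rule clip_mem[OF S])
  have "\<forall>\<^sub>F t in at ?u within {0..S}. W1 (\<nu> t) (\<nu> ?u) < ennreal e"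
    using W u e unfolding W1_continuous_on_def by (intro order_tendstoD(2)) auto
  then obtain d where d: "d > 0" "\<And>t. t \<in> {0..S} \<Longrightarrow> t \<noteq> ?u \<Longrightarrow> \<bar>t - ?u\<bar> < d \<Longrightarrow> W1 (\<nu> t) (\<nu> ?u) < ennreal e"
    unfolding eventually_at dist_real_def by blast
  have "dual_close (\<nu> (clip S t)) (\<nu> ?u) e" if "\<bar>t - s\<bar> < d" for t
  proof (cases "clip S t = ?u")
    \<comment> \<open>The limit in \<open>W1_continuous_on\<close> is taken over a punctured
      neighbourhood and says nothing about this case.\<close>
    case True
    then show ?thesis using e by (simp add: dual_close_self)
  next
    case False
    have t: "clip S t \<in> {0..S}" by (rule clip_mem[OF S])
    have "W1 (\<nu> (clip S t)) (\<nu> ?u) < ennreal e"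
      by (rule d(2)[OF t False]) (use dist_clip_le[of S t s] that in simp)
    then show ?thesis unfolding dual_close_def lipb_def using W1_dual_bound[OF P[OF t] P[OF u]] by metis
  qed
  with d(1) show ?thesis by blast
qed

text \<open>The component \<open>F i0\<close> plays the role of \<open>f\<^sub>0\<close>: its control also multiplies the interaction.\<close>

locale mean_field =
  fixes F :: "'k::finite \<Rightarrow> real^'n \<Rightarrow> real^'n" and JF :: "'k \<Rightarrow> real^'n \<Rightarrow> real^'n^'n"
    and g :: "real^'n \<Rightarrow> real^'n" and Jg :: "real^'n \<Rightarrow> real^'n^'n" and i0 :: 'k
    and \<theta> :: "(real^'n) measure" and S C L :: real
  assumes S: "0 < S" and \<theta>: "\<theta> \<in> Pc" and C: "0 \<le> C" and L: "0 \<le> L"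
    and FB: "\<And>k x. norm (F k x) \<le> C" and gB: "\<And>x. norm (g x) \<le> C"
    and FL: "\<And>k x y. norm (F k x - F k y) \<le> L * norm (x - y)" and gL: "\<And>x y. norm (g x - g y) \<le> L * norm (x - y)"
    and Fd: "\<And>k x. (F k has_derivative (\<lambda>h. JF k x *v h)) (at x)"
    and gd: "\<And>x. (g has_derivative (\<lambda>h. Jg x *v h)) (at x)"
    and JFc: "\<And>k. continuous_on UNIV (JF k)" and Jgc: "continuous_on UNIV Jg"
    and JFl: "\<And>k r. \<exists>K. \<forall>x y h. norm x \<le> r \<longrightarrow> norm y \<le> r \<longrightarrow> norm (JF k x *v h - JF k y *v h) \<le> K * norm (x - y) * norm h"
    and Jgl: "\<And>r. \<exists>K. \<forall>x y h. norm x \<le> r \<longrightarrow> norm y \<le> r \<longrightarrow> norm (Jg x *v h - Jg y *v h) \<le> K * norm (x - y) * norm h"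
    and godd: "\<And>x. g (- x) = - g x"
begin

interpretation \<theta>: prob_space \<theta> using \<theta> by (rule PcD)

lemma bm_\<theta>: "borel_measurable \<theta> = borel_measurable borel" by (rule borel_measurable_Pc[OF \<theta>])

lemma bm_pair_\<theta>: "borel_measurable (borel \<Otimes>\<^sub>M \<theta>) = borel_measurable (borel :: (real \<times> (real^'n)) measure)"
  by (rule measurable_cong_sets) (auto simp: borel_prod[symmetric] PcD(2)[OF \<theta>] cong: sets_pair_measure_cong)

text \<open>Borel coefficients with the bound at every time. As their absolute values sum to at most
  1, combinations of the fields inherit the bounds of a single field
  (\<open>ctrl_sum_le\<close>).\<close>

definition ctrl :: "(real \<Rightarrow> 'k \<Rightarrow> real) \<Rightarrow> bool" where
  "ctrl c \<longleftrightarrow> (\<forall>k. (\<lambda>s. c s k) \<in> borel_measurable borel) \<and> (\<forall>s. (\<Sum>k\<in>UNIV. \<bar>c s k\<bar>) \<le> 1)"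

definition vel :: "(real \<Rightarrow> 'k \<Rightarrow> real) \<Rightarrow> real \<Rightarrow> (real^'n \<Rightarrow> real^'n) \<Rightarrow> real^'n \<Rightarrow> real^'n" where
  "vel c s G x = (\<Sum>k\<in>UNIV. c s k *\<^sub>R F k x) + c s i0 *\<^sub>R G x"

text \<open>The interaction field \<open>conv g\<close> of the image of \<theta> under
  \<open>X s\<close> (\<open>conv_distr\<close>), written over \<theta> so that the coupled flow
  equation involves functions only.\<close>

definition force :: "(real \<Rightarrow> real^'n \<Rightarrow> real^'n) \<Rightarrow> real \<Rightarrow> real^'n \<Rightarrow> real^'n" where
  "force X s y = (\<integral>z. g (y - X s z) \<partial>\<theta>)"

definition flow :: "(real \<Rightarrow> 'k \<Rightarrow> real) \<Rightarrow> (real \<Rightarrow> real^'n \<Rightarrow> real^'n) \<Rightarrow> bool" where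
  "flow c X \<longleftrightarrow> continuous_on UNIV (\<lambda>z. X (fst z) (snd z)) \<and>
     (\<forall>s\<in>{0..S}. \<forall>x. X s x = x + integral {0..s} (\<lambda>\<sigma>. vel c \<sigma> (force X \<sigma>) (X \<sigma> x)))"

lemma ctrlD: "ctrl c \<Longrightarrow> (\<lambda>s. c s k) \<in> borel_measurable borel" "ctrl c \<Longrightarrow> (\<Sum>k\<in>UNIV. \<bar>c s k\<bar>) \<le> 1"
  by (auto simp: ctrl_def)

lemma ctrl_abs_le: "ctrl c \<Longrightarrow> \<bar>c s k\<bar> \<le> 1"
  using ctrlD(2)[of c s] member_le_sum[of k UNIV "\<lambda>k. \<bar>c s k\<bar>"] by simp

lemma ctrl_sum_le:
  fixes v :: "'k \<Rightarrow> 'b::real_normed_vector"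
  assumes c: "ctrl c" and v: "\<And>k. norm (v k) \<le> B"
  shows "norm (\<Sum>k\<in>UNIV. c s k *\<^sub>R v k) \<le> B"
proof -
  have B: "0 \<le> B" using v norm_ge_zero order_trans by blast
  have "norm (\<Sum>k\<in>UNIV. c s k *\<^sub>R v k) \<le> (\<Sum>k\<in>UNIV. \<bar>c s k\<bar> * B)"
    by (rule order_trans[OF norm_sum], rule sum_mono) (simp add: mult_left_mono v)
  also have "\<dots> = (\<Sum>k\<in>UNIV. \<bar>c s k\<bar>) * B" by (simp add: sum_distrib_right)
  also have "\<dots> \<le> 1 * B" by (rule mult_right_mono[OF ctrlD(2)[OF c] B])
  finally show ?thesis by simp
qed

lemma F_continuous: "continuous_on UNIV (F k)" and g_continuous: "continuous_on UNIV g"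
  by (intro continuous_at_imp_continuous_on ballI has_derivative_continuous[OF Fd] has_derivative_continuous[OF gd])+

lemma vel_bound:
  assumes c: "ctrl c" and G: "\<And>x. norm (G x) \<le> C" shows "norm (vel c s G x) \<le> 2 * C"
proof -
  have "norm (c s i0 *\<^sub>R G x) \<le> 1 * C" unfolding norm_scaleR
    using ctrl_abs_le[OF c] G C by (intro mult_mono) auto
  then show ?thesis unfolding vel_def
    using norm_triangle_mono[OF ctrl_sum_le[OF c, of "\<lambda>k. F k x", OF FB, of s]] by fastforce
qed

lemma vel_diff:
  assumes c: "ctrl c" shows "norm (vel c s G x - vel c s G' x') \<le> L * norm (x - x') + norm (G x - G' x')"
proof -
  have "vel c s G x - vel c s G' x' = (\<Sum>k\<in>UNIV. c s k *\<^sub>R (F k x - F k x')) + c s i0 *\<^sub>R (G x - G' x')"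
    by (simp add: vel_def sum_subtractf scaleR_diff_right)
  moreover have "norm (\<Sum>k\<in>UNIV. c s k *\<^sub>R (F k x - F k x')) \<le> L * norm (x - x')" by (rule ctrl_sum_le[OF c FL])
  moreover have "norm (c s i0 *\<^sub>R (G x - G' x')) \<le> 1 * norm (G x - G' x')" unfolding norm_scaleR
    using ctrl_abs_le[OF c] by (intro mult_right_mono) auto
  ultimately show ?thesis using norm_triangle_mono by fastforce
qed

lemma conv_bound: "\<mu> \<in> Pc \<Longrightarrow> norm (conv g \<mu> x) \<le> C"
proof -
  assume "\<mu> \<in> Pc"
  then interpret \<mu>: prob_space \<mu> by (rule PcD)
  show ?thesis unfolding conv_def by (rule \<mu>.norm_integral_le) (use gB C in auto)
qed

lemma force_diff:
  assumes X: "continuous_on UNIV (X s)" and X': "continuous_on UNIV (X' s)" and d: "\<And>z. norm (X s z - X' s z) \<le> d"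
  shows "norm (force X s y - force X' s y') \<le> L * (norm (y - y') + d)"
proof -
  have i: "integrable \<theta> (\<lambda>z. g (y - v z))" if "continuous_on UNIV v" for v y
    by (rule \<theta>.integrable_const_bound[where B=C])
       (use gB in \<open>auto simp: bm_\<theta> intro!: borel_measurable_continuous_onI continuous_on_compose2[OF g_continuous] continuous_intros that\<close>)
  have d0: "0 \<le> d" using order_trans[OF norm_ge_zero d] .
  have "force X s y - force X' s y' = (\<integral>z. g (y - X s z) - g (y' - X' s z) \<partial>\<theta>)"
    unfolding force_def using i[OF X] i[OF X'] by simp
  also have "norm \<dots> \<le> L * (norm (y - y') + d)"
  proof (rule \<theta>.norm_integral_le[OF AE_I2])
    fix z
    have "norm (g (y - X s z) - g (y' - X' s z)) \<le> L * norm ((y - X s z) - (y' - X' s z))" by (rule gL)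
    also have "(y - X s z) - (y' - X' s z) = (y - y') - (X s z - X' s z)" by simp
    also have "norm \<dots> \<le> norm (y - y') + d" using norm_triangle_ineq4[of "y - y'" "X s z - X' s z"] d[of z] by linarith
    finally show "norm (g (y - X s z) - g (y' - X' s z)) \<le> L * (norm (y - y') + d)" using L by (simp add: mult_left_mono)
  qed (use L d0 in simp)
  finally show ?thesis .
qed

lemma force_bound: "norm (force X s y) \<le> C"
  unfolding force_def by (rule \<theta>.norm_integral_le) (use gB C in auto)

lemma force_continuous:
  assumes X: "continuous_on UNIV (\<lambda>z. X (fst z) (snd z))"
  shows "continuous_on UNIV (\<lambda>z. force X (fst z) (snd z))"
  unfolding force_def
proof (rule continuous_on_lebesgue_integral[OF \<theta>.finite_measure_axioms])
  note Xs = continuous_on_slices[OF X]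
  show "(\<lambda>x. g (snd u - X (fst u) x)) \<in> borel_measurable \<theta>" for u :: "real \<times> (real^'n)" unfolding bm_\<theta>
    by (intro borel_measurable_continuous_onI continuous_on_compose2[OF g_continuous] continuous_intros Xs) auto
  show "continuous_on UNIV (\<lambda>u. g (snd u - X (fst u) z))" for z
    by (intro continuous_on_compose2[OF g_continuous] continuous_intros continuous_on_compose2[OF Xs(2)]) auto
qed (rule gB)

lemma force_flow_continuous:
  assumes X: "continuous_on UNIV (\<lambda>z. X (fst z) (snd z))"
  shows "continuous_on UNIV (\<lambda>z. force X (fst z) (X (fst z) (snd z)))"
proof -
  have "continuous_on UNIV (\<lambda>z. (fst z, X (fst z) (snd z)))"
    by (rule continuous_on_Pair[OF continuous_on_fst[OF continuous_on_id] X])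
  from continuous_on_compose2[OF force_continuous[OF X] this] show ?thesis by simp
qed

lemma vel_flow_measurable:
  assumes c: "ctrl c" and X: "continuous_on UNIV (\<lambda>z. X (fst z) (snd z))"
  shows "(\<lambda>z. vel c (fst z) (force X (fst z)) (X (fst z) (snd z))) \<in> borel_measurable borel"
proof -
  have f: "fst \<in> borel_measurable (borel :: (real \<times> (real^'n)) measure)"
    by (intro borel_measurable_continuous_onI continuous_intros)
  have [measurable]: "(\<lambda>z::real \<times> (real^'n). c (fst z) k) \<in> borel_measurable borel" for k
    by (rule measurable_compose[OF f ctrlD(1)[OF c]])
  have [measurable]: "(\<lambda>z. F k (X (fst z) (snd z))) \<in> borel_measurable borel" for k
    by (intro borel_measurable_continuous_onI continuous_on_compose2[OF F_continuous X]) auto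
  have [measurable]: "(\<lambda>z. force X (fst z) (X (fst z) (snd z))) \<in> borel_measurable borel"
    by (rule borel_measurable_continuous_onI[OF force_flow_continuous[OF X]])
  show ?thesis unfolding vel_def by measurable
qed

lemma flow_exists:
  assumes c: "ctrl c" obtains X where "flow c X"
proof -
  \<comment> \<open>The bounded displacement is solved for. The constant is \<open>L\<close> for the
    fields and \<open>2 * L\<close> for the interaction, where both the observed point and the
    particles move; 1 is added for positivity.\<close>
  obtain U D where U: "continuous_on UNIV (\<lambda>z. U (fst z) (snd z))" "\<And>s x. norm (U s x) \<le> D"
    "\<And>s x. s \<in> {0..S} \<Longrightarrow> U s x = 0 + integral {0..s} (\<lambda>\<sigma>. vel c \<sigma> (\<lambda>y. \<integral>z. g (y - (z + U \<sigma> z)) \<partial>\<theta>) (x + U \<sigma> x))"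
  proof (rule volterra_solution[of S "3 * L + 1" "\<lambda>_. 0" 0 "\<lambda>\<sigma> v x. vel c \<sigma> (\<lambda>y. \<integral>z. g (y - (z + v z)) \<partial>\<theta>) (x + v x)"])
    fix U :: "real \<Rightarrow> real^'n \<Rightarrow> real^'n" and x :: "real^'n"
    assume "continuous_on UNIV (\<lambda>z. U (fst z) (snd z))"
    then have "continuous_on UNIV (\<lambda>z. snd z + U (fst z) (snd z))" by (intro continuous_intros)
    from borel_measurable_slice[OF vel_flow_measurable[OF c this]]
    show "(\<lambda>\<sigma>. vel c \<sigma> (\<lambda>y. \<integral>z. g (y - (z + U \<sigma> z)) \<partial>\<theta>) (x + U \<sigma> x)) \<in> borel_measurable borel"
      unfolding force_def .
  next
    fix \<sigma> and v :: "real^'n \<Rightarrow> real^'n" assume v: "continuous_on UNIV v"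
    let ?X = "\<lambda>s::real. \<lambda>x. x + v x"
    have "continuous_on UNIV (\<lambda>z::real \<times> (real^'n). ?X (fst z) (snd z))"
      by (intro continuous_intros continuous_on_compose2[OF v]) auto
    from continuous_on_slices(1)[OF force_flow_continuous[OF this]]
    have "continuous_on UNIV (\<lambda>x. force ?X \<sigma> (x + v x))" .
    then show "continuous_on UNIV (\<lambda>x. vel c \<sigma> (\<lambda>y. \<integral>z. g (y - (z + v z)) \<partial>\<theta>) (x + v x))"
      unfolding vel_def force_def by (intro continuous_intros continuous_on_compose2[OF F_continuous] v) auto
  next
    fix \<rho>
    have "norm (vel c \<sigma> (\<lambda>y. \<integral>z. g (y - (z + v z)) \<partial>\<theta>) (x + v x)) \<le> 2 * C" for \<sigma> v x
      by (rule vel_bound[OF c]) (rule force_bound[of "\<lambda>s x. x + v x", unfolded force_def])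
    then show "\<exists>B. \<forall>\<sigma> v x. continuous_on UNIV v \<longrightarrow> (\<forall>y. norm (v y) \<le> \<rho>) \<longrightarrow> norm (vel c \<sigma> (\<lambda>y. \<integral>z. g (y - (z + v z)) \<partial>\<theta>) (x + v x)) \<le> B"
      by blast
  next
    fix \<sigma> and v v' :: "real^'n \<Rightarrow> real^'n" and x d
    assume v: "continuous_on UNIV v" "continuous_on UNIV v'" and d: "\<And>y. norm (v y - v' y) \<le> d"
    have "norm (vel c \<sigma> (force (\<lambda>s x. x + v x) \<sigma>) (x + v x) - vel c \<sigma> (force (\<lambda>s x. x + v' x) \<sigma>) (x + v' x))
       \<le> L * norm ((x + v x) - (x + v' x)) + L * (norm ((x + v x) - (x + v' x)) + d)"
      by (rule order_trans[OF vel_diff[OF c]], rule add_left_mono, rule force_diff)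
         (use d in \<open>auto intro!: continuous_intros v\<close>)
    also have "\<dots> \<le> L * d + L * (d + d)" using d[of x] L by (intro add_mono mult_left_mono) auto
    also have "\<dots> \<le> (3 * L + 1) * d" using order_trans[OF norm_ge_zero d] by (simp add: algebra_simps)
    finally show "norm (vel c \<sigma> (\<lambda>y. \<integral>z. g (y - (z + v z)) \<partial>\<theta>) (x + v x) - vel c \<sigma> (\<lambda>y. \<integral>z. g (y - (z + v' z)) \<partial>\<theta>) (x + v' x)) \<le> (3 * L + 1) * d"
      unfolding force_def .
  qed (use S L in auto)
  show thesis
    by (rule that[of "\<lambda>s x. x + U s x"]) (use U in \<open>auto simp: flow_def force_def[abs_def] intro!: continuous_intros\<close>)
qed

lemma flowD:
  assumes "flow c X"
  shows "continuous_on UNIV (\<lambda>z. X (fst z) (snd z))"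
    "s \<in> {0..S} \<Longrightarrow> X s x = x + integral {0..s} (\<lambda>\<sigma>. vel c \<sigma> (force X \<sigma>) (X \<sigma> x))"
    "X 0 x = x"
  using assms S unfolding flow_def by force+

lemma conv_distr:
  assumes "continuous_on UNIV (X s)" shows "conv g (distr \<theta> borel (X s)) = force X s"
proof
  fix x
  show "conv g (distr \<theta> borel (X s)) x = force X s x"
    unfolding conv_def force_def
    by (rule integral_distr)
       (auto simp: bm_\<theta> intro!: borel_measurable_continuous_onI continuous_on_compose2[OF g_continuous] continuous_intros assms)
qed

lemma flow_trajectory:
  assumes c: "ctrl c" and X: "flow c X"
  shows "continuity_eq S (\<lambda>s. vel c s (conv g (distr \<theta> borel (X s)))) (\<lambda>s. distr \<theta> borel (X s))"
proof -
  note Xs = continuous_on_slices[OF flowD(1)[OF X]]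
  have eq: "conv g (distr \<theta> borel (X s)) = force X s" for s by (rule conv_distr[OF Xs(1)])
  show ?thesis unfolding eq
  proof (rule continuity_eq_Lagrangian[OF \<theta> S flowD(1)[OF X] vel_flow_measurable[OF c flowD(1)[OF X]]])
    show "norm (vel c s (force X s) (X s x)) \<le> 2 * C" for s x by (rule vel_bound[OF c force_bound])
    show "X s x = X 0 x + integral {0..s} (\<lambda>\<sigma>. vel c \<sigma> (force X \<sigma>) (X \<sigma> x))" if "s \<in> {0..S}" for s x
      using flowD(2)[OF X that] flowD(3)[OF X] by simp
    have "continuous_on UNIV (force X s)" for s by (rule continuous_on_slices(1)[OF force_continuous[OF flowD(1)[OF X]]])
    then show "vel c s (force X s) \<in> borel_measurable borel" for s
      unfolding vel_def by (intro borel_measurable_continuous_onI continuous_intros F_continuous) auto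
  qed auto
qed

lemma distr_flow_0: assumes X: "flow c X" shows "distr \<theta> borel (X 0) = \<theta>"
proof -
  have "X 0 = (\<lambda>x. x)" by (rule ext) (rule flowD(3)[OF X])
  then show ?thesis using distr_id2[OF PcD(2)[OF \<theta>, symmetric]] by simp
qed

lemma trajectory_flow:
  assumes c: "ctrl c" and \<nu>: "continuity_eq S (\<lambda>s. vel c s (conv g (\<nu> s))) \<nu>" and \<nu>0: "\<nu> 0 = \<theta>"
  obtains X where "flow c X" "\<And>s. s \<in> {0..S} \<Longrightarrow> \<nu> s = distr \<theta> borel (X s)"
proof -
  \<comment> \<open>Clamping extends the curve to all times, as \<open>linear_ce\<close> requires,
    and keeps it unchanged on \<open>{0..S}\<close>.\<close>
  define \<mu> where "\<mu> s = \<nu> (clip S s)" for s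
  have S0: "0 \<le> S" using S by simp
  have \<mu>P: "\<mu> s \<in> Pc" for s using \<nu> clip_mem[OF S0] unfolding continuity_eq_def \<mu>_def by blast
  have \<mu>c: "\<exists>d>0. \<forall>t. \<bar>t - s\<bar> < d \<longrightarrow> dual_close (\<mu> t) (\<mu> s) e" if "e > 0" for s e
    unfolding \<mu>_def by (rule W1_continuous_dual_close[OF _ _ S0 that]) (use \<nu> in \<open>auto simp: continuity_eq_def\<close>)
  define h where "h s = conv g (\<mu> s)" for s
  have hB: "norm (h s x) \<le> C" for s x unfolding h_def by (rule conv_bound[OF \<mu>P])
  have gm: "(\<lambda>y. g (x - y)) \<in> borel_measurable borel" for x
    by (intro borel_measurable_continuous_onI continuous_on_compose2[OF g_continuous] continuous_intros) auto
  have gi: "integrable (\<mu> s) (\<lambda>y. g (x - y))" for s x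
  proof -
    interpret prob_space "\<mu> s" using \<mu>P by (rule PcD)
    show ?thesis by (rule integrable_const_bound[where B=C]) (use gB gm in \<open>auto simp: borel_measurable_Pc[OF \<mu>P]\<close>)
  qed
  have hL: "norm (h s x - h s x') \<le> L * norm (x - x')" for s x x'
  proof -
    interpret prob_space "\<mu> s" using \<mu>P by (rule PcD)
    have "h s x - h s x' = (\<integral>y. g (x - y) - g (x' - y) \<partial>\<mu> s)" unfolding h_def conv_def using gi by simp
    also have "norm \<dots> \<le> L * norm (x - x')"
    proof (rule norm_integral_le[OF AE_I2])
      show "norm (g (x - y) - g (x' - y)) \<le> L * norm (x - x')" for y using gL[of "x - y" "x' - y"] by simp
    qed (use L in simp)
    finally show ?thesis .
  qed
  have ht: "norm (h t x - h s x) \<le> CARD('n) * (L * e)" if "dual_close (\<mu> t) (\<mu> s) e" for t s x e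
    unfolding h_def by (rule conv_dual_close[OF gL gB L \<mu>P \<mu>P that])
  have small: "\<exists>d>0. \<forall>t. \<bar>t - s\<bar> < d \<longrightarrow> dual_close (\<mu> t) (\<mu> s) e \<and> (\<forall>x. norm (h t x - h s x) \<le> e)" if e: "e > 0" for s e
  proof -
    define e' where "e' = min e (e / (CARD('n) * L + 1))"
    have P: "0 \<le> CARD('n) * L" using L by simp
    have e': "0 < e'" "e' \<le> e" using e P by (auto simp: e'_def)
    have "CARD('n) * L * e' \<le> CARD('n) * L * (e / (CARD('n) * L + 1))" using P by (intro mult_left_mono) (auto simp: e'_def)
    also have "\<dots> \<le> e" using P e by (simp add: field_simps)
    finally have e'': "CARD('n) * (L * e') \<le> e" by (simp add: mult.assoc)
    obtain d where d: "d > 0" "\<And>t. \<bar>t - s\<bar> < d \<Longrightarrow> dual_close (\<mu> t) (\<mu> s) e'" using \<mu>c[OF e'(1)] by blast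
    have "dual_close (\<mu> t) (\<mu> s) e" if "dual_close (\<mu> t) (\<mu> s) e'" for t
      using that e'(2) unfolding dual_close_def lipb_def by (meson mult_left_mono order_trans)
    then show ?thesis using d ht order_trans[OF _ e''] by blast
  qed
  have hc: "continuous_on UNIV (\<lambda>z. h (fst z) (snd z))"
    unfolding continuous_on_iff
  proof (intro ballI allI impI)
    fix z :: "real \<times> (real^'n)" and e :: real assume e: "0 < e"
    obtain d where d: "d > 0" "\<And>t x. \<bar>t - fst z\<bar> < d \<Longrightarrow> norm (h t x - h (fst z) x) \<le> e / 2"
      using small[of "e / 2" "fst z"] e by auto
    define d' where "d' = min d (e / (2 * (L + 1)))"
    have d': "d' > 0" using d e L by (simp add: d'_def)
    have "dist (h (fst y) (snd y)) (h (fst z) (snd z)) < e" if y: "dist y z < d'" for y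
    proof -
      have "\<bar>fst y - fst z\<bar> < d" using y dist_fst_le[of y z] by (simp add: d'_def dist_real_def)
      from d(2)[OF this] have 1: "norm (h (fst y) (snd y) - h (fst z) (snd y)) \<le> e / 2" .
      have "norm (h (fst z) (snd y) - h (fst z) (snd z)) \<le> L * norm (snd y - snd z)" by (rule hL)
      also have "\<dots> \<le> L * (e / (2 * (L + 1)))" using y dist_snd_le[of y z] L by (intro mult_left_mono) (auto simp: d'_def dist_norm)
      also have "\<dots> < e / 2" using L e by (simp add: field_simps)
      finally show ?thesis using norm_triangle_ineq[of "h (fst y) (snd y) - h (fst z) (snd y)" "h (fst z) (snd y) - h (fst z) (snd z)"] 1
        by (simp add: dist_norm)
    qed
    then show "\<exists>d>0. \<forall>y\<in>UNIV. dist y z < d \<longrightarrow> dist (h (fst y) (snd y)) (h (fst z) (snd z)) < e" using d' by blast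
  qed
  define DG where "DG s x k = (\<integral>y. Jg (x - y) *v k \<partial>\<mu> s)" for s and x k :: "real^'n"
  have Jgb: "norm (Jg x *v k) \<le> L * norm k" for x k by (rule lipschitz_has_derivative[OF gd gL])
  have Jgv: "continuous_on UNIV (\<lambda>x. Jg x *v k)" for k by (intro continuous_on_matrix_vector_mult continuous_intros Jgc)
  have hd: "(h s has_derivative DG s x) (at x)" for s x
  proof -
    interpret prob_space "\<mu> s" using \<mu>P by (rule PcD)
    show ?thesis unfolding h_def conv_def[abs_def] DG_def[abs_def]
    proof (rule has_derivative_integral_param[OF finite_measure_axioms, where f="\<lambda>x y. g (x - y)" and f'="\<lambda>x y k. Jg (x - y) *v k" and C=C and B=L])
      show "((\<lambda>x. g (x - y)) has_derivative (*v) (Jg (x - y))) (at x)" for x y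
        by (rule has_derivative_compose[where f="\<lambda>x. x - y" and g=g and f'="\<lambda>h. h", OF _ gd])
           (auto intro!: derivative_eq_intros)
    qed (use gB Jgb gm in \<open>auto simp: borel_measurable_Pc[OF \<mu>P]\<close>)
  qed
  define w where "w s = vel c s (h s)" for s
  define A where "A s x k = (\<Sum>i\<in>UNIV. c s i *\<^sub>R (JF i x *v k)) + c s i0 *\<^sub>R DG s x k" for s x k
  have intc: "(\<lambda>s. \<integral>x. \<psi> x \<partial>\<mu> s) \<in> borel_measurable borel" if \<psi>: "lipb K \<psi>" for K \<psi>
  proof (rule borel_measurable_continuous_onI)
    have K: "0 \<le> K" using \<psi> by (simp add: lipb_def)
    show "continuous_on UNIV (\<lambda>s. \<integral>x. \<psi> x \<partial>\<mu> s)" unfolding continuous_on_iff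
    proof (intro ballI allI impI)
      fix s e :: real assume e: "0 < e"
      have e': "0 < e / (K + 1)" "K * (e / (K + 1)) < e" using e K by (auto simp: field_simps)
      obtain d where d: "d > 0" "\<And>t. \<bar>t - s\<bar> < d \<Longrightarrow> dual_close (\<mu> t) (\<mu> s) (e / (K + 1))" using \<mu>c[OF e'(1)] by blast
      have "dist (\<integral>x. \<psi> x \<partial>\<mu> t) (\<integral>x. \<psi> x \<partial>\<mu> s) < e" if "dist t s < d" for t
        using d(2)[of t] that \<psi> e'(2) unfolding dual_close_def dist_real_def by (meson order_le_less_trans)
      then show "\<exists>d>0. \<forall>t\<in>UNIV. dist t s < d \<longrightarrow> dist (\<integral>x. \<psi> x \<partial>\<mu> t) (\<integral>x. \<psi> x \<partial>\<mu> s) < e" using d(1) by blast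
    qed
  qed
  \<comment> \<open>Both the integrand and the measure depend on time: a change of the field costs
    \<open>Q * e'\<close>, a change of the measure \<open>K' * e'\<close>.\<close>
  have inth: "(\<lambda>s. \<integral>x. q x * (h s x \<bullet> b) \<partial>\<mu> s) \<in> borel_measurable borel" if q: "lipb K q" and b: "b \<in> Basis" for K q b
  proof (rule borel_measurable_continuous_onI)
    obtain Q where Q: "\<And>x. \<bar>q x\<bar> \<le> Q" using q by (auto simp: lipb_def)
    have Q0: "0 \<le> Q" using order_trans[OF abs_ge_zero Q] .
    show "continuous_on UNIV (\<lambda>s. \<integral>x. q x * (h s x \<bullet> b) \<partial>\<mu> s)" unfolding continuous_on_iff
    proof (intro ballI allI impI)
      fix s e :: real assume e: "0 < e"
      have lb: "\<exists>K. lipb K (\<lambda>x. q x * (h u x \<bullet> b))" for u by (rule lipb_mult[OF q lipb_inner[OF hL hB L b]])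
      then obtain K' where K': "lipb K' (\<lambda>x. q x * (h s x \<bullet> b))" by blast
      then have K0: "0 \<le> K'" by (simp add: lipb_def)
      define e' where "e' = e / (K' + Q + 1)"
      have e': "0 < e'" "(K' + Q) * e' < e" using e K0 Q0 by (auto simp: e'_def field_simps)
      obtain d where d: "d > 0" "\<And>t. \<bar>t - s\<bar> < d \<Longrightarrow> dual_close (\<mu> t) (\<mu> s) e' \<and> (\<forall>x. norm (h t x - h s x) \<le> e')"
        using small[OF e'(1)] by blast
      have "dist (\<integral>x. q x * (h t x \<bullet> b) \<partial>\<mu> t) (\<integral>x. q x * (h s x \<bullet> b) \<partial>\<mu> s) < e" if t: "dist t s < d" for t
      proof -
        have dt: "dual_close (\<mu> t) (\<mu> s) e'" "\<And>x. norm (h t x - h s x) \<le> e'" using d(2)[of t] t by (auto simp: dist_real_def)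
        interpret prob_space "\<mu> t" using \<mu>P by (rule PcD)
        have i: "integrable (\<mu> t) (\<lambda>x. q x * (h u x \<bullet> b))" for u using lb[of u] lipb_integrable[OF _ \<mu>P] by blast
        have "(\<integral>x. q x * (h t x \<bullet> b) \<partial>\<mu> t) - (\<integral>x. q x * (h s x \<bullet> b) \<partial>\<mu> t) = (\<integral>x. q x * ((h t x - h s x) \<bullet> b) \<partial>\<mu> t)"
          using i[of t] i[of s] by (simp add: inner_diff_left right_diff_distrib)
        also have "norm \<dots> \<le> Q * e'"
        proof (rule norm_integral_le[OF AE_I2])
          show "norm (q x * ((h t x - h s x) \<bullet> b)) \<le> Q * e'" for x
            unfolding norm_mult using Q order_trans[OF Basis_le_norm[OF b] dt(2)] Q0 by (intro mult_mono) auto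
        qed (use Q0 e' in simp)
        finally have 1: "\<bar>(\<integral>x. q x * (h t x \<bullet> b) \<partial>\<mu> t) - (\<integral>x. q x * (h s x \<bullet> b) \<partial>\<mu> t)\<bar> \<le> Q * e'" by simp
        have 2: "\<bar>(\<integral>x. q x * (h s x \<bullet> b) \<partial>\<mu> t) - (\<integral>x. q x * (h s x \<bullet> b) \<partial>\<mu> s)\<bar> \<le> K' * e'"
          using dt(1) K' unfolding dual_close_def by blast
        show ?thesis unfolding dist_real_def using 1 2 e'(2) by (simp add: distrib_right)
      qed
      then show "\<exists>d>0. \<forall>t\<in>UNIV. dist t s < d \<longrightarrow> dist (\<integral>x. q x * (h t x \<bullet> b) \<partial>\<mu> t) (\<integral>x. q x * (h s x \<bullet> b) \<partial>\<mu> s) < e"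
        using d(1) by blast
    qed
  qed
  interpret lin: linear_ce S \<theta> \<mu> w A "2 * C" "2 * L"
  proof
    show "\<mu> 0 = \<theta>" using \<nu>0 S by (simp add: \<mu>_def)
    show "(\<lambda>z. w (fst z) (snd z)) \<in> borel_measurable borel"
    proof -
      have f: "fst \<in> borel_measurable (borel :: (real \<times> (real^'n)) measure)"
        by (intro borel_measurable_continuous_onI continuous_intros)
      have [measurable]: "(\<lambda>z::real \<times> (real^'n). c (fst z) k) \<in> borel_measurable borel" for k
        by (rule measurable_compose[OF f ctrlD(1)[OF c]])
      have [measurable]: "(\<lambda>z::real \<times> (real^'n). F k (snd z)) \<in> borel_measurable borel" for k
        by (intro borel_measurable_continuous_onI continuous_on_compose2[OF F_continuous] continuous_intros) auto
      note borel_measurable_continuous_onI[OF hc, measurable]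
      show ?thesis unfolding w_def vel_def by measurable
    qed
    show "norm (w s x) \<le> 2 * C" for s x unfolding w_def by (rule vel_bound[OF c hB])
    show "norm (w s x - w s y) \<le> 2 * L * norm (x - y)" for s x y
      unfolding w_def using vel_diff[OF c, of s "h s" x "h s" y] hL[of s x y] by simp
    show "(w s has_derivative A s x) (at x)" for s x
      unfolding w_def vel_def[abs_def] A_def[abs_def]
      by (intro has_derivative_add has_derivative_sum has_derivative_scaleR_right Fd hd)
    show "(\<lambda>s. \<integral>x. q x * (w s x \<bullet> b) \<partial>\<mu> s) \<in> borel_measurable borel" if q: "lipb K q" and b: "b \<in> Basis" for q K b
    proof -
      have lF: "\<exists>K. lipb K (\<lambda>x. q x * (F k x \<bullet> b))" for k by (rule lipb_mult[OF q lipb_inner[OF FL FB L b]])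
      have lh: "\<exists>K. lipb K (\<lambda>x. q x * (h s x \<bullet> b))" for s by (rule lipb_mult[OF q lipb_inner[OF hL hB L b]])
      have "(\<integral>x. q x * (w s x \<bullet> b) \<partial>\<mu> s) = (\<Sum>k\<in>UNIV. c s k * (\<integral>x. q x * (F k x \<bullet> b) \<partial>\<mu> s)) + c s i0 * (\<integral>x. q x * (h s x \<bullet> b) \<partial>\<mu> s)" for s
      proof -
        have i: "integrable (\<mu> s) (\<lambda>x. q x * (F k x \<bullet> b))" "integrable (\<mu> s) (\<lambda>x. q x * (h s x \<bullet> b))" for k
          using lF lh lipb_integrable[OF _ \<mu>P] by blast+
        have "(\<integral>x. q x * (w s x \<bullet> b) \<partial>\<mu> s) = (\<integral>x. (\<Sum>k\<in>UNIV. c s k * (q x * (F k x \<bullet> b))) + c s i0 * (q x * (h s x \<bullet> b)) \<partial>\<mu> s)"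
          by (simp add: w_def vel_def inner_add_left inner_sum_left sum_distrib_left algebra_simps)
        then show ?thesis using i by simp
      qed
      then show ?thesis
        using lF intc inth[OF q b] ctrlD(1)[OF c] by (auto intro!: borel_measurable_add borel_measurable_sum borel_measurable_times)
    qed
    fix \<phi> :: "real \<times> (real^'n) \<Rightarrow> real" assume \<phi>: "test_function S \<phi>"
    have "(LINT s|lebesgue_on {0..S}. \<integral>x. frechet_derivative \<phi> (at (s, x)) (1, w s x) \<partial>\<mu> s)
        = (LINT s|lebesgue_on {0..S}. \<integral>x. frechet_derivative \<phi> (at (s, x)) (1, vel c s (conv g (\<nu> s)) x) \<partial>\<nu> s)"
      by (rule Bochner_Integration.integral_cong) (auto simp: w_def h_def \<mu>_def)
    also have "\<dots> = 0" using \<nu> \<phi> by (simp add: continuity_eq_def Let_def)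
    finally show "(LINT s|lebesgue_on {0..S}. \<integral>x. frechet_derivative \<phi> (at (s, x)) (1, w s x) \<partial>\<mu> s) = 0" .
  qed (use S \<mu>P \<mu>c in auto)
  \<comment> \<open>The derivative of the interaction field averages \<open>Jg (x - z)\<close> over
    the support of the measure. A ball common to all times yields a Lipschitz constant uniform in
    time.\<close>
  obtain R where R: "\<And>t. t \<in> {0..S} \<Longrightarrow> AE x in \<mu> t. norm x \<le> R" using lin.uniform_support by metis
  have R': "AE x in \<mu> t. norm x \<le> R" for t
    using R[OF clip_mem[OF S0], of t] unfolding \<mu>_def clip_id[OF clip_mem[OF S0]] .
  have A_lip: "\<exists>K. \<forall>s x y k. norm x \<le> r \<longrightarrow> norm y \<le> r \<longrightarrow> norm (A s x k - A s y k) \<le> K * norm (x - y) * norm k" for r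
  proof -
    obtain KF where KF: "\<And>i x y k. norm x \<le> r \<Longrightarrow> norm y \<le> r \<Longrightarrow> norm (JF i x *v k - JF i y *v k) \<le> KF i * norm (x - y) * norm k"
      using JFl[of r] by metis
    obtain Kg where Kg: "\<And>x y k. norm x \<le> r + R \<Longrightarrow> norm y \<le> r + R \<Longrightarrow> norm (Jg x *v k - Jg y *v k) \<le> Kg * norm (x - y) * norm k"
      using Jgl[of "r + R"] by blast
    define K where "K = Max (range KF)"
    have K: "KF i \<le> K" for i unfolding K_def by simp
    have "norm (A s x k - A s y k) \<le> (\<bar>K\<bar> + \<bar>Kg\<bar>) * norm (x - y) * norm k" if xy: "norm x \<le> r" "norm y \<le> r" for s x y k
    proof -
      interpret prob_space "\<mu> s" using \<mu>P by (rule PcD)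
      have "norm (\<Sum>i\<in>UNIV. c s i *\<^sub>R (JF i x *v k - JF i y *v k)) \<le> \<bar>K\<bar> * norm (x - y) * norm k"
      proof (rule ctrl_sum_le[OF c])
        fix i
        have "KF i * norm (x - y) * norm k \<le> \<bar>K\<bar> * norm (x - y) * norm k" using K[of i] by (intro mult_right_mono) auto
        with KF[OF xy, of i k] show "norm (JF i x *v k - JF i y *v k) \<le> \<bar>K\<bar> * norm (x - y) * norm k" by linarith
      qed
      moreover have "norm (c s i0 *\<^sub>R (DG s x k - DG s y k)) \<le> 1 * (\<bar>Kg\<bar> * norm (x - y) * norm k)"
        unfolding norm_scaleR
      proof (rule mult_mono[OF ctrl_abs_le[OF c]])
        have i: "integrable (\<mu> s) (\<lambda>z. Jg (x - z) *v k)" for x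
          by (rule integrable_const_bound[where B="L * norm k"])
             (use Jgb in \<open>auto simp: borel_measurable_Pc[OF \<mu>P] intro!: borel_measurable_continuous_onI continuous_on_compose2[OF Jgv] continuous_intros\<close>)
        have "DG s x k - DG s y k = (\<integral>z. Jg (x - z) *v k - Jg (y - z) *v k \<partial>\<mu> s)" unfolding DG_def using i by simp
        also have "norm \<dots> \<le> \<bar>Kg\<bar> * norm (x - y) * norm k"
        proof (rule norm_integral_le)
          show "AE z in \<mu> s. norm (Jg (x - z) *v k - Jg (y - z) *v k) \<le> \<bar>Kg\<bar> * norm (x - y) * norm k"
            using R'[of s]
          proof eventually_elim
            case (elim z)
            have "norm (x - z) \<le> r + R" "norm (y - z) \<le> r + R"
              using xy elim norm_triangle_ineq4[of x z] norm_triangle_ineq4[of y z] by auto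
            from Kg[OF this, of k] have "norm (Jg (x - z) *v k - Jg (y - z) *v k) \<le> Kg * norm (x - y) * norm k" by simp
            also have "\<dots> \<le> \<bar>Kg\<bar> * norm (x - y) * norm k" by (intro mult_right_mono) auto
            finally show ?case .
          qed
        qed simp
        finally show "norm (DG s x k - DG s y k) \<le> \<bar>Kg\<bar> * norm (x - y) * norm k" .
      qed auto
      moreover have "A s x k - A s y k = (\<Sum>i\<in>UNIV. c s i *\<^sub>R (JF i x *v k - JF i y *v k)) + c s i0 *\<^sub>R (DG s x k - DG s y k)"
        by (simp add: A_def sum_subtractf scaleR_diff_right)
      ultimately show ?thesis using norm_triangle_mono by (fastforce simp: distrib_right)
    qed
    then show ?thesis by blast
  qed
  obtain Y where Yc: "continuous_on UNIV (\<lambda>z. Y (fst z) (snd z))"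
    and Ye: "\<forall>s\<in>{0..S}. \<forall>x. Y s x = x + integral {0..s} (\<lambda>\<sigma>. w \<sigma> (Y \<sigma> x))" by (rule lin.flow_exists)
  have Y: "continuous_on UNIV (\<lambda>z. Y (fst z) (snd z))"
    "\<And>s x. s \<in> {0..S} \<Longrightarrow> Y s x = x + integral {0..s} (\<lambda>\<sigma>. w \<sigma> (Y \<sigma> x))" using Yc Ye by blast+
  have rep: "\<mu> s = distr \<theta> borel (Y s)" if "s \<in> {0..S}" for s
    using lin.flow_representation[OF Y A_lip that] by simp
  have "w \<sigma> (Y \<sigma> x) = vel c \<sigma> (force Y \<sigma>) (Y \<sigma> x)" if "\<sigma> \<in> {0..S}" for \<sigma> x
    unfolding w_def h_def rep[OF that] by (simp only: conv_distr[of Y \<sigma>, OF continuous_on_slices(1)[OF Y(1)]])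
  then have "integral {0..s} (\<lambda>\<sigma>. w \<sigma> (Y \<sigma> x)) = integral {0..s} (\<lambda>\<sigma>. vel c \<sigma> (force Y \<sigma>) (Y \<sigma> x))" if "s \<in> {0..S}" for s x
    by (intro Henstock_Kurzweil_Integration.integral_cong) (use that in auto)
  then have "flow c Y" unfolding flow_def using Y by auto
  then show thesis by (rule that) (use rep in \<open>simp add: \<mu>_def\<close>)
qed

end

section \<open>The costate\<close>

lemma has_integral_Pair:
  fixes f :: "real \<Rightarrow> 'a::euclidean_space" and h :: "real \<Rightarrow> 'b::euclidean_space"
  assumes "f integrable_on {s..t}" "h integrable_on {s..t}"
  shows "integral {s..t} (\<lambda>\<sigma>. (f \<sigma>, h \<sigma>)) = (integral {s..t} f, integral {s..t} h)"
proof -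
  have l: "bounded_linear (\<lambda>v::'a. (v, 0::'b))" "bounded_linear (\<lambda>v::'b. (0::'a, v))"
    by (intro bounded_linear_Pair bounded_linear_zero bounded_linear_ident)+
  have "((\<lambda>\<sigma>. (f \<sigma>, 0) + (0, h \<sigma>)) has_integral (integral {s..t} f, 0) + (0, integral {s..t} h)) {s..t}"
    using has_integral_add[OF has_integral_linear[OF integrable_integral[OF assms(1)] l(1)] has_integral_linear[OF integrable_integral[OF assms(2)] l(2)]]
    by (simp add: o_def)
  then show ?thesis by (intro integral_unique) simp
qed

lemma integral_reflect_ivl:
  fixes q :: "real \<Rightarrow> 'b::euclidean_space"
  assumes "q integrable_on {s..S}" "s \<le> S"
  shows "integral {0..S - s} (\<lambda>\<sigma>. q (S - \<sigma>)) = integral {s..S} q"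
proof -
  have "(\<lambda>x. S - x) ` {s..S} = {0..S - s}"
  proof -
    have "x \<in> (\<lambda>x. S - x) ` {s..S}" if "x \<in> {0..S - s}" for x
      by (rule image_eqI[of _ _ "S - x"]) (use that in auto)
    then show ?thesis by auto
  qed
  with has_integral_affinity[of q "integral {s..S} q" s S "-1" S] integrable_integral[OF assms(1)]
  have "((\<lambda>\<sigma>. q (S - \<sigma>)) has_integral integral {s..S} q) {0..S - s}" by simp
  then show ?thesis by (rule integral_unique)
qed

text \<open>The mean value inequality is applied on the ball around \<open>x\<close> through
  \<open>y\<close>, which lies in the ball of radius \<open>r\<close> where the derivative is
  Lipschitz.\<close>

lemma taylor_local:
  fixes \<phi> :: "'a::euclidean_space \<Rightarrow> 'b::euclidean_space"
  assumes d: "\<And>x. (\<phi> has_derivative \<phi>' x) (at x)"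
    and K: "\<And>x y h. norm x \<le> r \<Longrightarrow> norm y \<le> r \<Longrightarrow> norm (\<phi>' x h - \<phi>' y h) \<le> K * norm (x - y) * norm h"
    and xy: "norm x + norm (y - x) \<le> r" and K0: "0 \<le> K"
  shows "norm (\<phi> y - \<phi> x - \<phi>' x (y - x)) \<le> K * (norm (y - x))\<^sup>2"
proof -
  let ?\<chi> = "\<lambda>z. \<phi> z - \<phi>' x z"
  have lin: "bounded_linear (\<phi>' x)" using d by (rule has_derivative_bounded_linear)
  have "norm (?\<chi> y - ?\<chi> x) \<le> (K * norm (y - x)) * norm (y - x)"
  proof (rule differentiable_bound[where S="cball x (norm (y - x))" and f'="\<lambda>z h. \<phi>' z h - \<phi>' x h"])
    fix z assume z: "z \<in> cball x (norm (y - x))"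
    show "(?\<chi> has_derivative (\<lambda>h. \<phi>' z h - \<phi>' x h)) (at z within cball x (norm (y - x)))"
      by (intro has_derivative_diff has_derivative_at_withinI[OF d] bounded_linear_imp_has_derivative lin)
    have zr: "norm z \<le> r" "norm x \<le> r" "norm (z - x) \<le> norm (y - x)"
      using z xy norm_triangle_sub[of z x] order_trans[OF _ xy, of "norm x"] by (auto simp: dist_norm norm_minus_commute)
    show "onorm (\<lambda>h. \<phi>' z h - \<phi>' x h) \<le> K * norm (y - x)"
    proof (rule onorm_le)
      fix h
      have "norm (\<phi>' z h - \<phi>' x h) \<le> K * norm (z - x) * norm h" by (rule K[OF zr(1,2)])
      also have "\<dots> \<le> K * norm (y - x) * norm h" using zr(3) K0 by (intro mult_right_mono mult_left_mono) auto
      finally show "norm (\<phi>' z h - \<phi>' x h) \<le> K * norm (y - x) * norm h" .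
    qed
  qed (auto simp: dist_norm norm_minus_commute)
  moreover have "?\<chi> y - ?\<chi> x = \<phi> y - \<phi> x - \<phi>' x (y - x)"
    using linear_diff[OF bounded_linear.linear[OF lin], of y x] by simp
  ultimately show ?thesis by (simp add: power2_eq_square mult.assoc)
qed

text \<open>A matrix and its transpose have the same operator norm: the square of
  \<open>norm (p v* J)\<close> equals \<open>p \<bullet> (J *v (p v* J))\<close>.\<close>

lemma norm_vector_matrix_le:
  fixes J :: "real^'n^'n"
  assumes "\<And>h. norm (J *v h) \<le> L * norm h" shows "norm (p v* J) \<le> L * norm p"
proof (cases "p v* J = 0")
  case True
  have "0 \<le> L"
  proof -
    have "norm (axis undefined 1 :: real^'n) = 1" by (simp add: norm_axis_1)
    then show ?thesis using order_trans[OF norm_ge_zero assms[of "axis undefined 1"]] by simp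
  qed
  then show ?thesis using True by simp
next
  case False
  have "norm (p v* J) * norm (p v* J) = (p v* J) \<bullet> (p v* J)" by (simp add: power2_norm_eq_inner flip: power2_eq_square)
  also have "\<dots> = p \<bullet> (J *v (p v* J))" by (rule dot_lmul_matrix)
  also have "\<dots> \<le> norm p * norm (J *v (p v* J))" by (rule norm_cauchy_schwarz)
  also have "\<dots> \<le> norm p * (L * norm (p v* J))" by (intro mult_left_mono assms) auto
  finally have "norm (p v* J) * norm (p v* J) \<le> (L * norm p) * norm (p v* J)" by (simp add: mult_ac)
  then show ?thesis using False by simp
qed

lemma vector_matrix_diff: "(p - q) v* A = p v* A - q v* (A :: real^'n^'m)"
  by (simp add: vector_matrix_mult_def vec_eq_iff algebra_simps sum_subtractf)

locale mean_field_cost = mean_field F JF g Jg i0 \<theta> S C L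
  for F :: "'k::finite \<Rightarrow> real^'n \<Rightarrow> real^'n" and JF g Jg i0 \<theta> S C L +
  fixes l :: "real^'n \<Rightarrow> real" and Dl :: "real^'n \<Rightarrow> real^'n"
  assumes ld: "\<And>x. (l has_derivative (\<lambda>h. Dl x \<bullet> h)) (at x)" and Dlc: "continuous_on UNIV Dl"
    and DlB: "\<And>x. norm (Dl x) \<le> C" and lB: "\<And>x. \<bar>l x\<bar> \<le> C"
begin

interpretation \<theta>: prob_space \<theta> using \<theta> by (rule PcD)

text \<open>Up to its sign, the momentum component of \<open>vecH\<close> for the image of \<theta>
  under \<open>(X s, q)\<close>. It is the adjoint of the linearised velocity
  (\<open>adj_duality\<close>).\<close>

definition adj :: "(real \<Rightarrow> 'k \<Rightarrow> real) \<Rightarrow> (real \<Rightarrow> real^'n \<Rightarrow> real^'n) \<Rightarrow> (real^'n \<Rightarrow> real^'n) \<Rightarrow> real \<Rightarrow> real^'n \<Rightarrow> real^'n \<Rightarrow> real^'n" where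
  "adj c X q s y p = (\<Sum>k\<in>UNIV. c s k *\<^sub>R (p v* JF k y)) + c s i0 *\<^sub>R (\<integral>z. (p - q z) v* Jg (y - X s z) \<partial>\<theta>)"

definition costate :: "(real \<Rightarrow> 'k \<Rightarrow> real) \<Rightarrow> (real \<Rightarrow> real^'n \<Rightarrow> real^'n) \<Rightarrow> (real \<Rightarrow> real^'n \<Rightarrow> real^'n) \<Rightarrow> bool" where
  "costate c X P \<longleftrightarrow> continuous_on UNIV (\<lambda>z. P (fst z) (snd z)) \<and> (\<exists>B. \<forall>s x. norm (P s x) \<le> B) \<and>
     (\<forall>s\<in>{0..S}. \<forall>x. P s x = - Dl (X S x) + integral {s..S} (\<lambda>\<sigma>. adj c X (P \<sigma>) \<sigma> (X \<sigma> x) (P \<sigma> x)))"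

lemma JF_bound: "norm (JF k x *v h) \<le> L * norm h" by (rule lipschitz_has_derivative[OF Fd FL])
lemma Jg_bound: "norm (Jg x *v h) \<le> L * norm h" by (rule lipschitz_has_derivative[OF gd gL])
lemmas JF_bound' = norm_vector_matrix_le[OF JF_bound]
lemmas Jg_bound' = norm_vector_matrix_le[OF Jg_bound]

lemma adj_integrable:
  assumes X: "continuous_on UNIV (X s)" and q: "continuous_on UNIV q" "\<And>z. norm (q z) \<le> \<rho>"
  shows "integrable \<theta> (\<lambda>z. (p - q z) v* Jg (y - X s z))" "norm (\<integral>z. (p - q z) v* Jg (y - X s z) \<partial>\<theta>) \<le> L * (norm p + \<rho>)"
proof -
  have b: "norm ((p - q z) v* Jg (y - X s z)) \<le> L * (norm p + \<rho>)" for z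
    by (rule order_trans[OF Jg_bound']) (intro mult_left_mono L order_trans[OF norm_triangle_ineq4] add_mono order_refl q)
  show "integrable \<theta> (\<lambda>z. (p - q z) v* Jg (y - X s z))"
  proof (rule \<theta>.integrable_const_bound[where B="L * (norm p + \<rho>)"])
    show "(\<lambda>z. (p - q z) v* Jg (y - X s z)) \<in> borel_measurable \<theta>" unfolding bm_\<theta>
      by (intro borel_measurable_continuous_onI continuous_on_vector_matrix_mult continuous_on_compose2[OF Jgc] continuous_intros X q) auto
  qed (use b in auto)
  have "0 \<le> \<rho>" using order_trans[OF norm_ge_zero q(2)] .
  then show "norm (\<integral>z. (p - q z) v* Jg (y - X s z) \<partial>\<theta>) \<le> L * (norm p + \<rho>)"
    by (intro \<theta>.norm_integral_le AE_I2 b mult_nonneg_nonneg L) simp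
qed

lemma adj_bound:
  assumes c: "ctrl c" and X: "continuous_on UNIV (X s)" and q: "continuous_on UNIV q" "\<And>z. norm (q z) \<le> \<rho>" and p: "norm p \<le> \<rho>"
  shows "norm (adj c X q s y p) \<le> 3 * L * \<rho>"
proof -
  have \<rho>: "0 \<le> \<rho>" using order_trans[OF norm_ge_zero p] .
  have "norm (\<Sum>k\<in>UNIV. c s k *\<^sub>R (p v* JF k y)) \<le> L * \<rho>"
    by (rule ctrl_sum_le[OF c]) (rule order_trans[OF JF_bound'], intro mult_left_mono p L)
  moreover have "norm (c s i0 *\<^sub>R (\<integral>z. (p - q z) v* Jg (y - X s z) \<partial>\<theta>)) \<le> 1 * (L * (\<rho> + \<rho>))" unfolding norm_scaleR
  proof (rule mult_mono[OF ctrl_abs_le[OF c]])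
    show "norm (\<integral>z. (p - q z) v* Jg (y - X s z) \<partial>\<theta>) \<le> L * (\<rho> + \<rho>)"
      by (rule order_trans[OF adj_integrable(2)[where X=X and s=s, OF X q]]) (intro mult_left_mono add_mono p L order_refl)
  qed auto
  ultimately show ?thesis unfolding adj_def
    using norm_triangle_ineq[of "\<Sum>k\<in>UNIV. c s k *\<^sub>R (p v* JF k y)" "c s i0 *\<^sub>R (\<integral>z. (p - q z) v* Jg (y - X s z) \<partial>\<theta>)"] by simp
qed

text \<open>Linearity in the pair \<open>(q, p)\<close>, so that \<open>adj_bound\<close> doubles as
  a Lipschitz estimate.\<close>

lemma adj_diff:
  assumes X: "continuous_on UNIV (X s)" and q: "continuous_on UNIV q" "\<And>z. norm (q z) \<le> \<rho>"
    and q': "continuous_on UNIV q'" "\<And>z. norm (q' z) \<le> \<rho>'"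
  shows "adj c X q s y p - adj c X q' s y p' = adj c X (\<lambda>z. q z - q' z) s y (p - p')"
proof -
  have d: "(p - p' - (q z - q' z)) v* J = (p - q z) v* J - (p' - q' z) v* J" for z and J :: "real^'n^'n"
    unfolding vector_matrix_diff[symmetric] by (simp add: algebra_simps)
  have e: "(\<integral>z. (p - p' - (q z - q' z)) v* Jg (y - X s z) \<partial>\<theta>) = (\<integral>z. (p - q z) v* Jg (y - X s z) \<partial>\<theta>) - (\<integral>z. (p' - q' z) v* Jg (y - X s z) \<partial>\<theta>)"
    unfolding d
    by (rule Bochner_Integration.integral_diff[OF adj_integrable(1)[where X=X and s=s, OF X q] adj_integrable(1)[where X=X and s=s, OF X q']])
  show ?thesis unfolding adj_def e by (simp add: vector_matrix_diff scaleR_diff_right sum_subtractf)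
qed

lemma adj_continuous_parts:
  fixes X P :: "real \<Rightarrow> real^'n \<Rightarrow> real^'n"
  assumes X: "continuous_on UNIV (\<lambda>z. X (fst z) (snd z))" and P: "continuous_on UNIV (\<lambda>z. P (fst z) (snd z))"
    "\<And>s x. norm (P s x) \<le> \<rho>"
  shows "continuous_on UNIV (\<lambda>u. \<integral>z. (P (fst u) (snd u) - P (fst u) z) v* Jg (X (fst u) (snd u) - X (fst u) z) \<partial>\<theta>)"
    "continuous_on UNIV (\<lambda>u. P (fst u) (snd u) v* JF k (X (fst u) (snd u)))"
proof -
  note Xs = continuous_on_slices[OF X] and Ps = continuous_on_slices[OF P(1)]
  show "continuous_on UNIV (\<lambda>u. P (fst u) (snd u) v* JF k (X (fst u) (snd u)))"
    by (intro continuous_on_vector_matrix_mult P continuous_on_compose2[OF JFc X]) auto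
  show "continuous_on UNIV (\<lambda>u. \<integral>z. (P (fst u) (snd u) - P (fst u) z) v* Jg (X (fst u) (snd u) - X (fst u) z) \<partial>\<theta>)"
  proof (rule continuous_on_lebesgue_integral[OF \<theta>.finite_measure_axioms])
    show "(\<lambda>z. (P (fst u) (snd u) - P (fst u) z) v* Jg (X (fst u) (snd u) - X (fst u) z)) \<in> borel_measurable \<theta>" for u
      by (rule borel_measurable_integrable[OF adj_integrable(1)[where X=X, OF Xs(1) Ps(1) P(2)]])
    show "continuous_on UNIV (\<lambda>u. (P (fst u) (snd u) - P (fst u) z) v* Jg (X (fst u) (snd u) - X (fst u) z))" for z
      by (intro continuous_on_vector_matrix_mult continuous_on_diff P X continuous_on_compose2[OF Jgc]
          continuous_on_compose2[OF Ps(2)] continuous_on_compose2[OF Xs(2)] continuous_on_fst continuous_on_id) auto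
    show "norm ((P (fst u) (snd u) - P (fst u) z) v* Jg (X (fst u) (snd u) - X (fst u) z)) \<le> L * (\<rho> + \<rho>)" for u z
      by (rule order_trans[OF Jg_bound']) (intro mult_left_mono L order_trans[OF norm_triangle_ineq4] add_mono P)
  qed
qed

lemma adj_measurable:
  fixes X P :: "real \<Rightarrow> real^'n \<Rightarrow> real^'n"
  assumes c: "ctrl c" and X: "continuous_on UNIV (\<lambda>z. X (fst z) (snd z))" and P: "continuous_on UNIV (\<lambda>z. P (fst z) (snd z))"
    "\<And>s x. norm (P s x) \<le> \<rho>"
  shows "(\<lambda>z. adj c X (P (fst z)) (fst z) (X (fst z) (snd z)) (P (fst z) (snd z))) \<in> borel_measurable borel"
proof -
  have f: "fst \<in> borel_measurable (borel :: (real \<times> (real^'n)) measure)"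
    by (intro borel_measurable_continuous_onI continuous_intros)
  have [measurable]: "(\<lambda>z::real \<times> (real^'n). c (fst z) k) \<in> borel_measurable borel" for k
    by (rule measurable_compose[OF f ctrlD(1)[OF c]])
  note adj_continuous_parts[OF X P, THEN borel_measurable_continuous_onI, measurable]
  show ?thesis unfolding adj_def by measurable
qed

text \<open>Reversing time turns the terminal value into an initial one, and
  \<open>volterra_solution\<close> applies. The equation is linear but nonlocal: the costate at
  \<open>x\<close> involves the costates of all other particles through the integral over
  \<theta>.\<close>

lemma costate_exists:
  assumes c: "ctrl c" and X: "continuous_on UNIV (\<lambda>z. X (fst z) (snd z))"
  obtains P where "costate c X P"
proof -
  define c' where "c' s = c (S - s)" for s
  define X' where "X' s = X (S - s)" for s
  have c': "ctrl c'"
  proof -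
    have "(\<lambda>s. S - s) \<in> borel_measurable borel" by (intro borel_measurable_continuous_onI continuous_intros)
    then show ?thesis using measurable_compose[OF _ ctrlD(1)[OF c]] ctrlD(2)[OF c] unfolding ctrl_def c'_def by blast
  qed
  have X': "continuous_on UNIV (\<lambda>z. X' (fst z) (snd z))"
  proof -
    have "continuous_on UNIV (\<lambda>z::real \<times> (real^'n). (S - fst z, snd z))" by (intro continuous_intros)
    from continuous_on_compose2[OF X this] show ?thesis by (simp add: X'_def)
  qed
  note X's = continuous_on_slices[OF X']
  obtain U D where U: "continuous_on UNIV (\<lambda>z. U (fst z) (snd z))" "\<And>s x. norm (U s x) \<le> D"
    "\<And>s x. s \<in> {0..S} \<Longrightarrow> U s x = - Dl (X S x) + integral {0..s} (\<lambda>\<sigma>. adj c' X' (U \<sigma>) \<sigma> (X' \<sigma> x) (U \<sigma> x))"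
  proof (rule volterra_solution[of S "3 * L + 1" "\<lambda>x. - Dl (X S x)" C "\<lambda>\<sigma> v x. adj c' X' v \<sigma> (X' \<sigma> x) (v x)"])
    show "continuous_on UNIV (\<lambda>x. - Dl (X S x))"
      by (intro continuous_intros continuous_on_compose2[OF Dlc continuous_on_slices(1)[OF X]]) auto
    show "norm (- Dl (X S x)) \<le> C" for x using DlB by simp
  next
    fix U :: "real \<Rightarrow> real^'n \<Rightarrow> real^'n" and x :: "real^'n"
    assume U: "continuous_on UNIV (\<lambda>z. U (fst z) (snd z))" "\<exists>B. \<forall>s x. norm (U s x) \<le> B"
    then obtain B where B: "\<And>s x. norm (U s x) \<le> B" by blast
    show "(\<lambda>\<sigma>. adj c' X' (U \<sigma>) \<sigma> (X' \<sigma> x) (U \<sigma> x)) \<in> borel_measurable borel"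
      by (rule borel_measurable_slice[of "\<lambda>\<sigma> x. adj c' X' (U \<sigma>) \<sigma> (X' \<sigma> x) (U \<sigma> x)", OF adj_measurable[OF c' X' U(1) B]])
  next
    fix \<sigma> and v :: "real^'n \<Rightarrow> real^'n" assume v: "continuous_on UNIV v" and "\<exists>B. \<forall>y. norm (v y) \<le> B"
    then obtain B where B: "\<And>x. norm (v x) \<le> B" by blast
    have v': "continuous_on UNIV (\<lambda>z::real \<times> (real^'n). (\<lambda>s. v) (fst z) (snd z))"
      by (intro continuous_on_compose2[OF v] continuous_intros) auto
    show "continuous_on UNIV (\<lambda>x. adj c' X' v \<sigma> (X' \<sigma> x) (v x))"
      unfolding adj_def
      using continuous_on_slices(1)[of "\<lambda>s x. v x v* JF k (X' s x)" \<sigma> for k] continuous_on_slices(1)[of "\<lambda>s x. \<integral>z. (v x - v z) v* Jg (X' s x - X' s z) \<partial>\<theta>" \<sigma>]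
        adj_continuous_parts[OF X' v' B]
      by (intro continuous_intros) auto
  next
    fix \<rho>
    show "\<exists>B. \<forall>\<sigma> v x. continuous_on UNIV v \<longrightarrow> (\<forall>y. norm (v y) \<le> \<rho>) \<longrightarrow> norm (adj c' X' v \<sigma> (X' \<sigma> x) (v x)) \<le> B"
      using adj_bound[where X=X', OF c' X's(1)] by blast
  next
    fix \<sigma> and v v' :: "real^'n \<Rightarrow> real^'n" and x d
    assume v: "continuous_on UNIV v" "continuous_on UNIV v'" "\<exists>B. \<forall>y. norm (v y) \<le> B" "\<exists>B. \<forall>y. norm (v' y) \<le> B"
      and d: "\<And>y. norm (v y - v' y) \<le> d"
    obtain B B' where B: "\<And>y. norm (v y) \<le> B" "\<And>y. norm (v' y) \<le> B'" using v by blast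
    have "norm (adj c' X' v \<sigma> (X' \<sigma> x) (v x) - adj c' X' v' \<sigma> (X' \<sigma> x) (v' x)) \<le> 3 * L * d"
      unfolding adj_diff[where X=X' and s=\<sigma>, OF X's(1) v(1) B(1) v(2) B(2)]
      by (rule adj_bound[where X=X', OF c' X's(1)]) (use d in \<open>auto intro!: continuous_intros v\<close>)
    also have "\<dots> \<le> (3 * L + 1) * d" using order_trans[OF norm_ge_zero d] by (simp add: algebra_simps)
    finally show "norm (adj c' X' v \<sigma> (X' \<sigma> x) (v x) - adj c' X' v' \<sigma> (X' \<sigma> x) (v' x)) \<le> (3 * L + 1) * d" .
  qed (use S L in auto)
  define P where "P s = U (S - s)" for s
  have Pc: "continuous_on UNIV (\<lambda>z. P (fst z) (snd z))"
  proof -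
    have "continuous_on UNIV (\<lambda>z::real \<times> (real^'n). (S - fst z, snd z))" by (intro continuous_intros)
    from continuous_on_compose2[OF U(1) this] show ?thesis by (simp add: P_def)
  qed
  have Pb: "norm (P s x) \<le> D" for s x using U(2) by (simp add: P_def)
  have "P s x = - Dl (X S x) + integral {s..S} (\<lambda>\<sigma>. adj c X (P \<sigma>) \<sigma> (X \<sigma> x) (P \<sigma> x))" if s: "s \<in> {0..S}" for s x
  proof -
    let ?q = "\<lambda>\<sigma>. adj c X (P \<sigma>) \<sigma> (X \<sigma> x) (P \<sigma> x)"
    have m: "?q \<in> borel_measurable borel"
      by (rule borel_measurable_slice[of "\<lambda>\<sigma> x. adj c X (P \<sigma>) \<sigma> (X \<sigma> x) (P \<sigma> x)", OF adj_measurable[OF c X Pc Pb]])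
    have i: "?q integrable_on {s..S}"
      by (rule integrable_on_bounded_measurable[OF m adj_bound[where X=X, OF c continuous_on_slices(1)[OF X] continuous_on_slices(1)[OF Pc] Pb Pb]])
    have "P s x = - Dl (X S x) + integral {0..S - s} (\<lambda>\<sigma>. adj c' X' (U \<sigma>) \<sigma> (X' \<sigma> x) (U \<sigma> x))"
      unfolding P_def by (rule U(3)) (use s in auto)
    also have "integral {0..S - s} (\<lambda>\<sigma>. adj c' X' (U \<sigma>) \<sigma> (X' \<sigma> x) (U \<sigma> x)) = integral {0..S - s} (\<lambda>\<sigma>. ?q (S - \<sigma>))"
      by (simp add: P_def c'_def X'_def adj_def)
    also have "\<dots> = integral {s..S} ?q" by (rule integral_reflect_ivl[OF i]) (use s in auto)
    finally show ?thesis .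
  qed
  then have "costate c X P" unfolding costate_def using Pc Pb by blast
  then show thesis by (rule that)
qed

lemma costateD:
  assumes "costate c X P"
  shows "continuous_on UNIV (\<lambda>z. P (fst z) (snd z))" "\<exists>B. \<forall>s x. norm (P s x) \<le> B"
    "s \<in> {0..S} \<Longrightarrow> P s x = - Dl (X S x) + integral {s..S} (\<lambda>\<sigma>. adj c X (P \<sigma>) \<sigma> (X \<sigma> x) (P \<sigma> x))"
    "P S x = - Dl (X S x)"
  using assms S unfolding costate_def by force+

lemma costate_forward:
  assumes c: "ctrl c" and X: "flow c X" and P: "costate c X P" and s: "s \<in> {0..S}"
  shows "P s x = P 0 x + integral {0..s} (\<lambda>\<sigma>. - adj c X (P \<sigma>) \<sigma> (X \<sigma> x) (P \<sigma> x))"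
proof -
  obtain D where Pb: "\<And>s x. norm (P s x) \<le> D" using costateD(2)[OF P] by blast
  note Xc = flowD(1)[OF X] and Pc = costateD(1)[OF P]
  let ?q = "\<lambda>\<sigma>. adj c X (P \<sigma>) \<sigma> (X \<sigma> x) (P \<sigma> x)"
  have m: "?q \<in> borel_measurable borel"
    by (rule borel_measurable_slice[of "\<lambda>\<sigma> x. adj c X (P \<sigma>) \<sigma> (X \<sigma> x) (P \<sigma> x)", OF adj_measurable[OF c Xc Pc Pb]])
  have i: "?q integrable_on {0..S}"
    by (rule integrable_on_bounded_measurable[OF m adj_bound[where X=X, OF c continuous_on_slices(1)[OF Xc] continuous_on_slices(1)[OF Pc] Pb Pb]])
  have "integral {0..s} ?q + integral {s..S} ?q = integral {0..S} ?q"
    by (rule Henstock_Kurzweil_Integration.integral_combine) (use s i in auto)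
  then have "P s x - P 0 x = - integral {0..s} ?q"
    using costateD(3)[OF P s, of x] costateD(3)[OF P, of 0 x] S by (simp flip: \<open>_ + _ = _\<close>)
  then show ?thesis by (simp add: algebra_simps)
qed

text \<open>The paths \<open>(X, P)\<close> are Lagrangian paths in phase space. What needs work is
  measurability of the field on the whole phase space, beyond the paths.\<close>

lemma Hamiltonian_trajectory:
  assumes c: "ctrl c" and X: "flow c X" and P: "costate c X P"
  shows "continuity_eq S (\<lambda>s (y, p). (vel c s (force X s) y, - adj c X (P s) s y p)) (\<lambda>s. distr \<theta> borel (\<lambda>x. (X s x, P s x)))"
proof -
  obtain D where Pb: "\<And>s x. norm (P s x) \<le> D" using costateD(2)[OF P] by blast
  note Xc = flowD(1)[OF X] and Pc = costateD(1)[OF P]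
  note Xs = continuous_on_slices[OF Xc] and Ps = continuous_on_slices[OF Pc]
  let ?v = "\<lambda>s x. vel c s (force X s) (X s x)" and ?a = "\<lambda>s x. adj c X (P s) s (X s x) (P s x)"
  have vB: "norm (?v s x) \<le> 2 * C" for s x by (rule vel_bound[OF c force_bound])
  have aB: "norm (?a s x) \<le> 3 * L * D" for s x by (rule adj_bound[where X=X, OF c Xs(1) Ps(1) Pb Pb])
  have vm: "(\<lambda>z. ?v (fst z) (snd z)) \<in> borel_measurable borel" by (rule vel_flow_measurable[OF c Xc])
  have am: "(\<lambda>z. - ?a (fst z) (snd z)) \<in> borel_measurable borel"
    by (intro borel_measurable_uminus adj_measurable[OF c Xc Pc Pb])
  show ?thesis
  proof (rule continuity_eq_Lagrangian[OF \<theta> S, where V="\<lambda>s x. (?v s x, - ?a s x)" and B="2 * C + 3 * L * D"])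
    show "continuous_on UNIV (\<lambda>z. (X (fst z) (snd z), P (fst z) (snd z)))" by (rule continuous_on_Pair[OF Xc Pc])
    show "(\<lambda>z. (?v (fst z) (snd z), - ?a (fst z) (snd z))) \<in> borel_measurable borel"
      unfolding borel_prod[symmetric] by (rule measurable_Pair[OF vm am, unfolded borel_prod[symmetric]])
    show "norm (?v s x, - ?a s x) \<le> 2 * C + 3 * L * D" for s x
      using norm_Pair_le[of "?v s x" "- ?a s x"] vB[of s x] aB[of s x] by simp
    show "(X s x, P s x) = (X 0 x, P 0 x) + integral {0..s} (\<lambda>\<sigma>. (?v \<sigma> x, - ?a \<sigma> x))" if s: "s \<in> {0..S}" for s x
    proof -
      have "(\<lambda>\<sigma>. ?v \<sigma> x) integrable_on {0..s}"
        by (rule integrable_on_bounded_measurable[OF borel_measurable_slice[of ?v, OF vm] vB])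
      moreover have "(\<lambda>\<sigma>. - ?a \<sigma> x) integrable_on {0..s}"
        by (rule integrable_on_bounded_measurable[where B="3 * L * D", OF borel_measurable_slice[of "\<lambda>s x. - ?a s x", OF am]]) (simp add: aB)
      ultimately have "integral {0..s} (\<lambda>\<sigma>. (?v \<sigma> x, - ?a \<sigma> x)) = (integral {0..s} (\<lambda>\<sigma>. ?v \<sigma> x), integral {0..s} (\<lambda>\<sigma>. - ?a \<sigma> x))"
        by (rule has_integral_Pair)
      then show ?thesis using flowD(2)[OF X s] flowD(3)[OF X] costate_forward[OF c X P s, of x] by simp
    qed
    show "(\<lambda>(y, p). (vel c s (force X s) y, - adj c X (P s) s y p)) \<in> borel_measurable borel" for s
    proof -
      have "continuous_on UNIV (\<lambda>z. \<integral>x. (snd z - P s x) v* Jg (fst z - X s x) \<partial>\<theta>)"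
      proof -
        \<comment> \<open>The momentum variable is unbounded, so there is no uniform bound for
          dominated convergence. The part linear in the momentum is split off and expanded in the
          basis, which takes the momentum out of the integral.\<close>
        have "continuous_on (UNIV :: ((real^'n) \<times> (real^'n)) set) (\<lambda>z. (\<integral>x. snd z v* Jg (fst z - X s x) \<partial>\<theta>) - (\<integral>x. P s x v* Jg (fst z - X s x) \<partial>\<theta>))"
        proof (intro continuous_on_diff)
          have 1: "integrable \<theta> (\<lambda>x. p v* Jg (y - X s x))" for p y
            using adj_integrable(1)[where X=X and s=s and q="\<lambda>_. 0" and \<rho>=0 and p=p and y=y, OF Xs(1)] by simp
          have e: "(\<integral>x. p v* Jg (y - X s x) \<partial>\<theta>) = (\<Sum>b\<in>Basis. (p \<bullet> b) *\<^sub>R (\<integral>x. b v* Jg (y - X s x) \<partial>\<theta>))" for p y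
          proof -
            have "p v* J = (\<Sum>b\<in>Basis. (p \<bullet> b) *\<^sub>R (b v* J))" for J :: "real^'n^'n"
              by (rule linear_euclidean_sum[where A="\<lambda>p. p v* J"])
                 (auto intro!: linearI simp: vector_matrix_left_distrib scaleR_vector_matrix_assoc)
            then have "(\<integral>x. p v* Jg (y - X s x) \<partial>\<theta>) = (\<integral>x. (\<Sum>b\<in>Basis. (p \<bullet> b) *\<^sub>R (b v* Jg (y - X s x))) \<partial>\<theta>)" by presburger
            then show ?thesis using 1 by simp
          qed
          have cb: "continuous_on UNIV (\<lambda>z::(real^'n) \<times> (real^'n). \<integral>x. b v* Jg (fst z - X s x) \<partial>\<theta>)" for b
          proof (rule continuous_on_lebesgue_integral[OF \<theta>.finite_measure_axioms])
            show "norm (b v* Jg (fst u - X s z)) \<le> L * norm b" for u :: "(real^'n) \<times> (real^'n)" and z by (rule Jg_bound')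
          qed (use 1 in \<open>auto intro!: continuous_on_vector_matrix_mult continuous_on_compose2[OF Jgc] continuous_intros\<close>)
          show "continuous_on (UNIV :: ((real^'n) \<times> (real^'n)) set) (\<lambda>z. \<integral>x. snd z v* Jg (fst z - X s x) \<partial>\<theta>)"
            by (subst e) (intro continuous_intros cb)
          show "continuous_on (UNIV :: ((real^'n) \<times> (real^'n)) set) (\<lambda>z. \<integral>x. P s x v* Jg (fst z - X s x) \<partial>\<theta>)"
          proof (rule continuous_on_lebesgue_integral[OF \<theta>.finite_measure_axioms])
            show "(\<lambda>x. P s x v* Jg (fst u - X s x)) \<in> borel_measurable \<theta>" for u :: "(real^'n) \<times> (real^'n)" unfolding bm_\<theta>
              by (intro borel_measurable_continuous_onI continuous_on_vector_matrix_mult continuous_on_compose2[OF Jgc] continuous_intros Xs Ps) auto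
            show "norm (P s x v* Jg (fst u - X s x)) \<le> L * D" for u :: "(real^'n) \<times> (real^'n)" and x
              by (rule order_trans[OF Jg_bound']) (intro mult_left_mono Pb L)
          qed (auto intro!: continuous_on_vector_matrix_mult continuous_on_compose2[OF Jgc] continuous_intros)
        qed
        moreover have "(\<integral>x. snd z v* Jg (fst z - X s x) \<partial>\<theta>) - (\<integral>x. P s x v* Jg (fst z - X s x) \<partial>\<theta>) = (\<integral>x. (snd z - P s x) v* Jg (fst z - X s x) \<partial>\<theta>)" for z
        proof -
          have i: "integrable \<theta> (\<lambda>x. snd z v* Jg (fst z - X s x))"
            using adj_integrable(1)[where X=X and s=s and q="\<lambda>_. 0" and \<rho>=0 and p="snd z" and y="fst z", OF Xs(1)] by simp
          have i': "integrable \<theta> (\<lambda>x. P s x v* Jg (fst z - X s x))"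
          proof -
            have "integrable \<theta> (\<lambda>x. - ((0 - P s x) v* Jg (fst z - X s x)))"
              by (rule Bochner_Integration.integrable_minus[OF adj_integrable(1)[where X=X, OF Xs(1) Ps(1) Pb]])
            moreover have "- ((0 - p) v* J) = p v* J" for p and J :: "real^'n^'n" by (simp only: vector_matrix_diff) simp
            ultimately show ?thesis by (simp only:)
          qed
          show ?thesis unfolding vector_matrix_diff by (rule Bochner_Integration.integral_diff[OF i i', symmetric])
        qed
        ultimately show ?thesis by simp
      qed
      then have "continuous_on UNIV (\<lambda>z. (vel c s (force X s) (fst z), - adj c X (P s) s (fst z) (snd z)))"
        unfolding vel_def adj_def
        by (intro continuous_on_Pair continuous_intros continuous_on_compose2[OF F_continuous] continuous_on_vector_matrix_mult
            continuous_on_compose2[OF JFc] continuous_on_compose2[OF continuous_on_slices(1)[OF force_continuous[OF Xc]]]) auto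
      then show ?thesis by (intro borel_measurable_continuous_onI) (simp add: case_prod_beta')
    qed
  qed auto
qed

end

section \<open>First variation of the cost\<close>

definition mix :: "real \<Rightarrow> (real \<Rightarrow> 'k \<Rightarrow> real) \<Rightarrow> (real \<Rightarrow> 'k \<Rightarrow> real) \<Rightarrow> real \<Rightarrow> 'k \<Rightarrow> real" where
  "mix \<epsilon> c c' s k = c s k + \<epsilon> * (c' s k - c s k)"

context mean_field_cost
begin

interpretation \<theta>: prob_space \<theta> using \<theta> by (rule PcD)

lemma ctrl_mix:
  assumes c: "ctrl c" "ctrl c'" and \<epsilon>: "0 \<le> \<epsilon>" "\<epsilon> \<le> 1" shows "ctrl (mix \<epsilon> c c')"
proof -
  note [measurable] = ctrlD(1)[OF c(1)] ctrlD(1)[OF c(2)]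
  have "(\<Sum>k\<in>UNIV. \<bar>mix \<epsilon> c c' s k\<bar>) \<le> 1" for s
  proof -
    have "(\<Sum>k\<in>UNIV. \<bar>mix \<epsilon> c c' s k\<bar>) \<le> (\<Sum>k\<in>UNIV. (1 - \<epsilon>) * \<bar>c s k\<bar> + \<epsilon> * \<bar>c' s k\<bar>)"
    proof (rule sum_mono)
      fix k
      have "mix \<epsilon> c c' s k = (1 - \<epsilon>) * c s k + \<epsilon> * c' s k" by (simp add: mix_def algebra_simps)
      then show "\<bar>mix \<epsilon> c c' s k\<bar> \<le> (1 - \<epsilon>) * \<bar>c s k\<bar> + \<epsilon> * \<bar>c' s k\<bar>"
        using abs_triangle_ineq[of "(1 - \<epsilon>) * c s k" "\<epsilon> * c' s k"] \<epsilon> by (simp add: abs_mult)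
    qed
    also have "\<dots> = (1 - \<epsilon>) * (\<Sum>k\<in>UNIV. \<bar>c s k\<bar>) + \<epsilon> * (\<Sum>k\<in>UNIV. \<bar>c' s k\<bar>)"
      by (simp add: sum.distrib sum_distrib_left)
    also have "\<dots> \<le> (1 - \<epsilon>) * 1 + \<epsilon> * 1"
      using \<epsilon> ctrlD(2)[OF c(1)] ctrlD(2)[OF c(2)] by (intro add_mono mult_left_mono) auto
    finally show ?thesis by simp
  qed
  then show ?thesis unfolding ctrl_def mix_def[abs_def] by auto
qed

lemma vel_mix: "vel (mix \<epsilon> c c') s G x = vel c s G x + \<epsilon> *\<^sub>R (vel c' s G x - vel c s G x)"
proof -
  have "(\<Sum>k\<in>UNIV. mix \<epsilon> c c' s k *\<^sub>R F k x) = (\<Sum>k\<in>UNIV. c s k *\<^sub>R F k x) + \<epsilon> *\<^sub>R ((\<Sum>k\<in>UNIV. c' s k *\<^sub>R F k x) - (\<Sum>k\<in>UNIV. c s k *\<^sub>R F k x))"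
    unfolding mix_def sum_subtractf[symmetric] scaleR_sum_right sum.distrib[symmetric]
    by (simp add: algebra_simps)
  then show ?thesis unfolding vel_def by (simp add: mix_def algebra_simps)
qed

text \<open>Differentiation of \<open>godd\<close>. This symmetry lets the two particles be
  exchanged in \<open>adj_duality\<close>.\<close>

lemma Jg_even: "Jg (- x) = Jg x"
proof -
  have "((\<lambda>x. g (- x)) has_derivative (\<lambda>h. Jg (- x) *v (- h))) (at x)"
    by (rule has_derivative_compose[where f="\<lambda>x. - x" and f'="\<lambda>h. - h", OF _ gd]) (auto intro!: derivative_eq_intros)
  moreover have "((\<lambda>x. g (- x)) has_derivative (\<lambda>h. - (Jg x *v h))) (at x)"
    unfolding godd by (intro has_derivative_minus gd)
  ultimately have "(\<lambda>h. Jg (- x) *v (- h)) = (\<lambda>h. - (Jg x *v h))" by (rule has_derivative_unique)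
  moreover have "A *v (- h) = - (A *v h)" for A :: "real^'n^'n" and h by (rule linear_neg[OF matrix_vector_mul_linear])
  ultimately have "Jg (- x) *v h = Jg x *v h" for h by (metis neg_equal_iff_equal)
  then show ?thesis by (simp add: matrix_eq)
qed

lemma Fubini_\<theta>:
  fixes h :: "real^'n \<Rightarrow> real^'n \<Rightarrow> real"
  assumes h: "continuous_on UNIV (\<lambda>z. h (fst z) (snd z))" "\<And>x z. \<bar>h x z\<bar> \<le> B"
  shows "(\<integral>x. \<integral>z. h x z \<partial>\<theta> \<partial>\<theta>) = (\<integral>z. \<integral>x. h x z \<partial>\<theta> \<partial>\<theta>)"
proof -
  interpret P: pair_sigma_finite \<theta> \<theta> ..
  interpret PF: finite_measure "\<theta> \<Otimes>\<^sub>M \<theta>"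
    by (rule finite_measure_pair_measure) (rule \<theta>.finite_measure_axioms)+
  have eqm: "borel_measurable (\<theta> \<Otimes>\<^sub>M \<theta>) = (borel_measurable borel :: ((real^'n) \<times> (real^'n) \<Rightarrow> real) set)"
    by (rule measurable_cong_sets) (auto simp: borel_prod[symmetric] PcD(2)[OF \<theta>] cong: sets_pair_measure_cong)
  have "integrable (\<theta> \<Otimes>\<^sub>M \<theta>) (case_prod h)"
    by (rule PF.integrable_const_bound[where B=B])
       (use h in \<open>auto simp: eqm case_prod_beta' intro!: borel_measurable_continuous_onI\<close>)
  from P.Fubini_integral[OF this] show ?thesis by simp
qed

text \<open>In the interaction term the displacement \<open>d z\<close> of the other particle has to
  become a displacement at the integration point. Fubini exchanges the two particles, and evenness
  of \<open>Jg\<close> restores its argument; this is where the difference \<open>p x - p z\<close>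
  comes from.\<close>

lemma adj_duality:
  assumes X: "continuous_on UNIV (X s)" and p: "continuous_on UNIV p" "\<And>x. norm (p x) \<le> \<rho>"
    and d: "continuous_on UNIV d" "\<And>x. norm (d x) \<le> \<delta>"
  shows "(\<integral>x. p x \<bullet> ((\<Sum>k\<in>UNIV. c s k *\<^sub>R (JF k (X s x) *v d x)) + c s i0 *\<^sub>R (\<integral>z. Jg (X s x - X s z) *v (d x - d z) \<partial>\<theta>)) \<partial>\<theta>)
    = (\<integral>x. adj c X p s (X s x) (p x) \<bullet> d x \<partial>\<theta>)"
proof -
  have nn: "0 \<le> \<rho>" "0 \<le> \<delta>" using order_trans[OF norm_ge_zero p(2)] order_trans[OF norm_ge_zero d(2)] by auto
  \<comment> \<open>The interaction paired with \<open>p x\<close> is split into the part moved by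
    the other particle, \<open>f\<close>, and the part moved by the particle itself,
    \<open>e\<close>. Only \<open>f\<close> has its arguments exchanged.\<close>
  define f where "f x z = p x \<bullet> (Jg (X s x - X s z) *v d z)" for x z
  define e where "e x z = p x \<bullet> (Jg (X s x - X s z) *v d x)" for x z
  have xc: "continuous_on UNIV (\<lambda>z::(real^'n) \<times> (real^'n). X s (fst z))" "continuous_on UNIV (\<lambda>z::(real^'n) \<times> (real^'n). X s (snd z))"
    by (intro continuous_on_compose2[OF X] continuous_intros; simp)+
  have fc: "continuous_on UNIV (\<lambda>z. f (fst z) (snd z))" "continuous_on UNIV (\<lambda>z. e (fst z) (snd z))"
    unfolding f_def e_def
    by (intro continuous_on_inner continuous_on_matrix_vector_mult continuous_on_compose2[OF Jgc] continuous_on_diff xc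
        continuous_on_compose2[OF p(1)] continuous_on_compose2[OF d(1)] continuous_on_fst continuous_on_snd continuous_on_id; simp)+
  have b: "\<bar>p x \<bullet> (Jg y *v d z)\<bar> \<le> \<rho> * (L * \<delta>)" for x y z
  proof -
    have "\<bar>p x \<bullet> (Jg y *v d z)\<bar> \<le> norm (p x) * norm (Jg y *v d z)" by (rule Cauchy_Schwarz_ineq2)
    also have "\<dots> \<le> \<rho> * (L * \<delta>)"
      by (intro mult_mono p order_trans[OF Jg_bound] mult_left_mono d L nn norm_ge_zero order_refl)
    finally show ?thesis .
  qed
  have fb: "\<bar>f x z\<bar> \<le> \<rho> * (L * \<delta>)" "\<bar>e x z\<bar> \<le> \<rho> * (L * \<delta>)" for x z unfolding f_def e_def by (rule b)+
  have slice: "continuous_on UNIV (h x)" "continuous_on UNIV (\<lambda>x. h x z)" if "continuous_on UNIV (\<lambda>z. h (fst z) (snd z))" for h :: "real^'n \<Rightarrow> real^'n \<Rightarrow> real" and x z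
  proof -
    have "continuous_on UNIV (\<lambda>y::real^'n. (x, y))" "continuous_on UNIV (\<lambda>y::real^'n. (y, z))"
      by (intro continuous_on_Pair continuous_on_id continuous_on_const)+
    from this[THEN continuous_on_compose2[OF that]] show "continuous_on UNIV (h x)" "continuous_on UNIV (\<lambda>x. h x z)" by simp_all
  qed
  have i1: "integrable \<theta> (h x)" "integrable \<theta> (\<lambda>x. h x z)" "integrable \<theta> (\<lambda>x. \<integral>z. h x z \<partial>\<theta>)" "integrable \<theta> (\<lambda>z. \<integral>x. h x z \<partial>\<theta>)"
    if h: "continuous_on UNIV (\<lambda>z. h (fst z) (snd z))" "\<And>x z. \<bar>h x z\<bar> \<le> \<rho> * (L * \<delta>)" for h x z
  proof -
    have B0: "0 \<le> \<rho> * (L * \<delta>)" using nn L by simp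
    have m: "h x \<in> borel_measurable \<theta>" "(\<lambda>x. h x z) \<in> borel_measurable \<theta>" for x z
      unfolding bm_\<theta> by (rule borel_measurable_continuous_onI, rule slice[OF h(1)])+
    show "integrable \<theta> (h x)" "integrable \<theta> (\<lambda>x. h x z)" by (rule \<theta>.integrable_const_bound[where B="\<rho> * (L * \<delta>)"]; use h m in auto)+
    have "continuous_on UNIV (\<lambda>x. \<integral>z. h x z \<partial>\<theta>)" "continuous_on UNIV (\<lambda>z. \<integral>x. h x z \<partial>\<theta>)"
      by (rule continuous_on_lebesgue_integral[OF \<theta>.finite_measure_axioms, where B="\<rho> * (L * \<delta>)"]; use h m slice[OF h(1)] in auto)+
    moreover have "norm (\<integral>z. h x z \<partial>\<theta>) \<le> \<rho> * (L * \<delta>)" "norm (\<integral>x. h x z \<partial>\<theta>) \<le> \<rho> * (L * \<delta>)" for x z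
      by (rule \<theta>.norm_integral_le; use h B0 in auto)+
    ultimately show "integrable \<theta> (\<lambda>x. \<integral>z. h x z \<partial>\<theta>)" "integrable \<theta> (\<lambda>z. \<integral>x. h x z \<partial>\<theta>)"
      by (intro \<theta>.integrable_const_bound[where B="\<rho> * (L * \<delta>)"]; auto simp: bm_\<theta> intro!: borel_measurable_continuous_onI)+
  qed
  note fi = i1[OF fc(1) fb(1)] and ei = i1[OF fc(2) fb(2)]
  have iv: "integrable \<theta> (\<lambda>z. Jg (X s x - X s z) *v (d x - d z))" for x
  proof (rule \<theta>.integrable_const_bound[where B="L * (\<delta> + \<delta>)"])
    show "AE z in \<theta>. norm (Jg (X s x - X s z) *v (d x - d z)) \<le> L * (\<delta> + \<delta>)"
      by (rule AE_I2, rule order_trans[OF Jg_bound]) (intro mult_left_mono L order_trans[OF norm_triangle_ineq4] add_mono d)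
    show "(\<lambda>z. Jg (X s x - X s z) *v (d x - d z)) \<in> borel_measurable \<theta>" unfolding bm_\<theta>
      by (intro borel_measurable_continuous_onI continuous_on_matrix_vector_mult continuous_on_compose2[OF Jgc] continuous_intros X d) auto
  qed
  have lhs: "p x \<bullet> (\<integral>z. Jg (X s x - X s z) *v (d x - d z) \<partial>\<theta>) = (\<integral>z. e x z \<partial>\<theta>) - (\<integral>z. f x z \<partial>\<theta>)" for x
  proof -
    have "p x \<bullet> (\<integral>z. Jg (X s x - X s z) *v (d x - d z) \<partial>\<theta>) = (\<integral>z. p x \<bullet> (Jg (X s x - X s z) *v (d x - d z)) \<partial>\<theta>)"
      by (rule integral_inner_right[symmetric]) (rule iv)
    also have "\<dots> = (\<integral>z. e x z - f x z \<partial>\<theta>)"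
      by (simp add: e_def f_def matrix_vector_mult_diff_distrib inner_diff_right)
    also have "\<dots> = (\<integral>z. e x z \<partial>\<theta>) - (\<integral>z. f x z \<partial>\<theta>)" by (rule Bochner_Integration.integral_diff[OF ei(1) fi(1)])
    finally show ?thesis .
  qed
  have rhs: "(\<integral>z. (p x - p z) v* Jg (X s x - X s z) \<partial>\<theta>) \<bullet> d x = (\<integral>z. e x z \<partial>\<theta>) - (\<integral>z. f z x \<partial>\<theta>)" for x
  proof -
    have "(\<integral>z. (p x - p z) v* Jg (X s x - X s z) \<partial>\<theta>) \<bullet> d x = (\<integral>z. ((p x - p z) v* Jg (X s x - X s z)) \<bullet> d x \<partial>\<theta>)"
      by (rule integral_inner_left[symmetric]) (rule adj_integrable(1)[where X=X, OF X p])
    also have "\<dots> = (\<integral>z. e x z - f z x \<partial>\<theta>)"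
    proof (rule Bochner_Integration.integral_cong[OF refl])
      fix z
      have "Jg (X s z - X s x) = Jg (X s x - X s z)" using Jg_even[of "X s x - X s z"] by simp
      then show "((p x - p z) v* Jg (X s x - X s z)) \<bullet> d x = e x z - f z x"
        by (simp add: e_def f_def dot_lmul_matrix inner_diff_left)
    qed
    also have "\<dots> = (\<integral>z. e x z \<partial>\<theta>) - (\<integral>z. f z x \<partial>\<theta>)" by (rule Bochner_Integration.integral_diff[OF ei(1) fi(2)])
    finally show ?thesis .
  qed
  have Fi: "integrable \<theta> (\<lambda>x. p x \<bullet> (JF k (X s x) *v d x))" for k
  proof (rule \<theta>.integrable_const_bound[where B="\<rho> * (L * \<delta>)"])
    show "AE x in \<theta>. norm (p x \<bullet> (JF k (X s x) *v d x)) \<le> \<rho> * (L * \<delta>)"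
    proof (rule AE_I2)
      fix x
      have "\<bar>p x \<bullet> (JF k (X s x) *v d x)\<bar> \<le> norm (p x) * norm (JF k (X s x) *v d x)" by (rule Cauchy_Schwarz_ineq2)
      also have "\<dots> \<le> \<rho> * (L * \<delta>)"
        by (intro mult_mono p order_trans[OF JF_bound] mult_left_mono d L nn norm_ge_zero order_refl)
      finally show "norm (p x \<bullet> (JF k (X s x) *v d x)) \<le> \<rho> * (L * \<delta>)" by simp
    qed
    show "(\<lambda>x. p x \<bullet> (JF k (X s x) *v d x)) \<in> borel_measurable \<theta>" unfolding bm_\<theta>
      by (intro borel_measurable_continuous_onI continuous_on_inner continuous_on_matrix_vector_mult continuous_on_compose2[OF JFc] X p d) auto
  qed
  let ?s = "\<lambda>x. \<Sum>k\<in>UNIV. c s k * (p x \<bullet> (JF k (X s x) *v d x))"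
  have si: "integrable \<theta> ?s" using Fi by simp
  have "(\<integral>x. p x \<bullet> ((\<Sum>k\<in>UNIV. c s k *\<^sub>R (JF k (X s x) *v d x)) + c s i0 *\<^sub>R (\<integral>z. Jg (X s x - X s z) *v (d x - d z) \<partial>\<theta>)) \<partial>\<theta>)
     = (\<integral>x. ?s x + c s i0 * ((\<integral>z. e x z \<partial>\<theta>) - (\<integral>z. f x z \<partial>\<theta>)) \<partial>\<theta>)"
    by (simp add: inner_add_right inner_sum_right lhs)
  also have "\<dots> = (\<integral>x. ?s x \<partial>\<theta>) + c s i0 * ((\<integral>x. \<integral>z. e x z \<partial>\<theta> \<partial>\<theta>) - (\<integral>x. \<integral>z. f x z \<partial>\<theta> \<partial>\<theta>))"
    using si ei(3) fi(3) by simp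
  also have "(\<integral>x. \<integral>z. f x z \<partial>\<theta> \<partial>\<theta>) = (\<integral>z. \<integral>x. f x z \<partial>\<theta> \<partial>\<theta>)" by (rule Fubini_\<theta>[OF fc(1) fb(1)])
  also have "(\<integral>x. ?s x \<partial>\<theta>) + c s i0 * ((\<integral>x. \<integral>z. e x z \<partial>\<theta> \<partial>\<theta>) - (\<integral>z. \<integral>x. f x z \<partial>\<theta> \<partial>\<theta>))
     = (\<integral>x. ?s x + c s i0 * ((\<integral>z. e x z \<partial>\<theta>) - (\<integral>z. f z x \<partial>\<theta>)) \<partial>\<theta>)"
    using si ei(3) fi(4) by simp
  also have "\<dots> = (\<integral>x. adj c X p s (X s x) (p x) \<bullet> d x \<partial>\<theta>)"
    unfolding adj_def by (simp add: inner_add_left inner_sum_left rhs dot_lmul_matrix)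
  finally show ?thesis .
qed

section \<open>Dependence of the flow on the control\<close>

lemma flow_growth:
  assumes c: "ctrl c" and X: "flow c X" and s: "s \<in> {0..S}" shows "norm (X s x - x) \<le> 2 * C * S"
proof -
  have "norm (integral {0..s} (\<lambda>\<sigma>. vel c \<sigma> (force X \<sigma>) (X \<sigma> x))) \<le> 2 * C * (s - 0)"
    by (rule norm_integral_ivl_le[OF integrable_on_bounded_measurable[OF borel_measurable_slice[of "\<lambda>\<sigma> x. vel c \<sigma> (force X \<sigma>) (X \<sigma> x)", OF vel_flow_measurable[OF c flowD(1)[OF X]]]]])
       (use vel_bound[OF c force_bound] s in auto)
  also have "\<dots> \<le> 2 * C * S" using s C by (simp add: mult_left_mono)
  finally show ?thesis using flowD(2)[OF X s, of x] by simp
qed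

lemma flow_difference:
  assumes c: "ctrl c" "ctrl c'" and X: "flow c X" and X': "flow c' X'" and s: "s \<in> {0..S}"
  shows "X' s x - X s x = integral {0..s} (\<lambda>\<sigma>. vel c' \<sigma> (force X' \<sigma>) (X' \<sigma> x) - vel c \<sigma> (force X \<sigma>) (X \<sigma> x))"
    "(\<lambda>\<sigma>. vel c' \<sigma> (force X' \<sigma>) (X' \<sigma> x) - vel c \<sigma> (force X \<sigma>) (X \<sigma> x)) integrable_on {0..s}"
proof -
  have i: "(\<lambda>\<sigma>. vel c \<sigma> (force X \<sigma>) (X \<sigma> x)) integrable_on {0..s}" if "ctrl c" "flow c X" for c X
    by (rule integrable_on_bounded_measurable[OF borel_measurable_slice[of "\<lambda>\<sigma> x. vel c \<sigma> (force X \<sigma>) (X \<sigma> x)", OF vel_flow_measurable[OF that(1) flowD(1)[OF that(2)]]]])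
       (rule vel_bound[OF that(1) force_bound])
  note ii = i[OF c(2) X'] i[OF c(1) X]
  show "(\<lambda>\<sigma>. vel c' \<sigma> (force X' \<sigma>) (X' \<sigma> x) - vel c \<sigma> (force X \<sigma>) (X \<sigma> x)) integrable_on {0..s}"
    by (rule integrable_diff[OF ii])
  show "X' s x - X s x = integral {0..s} (\<lambda>\<sigma>. vel c' \<sigma> (force X' \<sigma>) (X' \<sigma> x) - vel c \<sigma> (force X \<sigma>) (X \<sigma> x))"
    using flowD(2)[OF X s, of x] flowD(2)[OF X' s, of x] by (simp add: integral_diff[OF ii])
qed

text \<open>A Gronwall estimate in the supremum over time and starting points with weight
  \<open>exp (- \<omega> * s)\<close>. Since \<open>3 * L / \<omega>\<close> is at most 1/2, half of
  the supremum is absorbed. The velocities of the two controls differ by at most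
  \<open>4 * C\<close>, and the absorption doubles the resulting
  \<open>4 * C * S * \<epsilon>\<close>.\<close>

lemma flow_perturbation:
  assumes c: "ctrl c" "ctrl c'" and \<epsilon>: "0 \<le> \<epsilon>" "\<epsilon> \<le> 1" and X: "flow c X" and X': "flow (mix \<epsilon> c c') X'" and s: "s \<in> {0..S}"
  shows "norm (X' s x - X s x) \<le> 8 * C * S * exp ((6 * L + 1) * S) * \<epsilon>"
proof -
  define \<omega> where "\<omega> = 6 * L + 1"
  have \<omega>: "0 < \<omega>" using L by (simp add: \<omega>_def)
  note cm = ctrl_mix[OF c \<epsilon>]
  note Xs = continuous_on_slices[OF flowD(1)[OF X]] and X's = continuous_on_slices[OF flowD(1)[OF X']]
  define I where "I = {0..S} \<times> (UNIV :: (real^'n) set)"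
  define N where "N z = exp (- \<omega> * fst z) * norm (X' (fst z) (snd z) - X (fst z) (snd z))" for z
  \<comment> \<open>The absorption requires the supremum to be finite beforehand; each flow stays
    within \<open>2 * C * S\<close> of its starting point.\<close>
  have bdd: "N z \<le> 4 * C * S" if "z \<in> I" for z
  proof -
    have z: "fst z \<in> {0..S}" using that by (auto simp: I_def)
    have "norm (X' (fst z) (snd z) - X (fst z) (snd z)) \<le> 4 * C * S"
      using flow_growth[OF c(1) X z, of "snd z"] flow_growth[OF cm X' z, of "snd z"]
        norm_triangle_ineq4[of "X' (fst z) (snd z) - snd z" "X (fst z) (snd z) - snd z"] by simp
    moreover have "exp (- \<omega> * fst z) \<le> 1" using z \<omega> by simp
    ultimately have "N z \<le> 1 * (4 * C * S)" unfolding N_def by (intro mult_mono) auto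
    then show ?thesis by simp
  qed
  define M where "M = (SUP z\<in>I. N z)"
  have bA: "bdd_above (N ` I)" using bdd by (intro bdd_aboveI2)
  have ne: "I \<noteq> {}" using S by (auto simp: I_def)
  have up: "norm (X' \<sigma> z - X \<sigma> z) \<le> M * exp (\<omega> * \<sigma>)" if "\<sigma> \<in> {0..S}" for \<sigma> z
  proof -
    have "N (\<sigma>, z) \<le> M" unfolding M_def by (rule cSUP_upper[OF _ bA]) (use that in \<open>simp add: I_def\<close>)
    then have "exp (- \<omega> * \<sigma>) * norm (X' \<sigma> z - X \<sigma> z) * exp (\<omega> * \<sigma>) \<le> M * exp (\<omega> * \<sigma>)"
      by (intro mult_right_mono) (auto simp: N_def)
    moreover have "exp (- \<omega> * \<sigma>) * exp (\<omega> * \<sigma>) = 1" by (simp add: exp_minus)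
    ultimately show ?thesis by (metis mult.assoc mult.commute mult.right_neutral)
  qed
  have M0: "0 \<le> M" using order_trans[OF norm_ge_zero up[of 0 0]] S by simp
  have "N z \<le> M / 2 + 4 * C * S * \<epsilon>" if z: "z \<in> I" for z
  proof -
    let ?t = "fst z" and ?x = "snd z"
    have t: "?t \<in> {0..S}" using z by (auto simp: I_def)
    have "norm (X' ?t ?x - X ?t ?x) \<le> integral {0..?t} (\<lambda>\<sigma>. 3 * L * M * exp (\<omega> * \<sigma>) + 4 * C * \<epsilon>)"
      unfolding flow_difference(1)[OF c(1) cm X X' t]
    proof (rule integral_norm_bound_integral)
      show "(\<lambda>\<sigma>. 3 * L * M * exp (\<omega> * \<sigma>) + 4 * C * \<epsilon>) integrable_on {0..?t}"
        by (intro integrable_continuous_interval continuous_intros)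
      fix \<sigma> assume "\<sigma> \<in> {0..?t}"
      then have \<sigma>: "\<sigma> \<in> {0..S}" using t by auto
      have 1: "norm (vel (mix \<epsilon> c c') \<sigma> (force X' \<sigma>) (X' \<sigma> ?x) - vel (mix \<epsilon> c c') \<sigma> (force X \<sigma>) (X \<sigma> ?x))
         \<le> L * norm (X' \<sigma> ?x - X \<sigma> ?x) + L * (norm (X' \<sigma> ?x - X \<sigma> ?x) + M * exp (\<omega> * \<sigma>))"
        by (rule order_trans[OF vel_diff[OF cm]], rule add_left_mono, rule force_diff[where X=X' and X'=X and s=\<sigma>, OF X's(1) Xs(1) up[OF \<sigma>]])
      have 2: "norm (\<epsilon> *\<^sub>R (vel c' \<sigma> (force X \<sigma>) (X \<sigma> ?x) - vel c \<sigma> (force X \<sigma>) (X \<sigma> ?x))) \<le> \<epsilon> * (2 * C + 2 * C)"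
        unfolding norm_scaleR using \<epsilon> order_trans[OF norm_triangle_ineq4 add_mono[OF vel_bound[OF c(2) force_bound] vel_bound[OF c(1) force_bound]]]
        by (intro mult_mono) auto
      have eq: "vel (mix \<epsilon> c c') \<sigma> (force X' \<sigma>) (X' \<sigma> ?x) - vel c \<sigma> (force X \<sigma>) (X \<sigma> ?x)
        = (vel (mix \<epsilon> c c') \<sigma> (force X' \<sigma>) (X' \<sigma> ?x) - vel (mix \<epsilon> c c') \<sigma> (force X \<sigma>) (X \<sigma> ?x))
          + \<epsilon> *\<^sub>R (vel c' \<sigma> (force X \<sigma>) (X \<sigma> ?x) - vel c \<sigma> (force X \<sigma>) (X \<sigma> ?x))"
        by (simp add: vel_mix[of \<epsilon> c c' \<sigma> "force X \<sigma>" "X \<sigma> ?x"])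
      have "L * norm (X' \<sigma> ?x - X \<sigma> ?x) \<le> L * (M * exp (\<omega> * \<sigma>))" by (rule mult_left_mono[OF up[OF \<sigma>] L])
      then have "L * norm (X' \<sigma> ?x - X \<sigma> ?x) + L * (norm (X' \<sigma> ?x - X \<sigma> ?x) + M * exp (\<omega> * \<sigma>)) + \<epsilon> * (2 * C + 2 * C) \<le> 3 * L * M * exp (\<omega> * \<sigma>) + 4 * C * \<epsilon>"
        by (simp add: algebra_simps)
      then show "norm (vel (mix \<epsilon> c c') \<sigma> (force X' \<sigma>) (X' \<sigma> ?x) - vel c \<sigma> (force X \<sigma>) (X \<sigma> ?x)) \<le> 3 * L * M * exp (\<omega> * \<sigma>) + 4 * C * \<epsilon>"
        unfolding eq using norm_triangle_mono[OF 1 2] by linarith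
    qed (rule flow_difference(2)[OF c(1) cm X X' t])
    also have "integral {0..?t} (\<lambda>\<sigma>. 3 * L * M * exp (\<omega> * \<sigma>) + 4 * C * \<epsilon>)
       = (3 * L * M / \<omega> * exp (\<omega> * ?t) + 4 * C * \<epsilon> * ?t) - (3 * L * M / \<omega> * exp (\<omega> * 0) + 4 * C * \<epsilon> * 0)"
      by (intro integral_unique fundamental_theorem_of_calculus)
         (use t \<omega> in \<open>auto intro!: derivative_eq_intros simp: has_real_derivative_iff_has_vector_derivative[symmetric]\<close>)
    also have "\<dots> \<le> M / 2 * exp (\<omega> * ?t) + 4 * C * S * \<epsilon>"
    proof -
      define k where "k = 3 * L * M / \<omega>"
      have "k \<le> M / 2" using L M0 \<omega> mult_nonneg_nonneg[OF L M0] by (simp add: k_def \<omega>_def field_simps)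
      then have k1: "k * exp (\<omega> * ?t) \<le> M / 2 * exp (\<omega> * ?t)" by (intro mult_right_mono) auto
      have k2: "4 * C * \<epsilon> * ?t \<le> 4 * C * S * \<epsilon>" using t C \<epsilon> mult_left_mono[of ?t S "4 * C * \<epsilon>"] by (simp add: mult_ac)
      have k3: "0 \<le> k" using L M0 \<omega> by (simp add: k_def)
      show ?thesis unfolding k_def[symmetric] mult_zero_right exp_zero mult_1_right using k1 k2 k3 by linarith
    qed
    finally have "N z \<le> exp (- \<omega> * ?t) * (M / 2 * exp (\<omega> * ?t) + 4 * C * S * \<epsilon>)"
      unfolding N_def by (intro mult_left_mono) auto
    also have "\<dots> = M / 2 + exp (- \<omega> * ?t) * (4 * C * S * \<epsilon>)" by (simp add: distrib_left exp_minus field_simps)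
    also have "\<dots> \<le> M / 2 + 1 * (4 * C * S * \<epsilon>)"
      using t \<omega> C S \<epsilon> by (intro add_left_mono mult_right_mono) auto
    finally show ?thesis by simp
  qed
  then have "M \<le> M / 2 + 4 * C * S * \<epsilon>" unfolding M_def by (intro cSUP_least ne)
  then have M: "M \<le> 8 * C * S * \<epsilon>" by simp
  have "norm (X' s x - X s x) \<le> M * exp (\<omega> * s)" by (rule up[OF s])
  also have "\<dots> \<le> (8 * C * S * \<epsilon>) * exp (\<omega> * S)" using s \<omega> M M0 C S \<epsilon> by (intro mult_mono) auto
  finally show ?thesis by (simp add: \<omega>_def mult_ac)
qed

lemma force_integrable:
  assumes "continuous_on UNIV (X s)" shows "integrable \<theta> (\<lambda>z. g (y - X s z))"
  by (rule \<theta>.integrable_const_bound[where B=C])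
     (use gB in \<open>auto simp: bm_\<theta> intro!: borel_measurable_continuous_onI continuous_on_compose2[OF g_continuous] continuous_intros assms\<close>)

text \<open>The derivative of the velocity along the flow in the direction of a displacement
  \<open>d\<close> of all particles, both the observed one and those that generate the
  interaction.\<close>

definition lin_vel :: "(real \<Rightarrow> 'k \<Rightarrow> real) \<Rightarrow> (real \<Rightarrow> real^'n \<Rightarrow> real^'n) \<Rightarrow> (real^'n \<Rightarrow> real^'n) \<Rightarrow> real \<Rightarrow> real^'n \<Rightarrow> real^'n" where
  "lin_vel c X d s x = (\<Sum>k\<in>UNIV. c s k *\<^sub>R (JF k (X s x) *v d x)) + c s i0 *\<^sub>R (\<integral>z. Jg (X s x - X s z) *v (d x - d z) \<partial>\<theta>)"

text \<open>Second-order Taylor remainders: \<open>K * e\<^sup>2\<close> for the fields, and four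
  times that for the interaction, where the relative displacement of two particles is up to
  \<open>2 * e\<close>. Relative positions explain the radius \<open>2 * r\<close>.\<close>

lemma lin_vel_remainder:
  assumes c: "ctrl c" and X: "continuous_on UNIV (X s)" "continuous_on UNIV (X' s)"
    and KF: "\<And>k x y h. norm x \<le> 2 * r \<Longrightarrow> norm y \<le> 2 * r \<Longrightarrow> norm (JF k x *v h - JF k y *v h) \<le> K * norm (x - y) * norm h"
    and Kg: "\<And>x y h. norm x \<le> 2 * r \<Longrightarrow> norm y \<le> 2 * r \<Longrightarrow> norm (Jg x *v h - Jg y *v h) \<le> K * norm (x - y) * norm h"
    and K: "0 \<le> K" and supp: "AE z in \<theta>. norm (X s z) + e \<le> r" and x: "norm (X s x) + e \<le> r"
    and e: "\<And>z. norm (X' s z - X s z) \<le> e"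
  shows "norm (vel c s (force X' s) (X' s x) - vel c s (force X s) (X s x) - lin_vel c X (\<lambda>z. X' s z - X s z) s x) \<le> 5 * K * e\<^sup>2"
proof -
  define d where "d z = X' s z - X s z" for z
  have e0: "0 \<le> e" using order_trans[OF norm_ge_zero e] .
  have r0: "0 \<le> r" using x e0 norm_ge_zero[of "X s x"] by linarith
  have dc: "continuous_on UNIV d" unfolding d_def by (intro continuous_on_diff X)
  have d: "norm (d z) \<le> e" for z using e by (simp add: d_def)
  have 1: "norm (\<Sum>k\<in>UNIV. c s k *\<^sub>R (F k (X' s x) - F k (X s x) - JF k (X s x) *v d x)) \<le> K * e\<^sup>2"
  proof (rule ctrl_sum_le[OF c])
    fix k
    have "norm (F k (X' s x) - F k (X s x) - JF k (X s x) *v (X' s x - X s x)) \<le> K * (norm (X' s x - X s x))\<^sup>2"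
      by (rule taylor_local[OF Fd KF _ K]) (use x e[of x] r0 in auto)
    also have "\<dots> \<le> K * e\<^sup>2" using e K by (intro mult_left_mono power_mono) auto
    finally show "norm (F k (X' s x) - F k (X s x) - JF k (X s x) *v d x) \<le> K * e\<^sup>2" by (simp add: d_def)
  qed
  have iv: "integrable \<theta> (\<lambda>z. Jg (X s x - X s z) *v (d x - d z))"
  proof (rule \<theta>.integrable_const_bound[where B="L * (e + e)"])
    show "AE z in \<theta>. norm (Jg (X s x - X s z) *v (d x - d z)) \<le> L * (e + e)"
      by (rule AE_I2, rule order_trans[OF Jg_bound]) (intro mult_left_mono L order_trans[OF norm_triangle_ineq4] add_mono d)
    show "(\<lambda>z. Jg (X s x - X s z) *v (d x - d z)) \<in> borel_measurable \<theta>" unfolding bm_\<theta>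
      by (intro borel_measurable_continuous_onI continuous_on_matrix_vector_mult continuous_on_compose2[OF Jgc] continuous_intros X dc) auto
  qed
  have "norm (force X' s (X' s x) - force X s (X s x) - (\<integral>z. Jg (X s x - X s z) *v (d x - d z) \<partial>\<theta>)) \<le> 4 * K * e\<^sup>2"
  proof -
    have "force X' s (X' s x) - force X s (X s x) - (\<integral>z. Jg (X s x - X s z) *v (d x - d z) \<partial>\<theta>)
       = (\<integral>z. g (X' s x - X' s z) - g (X s x - X s z) - Jg (X s x - X s z) *v (d x - d z) \<partial>\<theta>)"
      unfolding force_def using force_integrable[where X=X', OF X(2)] force_integrable[where X=X, OF X(1)] iv by simp
    also have "norm \<dots> \<le> 4 * K * e\<^sup>2"
    proof (rule \<theta>.norm_integral_le)
      show "AE z in \<theta>. norm (g (X' s x - X' s z) - g (X s x - X s z) - Jg (X s x - X s z) *v (d x - d z)) \<le> 4 * K * e\<^sup>2"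
        using supp
      proof eventually_elim
        case (elim z)
        let ?y = "X' s x - X' s z" and ?u = "X s x - X s z"
        have yu: "?y - ?u = d x - d z" by (simp add: d_def)
        have n: "norm (d x - d z) \<le> 2 * e" using norm_triangle_ineq4[of "d x" "d z"] d[of x] d[of z] by linarith
        have "norm (g ?y - g ?u - Jg ?u *v (?y - ?u)) \<le> K * (norm (?y - ?u))\<^sup>2"
          by (rule taylor_local[OF gd Kg _ K]) (use elim x n norm_triangle_ineq4[of "X s x" "X s z"] in \<open>auto simp: yu\<close>)
        also have "\<dots> \<le> K * (2 * e)\<^sup>2" unfolding yu using n K by (intro mult_left_mono power_mono) auto
        finally show ?case by (simp add: yu power_mult_distrib)
      qed
    qed (use K in simp)
    finally show ?thesis .
  qed
  then have 2: "norm (c s i0 *\<^sub>R (force X' s (X' s x) - force X s (X s x) - (\<integral>z. Jg (X s x - X s z) *v (d x - d z) \<partial>\<theta>))) \<le> 1 * (4 * K * e\<^sup>2)"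
    unfolding norm_scaleR using ctrl_abs_le[OF c] by (intro mult_mono) auto
  have "vel c s (force X' s) (X' s x) - vel c s (force X s) (X s x) - lin_vel c X d s x
    = (\<Sum>k\<in>UNIV. c s k *\<^sub>R (F k (X' s x) - F k (X s x) - JF k (X s x) *v d x))
      + c s i0 *\<^sub>R (force X' s (X' s x) - force X s (X s x) - (\<integral>z. Jg (X s x - X s z) *v (d x - d z) \<partial>\<theta>))"
    unfolding vel_def lin_vel_def by (simp add: sum_subtractf scaleR_diff_right)
  then have "norm (vel c s (force X' s) (X' s x) - vel c s (force X s) (X s x) - lin_vel c X d s x) \<le> 5 * K * e\<^sup>2"
    using norm_triangle_mono[OF 1 2] by simp
  then show ?thesis unfolding d_def .
qed

text \<open>The increment of the Hamiltonian along \<open>(X, P)\<close> when \<open>c\<close> is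
  replaced by \<open>c'\<close>; see \<open>gain_pairing\<close> and
  \<open>interaction_energy\<close>.\<close>

definition gain :: "(real \<Rightarrow> 'k \<Rightarrow> real) \<Rightarrow> (real \<Rightarrow> 'k \<Rightarrow> real) \<Rightarrow> (real \<Rightarrow> real^'n \<Rightarrow> real^'n) \<Rightarrow> (real \<Rightarrow> real^'n \<Rightarrow> real^'n) \<Rightarrow> real \<Rightarrow> real" where
  "gain c c' X P s = (\<integral>x. P s x \<bullet> (vel c' s (force X s) (X s x) - vel c s (force X s) (X s x)) \<partial>\<theta>)"

text \<open>The derivative of \<open>P \<bullet> (X' - X)\<close> in time pairs the costate with the
  difference of the velocities, and \<open>adj\<close> removes its linear part by duality. What
  survives is \<epsilon> times the gain and terms of second order. The rate is quadratic here; a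
  weaker remainder arises only from the cost function.\<close>

lemma first_variation:
  assumes c: "ctrl c" "ctrl c'" and X: "flow c X" and P: "costate c X P"
  obtains K where "\<forall>\<epsilon> X'. 0 \<le> \<epsilon> \<longrightarrow> \<epsilon> \<le> 1 \<longrightarrow> flow (mix \<epsilon> c c') X' \<longrightarrow>
     \<bar>(\<integral>x. P S x \<bullet> (X' S x - X S x) \<partial>\<theta>) - \<epsilon> * integral {0..S} (gain c c' X P)\<bar> \<le> K * \<epsilon>\<^sup>2"
proof -
  obtain \<rho> where Pb: "\<And>s x. norm (P s x) \<le> \<rho>" using costateD(2)[OF P] by blast
  have \<rho>: "0 \<le> \<rho>" using order_trans[OF norm_ge_zero Pb] .
  note Xc = flowD(1)[OF X] and Pc = costateD(1)[OF P]
  note Xs = continuous_on_slices[OF Xc] and Ps = continuous_on_slices[OF Pc]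
  obtain R where R: "AE x in \<theta>. norm x \<le> R"
  proof -
    obtain Z where Z: "compact Z" "AE x in \<theta>. x \<in> Z" using Pc_compact_AE[OF \<theta>] .
    obtain R where "\<forall>x\<in>Z. norm x \<le> R" using compact_imp_bounded[OF Z(1)] unfolding bounded_iff by blast
    then have "AE x in \<theta>. norm x \<le> R" using Z(2) by (auto elim: eventually_mono)
    then show thesis by (rule that)
  qed
  define k1 where "k1 = 8 * C * S * exp ((6 * L + 1) * S)"
  have k1: "0 \<le> k1" using C S by (simp add: k1_def)
  define r where "r = R + 2 * C * S + k1"
  obtain KF where KF: "\<And>k x y h. norm x \<le> 2 * r \<Longrightarrow> norm y \<le> 2 * r \<Longrightarrow> norm (JF k x *v h - JF k y *v h) \<le> KF k * norm (x - y) * norm h"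
    using JFl[of "2 * r"] by metis
  obtain Kg where Kg: "\<And>x y h. norm x \<le> 2 * r \<Longrightarrow> norm y \<le> 2 * r \<Longrightarrow> norm (Jg x *v h - Jg y *v h) \<le> Kg * norm (x - y) * norm h"
    using Jgl[of "2 * r"] by blast
  define K where "K = (\<Sum>k\<in>UNIV. \<bar>KF k\<bar>) + \<bar>Kg\<bar>"
  have K: "0 \<le> K" by (simp add: K_def sum_nonneg)
  have KFk: "KF k \<le> K" for k using member_le_sum[of k UNIV "\<lambda>k. \<bar>KF k\<bar>"] by (simp add: K_def)
  have KF': "norm (JF k x *v h - JF k y *v h) \<le> K * norm (x - y) * norm h" if "norm x \<le> 2 * r" "norm y \<le> 2 * r" for k x y h
    using KF[OF that, of k h] mult_right_mono[OF KFk, of "norm (x - y) * norm h" k] by (simp add: mult.assoc)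
  have Kg': "norm (Jg x *v h - Jg y *v h) \<le> K * norm (x - y) * norm h" if "norm x \<le> 2 * r" "norm y \<le> 2 * r" for x y h
  proof -
    have "0 \<le> (\<Sum>k\<in>UNIV. \<bar>KF k\<bar>)" by (simp add: sum_nonneg)
    then have "Kg \<le> K" unfolding K_def by linarith
    then have "Kg * (norm (x - y) * norm h) \<le> K * (norm (x - y) * norm h)" by (rule mult_right_mono) simp
    with Kg[OF that, of h] show ?thesis by (simp add: mult.assoc)
  qed
  \<comment> \<open>The first term is the remainder of \<open>lin_vel_remainder\<close> for the
    control \<open>c\<close>. The second arises because the increment of the control acts along the
    perturbed flow instead of \<open>X\<close>: \<open>3 * L * k1\<close> for each of the two
    controls.\<close>
  define K2 where "K2 = 5 * K * k1\<^sup>2 + 6 * L * k1"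
  have K2: "0 \<le> K2" using K L k1 by (simp add: K2_def)
  have "\<bar>(\<integral>x. P S x \<bullet> (X' S x - X S x) \<partial>\<theta>) - \<epsilon> * integral {0..S} (gain c c' X P)\<bar> \<le> (\<rho> * K2 * S) * \<epsilon>\<^sup>2"
    if \<epsilon>: "0 \<le> \<epsilon>" "\<epsilon> \<le> 1" and X': "flow (mix \<epsilon> c c') X'" for \<epsilon> X'
  proof -
    note cm = ctrl_mix[OF c \<epsilon>]
    note X'c = flowD(1)[OF X']
    note X's = continuous_on_slices[OF X'c]
    let ?D = "\<lambda>s x. X' s x - X s x"
    let ?V = "\<lambda>s x. vel c s (force X s) (X s x)" and ?V' = "\<lambda>s x. vel (mix \<epsilon> c c') s (force X' s) (X' s x)"
    let ?R = "\<lambda>s x. ?V' s x - ?V s x"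
    let ?Q = "\<lambda>s x. adj c X (P s) s (X s x) (P s x)"
    let ?W = "\<lambda>s x. vel c' s (force X s) (X s x) - ?V s x"
    have D: "norm (?D s x) \<le> k1 * \<epsilon>" if "s \<in> {0..S}" for s x
      using flow_perturbation[OF c \<epsilon> X X' that, of x] by (simp add: k1_def)
    have Dc: "continuous_on UNIV (\<lambda>z. ?D (fst z) (snd z))" by (intro continuous_on_diff X'c Xc)
    have velb: "norm (vel a s G x - vel b s G' y) \<le> 4 * C" if "ctrl a" "ctrl b" "\<And>x. norm (G x) \<le> C" "\<And>x. norm (G' x) \<le> C" for a b s G G' x y
      using norm_triangle_ineq4[of "vel a s G x" "vel b s G' y"] vel_bound[where G=G and s=s and x=x, OF that(1,3)] vel_bound[where G=G' and s=s and x=y, OF that(2,4)] by linarith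
    have Rb: "norm (?R s x) \<le> 4 * C" for s x by (rule velb[OF cm c(1) force_bound force_bound])
    have Wb: "norm (?W s x) \<le> 4 * C" for s x by (rule velb[OF c(2,1) force_bound force_bound])
    have Qb: "norm (?Q s x) \<le> 3 * L * \<rho>" for s x by (rule adj_bound[where X=X, OF c(1) Xs(1) Ps(1) Pb Pb])
    have Rm: "(\<lambda>z. ?R (fst z) (snd z)) \<in> borel_measurable borel"
      by (intro borel_measurable_diff vel_flow_measurable[OF cm X'c] vel_flow_measurable[OF c(1) Xc])
    have Wm: "(\<lambda>z. ?W (fst z) (snd z)) \<in> borel_measurable borel"
      by (intro borel_measurable_diff vel_flow_measurable[OF c(2) Xc] vel_flow_measurable[OF c(1) Xc])
    have Qm: "(\<lambda>z. ?Q (fst z) (snd z)) \<in> borel_measurable borel" by (rule adj_measurable[OF c(1) Xc Pc Pb])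
    have Pm: "(\<lambda>z. P (fst z) (snd z)) \<in> borel_measurable borel" by (rule borel_measurable_continuous_onI[OF Pc])
    have Dm: "(\<lambda>z. ?D (fst z) (snd z)) \<in> borel_measurable borel" by (rule borel_measurable_continuous_onI[OF Dc])
    have Gm: "(\<lambda>(s, x). P s x \<bullet> ?W s x) \<in> borel_measurable (borel \<Otimes>\<^sub>M \<theta>)"
      unfolding bm_pair_\<theta> case_prod_beta' by (intro borel_measurable_inner Pm Wm)
    have Fm: "(\<lambda>(s, x). P s x \<bullet> ?R s x - ?Q s x \<bullet> ?D s x) \<in> borel_measurable (borel \<Otimes>\<^sub>M \<theta>)"
      unfolding bm_pair_\<theta> case_prod_beta' by (intro borel_measurable_diff borel_measurable_inner Pm Rm Qm Dm)
    have inb: "\<bar>p \<bullet> q\<bar> \<le> a * b" if "norm p \<le> a" "norm q \<le> b" for p q :: "real^'n" and a b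
      by (rule order_trans[OF Cauchy_Schwarz_ineq2]) (intro mult_mono that norm_ge_zero order_trans[OF norm_ge_zero that(1)])
    have Gb: "norm (P s x \<bullet> ?W s x) \<le> \<rho> * (4 * C)" for s x using inb[OF Pb Wb] by simp
    have Fb: "norm (P s x \<bullet> ?R s x - ?Q s x \<bullet> ?D s x) \<le> \<rho> * (4 * C) + 3 * L * \<rho> * (k1 * \<epsilon>)" if "s \<in> {0..S}" for s x
      using inb[OF Pb Rb, of s x s x] inb[OF Qb D[OF that], of s x x] by (simp add: abs_le_iff)
    let ?F = "\<lambda>s. \<integral>x. P s x \<bullet> ?R s x - ?Q s x \<bullet> ?D s x \<partial>\<theta>"
    \<comment> \<open>The product rule for two merely absolutely continuous paths, obtained from the
      chain rule applied to the inner product of a pair. The boundary term at 0 vanishes since both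
      flows start at \<open>x\<close>.\<close>
    have path: "P S x \<bullet> ?D S x = integral {0..S} (\<lambda>s. P s x \<bullet> ?R s x - ?Q s x \<bullet> ?D s x)" for x
    proof -
      have mR: "(\<lambda>s. ?R s x) \<in> borel_measurable borel" by (rule borel_measurable_slice[of ?R, OF Rm])
      have mQ: "(\<lambda>s. - ?Q s x) \<in> borel_measurable borel" by (intro borel_measurable_uminus borel_measurable_slice[of ?Q, OF Qm])
      have iR: "(\<lambda>s. ?R s x) integrable_on {0..t}" for t by (rule integrable_on_bounded_measurable[OF mR Rb])
      have iQ: "(\<lambda>s. - ?Q s x) integrable_on {0..t}" for t
        by (rule integrable_on_bounded_measurable[OF mQ, where B="3 * L * \<rho>"]) (simp add: Qb)
      have "(\<lambda>z. fst z \<bullet> snd z) (P S x, ?D S x) = (\<lambda>z. fst z \<bullet> snd z) (P 0 x, ?D 0 x) +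
          integral {0..S} (\<lambda>s. (\<lambda>z h. fst z \<bullet> snd h + fst h \<bullet> snd z) (P s x, ?D s x) (- ?Q s x, ?R s x))"
      proof (rule chain_rule_integral_path_eq[where Y="\<lambda>s. (P s x, ?D s x)" and V="\<lambda>s. (- ?Q s x, ?R s x)" and S=S and B="3 * L * \<rho> + 4 * C"])
        show "(\<lambda>s. (- ?Q s x, ?R s x)) \<in> borel_measurable borel"
          unfolding borel_prod[symmetric] by (rule measurable_Pair[OF mQ mR])
        show "norm (- ?Q s x, ?R s x) \<le> 3 * L * \<rho> + 4 * C" for s
          using norm_Pair_le[of "- ?Q s x" "?R s x"] Qb[of s x] Rb[of s x] by simp
        show "continuous_on UNIV (\<lambda>s. (P s x, ?D s x))" by (intro continuous_on_Pair continuous_on_diff Ps Xs X's)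
        show "(P s x, ?D s x) = (P 0 x, ?D 0 x) + integral {0..s} (\<lambda>s. (- ?Q s x, ?R s x))" if s: "s \<in> {0..S}" for s
          using has_integral_Pair[OF iQ iR, of s] costate_forward[OF c(1) X P s, of x] flow_difference(1)[OF c(1) cm X X' s, of x]
            flowD(3)[OF X] flowD(3)[OF X'] by simp
        show "((\<lambda>z. fst z \<bullet> snd z) has_derivative (\<lambda>h. fst z \<bullet> snd h + fst h \<bullet> snd z)) (at z)" for z :: "(real^'n) \<times> (real^'n)"
          by (intro has_derivative_inner bounded_linear_imp_has_derivative bounded_linear_fst bounded_linear_snd)
        show "continuous_on UNIV (\<lambda>z. fst z \<bullet> snd b + fst b \<bullet> snd z)" for b :: "(real^'n) \<times> (real^'n)" by (intro continuous_intros)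
      qed (use S in auto)
      then show ?thesis using flowD(3)[OF X] flowD(3)[OF X'] by simp
    qed
    have lhs: "(\<integral>x. P S x \<bullet> ?D S x \<partial>\<theta>) = integral {0..S} ?F"
      unfolding path by (rule integral_ivl_swap[OF \<theta>.finite_measure_axioms Fm Fb, symmetric])
    have Fi: "?F integrable_on {0..S}"
      by (rule integrable_on_bounded_measurable[OF borel_measurable_lebesgue_integral_time[OF \<theta>.finite_measure_axioms Fm Fb] norm_lebesgue_integral_time_le[OF \<theta>.finite_measure_axioms Fm Fb]])
    have Gi: "gain c c' X P integrable_on {0..S}" unfolding gain_def[abs_def]
      by (rule integrable_on_bounded_measurable[OF borel_measurable_lebesgue_integral_time[OF \<theta>.finite_measure_axioms Gm Gb] norm_lebesgue_integral_time_le[OF \<theta>.finite_measure_axioms Gm Gb]])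
    \<comment> \<open>Duality replaces the pairing of \<open>adj\<close> with the displacement by
      the pairing of \<open>P\<close> with \<open>lin_vel\<close>, so that only the remainders
      collected in \<open>K2\<close> are left.\<close>
    have point: "norm (?F s - \<epsilon> * gain c c' X P s) \<le> \<rho> * (K2 * \<epsilon>\<^sup>2)" if s: "s \<in> {0..S}" for s
    proof -
      let ?Lin = "\<lambda>x. lin_vel c X (?D s) s x"
      have Dsc: "continuous_on UNIV (?D s)" by (rule continuous_on_slices(1)[of ?D, OF Dc])
      have dual: "(\<integral>x. P s x \<bullet> ?Lin x \<partial>\<theta>) = (\<integral>x. ?Q s x \<bullet> ?D s x \<partial>\<theta>)"
        unfolding lin_vel_def by (rule adj_duality[where X=X, OF Xs(1) Ps(1) Pb Dsc D[OF s]])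
      have sl: "continuous_on UNIV (\<lambda>x. vel a s (force Z s) (Z s x))" if Z: "continuous_on UNIV (\<lambda>z. Z (fst z) (snd z))" for a Z
        unfolding vel_def
        by (intro continuous_intros continuous_on_compose2[OF F_continuous] continuous_on_slices[OF Z]
            continuous_on_slices(1)[of "\<lambda>s x. force Z s (Z s x)", OF force_flow_continuous[OF Z]]) auto
      have Lc: "continuous_on UNIV ?Lin"
      proof -
        have "continuous_on UNIV (\<lambda>x. \<integral>z. Jg (X s x - X s z) *v (?D s x - ?D s z) \<partial>\<theta>)"
        proof (rule continuous_on_lebesgue_integral[OF \<theta>.finite_measure_axioms, where B="L * (k1 * \<epsilon> + k1 * \<epsilon>)"])
          show "(\<lambda>z. Jg (X s x - X s z) *v (?D s x - ?D s z)) \<in> borel_measurable \<theta>" for x unfolding bm_\<theta>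
            by (intro borel_measurable_continuous_onI continuous_on_matrix_vector_mult continuous_on_compose2[OF Jgc] continuous_intros Xs X's) auto
          show "continuous_on UNIV (\<lambda>x. Jg (X s x - X s z) *v (?D s x - ?D s z))" for z
            by (intro continuous_on_matrix_vector_mult continuous_on_compose2[OF Jgc] continuous_intros Xs X's) auto
          show "norm (Jg (X s x - X s z) *v (?D s x - ?D s z)) \<le> L * (k1 * \<epsilon> + k1 * \<epsilon>)" for x z
            by (rule order_trans[OF Jg_bound]) (intro mult_left_mono L order_trans[OF norm_triangle_ineq4] add_mono D[OF s])
        qed
        then show ?thesis unfolding lin_vel_def
          by (intro continuous_intros continuous_on_matrix_vector_mult continuous_on_compose2[OF JFc] Xs X's) auto
      qed
      have Lb: "norm (?Lin x) \<le> 3 * L * (k1 * \<epsilon>)" for x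
      proof -
        have "norm (\<Sum>k\<in>UNIV. c s k *\<^sub>R (JF k (X s x) *v ?D s x)) \<le> L * (k1 * \<epsilon>)"
          by (rule ctrl_sum_le[OF c(1)], rule order_trans[OF JF_bound]) (intro mult_left_mono L D[OF s])
        moreover have "norm (c s i0 *\<^sub>R (\<integral>z. Jg (X s x - X s z) *v (?D s x - ?D s z) \<partial>\<theta>)) \<le> 1 * (L * (k1 * \<epsilon> + k1 * \<epsilon>))"
          unfolding norm_scaleR
        proof (rule mult_mono[OF ctrl_abs_le[OF c(1)]])
          show "norm (\<integral>z. Jg (X s x - X s z) *v (?D s x - ?D s z) \<partial>\<theta>) \<le> L * (k1 * \<epsilon> + k1 * \<epsilon>)"
          proof (rule \<theta>.norm_integral_le[OF AE_I2])
            fix z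
            show "norm (Jg (X s x - X s z) *v (?D s x - ?D s z)) \<le> L * (k1 * \<epsilon> + k1 * \<epsilon>)"
              by (rule order_trans[OF Jg_bound]) (intro mult_left_mono L order_trans[OF norm_triangle_ineq4] add_mono D[OF s])
          qed (use L k1 \<epsilon> in simp)
        qed auto
        ultimately show ?thesis unfolding lin_vel_def by (rule order_trans[OF norm_triangle_mono eq_refl]) (simp add: algebra_simps)
      qed
      have iP: "integrable \<theta> (\<lambda>x. P s x \<bullet> h x)" if "continuous_on UNIV h" "\<And>x. norm (h x) \<le> b" for h b
        by (rule \<theta>.integrable_const_bound[where B="\<rho> * b"])
           (use inb[OF Pb that(2)] in \<open>auto simp: bm_\<theta> intro!: borel_measurable_continuous_onI continuous_on_inner Ps that\<close>)
      have i1: "integrable \<theta> (\<lambda>x. P s x \<bullet> ?R s x)" by (rule iP[OF continuous_on_diff[OF sl[OF X'c] sl[OF Xc]] Rb])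
      have i2: "integrable \<theta> (\<lambda>x. P s x \<bullet> ?W s x)" by (rule iP[OF continuous_on_diff[OF sl[OF Xc] sl[OF Xc]] Wb])
      have i3: "integrable \<theta> (\<lambda>x. P s x \<bullet> ?Lin x)" by (rule iP[OF Lc Lb])
      have i4: "integrable \<theta> (\<lambda>x. ?Q s x \<bullet> ?D s x)"
      proof (rule \<theta>.integrable_const_bound[where B="3 * L * \<rho> * (k1 * \<epsilon>)"])
        have "(\<lambda>x::real^'n. (s, x)) \<in> borel_measurable borel"
          by (intro borel_measurable_continuous_onI continuous_on_Pair continuous_on_id continuous_on_const)
        from measurable_compose[OF this borel_measurable_inner[OF Qm Dm]]
        show "(\<lambda>x. ?Q s x \<bullet> ?D s x) \<in> borel_measurable \<theta>" unfolding bm_\<theta> by simp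
      qed (use inb[OF Qb D[OF s]] in auto)
      have "?F s - \<epsilon> * gain c c' X P s = (\<integral>x. P s x \<bullet> ?R s x \<partial>\<theta>) - (\<integral>x. ?Q s x \<bullet> ?D s x \<partial>\<theta>) - \<epsilon> * (\<integral>x. P s x \<bullet> ?W s x \<partial>\<theta>)"
        unfolding gain_def using Bochner_Integration.integral_diff[OF i1 i4] by simp
      also have "\<dots> = (\<integral>x. P s x \<bullet> ?R s x - P s x \<bullet> ?Lin x - \<epsilon> * (P s x \<bullet> ?W s x) \<partial>\<theta>)"
        unfolding dual[symmetric] using i1 i2 i3 by simp
      also have "\<dots> = (\<integral>x. P s x \<bullet> (?R s x - ?Lin x - \<epsilon> *\<^sub>R ?W s x) \<partial>\<theta>)" by (simp add: inner_diff_right)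
      also have "norm \<dots> \<le> \<rho> * (K2 * \<epsilon>\<^sup>2)"
      proof (rule \<theta>.norm_integral_le)
        have suppz: "norm (X s z) + k1 * \<epsilon> \<le> r" if "norm z \<le> R" for z
          using flow_growth[OF c(1) X s, of z] that norm_triangle_sub[of "X s z" z] mult_left_mono[OF \<epsilon>(2) k1] unfolding r_def by linarith
        have suppAE: "AE z in \<theta>. norm (X s z) + k1 * \<epsilon> \<le> r" using R by eventually_elim (rule suppz)
        show "AE x in \<theta>. norm (P s x \<bullet> (?R s x - ?Lin x - \<epsilon> *\<^sub>R ?W s x)) \<le> \<rho> * (K2 * \<epsilon>\<^sup>2)" using R
        proof eventually_elim
          case (elim x)
          have e1: "norm (vel c s (force X' s) (X' s x) - ?V s x - ?Lin x) \<le> 5 * K * (k1 * \<epsilon>)\<^sup>2"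
            by (rule lin_vel_remainder[where X=X and X'=X' and r=r, OF c(1) Xs(1) X's(1) KF' Kg' K suppAE suppz[OF elim] D[OF s]])
          have dv: "norm (vel a s (force X' s) (X' s x) - vel a s (force X s) (X s x)) \<le> 3 * L * (k1 * \<epsilon>)" if "ctrl a" for a
          proof -
            have "norm (vel a s (force X' s) (X' s x) - vel a s (force X s) (X s x)) \<le> L * norm (?D s x) + L * (norm (?D s x) + k1 * \<epsilon>)"
              by (rule order_trans[OF vel_diff[OF that]], rule add_left_mono, rule force_diff[where X=X' and X'=X and s=s, OF X's(1) Xs(1) D[OF s]])
            also have "\<dots> \<le> L * (k1 * \<epsilon>) + L * (k1 * \<epsilon> + k1 * \<epsilon>)" by (intro add_mono mult_left_mono L D[OF s] order_refl)
            finally show ?thesis by (simp add: algebra_simps)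
          qed
          have "norm ((vel c' s (force X' s) (X' s x) - vel c' s (force X s) (X s x)) - (vel c s (force X' s) (X' s x) - vel c s (force X s) (X s x))) \<le> 6 * L * (k1 * \<epsilon>)"
            by (rule order_trans[OF norm_triangle_ineq4]) (use dv[OF c(2)] dv[OF c(1)] in linarith)
          then have e2: "norm (\<epsilon> *\<^sub>R ((vel c' s (force X' s) (X' s x) - vel c' s (force X s) (X s x)) - (vel c s (force X' s) (X' s x) - vel c s (force X s) (X s x)))) \<le> \<epsilon> * (6 * L * (k1 * \<epsilon>))"
            unfolding norm_scaleR using \<epsilon> by (simp add: mult_left_mono)
          have "?R s x - ?Lin x - \<epsilon> *\<^sub>R ?W s x = (vel c s (force X' s) (X' s x) - ?V s x - ?Lin x)
             + \<epsilon> *\<^sub>R ((vel c' s (force X' s) (X' s x) - vel c' s (force X s) (X s x)) - (vel c s (force X' s) (X' s x) - vel c s (force X s) (X s x)))"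
            unfolding vel_mix by (simp add: algebra_simps)
          then have "norm (?R s x - ?Lin x - \<epsilon> *\<^sub>R ?W s x) \<le> 5 * K * (k1 * \<epsilon>)\<^sup>2 + \<epsilon> * (6 * L * (k1 * \<epsilon>))"
            using norm_triangle_mono[OF e1 e2] by (simp only:)
          also have "\<dots> = K2 * \<epsilon>\<^sup>2" by (simp add: K2_def power2_eq_square algebra_simps)
          finally show ?case using inb[OF Pb] by simp
        qed
      qed (use \<rho> K2 in simp)
      finally show ?thesis .
    qed
    have "integral {0..S} ?F - \<epsilon> * integral {0..S} (gain c c' X P) = integral {0..S} (\<lambda>s. ?F s - \<epsilon> * gain c c' X P s)"
      using Fi integrable_on_mult_right[OF Gi, of \<epsilon>] by (simp add: integral_diff)
    also have "norm \<dots> \<le> \<rho> * (K2 * \<epsilon>\<^sup>2) * (S - 0)"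
      by (rule norm_integral_ivl_le[OF integrable_diff[OF Fi integrable_on_mult_right[OF Gi]] point]) (use S in auto)
    finally show ?thesis unfolding lhs by (simp add: mult_ac)
  qed
  then show thesis by (intro that[of "\<rho> * K2 * S"]) blast
qed

text \<open>Optimality is divided by \<epsilon> along the sequence \<open>1 / (n + 1)\<close>. The
  terminal costate converts the linearised cost into the functional of
  \<open>first_variation\<close>; the remainder of \<open>l\<close>, which is just continuously
  differentiable, disappears by dominated convergence.\<close>

lemma optimal_gain:
  assumes c: "ctrl c" "ctrl c'" and X: "flow c X" and P: "costate c X P"
    and opt: "\<And>\<epsilon> X'. 0 < \<epsilon> \<Longrightarrow> \<epsilon> \<le> 1 \<Longrightarrow> flow (mix \<epsilon> c c') X' \<Longrightarrow> (\<integral>x. l (X S x) \<partial>\<theta>) \<le> (\<integral>x. l (X' S x) \<partial>\<theta>)"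
  shows "integral {0..S} (gain c c' X P) \<le> 0"
proof -
  obtain K where "\<forall>\<epsilon> X'. 0 \<le> \<epsilon> \<longrightarrow> \<epsilon> \<le> 1 \<longrightarrow> flow (mix \<epsilon> c c') X' \<longrightarrow>
     \<bar>(\<integral>x. P S x \<bullet> (X' S x - X S x) \<partial>\<theta>) - \<epsilon> * integral {0..S} (gain c c' X P)\<bar> \<le> K * \<epsilon>\<^sup>2"
    by (rule first_variation[OF c X P])
  then have K: "\<bar>(\<integral>x. P S x \<bullet> (X' S x - X S x) \<partial>\<theta>) - \<epsilon> * integral {0..S} (gain c c' X P)\<bar> \<le> K * \<epsilon>\<^sup>2"
    if "0 \<le> \<epsilon>" "\<epsilon> \<le> 1" "flow (mix \<epsilon> c c') X'" for \<epsilon> X' using that by blast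
  define k1 where "k1 = 8 * C * S * exp ((6 * L + 1) * S)"
  have k1: "0 \<le> k1" using C S by (simp add: k1_def)
  define \<epsilon> where "\<epsilon> n = inverse (real (Suc n))" for n
  have \<epsilon>: "0 < \<epsilon> n" "\<epsilon> n \<le> 1" for n by (auto simp: \<epsilon>_def field_simps)
  have \<epsilon>0: "\<epsilon> \<longlonglongrightarrow> 0" unfolding \<epsilon>_def by (rule LIMSEQ_inverse_real_of_nat)
  have "\<exists>Z. flow (mix (\<epsilon> n) c c') Z" for n
    using flow_exists[OF ctrl_mix[OF c less_imp_le[OF \<epsilon>(1)] \<epsilon>(2)]] by blast
  then obtain Z where Z: "\<And>n. flow (mix (\<epsilon> n) c c') (Z n)" by metis
  have S': "S \<in> {0..S}" using S by simp
  note Xs = continuous_on_slices(1)[OF flowD(1)[OF X]] and Zs = continuous_on_slices(1)[OF flowD(1)[OF Z]]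
  let ?D = "\<lambda>n x. Z n S x - X S x"
  have D: "norm (?D n x) \<le> k1 * \<epsilon> n" for n x
    using flow_perturbation[where x=x, OF c less_imp_le[OF \<epsilon>(1)] \<epsilon>(2) X Z S', of n] by (simp add: k1_def)
  have lc: "continuous_on UNIV l"
    by (intro continuous_at_imp_continuous_on ballI has_derivative_continuous[OF ld])
  have li: "integrable \<theta> (\<lambda>x. l (Y x))" if "continuous_on UNIV Y" for Y
    by (rule \<theta>.integrable_const_bound[where B=C])
       (use lB in \<open>auto simp: bm_\<theta> intro!: borel_measurable_continuous_onI continuous_on_compose2[OF lc that]\<close>)
  have DlD: "\<bar>Dl y \<bullet> h\<bar> \<le> C * norm h" for y h
    by (rule order_trans[OF Cauchy_Schwarz_ineq2]) (intro mult_right_mono DlB norm_ge_zero)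
  have Di: "integrable \<theta> (\<lambda>x. Dl (X S x) \<bullet> ?D n x)" for n
  proof (rule \<theta>.integrable_const_bound[where B="C * (k1 * \<epsilon> n)"])
    show "AE x in \<theta>. norm (Dl (X S x) \<bullet> ?D n x) \<le> C * (k1 * \<epsilon> n)"
      by (rule AE_I2, simp only: real_norm_def, rule order_trans[OF DlD], rule mult_left_mono[OF D C])
    show "(\<lambda>x. Dl (X S x) \<bullet> ?D n x) \<in> borel_measurable \<theta>" unfolding bm_\<theta>
      by (intro borel_measurable_continuous_onI continuous_on_inner continuous_on_compose2[OF Dlc Xs] continuous_on_diff Xs Zs) auto
  qed
  \<comment> \<open>The Taylor remainder of \<open>l\<close> relative to \<epsilon>. It tends to 0
    pointwise without a rate and is bounded by \<open>2 * C * k1\<close>, because \<open>l\<close>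
    is Lipschitz with constant \<open>C\<close> and the flows differ by at most
    \<open>k1 * \<epsilon>\<close>.\<close>
  let ?r = "\<lambda>n x. (l (Z n S x) - l (X S x) - Dl (X S x) \<bullet> ?D n x) / \<epsilon> n"
  have ri: "integrable \<theta> (?r n)" for n using li[OF Zs] li[OF Xs] Di by simp
  have "(\<lambda>n. \<integral>x. ?r n x \<partial>\<theta>) \<longlonglongrightarrow> (\<integral>x. 0 \<partial>\<theta>)"
  proof (rule integral_dominated_convergence[where w="\<lambda>_. 2 * C * k1"])
    show "AE x in \<theta>. (\<lambda>n. ?r n x) \<longlonglongrightarrow> 0"
    proof (rule AE_I2, rule LIMSEQ_I)
      fix x and e :: real assume e: "0 < e"
      have "0 < e / (k1 + 1)" using e k1 by simp
      then obtain d where d: "d > 0" "\<And>y. norm (y - X S x) < d \<Longrightarrow> norm (l y - l (X S x) - Dl (X S x) \<bullet> (y - X S x)) \<le> e / (k1 + 1) * norm (y - X S x)"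
        using ld[of "X S x"] unfolding has_derivative_at_alt by blast
      have "(\<lambda>n. k1 * \<epsilon> n) \<longlonglongrightarrow> k1 * 0" by (intro tendsto_intros \<epsilon>0)
      then have "\<forall>\<^sub>F n in sequentially. k1 * \<epsilon> n < d" using d(1) by (intro order_tendstoD(2)) auto
      then obtain N where N: "\<And>n. n \<ge> N \<Longrightarrow> k1 * \<epsilon> n < d" unfolding eventually_sequentially by blast
      have "norm (?r n x - 0) < e" if "n \<ge> N" for n
      proof -
        have "norm (l (Z n S x) - l (X S x) - Dl (X S x) \<bullet> ?D n x) \<le> e / (k1 + 1) * norm (?D n x)"
          by (rule d(2)) (rule le_less_trans[OF D N[OF that]])
        also have "\<dots> \<le> e / (k1 + 1) * (k1 * \<epsilon> n)" using D e k1 by (intro mult_left_mono) auto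
        finally have "norm (?r n x) \<le> e / (k1 + 1) * k1" using \<epsilon>(1)[of n] by (simp add: pos_divide_le_eq mult_ac)
        also have "\<dots> < e" using e k1 by (simp add: field_simps)
        finally show ?thesis by simp
      qed
      then show "\<exists>N. \<forall>n\<ge>N. norm (?r n x - 0) < e" by blast
    qed
    show "AE x in \<theta>. norm (?r n x) \<le> 2 * C * k1" for n
    proof (rule AE_I2)
      fix x
      have "\<bar>l (Z n S x) - l (X S x)\<bar> \<le> C * norm (?D n x)"
        using has_derivative_lipschitz[OF ld, of C "Z n S x" "X S x"] DlD by simp
      then have "\<bar>l (Z n S x) - l (X S x) - Dl (X S x) \<bullet> ?D n x\<bar> \<le> 2 * C * norm (?D n x)"
        using DlD[of "X S x" "?D n x"] by linarith
      also have "\<dots> \<le> 2 * C * (k1 * \<epsilon> n)" using D C by (intro mult_left_mono) auto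
      finally show "norm (?r n x) \<le> 2 * C * k1" using \<epsilon>(1)[of n] by (simp add: pos_divide_le_eq mult_ac)
    qed
  qed (use borel_measurable_integrable[OF ri] in auto)
  then have lim: "(\<lambda>n. (\<integral>x. ?r n x \<partial>\<theta>) + K * \<epsilon> n) \<longlonglongrightarrow> 0 + K * 0"
    by (intro tendsto_add tendsto_mult tendsto_const \<epsilon>0) simp
  have "integral {0..S} (gain c c' X P) \<le> (\<integral>x. ?r n x \<partial>\<theta>) + K * \<epsilon> n" for n
  proof -
    let ?G = "integral {0..S} (gain c c' X P)"
    have 1: "0 \<le> (\<integral>x. l (Z n S x) \<partial>\<theta>) - (\<integral>x. l (X S x) \<partial>\<theta>)" using opt[OF \<epsilon>(1,2) Z] by simp
    have 2: "\<epsilon> n * (\<integral>x. ?r n x \<partial>\<theta>) = (\<integral>x. l (Z n S x) \<partial>\<theta>) - (\<integral>x. l (X S x) \<partial>\<theta>) - (\<integral>x. Dl (X S x) \<bullet> ?D n x \<partial>\<theta>)"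
      using li[OF Zs] li[OF Xs] Di \<epsilon>(1)[of n] by simp
    have 3: "(\<integral>x. P S x \<bullet> ?D n x \<partial>\<theta>) = - (\<integral>x. Dl (X S x) \<bullet> ?D n x \<partial>\<theta>)"
      unfolding costateD(4)[OF P] by simp
    have "\<epsilon> n * ?G \<le> (\<integral>x. P S x \<bullet> ?D n x \<partial>\<theta>) + K * (\<epsilon> n)\<^sup>2"
      using K[OF less_imp_le[OF \<epsilon>(1)] \<epsilon>(2) Z, of n] by linarith
    also have "\<dots> \<le> \<epsilon> n * (\<integral>x. ?r n x \<partial>\<theta>) + K * (\<epsilon> n)\<^sup>2" using 1 2 3 by linarith
    also have "\<dots> = \<epsilon> n * ((\<integral>x. ?r n x \<partial>\<theta>) + K * \<epsilon> n)" by (simp add: power2_eq_square algebra_simps)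
    finally show ?thesis using \<epsilon>(1)[of n] by (simp only: mult_le_cancel_left_pos)
  qed
  then have "integral {0..S} (gain c c' X P) \<le> 0 + K * 0" by (intro LIMSEQ_le_const[OF lim]) blast
  then show ?thesis by simp
qed

end

section \<open>Pointwise maximisation\<close>

lemma AE_lebesgue_on_ivl:
  "(AE s in lebesgue_on {a..b::real}. P s) \<longleftrightarrow> (AE s in lebesgue. s \<in> {a..b} \<longrightarrow> P s)"
  by (rule AE_restrict_space_iff) simp

lemma AE_ivl_measure_lebesgue_on:
  assumes "AE s in ivl_measure a b. P s" shows "AE s in lebesgue_on {a..b}. P s"
proof -
  have "AE s in lborel. 0 < (indicator {a..b} s :: ennreal) \<longrightarrow> P s"
    using assms unfolding ivl_measure_def by (subst (asm) AE_density) auto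
  then have "AE s in lborel. s \<in> {a..b} \<longrightarrow> P s" by (rule eventually_mono) (auto simp: indicator_def)
  then show ?thesis unfolding AE_lebesgue_on_ivl by (rule AE_completion)
qed

text \<open>The weak formulation integrates over time, so fields that agree at almost every time
  have the same solutions. This is the passage between a control and its Borel
  representative.\<close>

lemma continuity_eq_cong_AE:
  assumes ae: "AE s in lebesgue_on {0..S}. w s = w' s" and w: "continuity_eq S w \<mu>"
  shows "continuity_eq S w' \<mu>"
proof -
  obtain N where N: "N \<in> null_sets lebesgue" "\<And>s. s \<in> {0..S} \<Longrightarrow> s \<notin> N \<Longrightarrow> w s = w' s"
  proof -
    from ae have "AE s in lebesgue. s \<in> {0..S} \<longrightarrow> w s = w' s" unfolding AE_lebesgue_on_ivl .
    from AE_E3[OF this] obtain N where "\<And>s. s \<in> UNIV - N \<Longrightarrow> s \<in> {0..S} \<longrightarrow> w s = w' s" "N \<in> null_sets lebesgue" by auto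
    then show thesis by (intro that[of N]) auto
  qed
  have "integrable (lebesgue_on {0..S}) F' \<and> integral\<^sup>L (lebesgue_on {0..S}) F' = 0"
    if t: "test_function S \<phi>" and F': "F' = (\<lambda>s. \<integral>x. frechet_derivative \<phi> (at (s, x)) (1, w' s x) \<partial>(\<mu> s))" for \<phi> F'
  proof -
    define F where "F s = (\<integral>x. frechet_derivative \<phi> (at (s, x)) (1, w s x) \<partial>(\<mu> s))" for s
    have F: "integrable (lebesgue_on {0..S}) F" "integral\<^sup>L (lebesgue_on {0..S}) F = 0"
      using w t unfolding continuity_eq_def Let_def F_def by blast+
    have eq: "F' s = F s" if "s \<in> {0..S} - N" for s using N(2)[of s] that by (simp add: F' F_def)
    have conv: "integrable (lebesgue_on {0..S}) G \<longleftrightarrow> G absolutely_integrable_on {0..S}" for G :: "real \<Rightarrow> real"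
      unfolding set_integrable_def by (rule integrable_restrict_space) simp
    have "F' absolutely_integrable_on {0..S}"
      by (rule absolutely_integrable_spike[OF F(1)[unfolded conv], of N]) (use N(1) eq in \<open>auto simp: negligible_iff_null_sets\<close>)
    then have F'i: "integrable (lebesgue_on {0..S}) F'" by (simp only: conv)
    have "integral\<^sup>L (lebesgue_on {0..S}) F' = integral\<^sup>L (lebesgue_on {0..S}) F"
    proof (rule integral_cong_AE)
      show "AE s in lebesgue_on {0..S}. F' s = F s" using ae by eventually_elim (simp add: F' F_def)
    qed (use F'i F(1) in auto)
    then show ?thesis using F'i F(2) by simp
  qed
  then show ?thesis using w unfolding continuity_eq_def Let_def by blast
qed

text \<open>Otherwise mass of \<open>\<alpha>\<close> could be moved from a set where \<open>\<phi> < r\<close> to one where \<open>\<phi> > r\<close>.\<close>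

lemma bathtub:
  fixes \<phi> \<alpha> :: "'a \<Rightarrow> real"
  assumes M: "finite_measure M" and \<phi>[measurable]: "\<phi> \<in> borel_measurable M" and B: "\<And>x. \<bar>\<phi> x\<bar> \<le> B"
    and \<alpha>[measurable]: "\<alpha> \<in> borel_measurable M" and \<alpha>01: "\<And>x. 0 \<le> \<alpha> x" "\<And>x. \<alpha> x \<le> 1"
    and less: "(\<integral>x. \<alpha> x \<partial>M) < measure M (space M)"
    and opt: "\<And>\<alpha>'. \<alpha>' \<in> borel_measurable M \<Longrightarrow> \<forall>x. 0 \<le> \<alpha>' x \<and> \<alpha>' x \<le> 1 \<Longrightarrow> (\<integral>x. \<alpha>' x \<partial>M) = (\<integral>x. \<alpha> x \<partial>M) \<Longrightarrow>
      (\<integral>x. \<phi> x * \<alpha>' x \<partial>M) \<le> (\<integral>x. \<phi> x * \<alpha> x \<partial>M)"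
  shows "\<exists>c. AE x in M. (\<alpha> x < 1 \<longrightarrow> \<phi> x \<le> c) \<and> (0 < \<alpha> x \<longrightarrow> c \<le> \<phi> x)"
proof -
  interpret finite_measure M by fact
  have B0: "0 \<le> B" using order_trans[OF abs_ge_zero B] .
  have bi: "integrable M u" if "u \<in> borel_measurable M" "\<And>x. \<bar>u x\<bar> \<le> K" for u :: "'a \<Rightarrow> real" and K
    by (rule integrable_const_bound[where B=K]) (use that in auto)
  have low: "AE x in M. 0 < \<alpha> x \<longrightarrow> r \<le> \<phi> x" if r: "\<not> (AE x in M. \<alpha> x < 1 \<longrightarrow> \<phi> x \<le> r)" for r
  proof (rule ccontr)
    assume n: "\<not> (AE x in M. 0 < \<alpha> x \<longrightarrow> r \<le> \<phi> x)"
    \<comment> \<open>\<open>e\<close> is the room left for \<alpha> where \<phi> exceeds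
      \<open>r\<close>, and \<open>d\<close> is the mass that can be withdrawn where \<phi> lies
      below \<open>r\<close>. By assumption neither vanishes almost everywhere.\<close>
    define e where "e x = (if r < \<phi> x then 1 - \<alpha> x else 0)" for x
    define d where "d x = (if \<phi> x < r then \<alpha> x else 0)" for x
    have [measurable]: "e \<in> borel_measurable M" "d \<in> borel_measurable M" unfolding e_def d_def by measurable
    have e01: "0 \<le> e x" "e x \<le> 1 - \<alpha> x" "\<bar>e x\<bar> \<le> 1" and d01: "0 \<le> d x" "d x \<le> \<alpha> x" "\<bar>d x\<bar> \<le> 1" for x
      using \<alpha>01[of x] by (auto simp: e_def d_def)
    have i: "integrable M e" "integrable M d" "integrable M \<alpha>"
      by (rule bi[where K=1]; use e01(3) d01(3) \<alpha>01 in \<open>simp add: abs_le_iff order_trans[of "- 1" 0]\<close>)+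
    have \<phi>b: "\<bar>\<phi> x * u\<bar> \<le> B" if "\<bar>u\<bar> \<le> 1" for x u
      using mult_mono[OF B that B0 abs_ge_zero, of x] by (simp add: abs_mult)
    have \<phi>i: "integrable M (\<lambda>x. \<phi> x * u x)" if "u \<in> borel_measurable M" "\<And>x. \<bar>u x\<bar> \<le> 1" for u
      using that by (intro bi[where K=B] \<phi>b) auto
    note \<phi>is = \<phi>i[of e] \<phi>i[of d] \<phi>i[of \<alpha>]
    define a where "a = (\<integral>x. e x \<partial>M)"
    define b where "b = (\<integral>x. d x \<partial>M)"
    have a: "0 < a"
    proof -
      have "a \<noteq> 0"
      proof
        assume "a = 0"
        then have "AE x in M. e x = 0" using integral_nonneg_eq_0_iff_AE[OF i(1)] e01 by (simp add: a_def)
        then have "AE x in M. \<alpha> x < 1 \<longrightarrow> \<phi> x \<le> r" by eventually_elim (auto simp: e_def split: if_splits)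
        with r show False ..
      qed
      moreover have "0 \<le> a" unfolding a_def using e01 by (intro Bochner_Integration.integral_nonneg) auto
      ultimately show ?thesis by simp
    qed
    have b: "0 < b"
    proof -
      have "b \<noteq> 0"
      proof
        assume "b = 0"
        then have "AE x in M. d x = 0" using integral_nonneg_eq_0_iff_AE[OF i(2)] d01 by (simp add: b_def)
        then have "AE x in M. 0 < \<alpha> x \<longrightarrow> r \<le> \<phi> x" by eventually_elim (auto simp: d_def split: if_splits)
        with n show False ..
      qed
      moreover have "0 \<le> b" unfolding b_def using d01 by (intro Bochner_Integration.integral_nonneg) auto
      ultimately show ?thesis by simp
    qed
    \<comment> \<open>The amount of mass that is moved. Rescaling \<open>e\<close> and
      \<open>d\<close> to the common integral \<open>k\<close> preserves the integral of \<alpha>,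
      and \<open>k\<close> being at most \<open>a\<close> and \<open>b\<close> preserves the values
      between 0 and 1.\<close>
    define k where "k = min a b"
    have k: "0 < k" "k \<le> a" "k \<le> b" using a b by (auto simp: k_def)
    define \<alpha>' where "\<alpha>' x = \<alpha> x + (k / a * e x - k / b * d x)" for x
    have \<alpha>'m: "\<alpha>' \<in> borel_measurable M" unfolding \<alpha>'_def by measurable
    have ka: "0 \<le> k / a" "k / a \<le> 1" and kb: "0 \<le> k / b" "k / b \<le> 1" using k a b by auto
    have "0 \<le> \<alpha>' x \<and> \<alpha>' x \<le> 1" for x
    proof -
      have "0 \<le> k / a * e x" "k / a * e x \<le> e x" "0 \<le> k / b * d x" "k / b * d x \<le> d x"

        by (rule mult_nonneg_nonneg[OF ka(1) e01(1)] mult_left_le_one_le[OF e01(1) ka] mult_nonneg_nonneg[OF kb(1) d01(1)] mult_left_le_one_le[OF d01(1) kb])+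
      then show ?thesis using e01(2)[of x] d01(2)[of x] unfolding \<alpha>'_def by linarith
    qed
    moreover have "(\<integral>x. \<alpha>' x \<partial>M) = (\<integral>x. \<alpha> x \<partial>M)"
      unfolding \<alpha>'_def using i a b by (simp flip: a_def b_def)
    ultimately have "(\<integral>x. \<phi> x * \<alpha>' x \<partial>M) \<le> (\<integral>x. \<phi> x * \<alpha> x \<partial>M)" using \<alpha>'m by (intro opt) auto
    moreover have "(\<integral>x. \<phi> x * \<alpha>' x \<partial>M) = (\<integral>x. \<phi> x * \<alpha> x \<partial>M) + (k / a * (\<integral>x. \<phi> x * e x \<partial>M) - k / b * (\<integral>x. \<phi> x * d x \<partial>M))"
    proof -
      have "\<phi> x * \<alpha>' x = \<phi> x * \<alpha> x + (k / a * (\<phi> x * e x) - k / b * (\<phi> x * d x))" for x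
        by (simp add: \<alpha>'_def algebra_simps)
      then show ?thesis using \<phi>is e01 d01 \<alpha>01 by simp
    qed
    ultimately have "k / a * (\<integral>x. \<phi> x * e x \<partial>M) \<le> k / b * (\<integral>x. \<phi> x * d x \<partial>M)" by simp
    moreover have "k / a * (r * a) \<le> k / a * (\<integral>x. \<phi> x * e x \<partial>M)"
    proof (rule mult_left_mono[OF _ ka(1)])
      have "r * a = (\<integral>x. r * e x \<partial>M)" by (simp add: a_def)
      also have "\<dots> \<le> (\<integral>x. \<phi> x * e x \<partial>M)"
      proof (rule integral_mono)
        show "r * e x \<le> \<phi> x * e x" for x using \<alpha>01[of x] by (auto simp: e_def intro!: mult_right_mono)
      qed (use i(1) \<phi>is(1) e01 in auto)
      finally show "r * a \<le> (\<integral>x. \<phi> x * e x \<partial>M)" .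
    qed
    moreover have "k / b * (\<integral>x. \<phi> x * d x \<partial>M) < k / b * (r * b)"
    proof (rule mult_strict_left_mono)
      let ?u = "\<lambda>x. r * d x - \<phi> x * d x"
      have ui: "integrable M ?u" using i(2) \<phi>is(2) d01 by auto
      have u0: "0 \<le> ?u x" for x using \<alpha>01 by (auto simp: d_def intro!: mult_right_mono)
      have "(\<integral>x. ?u x \<partial>M) \<noteq> 0"
      proof
        assume "(\<integral>x. ?u x \<partial>M) = 0"
        then have "AE x in M. ?u x = 0" using integral_nonneg_eq_0_iff_AE[OF ui] u0 by simp
        then have "AE x in M. 0 < \<alpha> x \<longrightarrow> r \<le> \<phi> x" by eventually_elim (auto simp: d_def split: if_splits)
        with n show False ..
      qed
      moreover have "0 \<le> (\<integral>x. ?u x \<partial>M)" using u0 by (intro Bochner_Integration.integral_nonneg) auto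
      moreover have "(\<integral>x. ?u x \<partial>M) = r * b - (\<integral>x. \<phi> x * d x \<partial>M)" using i(2) \<phi>is(2) d01 by (simp add: b_def)
      ultimately show "(\<integral>x. \<phi> x * d x \<partial>M) < r * b" by simp
    qed (use k b in simp)
    ultimately show False using a b by simp
  qed
  \<comment> \<open>The essential upper bounds of \<phi> where \<open>\<alpha> < 1\<close>; the
    level sought is their infimum. It is finite since the strict inequality \<open>less\<close>
    prevents \<alpha> from being 1 almost everywhere.\<close>
  define R where "R = {r. AE x in M. \<alpha> x < 1 \<longrightarrow> \<phi> x \<le> r}"
  have BR: "B \<in> R" unfolding R_def using B by (auto intro!: AE_I2 simp: abs_le_iff)
  have lower: "- B \<le> r" if "r \<in> R" for r
  proof (rule ccontr)
    assume "\<not> - B \<le> r"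
    then have "AE x in M. \<alpha> x = 1"
      using that unfolding R_def mem_Collect_eq
    proof (elim eventually_mono)
      fix x assume "\<not> - B \<le> r" "\<alpha> x < 1 \<longrightarrow> \<phi> x \<le> r"
      then show "\<alpha> x = 1" using B[of x] \<alpha>01(2)[of x] by (cases "\<alpha> x = 1") (auto simp: abs_le_iff)
    qed
    then have "(\<integral>x. \<alpha> x \<partial>M) = (\<integral>x. 1 \<partial>M)" by (intro integral_cong_AE) auto
    with less show False by simp
  qed
  have bdd: "bdd_below R" using lower by (rule bdd_belowI)
  define c where "c = Inf R"
  \<comment> \<open>Both inequalities are first proved with a margin \<open>1 / (n + 1)\<close>:
    levels above \<open>c\<close> are essential upper bounds, and levels below \<open>c\<close> are
    not, so that \<open>low\<close> applies. The countably many null sets are then united.\<close>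
  have "AE x in M. \<alpha> x < 1 \<longrightarrow> \<phi> x \<le> c + inverse (real (Suc n))" for n
  proof -
    have "c < c + inverse (real (Suc n))" by simp
    then obtain r where r: "r \<in> R" "r < c + inverse (real (Suc n))" using cInf_lessD[of R] BR unfolding c_def by blast
    from r(1) show ?thesis unfolding R_def mem_Collect_eq by (rule eventually_mono) (use r(2) in auto)
  qed
  then have up: "AE x in M. \<forall>n. \<alpha> x < 1 \<longrightarrow> \<phi> x \<le> c + inverse (real (Suc n))" unfolding AE_all_countable by blast
  have "AE x in M. 0 < \<alpha> x \<longrightarrow> c - inverse (real (Suc n)) \<le> \<phi> x" for n
  proof (rule low)
    have "c - inverse (real (Suc n)) \<notin> R"
    proof
      assume "c - inverse (real (Suc n)) \<in> R"
      then have "c \<le> c - inverse (real (Suc n))" unfolding c_def by (rule cInf_lower[OF _ bdd])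
      moreover have "0 < inverse (real (Suc n))" by simp
      ultimately show False by linarith
    qed
    then show "\<not> (AE x in M. \<alpha> x < 1 \<longrightarrow> \<phi> x \<le> c - inverse (real (Suc n)))" unfolding R_def by simp
  qed
  then have lo: "AE x in M. \<forall>n. 0 < \<alpha> x \<longrightarrow> c - inverse (real (Suc n)) \<le> \<phi> x" unfolding AE_all_countable by blast
  have "AE x in M. (\<alpha> x < 1 \<longrightarrow> \<phi> x \<le> c) \<and> (0 < \<alpha> x \<longrightarrow> c \<le> \<phi> x)" using up lo
  proof eventually_elim
    case (elim x)
    have "\<phi> x \<le> c" if "\<alpha> x < 1"
    proof (rule LIMSEQ_le_const)
      show "(\<lambda>n. c + inverse (real (Suc n))) \<longlonglongrightarrow> c" using tendsto_add[OF tendsto_const[of c] LIMSEQ_inverse_real_of_nat] by simp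
    qed (use elim that in auto)
    moreover have "c \<le> \<phi> x" if "0 < \<alpha> x"
    proof (rule LIMSEQ_le_const2)
      show "(\<lambda>n. c - inverse (real (Suc n))) \<longlonglongrightarrow> c" using tendsto_diff[OF tendsto_const[of c] LIMSEQ_inverse_real_of_nat] by simp
    qed (use elim that in auto)
    ultimately show ?case by blast
  qed
  then show ?thesis by blast
qed

text \<open>The signed weights maximise the linear form \<open>h\<close> over the unit ball of the
  Manhattan norm. Averaging over all maximising indices avoids a choice among them, so the weights
  depend measurably on \<open>h\<close>.\<close>

lemma average_sign:
  fixes h :: "'m::finite \<Rightarrow> real"
  defines "H \<equiv> MAX k. \<bar>h k\<bar>"
  defines "\<sigma> \<equiv> \<lambda>k. (if \<bar>h k\<bar> = H then sgn (h k) else 0) / (\<Sum>j\<in>UNIV. if \<bar>h j\<bar> = H then 1 else 0)"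
  shows "(\<Sum>k\<in>UNIV. \<bar>\<sigma> k\<bar>) \<le> 1" "(\<Sum>k\<in>UNIV. \<sigma> k * h k) = H"
proof -
  define N where "N = (\<Sum>j\<in>UNIV. if \<bar>h j\<bar> = H then 1 else 0 :: real)"
  have "H \<in> (\<lambda>k. \<bar>h k\<bar>) ` UNIV" unfolding H_def by (rule Max_in) auto
  then obtain k where k: "\<bar>h k\<bar> = H" by auto
  have "(if \<bar>h k\<bar> = H then 1 else 0) \<le> N" unfolding N_def by (rule member_le_sum) auto
  then have N: "0 < N" using k by simp
  have "(\<Sum>k\<in>UNIV. \<bar>\<sigma> k\<bar>) \<le> (\<Sum>k\<in>UNIV. (if \<bar>h k\<bar> = H then 1 else 0) / N)"
    unfolding \<sigma>_def N_def[symmetric] using N by (intro sum_mono) (auto simp: abs_divide divide_right_mono abs_sgn_eq)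
  also have "\<dots> = 1" using N by (simp add: N_def flip: sum_divide_distrib)
  finally show "(\<Sum>k\<in>UNIV. \<bar>\<sigma> k\<bar>) \<le> 1" .
  have "\<sigma> k * h k = (if \<bar>h k\<bar> = H then 1 else 0) * (H / N)" for k
    unfolding \<sigma>_def N_def[symmetric] by (cases "\<bar>h k\<bar> = H") (auto simp: abs_sgn mult.commute)
  then have "(\<Sum>k\<in>UNIV. \<sigma> k * h k) = (\<Sum>k\<in>UNIV. (if \<bar>h k\<bar> = H then 1 else 0) * (H / N))" by (simp only:)
  also have "\<dots> = N * (H / N)" unfolding N_def by (rule sum_distrib_right[symmetric])
  finally have "(\<Sum>k\<in>UNIV. \<sigma> k * h k) = N * (H / N)" .
  then show "(\<Sum>k\<in>UNIV. \<sigma> k * h k) = H" using N by simp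
qed

text \<open>Competitors \<open>b\<close> with \<open>\<Sum>b h = (1 - a) max \<bar>h\<bar>\<close> reduce the problem to the
  bathtub principle for \<open>h0 - max \<bar>h\<bar>\<close>.\<close>

lemma pointwise_maximum:
  fixes a :: "real \<Rightarrow> real" and b :: "real \<Rightarrow> 'm::finite \<Rightarrow> real"
  assumes M: "finite_measure M" and sM: "sets M = sets borel"
    and h[measurable]: "h0 \<in> borel_measurable borel" "\<And>k. (\<lambda>s. h s k) \<in> borel_measurable borel"
    and hB: "\<And>s. \<bar>h0 s\<bar> \<le> B" "\<And>s k. \<bar>h s k\<bar> \<le> B"
    and ab[measurable]: "a \<in> borel_measurable borel" "\<And>k. (\<lambda>s. b s k) \<in> borel_measurable borel"
    and abA: "\<And>s. 0 \<le> a s" "\<And>s. a s + (\<Sum>k\<in>UNIV. \<bar>b s k\<bar>) \<le> 1"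
    and less: "(\<integral>s. a s \<partial>M) < measure M (space M)"
    and opt: "\<And>a' b'. a' \<in> borel_measurable borel \<Longrightarrow> \<forall>k. (\<lambda>s. b' s k) \<in> borel_measurable borel \<Longrightarrow>
      \<forall>s. 0 \<le> a' s \<and> a' s + (\<Sum>k\<in>UNIV. \<bar>b' s k\<bar>) \<le> 1 \<Longrightarrow> (\<integral>s. a' s \<partial>M) = (\<integral>s. a s \<partial>M) \<Longrightarrow>
      (\<integral>s. h0 s * (a' s - a s) + (\<Sum>k\<in>UNIV. (b' s k - b s k) * h s k) \<partial>M) \<le> 0"
  shows "\<exists>c. AE s in M. a s * h0 s + a s * c + (\<Sum>k\<in>UNIV. b s k * h s k) = max (h0 s + c) (MAX k. \<bar>h s k\<bar>)"
proof -
  interpret finite_measure M by fact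
  note [measurable_cong] = sM
  define H where "H s = (MAX k. \<bar>h s k\<bar>)" for s
  have [measurable]: "H \<in> borel_measurable borel" unfolding H_def by measurable
  have hH: "\<bar>h s k\<bar> \<le> H s" for s k unfolding H_def by (rule Max_ge) auto
  have "\<exists>k. H s = \<bar>h s k\<bar>" for s
  proof -
    have "H s \<in> (\<lambda>k. \<bar>h s k\<bar>) ` UNIV" unfolding H_def by (rule Max_in) auto
    then show ?thesis by auto
  qed
  then have H: "0 \<le> H s" "H s \<le> B" "\<bar>H s\<bar> \<le> B" for s using hB(2) by (metis abs_ge_zero, metis, metis abs_idempotent)
  have B0: "0 \<le> B" using order_trans[OF H(1,2)] .
  define \<sigma> where "\<sigma> s k = (if \<bar>h s k\<bar> = H s then sgn (h s k) else 0) / (\<Sum>j\<in>UNIV. if \<bar>h s j\<bar> = H s then 1 else 0)" for s k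
  have [measurable]: "(\<lambda>s. \<sigma> s k) \<in> borel_measurable borel" for k unfolding \<sigma>_def by measurable
  have \<sigma>: "(\<Sum>k\<in>UNIV. \<bar>\<sigma> s k\<bar>) \<le> 1" "(\<Sum>k\<in>UNIV. \<sigma> s k * h s k) = H s" for s
    unfolding \<sigma>_def H_def by (rule average_sign)+
  have bi: "integrable M u" if "u \<in> borel_measurable borel" "\<And>x. \<bar>u x\<bar> \<le> K" for u :: "real \<Rightarrow> real" and K
    by (rule integrable_const_bound[where B=K]) (use that in \<open>auto simp: measurable_cong_sets[OF sM refl]\<close>)
  have b0: "0 \<le> (\<Sum>k\<in>UNIV. \<bar>b s k\<bar>)" for s by (rule sum_nonneg) simp
  have a1: "a s \<le> 1" for s using abA(2)[of s] b0[of s] by linarith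
  define q where "q s = (\<Sum>k\<in>UNIV. b s k * h s k)" for s
  have [measurable]: "q \<in> borel_measurable borel" unfolding q_def by measurable
  have qH: "\<bar>q s\<bar> \<le> (1 - a s) * H s" for s
  proof -
    have "\<bar>q s\<bar> \<le> (\<Sum>k\<in>UNIV. \<bar>b s k\<bar> * H s)" unfolding q_def
      by (rule order_trans[OF sum_abs], rule sum_mono) (simp add: abs_mult mult_left_mono hH)
    also have "\<dots> \<le> (1 - a s) * H s" unfolding sum_distrib_right[symmetric]
      using abA(2)[of s] H by (intro mult_right_mono) linarith+
    finally show ?thesis .
  qed
  \<comment> \<open>For a given \<open>a'\<close> the budget \<open>1 - a'\<close> is spent entirely
    along \<sigma>, which realises the largest possible value \<open>(1 - a') * H\<close>.\<close>
  have comp: "(\<integral>s. h0 s * (a' s - a s) + ((1 - a' s) * H s - q s) \<partial>M) \<le> 0"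
    if a': "a' \<in> borel_measurable borel" "\<forall>s. 0 \<le> a' s \<and> a' s \<le> 1" "(\<integral>s. a' s \<partial>M) = (\<integral>s. a s \<partial>M)" for a'
  proof -
    have [measurable]: "a' \<in> borel_measurable borel" by (rule a')
    have "(\<integral>s. h0 s * (a' s - a s) + (\<Sum>k\<in>UNIV. ((1 - a' s) * \<sigma> s k - b s k) * h s k) \<partial>M) \<le> 0"
    proof (rule opt)
      show "\<forall>s. 0 \<le> a' s \<and> a' s + (\<Sum>k\<in>UNIV. \<bar>(1 - a' s) * \<sigma> s k\<bar>) \<le> 1"
      proof
        fix s
        have "(\<Sum>k\<in>UNIV. \<bar>(1 - a' s) * \<sigma> s k\<bar>) = (1 - a' s) * (\<Sum>k\<in>UNIV. \<bar>\<sigma> s k\<bar>)"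
          using a'(2) by (simp add: abs_mult sum_distrib_left)
        also have "\<dots> \<le> (1 - a' s) * 1" using a'(2) \<sigma>(1) by (intro mult_left_mono) auto
        finally show "0 \<le> a' s \<and> a' s + (\<Sum>k\<in>UNIV. \<bar>(1 - a' s) * \<sigma> s k\<bar>) \<le> 1" using a'(2) by simp
      qed
    qed (use a' in measurable)
    moreover have "(\<Sum>k\<in>UNIV. ((1 - a' s) * \<sigma> s k - b s k) * h s k) = (1 - a' s) * H s - q s" for s
      unfolding \<sigma>(2)[of s, symmetric] q_def by (simp add: left_diff_distrib sum_subtractf sum_distrib_left mult.assoc)
    ultimately show ?thesis by simp
  qed
  have qi: "integrable M q" and i1: "integrable M (\<lambda>s. (1 - a s) * H s)"
  proof -
    have 1: "\<bar>(1 - a s) * H s\<bar> \<le> B" for s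
      using mult_mono[of "\<bar>1 - a s\<bar>" 1 "\<bar>H s\<bar>" B] abA(1)[of s] a1[of s] H by (simp add: abs_mult)
    show "integrable M (\<lambda>s. (1 - a s) * H s)" by (rule bi[OF _ 1]) measurable
    show "integrable M q" by (rule bi[where K=B]) (use order_trans[OF qH order_trans[OF abs_ge_self 1]] in auto)
  qed
  \<comment> \<open>The competitor with the same \<open>a\<close> shows that \<open>b\<close>
    already spends the remaining budget optimally at almost every time.\<close>
  have q: "AE s in M. q s = (1 - a s) * H s"
  proof -
    let ?u = "\<lambda>s. (1 - a s) * H s - q s"
    have u0: "0 \<le> ?u s" for s using qH[of s] by (simp add: abs_le_iff)
    have ui: "integrable M ?u" using qi i1 by simp
    have "(\<integral>s. ?u s \<partial>M) \<le> 0" using comp[of a] abA(1) a1 by simp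
    moreover have "0 \<le> (\<integral>s. ?u s \<partial>M)" using u0 by (intro Bochner_Integration.integral_nonneg) auto
    ultimately have "AE s in M. ?u s = 0" using integral_nonneg_eq_0_iff_AE[OF ui] u0 by simp
    then show ?thesis by eventually_elim simp
  qed
  have "\<exists>c. AE s in M. (a s < 1 \<longrightarrow> h0 s - H s \<le> c) \<and> (0 < a s \<longrightarrow> c \<le> h0 s - H s)"
  proof (rule bathtub[where B="B + B", OF M])
    show "\<bar>h0 s - H s\<bar> \<le> B + B" for s using order_trans[OF abs_triangle_ineq4 add_mono[OF hB(1) H(3)]] .
    fix a' assume "a' \<in> borel_measurable M" and a'01: "\<forall>s. 0 \<le> a' s \<and> a' s \<le> 1" and a'i: "(\<integral>s. a' s \<partial>M) = (\<integral>s. a s \<partial>M)"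
    then have [measurable]: "a' \<in> borel_measurable borel" by (simp add: measurable_cong_sets[OF sM refl])
    have ib: "integrable M (\<lambda>s. (h0 s - H s) * u s)" if [measurable]: "u \<in> borel_measurable borel" and u: "\<And>s. \<bar>u s\<bar> \<le> 1" for u
    proof (rule bi[where K="(B + B) * 1"])
      show "\<bar>(h0 s - H s) * u s\<bar> \<le> (B + B) * 1" for s unfolding abs_mult
        using B0 by (intro mult_mono u order_trans[OF abs_triangle_ineq4 add_mono[OF hB(1) H(3)]]) auto
    qed measurable
    have i2: "integrable M (\<lambda>s. (h0 s - H s) * a' s)" "integrable M (\<lambda>s. (h0 s - H s) * a s)"
      using a'01 abA(1) a1 by (auto intro!: ib)
    \<comment> \<open>With \<open>q\<close> known, the terms free of \<open>a'\<close> cancel, and a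
      linear functional of \<open>a'\<close> with weight \<open>h0 - H\<close> is left.\<close>
    have "(\<integral>s. (h0 s - H s) * a' s \<partial>M) - (\<integral>s. (h0 s - H s) * a s \<partial>M) + ((\<integral>s. (1 - a s) * H s \<partial>M) - (\<integral>s. q s \<partial>M))
       = (\<integral>s. h0 s * (a' s - a s) + ((1 - a' s) * H s - q s) \<partial>M)"
    proof -
      have eq: "h0 s * (a' s - a s) + ((1 - a' s) * H s - q s)
         = ((h0 s - H s) * a' s - (h0 s - H s) * a s) + ((1 - a s) * H s - q s)" for s by (simp add: algebra_simps)
      show ?thesis unfolding eq using i1 i2 qi by simp
    qed
    also have "\<dots> \<le> 0" by (rule comp) (use a'01 a'i in auto)
    also have "(\<integral>s. (1 - a s) * H s \<partial>M) = (\<integral>s. q s \<partial>M)" by (rule integral_cong_AE) (use q in auto)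
    finally show "(\<integral>s. (h0 s - H s) * a' s \<partial>M) \<le> (\<integral>s. (h0 s - H s) * a s \<partial>M)" by simp
  qed (use abA a1 less in auto)
  then obtain c where "AE s in M. (a s < 1 \<longrightarrow> h0 s - H s \<le> c) \<and> (0 < a s \<longrightarrow> c \<le> h0 s - H s)" ..
  \<comment> \<open>The multiplier is the negative of the bathtub level. The left side equals
    \<open>H s + a s * (h0 s - H s - c)\<close>, and the bathtub alternative makes the last product
    the positive part of \<open>h0 s - H s - c\<close>.\<close>
  then have "AE s in M. a s * h0 s + a s * (- c) + q s = max (h0 s + (- c)) (H s)" using q
  proof eventually_elim
    case (elim s)
    have eq: "a s * h0 s + a s * (- c) + q s = H s + a s * (h0 s - H s - c)" using elim(2) by (simp add: algebra_simps)
    consider "a s = 0" | "a s = 1" | "0 < a s" "a s < 1" using abA(1)[of s] a1[of s] by linarith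
    then show ?case unfolding eq using elim(1) by cases auto
  qed
  then show ?thesis unfolding q_def H_def by blast
qed

section \<open>The Hamiltonian along the flow\<close>

context mean_field_cost
begin

interpretation \<theta>: prob_space \<theta> using \<theta> by (rule PcD)

definition pairing :: "(real \<Rightarrow> real^'n \<Rightarrow> real^'n) \<Rightarrow> (real \<Rightarrow> real^'n \<Rightarrow> real^'n) \<Rightarrow> real \<Rightarrow> real" where
  "pairing P V s = (\<integral>x. P s x \<bullet> V s x \<partial>\<theta>)"

lemma
  assumes P: "continuous_on UNIV (\<lambda>z. P (fst z) (snd z))" "\<And>s x. norm (P s x) \<le> \<rho>"
    and V: "continuous_on UNIV (\<lambda>z. V (fst z) (snd z))" "\<And>s x. norm (V s x) \<le> C"
  shows pairing_integrable: "integrable \<theta> (\<lambda>x. P s x \<bullet> V s x)"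
    and pairing_measurable: "pairing P V \<in> borel_measurable borel"
    and pairing_bound: "\<bar>pairing P V s\<bar> \<le> \<rho> * C"
proof -
  note Ps = continuous_on_slices[OF P(1)] and Vs = continuous_on_slices[OF V(1)]
  have \<rho>: "0 \<le> \<rho>" using order_trans[OF norm_ge_zero P(2)] .
  have b: "\<bar>P s x \<bullet> V s x\<bar> \<le> \<rho> * C" for s x
    by (rule order_trans[OF Cauchy_Schwarz_ineq2]) (intro mult_mono P(2) V(2) \<rho> norm_ge_zero)
  have m: "(\<lambda>x. P s x \<bullet> V s x) \<in> borel_measurable \<theta>" for s
    unfolding bm_\<theta> by (intro borel_measurable_continuous_onI continuous_on_inner Ps Vs)
  show "integrable \<theta> (\<lambda>x. P s x \<bullet> V s x)"
    by (rule \<theta>.integrable_const_bound[where B="\<rho> * C"]) (use b m in auto)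
  have "continuous_on UNIV (\<lambda>s. \<integral>x. P s x \<bullet> V s x \<partial>\<theta>)"
    by (rule continuous_on_lebesgue_integral[OF \<theta>.finite_measure_axioms, where B="\<rho> * C"])
       (use b m in \<open>auto intro!: continuous_on_inner Ps Vs\<close>)
  then show "pairing P V \<in> borel_measurable borel" unfolding pairing_def[abs_def] by (rule borel_measurable_continuous_onI)
  have "norm (\<integral>x. P s x \<bullet> V s x \<partial>\<theta>) \<le> \<rho> * C" by (rule \<theta>.norm_integral_le) (use b \<rho> C in auto)
  then show "\<bar>pairing P V s\<bar> \<le> \<rho> * C" by (simp add: pairing_def)
qed

text \<open>The Hamiltonian is linear in the control coefficients along a fixed pair
  \<open>(X, P)\<close>, and the interaction shares the coefficient of \<open>i0\<close>.\<close>

lemma gain_pairing: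
  assumes X: "flow c X" and P: "costate c X P"
  shows "gain c c' X P s = (\<Sum>k\<in>UNIV. (c' s k - c s k) * pairing P (\<lambda>s x. F k (X s x)) s)
    + (c' s i0 - c s i0) * pairing P (\<lambda>s x. force X s (X s x)) s"
proof -
  obtain \<rho> where Pb: "\<And>s x. norm (P s x) \<le> \<rho>" using costateD(2)[OF P] by blast
  note Xc = flowD(1)[OF X] and Pc = costateD(1)[OF P]
  have Fi: "integrable \<theta> (\<lambda>x. P s x \<bullet> F k (X s x))" for k
    by (rule pairing_integrable[OF Pc Pb continuous_on_compose2[OF F_continuous Xc] FB]) simp
  have fi: "integrable \<theta> (\<lambda>x. P s x \<bullet> force X s (X s x))"
    by (rule pairing_integrable[OF Pc Pb force_flow_continuous[OF Xc] force_bound])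
  have "P s x \<bullet> (vel c' s (force X s) (X s x) - vel c s (force X s) (X s x))
    = (\<Sum>k\<in>UNIV. (c' s k - c s k) * (P s x \<bullet> F k (X s x))) + (c' s i0 - c s i0) * (P s x \<bullet> force X s (X s x))" for x
    unfolding vel_def
    by (simp add: inner_diff_right inner_add_right inner_sum_right left_diff_distrib sum_subtractf)
  then show ?thesis unfolding gain_def pairing_def using Fi fi by simp
qed

lemma interaction_kernel_continuous:
  assumes X: "continuous_on UNIV (\<lambda>z. X (fst z) (snd z))" and p: "continuous_on UNIV p" "\<And>x. norm (p x) \<le> \<rho>"
  shows "(\<integral>z. (q - p z) \<bullet> g (y - X s z) \<partial>\<theta>) = q \<bullet> force X s y - (\<integral>z. p z \<bullet> g (y - X s z) \<partial>\<theta>)"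
    "continuous_on UNIV (\<lambda>y. \<integral>z. p z \<bullet> g (y - X s z) \<partial>\<theta>)"
    "norm (\<integral>z. p z \<bullet> g (y - X s z) \<partial>\<theta>) \<le> \<rho> * C"
proof -
  note Xs = continuous_on_slices[OF X]
  have \<rho>: "0 \<le> \<rho>" using order_trans[OF norm_ge_zero p(2)] .
  have b: "\<bar>p z \<bullet> g (y - X s z)\<bar> \<le> \<rho> * C" for y z
    by (rule order_trans[OF Cauchy_Schwarz_ineq2]) (intro mult_mono p(2) gB \<rho> norm_ge_zero)
  have m: "(\<lambda>z. p z \<bullet> g (y - X s z)) \<in> borel_measurable \<theta>" for y unfolding bm_\<theta>
    by (intro borel_measurable_continuous_onI continuous_on_inner p continuous_on_compose2[OF g_continuous] continuous_intros Xs) auto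
  have i: "integrable \<theta> (\<lambda>z. p z \<bullet> g (y - X s z))" for y
    by (rule \<theta>.integrable_const_bound[where B="\<rho> * C"]) (use b m in auto)
  show "(\<integral>z. (q - p z) \<bullet> g (y - X s z) \<partial>\<theta>) = q \<bullet> force X s y - (\<integral>z. p z \<bullet> g (y - X s z) \<partial>\<theta>)"
    unfolding force_def using i force_integrable[where X=X and s=s and y=y, OF Xs(1)] by (simp add: inner_diff_left)
  show "continuous_on UNIV (\<lambda>y. \<integral>z. p z \<bullet> g (y - X s z) \<partial>\<theta>)"
    by (rule continuous_on_lebesgue_integral[OF \<theta>.finite_measure_axioms, where B="\<rho> * C"])
       (use b m in \<open>auto intro!: continuous_on_inner continuous_intros continuous_on_compose2[OF g_continuous]\<close>)
  show "norm (\<integral>z. p z \<bullet> g (y - X s z) \<partial>\<theta>) \<le> \<rho> * C" by (rule \<theta>.norm_integral_le) (use b \<rho> C in auto)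
qed

text \<open>Exchanging the two particles and using that \<open>g\<close> is odd, the terms with
  \<open>P s x\<close> and with \<open>P s z\<close> contribute equally. This cancels the factor 1/2
  in \<open>calH\<close>.\<close>

lemma interaction_energy:
  assumes X: "continuous_on UNIV (\<lambda>z. X (fst z) (snd z))"
    and P: "continuous_on UNIV (\<lambda>z. P (fst z) (snd z))" "\<And>s x. norm (P s x) \<le> \<rho>"
  shows "(\<integral>x. (\<integral>z. (P s x - P s z) \<bullet> g (X s x - X s z) \<partial>\<theta>) \<partial>\<theta>) = 2 * pairing P (\<lambda>s x. force X s (X s x)) s"
proof -
  note Xs = continuous_on_slices(1)[OF X] and Ps = continuous_on_slices(1)[OF P(1)]
  note K = interaction_kernel_continuous[where X=X and s=s and p="P s", OF X Ps P(2)]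
  have \<rho>: "0 \<le> \<rho>" using order_trans[OF norm_ge_zero P(2)] .
  have fi: "integrable \<theta> (\<lambda>x. P s x \<bullet> force X s (X s x))"
    by (rule pairing_integrable[OF P force_flow_continuous[OF X] force_bound])
  have i: "integrable \<theta> (\<lambda>x. \<integral>z. P s z \<bullet> g (X s x - X s z) \<partial>\<theta>)"
    by (rule \<theta>.integrable_const_bound[where B="\<rho> * C"])
       (use K(3) in \<open>auto simp: bm_\<theta> intro!: borel_measurable_continuous_onI continuous_on_compose2[OF K(2)] Xs\<close>)
  have xc: "continuous_on UNIV (\<lambda>z::(real^'n) \<times> (real^'n). X s (fst z))" "continuous_on UNIV (\<lambda>z::(real^'n) \<times> (real^'n). X s (snd z))"
    by (intro continuous_on_compose2[OF Xs] continuous_intros; simp)+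
  have "(\<integral>x. (\<integral>z. P s z \<bullet> g (X s x - X s z) \<partial>\<theta>) \<partial>\<theta>) = (\<integral>z. (\<integral>x. P s z \<bullet> g (X s x - X s z) \<partial>\<theta>) \<partial>\<theta>)"
  proof (rule Fubini_\<theta>)
    show "continuous_on UNIV (\<lambda>z. P s (snd z) \<bullet> g (X s (fst z) - X s (snd z)))"
      by (intro continuous_on_inner continuous_on_compose2[OF g_continuous] continuous_on_diff xc continuous_on_compose2[OF Ps] continuous_on_snd continuous_on_id; simp)
    show "\<bar>P s z \<bullet> g (X s x - X s z)\<bar> \<le> \<rho> * C" for x z
      by (rule order_trans[OF Cauchy_Schwarz_ineq2]) (intro mult_mono P(2) gB \<rho> norm_ge_zero)
  qed
  also have "\<dots> = (\<integral>z. - (P s z \<bullet> force X s (X s z)) \<partial>\<theta>)"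
  proof (rule Bochner_Integration.integral_cong[OF refl])
    fix z
    have "g (X s x - X s z) = - g (X s z - X s x)" for x using godd[of "X s z - X s x"] by simp
    then show "(\<integral>x. P s z \<bullet> g (X s x - X s z) \<partial>\<theta>) = - (P s z \<bullet> force X s (X s z))"
      unfolding force_def using force_integrable[where X=X and s=s and y="X s z", OF Xs] by simp
  qed
  finally have "(\<integral>x. (\<integral>z. P s z \<bullet> g (X s x - X s z) \<partial>\<theta>) \<partial>\<theta>) = - pairing P (\<lambda>s x. force X s (X s x)) s"
    by (simp add: pairing_def)
  then show ?thesis unfolding K(1) using fi i by (simp add: pairing_def)
qed

end

section \<open>The maximum principle\<close>

text \<open>One family indexed by an option type holds both parts of the control, with
  \<open>None\<close> for \<alpha>. Lebesgue measurability and constraints valid almost everywhere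
  become Borel measurability and constraints valid everywhere.\<close>

lemma controls_representative:
  fixes \<alpha> :: "real \<Rightarrow> real" and \<beta> :: "real \<Rightarrow> real^'m"
  assumes "(\<alpha>, \<beta>) \<in> controls S T"
  obtains c :: "real \<Rightarrow> 'm option \<Rightarrow> real" where
    "\<And>k. (\<lambda>s. c s k) \<in> borel_measurable borel" "\<And>s. 0 \<le> c s None" "\<And>s. (\<Sum>k\<in>UNIV. \<bar>c s k\<bar>) \<le> 1"
    "AE s in lebesgue_on {0..S}. \<alpha> s = c s None \<and> \<beta> s = (\<chi> k. c s (Some k))"
proof -
  have m: "\<alpha> \<in> borel_measurable (lebesgue_on {0..S})" "\<beta> \<in> borel_measurable (lebesgue_on {0..S})"
    and A: "AE s in lebesgue_on {0..S}. (\<alpha> s, \<beta> s) \<in> control_set" using assms unfolding controls_def by auto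
  define e where "e s k = (case k of None \<Rightarrow> \<alpha> s | Some k \<Rightarrow> \<beta> s $ k)" for s k
  have em: "(\<lambda>s. e s k) \<in> borel_measurable (lebesgue_on {0..S})" for k
  proof (cases k)
    case (Some j)
    have "(\<lambda>v::real^'m. v $ j) \<in> borel_measurable borel"
      by (intro borel_measurable_continuous_onI continuous_on_component continuous_on_id)
    from measurable_compose[OF m(2) this] show ?thesis by (simp add: e_def Some)
  qed (use m in \<open>simp add: e_def\<close>)
  have "\<exists>d. d \<in> borel_measurable borel \<and> (AE s in lebesgue_on {0..S}. e s k = d s)" for k
  proof -
    have "(\<lambda>s. indicator {0..S} s *\<^sub>R e s k) \<in> borel_measurable lebesgue"
      using em[of k] by (subst (asm) borel_measurable_restrict_space_iff) auto
    from completion_ex_borel_measurable_real[OF this]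
    obtain d where d: "d \<in> borel_measurable lborel" "AE s in lborel. indicator {0..S} s *\<^sub>R e s k = d s" by blast
    from AE_completion[OF d(2)] have "AE s in lebesgue_on {0..S}. e s k = d s"
      unfolding AE_lebesgue_on_ivl by eventually_elim auto
    with d(1) show ?thesis by auto
  qed
  then obtain d where d[measurable]: "\<And>k. d k \<in> borel_measurable borel" and de: "\<And>k. AE s in lebesgue_on {0..S}. e s k = d k s"
    by metis
  \<comment> \<open>At the exceptional times the control is replaced by 0, which belongs to the
    control set.\<close>
  define c where "c s k = (if 0 \<le> d None s \<and> (\<Sum>k\<in>UNIV. \<bar>d k s\<bar>) \<le> 1 then d k s else 0)" for s k
  show thesis
  proof
    show "(\<lambda>s. c s k) \<in> borel_measurable borel" for k unfolding c_def by measurable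
    show "0 \<le> c s None" for s by (simp add: c_def)
    show "(\<Sum>k\<in>UNIV. \<bar>c s k\<bar>) \<le> 1" for s
    proof (cases "0 \<le> d None s \<and> (\<Sum>k\<in>UNIV. \<bar>d k s\<bar>) \<le> 1")
      case True
      show ?thesis unfolding c_def if_P[OF True] using True by blast
    next
      case False
      show ?thesis unfolding c_def if_not_P[OF False] by simp
    qed
    have "AE s in lebesgue_on {0..S}. \<forall>k. e s k = d k s" using de by (simp add: AE_all_countable)
    then show "AE s in lebesgue_on {0..S}. \<alpha> s = c s None \<and> \<beta> s = (\<chi> k. c s (Some k))" using A
    proof eventually_elim
      case (elim s)
      have "0 \<le> e s None" "(\<Sum>k\<in>UNIV. \<bar>e s k\<bar>) \<le> 1"
        using elim(2) by (simp_all add: e_def control_set_def UNIV_option_conv sum.reindex)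
      then have "c s k = e s k" for k using elim(1) by (simp add: c_def)
      then show ?case by (simp add: e_def vec_eq_iff)
    qed
  qed
qed

lemma integral_lebesgue_on_ivl_measure:
  fixes f :: "real \<Rightarrow> real"
  assumes f: "f \<in> borel_measurable borel" "\<And>t. \<bar>f t\<bar> \<le> B"
  shows "integral\<^sup>L (lebesgue_on {a..b}) f = integral\<^sup>L (ivl_measure a b) f"
proof -
  have "integrable (lebesgue_on {a..b}) f" by (rule integrable_lebesgue_on_bounded[OF f(1), of _ _ B]) (use f(2) in simp)
  then have "integral\<^sup>L (lebesgue_on {a..b}) f = integral {a..b} f" by (rule lebesgue_integral_eq_integral) simp
  then show ?thesis using integral_ivl_measure[OF f(1), of a b B] f(2) by simp
qed

lemma controlsI:
  fixes c :: "real \<Rightarrow> 'm::finite option \<Rightarrow> real"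
  assumes c: "\<And>k. (\<lambda>s. c s k) \<in> borel_measurable borel" "\<And>s. 0 \<le> c s None" "\<And>s. (\<Sum>k\<in>UNIV. \<bar>c s k\<bar>) \<le> 1"
    and T: "(\<integral>s. c s None \<partial>ivl_measure 0 S) = T"
  shows "((\<lambda>s. c s None), (\<lambda>s. \<chi> k. c s (Some k))) \<in> controls S T"
proof -
  have "\<bar>c s None\<bar> \<le> 1" for s
    using member_le_sum[of None UNIV "\<lambda>k. \<bar>c s k\<bar>"] c(3)[of s] by simp
  from integral_lebesgue_on_ivl_measure[OF c(1) this] have "integral\<^sup>L (lebesgue_on {0..S}) (\<lambda>s. c s None) = T" using T by simp
  moreover have "(\<lambda>s. \<chi> k. c s (Some k)) \<in> borel_measurable borel"
  proof (subst borel_measurable_euclidean_space, rule ballI)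
    fix b :: "real^'m" assume "b \<in> Basis"
    then obtain j where "b = axis j 1" by (auto simp: Basis_vec_def)
    then show "(\<lambda>s. (\<chi> k. c s (Some k)) \<bullet> b) \<in> borel_measurable borel" using c(1) by (simp add: inner_axis)
  qed
  moreover have "(c s None, \<chi> k. c s (Some k)) \<in> control_set" for s
    using c(2,3)[of s] by (simp add: control_set_def UNIV_option_conv sum.reindex)
  ultimately show ?thesis unfolding controls_def using c(1) by (auto intro: borel_measurable_lebesgue_onI)
qed

section \<open>From the assumptions on the data to the mean-field setting\<close>

lemma Ck1_jacobian:
  fixes f :: "real^'n \<Rightarrow> real^'n"
  assumes "Ck 1 f"
  shows "(f has_derivative (\<lambda>h. jacobian f (at x) *v h)) (at x)" "continuous_on UNIV (\<lambda>x. jacobian f (at x))"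
proof -
  have Ck: "Ck (Suc 0) f" using assms by simp
  show "(f has_derivative (\<lambda>h. jacobian f (at x) *v h)) (at x)"
    using Ck jacobian_works[of f "at x"] by simp
  have "continuous_on UNIV (\<lambda>x. frechet_derivative f (at x) (axis j 1))" for j
    by (rule Ck1D(2)[OF Ck]) (simp add: axis_in_Basis_iff)
  then show "continuous_on UNIV (\<lambda>x. jacobian f (at x))" unfolding jacobian_def matrix_def
    by (intro continuous_on_vec_lambda continuous_on_component)
qed

lemma Ck1_grad:
  fixes l :: "real^'n \<Rightarrow> real"
  assumes "Ck 1 l"
  shows "(l has_derivative (\<lambda>h. grad l x \<bullet> h)) (at x)" "continuous_on UNIV (grad l)"
proof -
  have Ck: "Ck (Suc 0) l" using assms by simp
  let ?D = "frechet_derivative l (at x)"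
  have lin: "linear ?D" using Ck1D(1)[OF Ck] by (rule has_derivative_linear)
  have "?D h = grad l x \<bullet> h" for h
  proof -
    have "?D h = ?D (\<Sum>i\<in>UNIV. h $ i *\<^sub>R axis i 1)" using basis_expansion[of h] by (simp add: scalar_mult_eq_scaleR)
    also have "\<dots> = grad l x \<bullet> h"
      by (simp add: linear_sum[OF lin] linear_scale[OF lin] grad_def inner_vec_def mult.commute)
    finally show ?thesis .
  qed
  then have "?D = (\<lambda>h. grad l x \<bullet> h)" by (rule ext)
  then show "(l has_derivative (\<lambda>h. grad l x \<bullet> h)) (at x)" using Ck1D(1)[OF Ck, of x] by simp
  show "continuous_on UNIV (grad l)" unfolding grad_def[abs_def]
    by (intro continuous_on_vec_lambda Ck1D(2)[OF Ck]) (simp add: axis_in_Basis_iff)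
qed

lemma norm_matrix_vector_le: "norm (A *v h) \<le> CARD('m) * norm A * norm (h::real^'n)" for A :: "real^'n^'m"
proof -
  have "norm (A *v h) \<le> (\<Sum>i\<in>UNIV. \<bar>(A *v h) $ i\<bar>)" by (rule norm_le_l1_cart)
  also have "\<dots> \<le> (\<Sum>i\<in>(UNIV::'m set). norm A * norm h)"
  proof (rule sum_mono)
    fix i
    have "\<bar>(A *v h) $ i\<bar> \<le> norm (A $ i) * norm h"
      unfolding matrix_vector_mul_component by (rule Cauchy_Schwarz_ineq2)
    also have "\<dots> \<le> norm A * norm h" by (intro mult_right_mono Finite_Cartesian_Product.norm_nth_le norm_ge_zero)
    finally show "\<bar>(A *v h) $ i\<bar> \<le> norm A * norm h" .
  qed
  finally show ?thesis by simp
qed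

lemma jacobian_locally_Lipschitz:
  fixes J :: "real^'n \<Rightarrow> real^'n^'n"
  assumes "\<And>K. compact K \<Longrightarrow> \<exists>LK. \<forall>x\<in>K. \<forall>y\<in>K. l1norm (J x - J y) \<le> LK * l1norm (x - y)"
  shows "\<exists>K. \<forall>x y h. norm x \<le> r \<longrightarrow> norm y \<le> r \<longrightarrow> norm (J x *v h - J y *v h) \<le> K * norm (x - y) * norm h"
proof -
  obtain LK where LK: "\<forall>x\<in>cball 0 r. \<forall>y\<in>cball 0 r. l1norm (J x - J y) \<le> LK * l1norm (x - y)"
    using assms[of "cball 0 r"] by auto
  show ?thesis
  proof (intro exI[of _ "CARD('n) * (\<bar>LK\<bar> * CARD('n))"] allI impI)
    fix x y h :: "real^'n" assume xy: "norm x \<le> r" "norm y \<le> r"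
    have "norm (J x - J y) \<le> l1norm (J x - J y)" by (rule norm_le_l1norm)
    also have "\<dots> \<le> LK * l1norm (x - y)" using LK xy by simp
    also have "\<dots> \<le> \<bar>LK\<bar> * l1norm (x - y)" by (intro mult_right_mono abs_ge_self l1norm_nonneg)
    also have "\<dots> \<le> \<bar>LK\<bar> * (CARD('n) * norm (x - y))"
      using l1norm_le_norm[of "x - y"] by (intro mult_left_mono) auto
    finally have J: "norm (J x - J y) \<le> \<bar>LK\<bar> * (CARD('n) * norm (x - y))" .
    have "norm (J x *v h - J y *v h) \<le> CARD('n) * norm (J x - J y) * norm h"
      using norm_matrix_vector_le[of "J x - J y" h] by (simp add: matrix_vector_mult_diff_rdistrib)
    also have "\<dots> \<le> CARD('n) * (\<bar>LK\<bar> * (CARD('n) * norm (x - y))) * norm h"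
      by (intro mult_left_mono mult_right_mono J) auto
    finally show "norm (J x *v h - J y *v h) \<le> CARD('n) * (\<bar>LK\<bar> * CARD('n)) * norm (x - y) * norm h"
      by (simp add: mult_ac)
  qed
qed

text \<open>The locale uses Euclidean norms. They are at most the Manhattan norms, so
  \<open>C\<close> is kept, while the Manhattan norm on the right of the Lipschitz condition costs
  the factor \<open>CARD('n)\<close>.\<close>

lemma mean_field_cost_data:
  fixes f0 g :: "real^'n \<Rightarrow> real^'n" and f :: "'m::finite \<Rightarrow> real^'n \<Rightarrow> real^'n"
  assumes S: "0 < S" and C: "0 < C" and L: "0 < L"
    and A1: "assumption_A1 C L f0 f g" and A2: "assumption_A2 f0 f g" and A3: "assumption_A3 C l" and \<theta>: "\<theta> \<in> Pc"
  shows "mean_field_cost (\<lambda>k. case k of None \<Rightarrow> f0 | Some i \<Rightarrow> f i)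
    (\<lambda>k x. jacobian (case k of None \<Rightarrow> f0 | Some i \<Rightarrow> f i) (at x)) g (\<lambda>x. jacobian g (at x)) \<theta> S C (L * CARD('n)) l (grad l)"
proof -
  let ?F = "\<lambda>k. case k of None \<Rightarrow> f0 | Some i \<Rightarrow> f i"
  have B: "l1norm (f0 x) + (\<Sum>i\<in>UNIV. l1norm (f i x)) + l1norm (g x) \<le> C" for x
    using A1 unfolding assumption_A1_def by blast
  have Lip: "l1norm (f0 x - f0 y) + (\<Sum>i\<in>UNIV. l1norm (f i x - f i y)) + l1norm (g x - g y) \<le> L * l1norm (x - y)" for x y
    using A1 unfolding assumption_A1_def by blast
  have part: "l1norm u \<le> l1norm u + (\<Sum>i\<in>UNIV. l1norm (w i)) + l1norm v" "l1norm v \<le> l1norm u + (\<Sum>i\<in>UNIV. l1norm (w i)) + l1norm v"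
     "l1norm (w i) \<le> l1norm u + (\<Sum>i\<in>UNIV. l1norm (w i)) + l1norm v" for u v :: "real^'n" and w :: "'m \<Rightarrow> real^'n" and i
  proof -
    have 1: "l1norm (w i) \<le> (\<Sum>i\<in>UNIV. l1norm (w i))" by (rule member_le_sum) (auto simp: l1norm_nonneg)
    then show "l1norm u \<le> l1norm u + (\<Sum>i\<in>UNIV. l1norm (w i)) + l1norm v" "l1norm v \<le> l1norm u + (\<Sum>i\<in>UNIV. l1norm (w i)) + l1norm v"
      "l1norm (w i) \<le> l1norm u + (\<Sum>i\<in>UNIV. l1norm (w i)) + l1norm v"
      using l1norm_nonneg[of u] l1norm_nonneg[of v] l1norm_nonneg[of "w i"] by linarith+
  qed
  have FB: "norm (?F k x) \<le> C" for k x
    by (cases k; simp; rule order_trans[OF norm_le_l1norm], rule order_trans[OF _ B], rule part)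
  have gB: "norm (g x) \<le> C" for x by (rule order_trans[OF norm_le_l1norm], rule order_trans[OF _ B], rule part)
  have Ln: "L * l1norm (x - y) \<le> L * CARD('n) * norm (x - y)" for x y :: "real^'n"
    using mult_left_mono[OF l1norm_le_norm[of "x - y"], of L] L by (simp add: mult_ac)
  have FL: "norm (?F k x - ?F k y) \<le> L * CARD('n) * norm (x - y)" for k x y
    by (cases k; simp; rule order_trans[OF norm_le_l1norm], rule order_trans[OF _ order_trans[OF Lip Ln]], rule part)
  have gL: "norm (g x - g y) \<le> L * CARD('n) * norm (x - y)" for x y
    by (rule order_trans[OF norm_le_l1norm], rule order_trans[OF _ order_trans[OF Lip Ln]], rule part)
  have Ck: "Ck 1 g" "Ck 1 (?F k)" for k using A2 unfolding assumption_A2_def by (auto split: option.split)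
  have loc: "\<exists>LK>0. \<forall>x\<in>K. \<forall>x'\<in>K.
        l1norm (jacobian g (at x) - jacobian g (at x')) \<le> LK * l1norm (x - x') \<and>
        l1norm (jacobian f0 (at x) - jacobian f0 (at x')) \<le> LK * l1norm (x - x') \<and>
        (\<forall>i. l1norm (jacobian (f i) (at x) - jacobian (f i) (at x')) \<le> LK * l1norm (x - x'))" if "compact K" for K
    using A2 that unfolding assumption_A2_def by blast
  have Jl: "\<exists>K. \<forall>x y h. norm x \<le> r \<longrightarrow> norm y \<le> r \<longrightarrow>
      norm (jacobian (?F k) (at x) *v h - jacobian (?F k) (at y) *v h) \<le> K * norm (x - y) * norm h" for k r
    by (rule jacobian_locally_Lipschitz, drule loc) (cases k; auto)
  have Jgl: "\<exists>K. \<forall>x y h. norm x \<le> r \<longrightarrow> norm y \<le> r \<longrightarrow>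
      norm (jacobian g (at x) *v h - jacobian g (at y) *v h) \<le> K * norm (x - y) * norm h" for r
    by (rule jacobian_locally_Lipschitz, drule loc) auto
  have l: "Ck 1 l" "\<And>x. \<bar>l x\<bar> + l1norm (grad l x) \<le> C" using A3 unfolding assumption_A3_def by auto
  have "\<bar>l x\<bar> \<le> C" "norm (grad l x) \<le> C" for x
    using l(2)[of x] norm_le_l1norm[of "grad l x"] l1norm_nonneg[of "grad l x"] by linarith+
  moreover have "g (- x) = - g x" for x using A2 unfolding assumption_A2_def by blast
  ultimately show ?thesis
    using S C L \<theta> FB gB FL gL Ck1_jacobian[OF Ck(1)] Ck1_jacobian[OF Ck(2)] Jl Jgl Ck1_grad[OF l(1)]
    by unfold_locales auto
qed

lemma sum_option: "(\<Sum>k\<in>UNIV. h k) = h None + (\<Sum>k\<in>UNIV. h (Some k))" for h :: "'m::finite option \<Rightarrow> 'b::comm_monoid_add"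
  by (simp add: UNIV_option_conv sum.reindex)

lemma vector_matrix_sum:
  fixes p :: "real^'n" and A :: "real^'n^'n" and B :: "'m::finite \<Rightarrow> real^'n^'n"
  shows "p v* (a *\<^sub>R A + (\<Sum>k\<in>UNIV. b k *\<^sub>R B k)) = a *\<^sub>R (p v* A) + (\<Sum>k\<in>UNIV. b k *\<^sub>R (p v* B k))"
proof -
  have l: "linear (\<lambda>A::real^'n^'n. p v* A)"
    by (intro linearI) (auto simp: vector_matrix_mult_def vec_eq_iff algebra_simps sum.distrib sum_distrib_left)
  show ?thesis by (simp add: linear_add[OF l] linear_scale[OF l] linear_sum[OF l])
qed

theorem theorem4p9:
  fixes f0 g :: "real^'n \<Rightarrow> real^'n"
    and f :: "'m::finite \<Rightarrow> real^'n \<Rightarrow> real^'n"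
    and l :: "real^'n \<Rightarrow> real"
    and \<theta> :: "(real^'n) measure"
    and T M S C L :: real
    and \<alpha> :: "real \<Rightarrow> real" and \<beta> :: "real \<Rightarrow> real^'m"
  assumes "T > 0" and "M > 0" and "S = T + M"
    and "C > 0" and "L > 0"
    and "assumption_A1 C L f0 f g" and "assumption_A2 f0 f g" and "assumption_A3 C l"
    and "\<theta> \<in> Pc"
    and "(\<alpha>, \<beta>) \<in> controls S T" and "optimal S T f0 f g l \<theta> \<alpha> \<beta>"
  shows "\<exists>(c::real) (\<gamma> :: real \<Rightarrow> ((real^'n) \<times> (real^'n)) measure).
    regular_solution S f0 f g l \<theta> \<alpha> \<beta> \<gamma> \<and>
    (AE s in lebesgue_on {0..S}.
       is_maximum (calH f0 f g (\<gamma> s) c (\<alpha> s) (\<beta> s))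
         ((\<lambda>(a, b). calH f0 f g (\<gamma> s) c a b) ` control_set) \<and>
       calH f0 f g (\<gamma> s) c (\<alpha> s) (\<beta> s) = max (calH1 f0 g (\<gamma> s) c) (calH0 f (\<gamma> s)))"
proof -
  have Spos: "0 < S" using assms(1-3) by simp
  \<comment> \<open>The drift \<open>f0\<close> becomes the component \<open>None\<close>, whose
    coefficient also multiplies the interaction.\<close>
  define F where "F k = (case k of None \<Rightarrow> f0 | Some i \<Rightarrow> f i)" for k
  define JF where "JF k x = jacobian (F k) (at x)" for k x
  define Jg where "Jg x = jacobian g (at x)" for x
  have F_simps: "F None = f0" "F (Some i) = f i" for i by (simp_all add: F_def)
  interpret mean_field_cost F JF g Jg None \<theta> S C "L * CARD('n)" l "grad l"
    using mean_field_cost_data[OF Spos assms(4-9)] unfolding F_def[abs_def] JF_def[abs_def] Jg_def[abs_def] .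
  let ?I = "ivl_measure 0 S"
  obtain c where cm: "\<And>k. (\<lambda>s. c s k) \<in> borel_measurable borel" and c0: "\<And>s. 0 \<le> c s None"
    and c1: "\<And>s. (\<Sum>k\<in>UNIV. \<bar>c s k\<bar>) \<le> 1"
    and c\<alpha>\<beta>: "AE s in lebesgue_on {0..S}. \<alpha> s = c s None \<and> \<beta> s = (\<chi> k. c s (Some k))"
    using controls_representative[OF assms(10)] by blast
  have c: "ctrl c" using cm c1 unfolding ctrl_def by blast
  have cT: "(\<integral>s. c s None \<partial>?I) = T"
  proof -
    have "(\<integral>s. c s None \<partial>?I) = integral\<^sup>L (lebesgue_on {0..S}) (\<lambda>s. c s None)"
      by (rule integral_lebesgue_on_ivl_measure[symmetric, OF cm ctrl_abs_le[OF c]])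
    also have "\<dots> = integral\<^sup>L (lebesgue_on {0..S}) \<alpha>"
      by (rule integral_cong_AE) (use c\<alpha>\<beta> assms(10) cm in \<open>auto simp: controls_def intro: borel_measurable_lebesgue_onI\<close>)
    also have "\<dots> = T" using assms(10) by (simp add: controls_def)
    finally show ?thesis .
  qed
  have vel_option: "vel d s G x = d s None *\<^sub>R (f0 x + G x) + (\<Sum>i\<in>UNIV. d s (Some i) *\<^sub>R f i x)" for d s G x
    by (simp add: vel_def sum_option F_simps scaleR_add_right)
  obtain \<nu> where \<nu>: "trajectory S f0 f g \<theta> \<alpha> \<beta> \<nu>"
    and \<nu>_opt: "\<forall>(\<alpha>', \<beta>')\<in>controls S T. \<forall>\<nu>'. trajectory S f0 f g \<theta> \<alpha>' \<beta>' \<nu>' \<longrightarrow> (\<integral>x. l x \<partial>(\<nu> S)) \<le> (\<integral>x. l x \<partial>(\<nu>' S))"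
    using assms(11) unfolding optimal_def by blast
  have "continuity_eq S (\<lambda>s. vel c s (conv g (\<nu> s))) \<nu>"
  proof (rule continuity_eq_cong_AE)
    show "continuity_eq S (\<lambda>s x. \<alpha> s *\<^sub>R (f0 x + conv g (\<nu> s) x) + (\<Sum>i\<in>UNIV. \<beta> s $ i *\<^sub>R f i x)) \<nu>"
      using \<nu> unfolding trajectory_def by blast
    show "AE s in lebesgue_on {0..S}. (\<lambda>x. \<alpha> s *\<^sub>R (f0 x + conv g (\<nu> s) x) + (\<Sum>i\<in>UNIV. \<beta> s $ i *\<^sub>R f i x)) = vel c s (conv g (\<nu> s))"
      using c\<alpha>\<beta> by eventually_elim (simp add: vel_option fun_eq_iff)
  qed
  moreover have "\<nu> 0 = \<theta>" using \<nu> unfolding trajectory_def by blast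
  ultimately obtain X where X: "flow c X" and \<nu>X: "\<And>s. s \<in> {0..S} \<Longrightarrow> \<nu> s = distr \<theta> borel (X s)"
    using trajectory_flow[OF c] by metis
  note Xc = flowD(1)[OF X]
  obtain P where P: "costate c X P" using costate_exists[OF c Xc] .
  note Pc = costateD(1)[OF P]
  obtain \<rho> where Pb: "\<And>s x. norm (P s x) \<le> \<rho>" using costateD(2)[OF P] by blast
  have \<rho>: "0 \<le> \<rho>" using order_trans[OF norm_ge_zero Pb] .
  note Xs = continuous_on_slices(1)[OF Xc] and Ps = continuous_on_slices(1)[OF Pc]
  have lc: "continuous_on UNIV l" by (intro continuous_at_imp_continuous_on ballI has_derivative_continuous[OF ld])
  have l_distr: "(\<integral>x. l x \<partial>(distr \<theta> borel Y)) = (\<integral>x. l (Y x) \<partial>\<theta>)" if "continuous_on UNIV Y" for Y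
    by (rule integral_distr) (use that lc in \<open>auto simp: bm_\<theta> intro: borel_measurable_continuous_onI\<close>)

  have gain_le: "(\<integral>s. gain c d X P s \<partial>?I) \<le> 0"
    \<comment> \<open>Every competitor with the same integral of its \<open>None\<close> component
      is admissible here: the convex combination with \<open>c\<close> then satisfies the integral
      constraint as well, and its flow provides a trajectory to compare with \<nu>.\<close>
    if d: "\<And>k. (\<lambda>s. d s k) \<in> borel_measurable borel" "\<And>s. 0 \<le> d s None" "\<And>s. (\<Sum>k\<in>UNIV. \<bar>d s k\<bar>) \<le> 1"
      and dT: "(\<integral>s. d s None \<partial>?I) = T" and gm: "gain c d X P \<in> borel_measurable borel" and gb: "\<And>s. \<bar>gain c d X P s\<bar> \<le> K" for d K
  proof -
    interpret I: finite_measure ?I by (rule finite_measure_ivl_measure)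
    have dc: "ctrl d" using d unfolding ctrl_def by blast
    have "integral {0..S} (gain c d X P) \<le> 0"
    proof (rule optimal_gain[OF c dc X P])
      fix \<epsilon> X' assume \<epsilon>: "0 < \<epsilon>" "\<epsilon> \<le> 1" and X': "flow (mix \<epsilon> c d) X'"
      let ?m = "mix \<epsilon> c d"
      have mc: "ctrl ?m" by (rule ctrl_mix[OF c dc]) (use \<epsilon> in auto)
      have i: "integrable ?I (\<lambda>s. e s None)" if "ctrl e" for e
        by (rule I.integrable_const_bound[where B=1])
           (use ctrl_abs_le[OF that] ctrlD(1)[OF that] in \<open>auto simp: measurable_cong_sets[OF sets_ivl_measure refl]\<close>)
      have "(\<lambda>s. ?m s None, \<lambda>s. \<chi> k. ?m s (Some k)) \<in> controls S T"
      proof (rule controlsI[OF ctrlD(1)[OF mc] _ ctrlD(2)[OF mc]])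
        show "0 \<le> ?m s None" for s
        proof -
          have "?m s None = (1 - \<epsilon>) * c s None + \<epsilon> * d s None" by (simp add: mix_def algebra_simps)
          then show ?thesis using \<epsilon> c0[of s] d(2)[of s] by simp
        qed
        show "(\<integral>s. ?m s None \<partial>?I) = T" unfolding mix_def using i[OF c] i[OF dc] cT dT by simp
      qed
      moreover have "trajectory S f0 f g \<theta> (\<lambda>s. ?m s None) (\<lambda>s. \<chi> k. ?m s (Some k)) (\<lambda>s. distr \<theta> borel (X' s))"
        unfolding trajectory_def
      proof
        have "vel ?m s G = (\<lambda>x. ?m s None *\<^sub>R (f0 x + G x) + (\<Sum>i\<in>UNIV. (\<chi> k. ?m s (Some k)) $ i *\<^sub>R f i x))" for s G
          by (simp add: vel_option fun_eq_iff)
        from flow_trajectory[OF mc X', unfolded this]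
        show "continuity_eq S (\<lambda>s x. ?m s None *\<^sub>R (f0 x + conv g (distr \<theta> borel (X' s)) x) + (\<Sum>i\<in>UNIV. (\<chi> k. ?m s (Some k)) $ i *\<^sub>R f i x)) (\<lambda>s. distr \<theta> borel (X' s))" .
      qed (rule distr_flow_0[OF X'])
      ultimately have "(\<integral>x. l x \<partial>(\<nu> S)) \<le> (\<integral>x. l x \<partial>(distr \<theta> borel (X' S)))" using \<nu>_opt by blast
      then show "(\<integral>x. l (X S x) \<partial>\<theta>) \<le> (\<integral>x. l (X' S x) \<partial>\<theta>)"
        using \<nu>X[of S] Spos by (simp add: l_distr Xs continuous_on_slices(1)[OF flowD(1)[OF X']])
    qed
    then show ?thesis using integral_ivl_measure[OF gm, of 0 S K] gb by simp
  qed

  \<comment> \<open>The coefficients of \<open>a\<close> and of the components of \<open>b\<close>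
    in the Hamiltonian along \<open>(X, P)\<close>. The interaction enters with factor 1, as its
    double integral is twice this pairing.\<close>
  define h0 where "h0 s = pairing P (\<lambda>s x. f0 (X s x)) s + pairing P (\<lambda>s x. force X s (X s x)) s" for s
  define h where "h s k = pairing P (\<lambda>s x. f k (X s x)) s" for s k
  have Fc: "continuous_on UNIV (\<lambda>z. F k (X (fst z) (snd z)))" for k
    by (rule continuous_on_compose2[OF F_continuous Xc]) simp
  note pF = pairing_measurable[OF Pc Pb Fc FB] pairing_bound[OF Pc Pb Fc FB]
  note pf = pairing_measurable[OF Pc Pb force_flow_continuous[OF Xc] force_bound] pairing_bound[OF Pc Pb force_flow_continuous[OF Xc] force_bound]
  have hm[measurable]: "h0 \<in> borel_measurable borel" "(\<lambda>s. h s k) \<in> borel_measurable borel" for k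
    unfolding h0_def h_def using pF(1)[of None] pF(1)[of "Some k"] pf(1) by (simp_all add: F_simps)
  have hb: "\<bar>h0 s\<bar> \<le> 2 * (\<rho> * C)" "\<bar>h s k\<bar> \<le> 2 * (\<rho> * C)" for s k
    using pF(2)[of None s] pF(2)[of "Some k" s] pf(2)[of s] \<rho> C unfolding h0_def h_def F_simps by auto
  have gain_h: "gain c d X P s = h0 s * (d s None - c s None) + (\<Sum>k\<in>UNIV. (d s (Some k) - c s (Some k)) * h s k)" for d s
    unfolding gain_pairing[OF X P] sum_option F_simps h0_def h_def by (simp add: algebra_simps)
  have "\<exists>\<kappa>. AE s in ?I. c s None * h0 s + c s None * \<kappa> + (\<Sum>k\<in>UNIV. c s (Some k) * h s k) = max (h0 s + \<kappa>) (MAX k. \<bar>h s k\<bar>)"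
  proof (rule pointwise_maximum[where b="\<lambda>s k. c s (Some k)", OF finite_measure_ivl_measure sets_ivl_measure hm hb cm cm c0])
    show "c s None + (\<Sum>k\<in>UNIV. \<bar>c s (Some k)\<bar>) \<le> 1" for s using c1[of s] c0[of s] by (simp add: sum_option)
    \<comment> \<open>The strict inequality required for the multiplier is \<open>T < S\<close>,
      that is, \<open>M > 0\<close>.\<close>
    have "measure ?I (space ?I) = S"
      using integral_ivl_measure[of "\<lambda>_. 1::real" 0 S 1] Spos by simp
    then show "(\<integral>s. c s None \<partial>?I) < measure ?I (space ?I)" using cT assms(2,3) by simp
    fix a' :: "real \<Rightarrow> real" and b' :: "real \<Rightarrow> 'm \<Rightarrow> real"
    assume m[measurable]: "a' \<in> borel_measurable borel" "\<forall>k. (\<lambda>s. b' s k) \<in> borel_measurable borel"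
      and A: "\<forall>s. 0 \<le> a' s \<and> a' s + (\<Sum>k\<in>UNIV. \<bar>b' s k\<bar>) \<le> 1" and i: "(\<integral>s. a' s \<partial>?I) = (\<integral>s. c s None \<partial>?I)"
    define d where "d s k = (case k of None \<Rightarrow> a' s | Some k \<Rightarrow> b' s k)" for s k
    have d: "(\<lambda>s. d s k) \<in> borel_measurable borel" "0 \<le> d s None" "(\<Sum>k\<in>UNIV. \<bar>d s k\<bar>) \<le> 1" for s k
    proof -
      show "(\<lambda>s. d s k) \<in> borel_measurable borel" using m by (cases k) (simp_all add: d_def)
      show "0 \<le> d s None" using A by (simp add: d_def)
      have "a' s + (\<Sum>k\<in>UNIV. \<bar>b' s k\<bar>) \<le> 1" "0 \<le> a' s" using A by blast+
      then show "(\<Sum>k\<in>UNIV. \<bar>d s k\<bar>) \<le> 1" by (simp add: d_def sum_option)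
    qed
    have dc: "ctrl d" using d unfolding ctrl_def by blast
    note [measurable] = d(1) cm
    have "(\<integral>s. gain c d X P s \<partial>?I) \<le> 0"
    proof (rule gain_le[OF d])
      show "(\<integral>s. d s None \<partial>?I) = T" using i cT by (simp add: d_def)
      show "gain c d X P \<in> borel_measurable borel" unfolding gain_h[abs_def] by measurable
      let ?B = "2 * (\<rho> * C)"
      have 1: "\<bar>d s k - c s k\<bar> \<le> 2" for s k using ctrl_abs_le[OF c, of s k] ctrl_abs_le[OF dc, of s k] by linarith
      show "\<bar>gain c d X P s\<bar> \<le> ?B * 2 + (\<Sum>k\<in>(UNIV::'m set). 2 * ?B)" for s unfolding gain_h
      proof (rule order_trans[OF abs_triangle_ineq add_mono])
        show "\<bar>h0 s * (d s None - c s None)\<bar> \<le> ?B * 2" unfolding abs_mult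
          using \<rho> C by (intro mult_mono hb 1) auto
        show "\<bar>\<Sum>k\<in>UNIV. (d s (Some k) - c s (Some k)) * h s k\<bar> \<le> (\<Sum>k\<in>(UNIV::'m set). 2 * ?B)"
        proof (rule order_trans[OF sum_abs], rule sum_mono)
          show "\<bar>(d s (Some k) - c s (Some k)) * h s k\<bar> \<le> 2 * ?B" for k unfolding abs_mult by (intro mult_mono hb 1) auto
        qed
      qed
    qed
    then show "(\<integral>s. h0 s * (a' s - c s None) + (\<Sum>k\<in>UNIV. (b' s k - c s (Some k)) * h s k) \<partial>?I) \<le> 0"
      unfolding gain_h by (simp add: d_def)
  qed
  then obtain \<kappa> where "AE s in ?I. c s None * h0 s + c s None * \<kappa> + (\<Sum>k\<in>UNIV. c s (Some k) * h s k) = max (h0 s + \<kappa>) (MAX k. \<bar>h s k\<bar>)" ..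
  note \<kappa> = AE_ivl_measure_lebesgue_on[OF this]

  define \<gamma> where "\<gamma> s = distr \<theta> borel (\<lambda>x. (X s x, P s x))" for s
  have Zc: "continuous_on UNIV (\<lambda>x. (X s x, P s x))" for s by (intro continuous_on_Pair Xs Ps)
  have Zm: "(\<lambda>x. (X s x, P s x)) \<in> measurable \<theta> borel" for s by (simp add: bm_\<theta> borel_measurable_continuous_onI[OF Zc])
  have int_\<gamma>: "(\<integral>z. \<phi> z \<partial>(\<gamma> s)) = (\<integral>x. \<phi> (X s x, P s x) \<partial>\<theta>)" if "continuous_on UNIV \<phi>"
    for \<phi> :: "(real^'n) \<times> (real^'n) \<Rightarrow> 'b::euclidean_space" and s
    unfolding \<gamma>_def by (rule integral_distr[OF Zm borel_measurable_continuous_onI[OF that]])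
  have cf: "continuous_on UNIV (\<lambda>z::(real^'n) \<times> (real^'n). snd z \<bullet> F k (fst z))" for k
    by (intro continuous_on_inner continuous_on_compose2[OF F_continuous] continuous_on_fst continuous_on_snd continuous_on_id; simp)
  have pair_\<gamma>: "(\<integral>(y, p). p \<bullet> F k y \<partial>(\<gamma> s)) = pairing P (\<lambda>s x. F k (X s x)) s" for k s
    using int_\<gamma>[OF cf] by (simp add: pairing_def case_prod_beta')
  have inner_\<gamma>: "(\<integral>(z, q). (p - q) \<bullet> g (y - z) \<partial>(\<gamma> s)) = p \<bullet> force X s y - (\<integral>z. P s z \<bullet> g (y - X s z) \<partial>\<theta>)"
    "(\<integral>(z, q). (p - q) v* Jg (y - z) \<partial>(\<gamma> s)) = (\<integral>z. (p - P s z) v* Jg (y - X s z) \<partial>\<theta>)" for p y s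
  proof -
    have "continuous_on UNIV (\<lambda>z::(real^'n) \<times> (real^'n). (p - snd z) \<bullet> g (y - fst z))"
      by (intro continuous_on_inner continuous_on_compose2[OF g_continuous] continuous_intros; simp)
    from int_\<gamma>[OF this] show "(\<integral>(z, q). (p - q) \<bullet> g (y - z) \<partial>(\<gamma> s)) = p \<bullet> force X s y - (\<integral>z. P s z \<bullet> g (y - X s z) \<partial>\<theta>)"
      using interaction_kernel_continuous(1)[where X=X and s=s and p="P s" and q=p and y=y, OF Xc Ps Pb] by (simp add: case_prod_beta')
    have "continuous_on UNIV (\<lambda>z::(real^'n) \<times> (real^'n). (p - snd z) v* Jg (y - fst z))"
      by (intro continuous_on_vector_matrix_mult continuous_on_compose2[OF Jgc] continuous_intros; simp)
    from int_\<gamma>[OF this] show "(\<integral>(z, q). (p - q) v* Jg (y - z) \<partial>(\<gamma> s)) = (\<integral>z. (p - P s z) v* Jg (y - X s z) \<partial>\<theta>)"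
      by (simp add: case_prod_beta')
  qed
  have energy_\<gamma>: "(\<integral>(y, p). (\<integral>(z, q). (p - q) \<bullet> g (y - z) \<partial>(\<gamma> s)) \<partial>(\<gamma> s)) = 2 * pairing P (\<lambda>s x. force X s (X s x)) s" for s
  proof -
    note K = interaction_kernel_continuous[where X=X and s=s and p="P s", OF Xc Ps Pb]
    have "continuous_on UNIV (\<lambda>z::(real^'n) \<times> (real^'n). snd z \<bullet> force X s (fst z) - (\<integral>x. P s x \<bullet> g (fst z - X s x) \<partial>\<theta>))"
      by (intro continuous_on_diff continuous_on_inner continuous_on_compose2[OF K(2)] continuous_on_fst continuous_on_snd continuous_on_id
          continuous_on_compose2[OF continuous_on_slices(1)[OF force_continuous[OF Xc]]]; simp)
    from int_\<gamma>[OF this, of s] show ?thesis unfolding inner_\<gamma> interaction_energy[where X=X and P=P and s=s, OF Xc Pc Pb, symmetric] K(1)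
      by (simp add: case_prod_beta')
  qed
  \<comment> \<open>The formula holds for all \<open>a\<close> and \<open>b\<close>, so that the
    same coefficients decide both the value at the optimal control and the maximum over the control
    set.\<close>
  have calH: "calH f0 f g (\<gamma> s) \<kappa> a b = a * h0 s + a * \<kappa> + (\<Sum>k\<in>UNIV. b $ k * h s k)" for s a b
    unfolding calH_def energy_\<gamma> using pair_\<gamma>[of s None] pair_\<gamma>[of s "Some _"]
    by (simp add: F_simps h0_def h_def algebra_simps)
  have calH1: "calH1 f0 g (\<gamma> s) \<kappa> = h0 s + \<kappa>" for s
    unfolding calH1_def energy_\<gamma> using pair_\<gamma>[of s None] by (simp add: F_simps h0_def)
  have calH0: "calH0 f (\<gamma> s) = (MAX k. \<bar>h s k\<bar>)" for s
    unfolding calH0_def using pair_\<gamma>[of s "Some _"] by (simp add: F_simps h_def)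
  have fst_\<gamma>: "distr (\<gamma> s) borel fst = distr \<theta> borel (X s)" for s
    unfolding \<gamma>_def by (subst distr_distr[OF _ Zm]) (auto simp: o_def intro!: borel_measurable_continuous_onI continuous_intros)
  have snd_\<gamma>: "distr (\<gamma> s) borel snd = distr \<theta> borel (P s)" for s
    unfolding \<gamma>_def by (subst distr_distr[OF _ Zm]) (auto simp: o_def intro!: borel_measurable_continuous_onI continuous_intros)
  have Xm: "X s \<in> measurable \<theta> borel" for s by (simp add: bm_\<theta> borel_measurable_continuous_onI[OF Xs])
  have PS: "P S = (\<lambda>x. - grad l (X S x))" by (rule ext) (rule costateD(4)[OF P])
  have regular: "regular_solution S f0 f g l \<theta> \<alpha> \<beta> \<gamma>"
    unfolding regular_solution_def bvp_solution_def
  proof (intro conjI exI[of _ \<nu>])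
    show "continuity_eq S (\<lambda>s. vecH f0 f g (\<gamma> s) (\<alpha> s) (\<beta> s)) \<gamma>"
    proof (rule continuity_eq_cong_AE)
      show "continuity_eq S (\<lambda>s (y, p). (vel c s (force X s) y, - adj c X (P s) s y p)) \<gamma>"
        using Hamiltonian_trajectory[OF c X P] unfolding \<gamma>_def[abs_def] .
      show "AE s in lebesgue_on {0..S}. (\<lambda>(y, p). (vel c s (force X s) y, - adj c X (P s) s y p)) = vecH f0 f g (\<gamma> s) (\<alpha> s) (\<beta> s)"
        using c\<alpha>\<beta>
      proof eventually_elim
        case (elim s)
        have G: "(\<integral>z. g (y - z) \<partial>(distr \<theta> borel (X s))) = force X s y" for y
          using fun_cong[OF conv_distr[where X=X and s=s, OF Xs], of y] by (simp add: conv_def)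
        show ?case unfolding vecH_def fst_\<gamma> G inner_\<gamma>(2)[unfolded Jg_def] vector_matrix_sum
          using elim by (simp add: vel_option adj_def sum_option JF_def F_simps Jg_def fun_eq_iff algebra_simps)
      qed
    qed
    show "distr (\<gamma> 0) borel fst = \<theta>" unfolding fst_\<gamma> by (rule distr_flow_0[OF X])
    have gl: "(\<lambda>x. - grad l x) \<in> borel_measurable borel" "(\<lambda>x. (x, - grad l x)) \<in> borel_measurable borel"
      by (intro borel_measurable_continuous_onI continuous_intros Dlc)+
    show "distr (\<gamma> S) borel snd = distr (distr (\<gamma> S) borel fst) borel (\<lambda>x. - grad l x)"
      unfolding fst_\<gamma> snd_\<gamma> distr_distr[OF gl(1) Xm] by (simp add: PS o_def)
    show "trajectory S f0 f g \<theta> \<alpha> \<beta> \<nu>" by (rule \<nu>)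
    have "\<nu> S = distr \<theta> borel (X S)" using \<nu>X[of S] Spos by simp
    then show "\<gamma> S = distr (\<nu> S) borel (\<lambda>x. (x, - grad l x))"
      unfolding \<gamma>_def by (simp add: distr_distr[OF gl(2) Xm] PS o_def)
  qed
  \<comment> \<open>The weights \<open>a\<close> and \<open>?b\<close> add up to at most 1. A total
    weight below 1 is harmless because the maximum is nonnegative, being at least
    \<open>?H\<close>.\<close>
  have upper: "a * h0 s + a * \<kappa> + (\<Sum>k\<in>UNIV. b $ k * h s k) \<le> max (h0 s + \<kappa>) (MAX k. \<bar>h s k\<bar>)" if "(a, b) \<in> control_set" for a b s
  proof -
    let ?H = "MAX k. \<bar>h s k\<bar>" and ?b = "\<Sum>k\<in>UNIV. \<bar>b $ k\<bar>"
    have A: "0 \<le> a" "a + ?b \<le> 1" using that by (auto simp: control_set_def)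
    have hH: "\<bar>h s k\<bar> \<le> ?H" for k by (rule Max_ge) auto
    have H: "0 \<le> ?H" using order_trans[OF abs_ge_zero hH] .
    have "(\<Sum>k\<in>UNIV. b $ k * h s k) \<le> (\<Sum>k\<in>UNIV. \<bar>b $ k\<bar> * ?H)"
    proof (rule sum_mono)
      fix k
      have "b $ k * h s k \<le> \<bar>b $ k\<bar> * \<bar>h s k\<bar>" using abs_ge_self[of "b $ k * h s k"] by (simp add: abs_mult)
      also have "\<dots> \<le> \<bar>b $ k\<bar> * ?H" by (intro mult_left_mono hH abs_ge_zero)
      finally show "b $ k * h s k \<le> \<bar>b $ k\<bar> * ?H" .
    qed
    then have "a * h0 s + a * \<kappa> + (\<Sum>k\<in>UNIV. b $ k * h s k) \<le> a * (h0 s + \<kappa>) + ?b * ?H"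
      by (simp add: distrib_left sum_distrib_right)
    also have "\<dots> \<le> a * max (h0 s + \<kappa>) ?H + ?b * max (h0 s + \<kappa>) ?H"
      using A(1) by (intro add_mono mult_left_mono) (auto intro: sum_nonneg)
    also have "\<dots> = (a + ?b) * max (h0 s + \<kappa>) ?H" by (simp add: distrib_right)
    also have "\<dots> \<le> 1 * max (h0 s + \<kappa>) ?H" using A(2) H by (intro mult_right_mono) auto
    finally show ?thesis by simp
  qed
  have "AE s in lebesgue_on {0..S}. (\<alpha> s, \<beta> s) \<in> control_set" using assms(10) by (simp add: controls_def)
  then have "AE s in lebesgue_on {0..S}.
       is_maximum (calH f0 f g (\<gamma> s) \<kappa> (\<alpha> s) (\<beta> s)) ((\<lambda>(a, b). calH f0 f g (\<gamma> s) \<kappa> a b) ` control_set) \<and>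
       calH f0 f g (\<gamma> s) \<kappa> (\<alpha> s) (\<beta> s) = max (calH1 f0 g (\<gamma> s) \<kappa>) (calH0 f (\<gamma> s))"
    using c\<alpha>\<beta> \<kappa>
  proof eventually_elim
    case (elim s)
    have eq: "calH f0 f g (\<gamma> s) \<kappa> (\<alpha> s) (\<beta> s) = max (h0 s + \<kappa>) (MAX k. \<bar>h s k\<bar>)" using elim(2,3) by (simp add: calH)
    moreover have "calH f0 f g (\<gamma> s) \<kappa> (\<alpha> s) (\<beta> s) \<in> (\<lambda>(a, b). calH f0 f g (\<gamma> s) \<kappa> a b) ` control_set"
      by (rule image_eqI[OF _ elim(1)]) simp
    moreover have "case z of (a, b) \<Rightarrow> calH f0 f g (\<gamma> s) \<kappa> a b \<le> max (h0 s + \<kappa>) (MAX k. \<bar>h s k\<bar>)" if "z \<in> control_set" for z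
      using upper that by (cases z) (simp add: calH)
    ultimately show ?case unfolding is_maximum_def calH1 calH0 by auto
  qed
  with regular show ?thesis by blast
qed

end
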